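(* Let $\mathcal X=\mathbb T^{d_x}$, $\mathcal Y=\mathbb T^{d_y}$ be flat tori, $\tau>0$, $k\in\mathcal C^2(\mathcal X\times\mathcal Y)$, and $M_{11}=\sup_{x,y}\|\nabla_x\nabla_yk(x,y)\|_{\mathrm{op}}$. Let $(\nu^x,\nu^y)$ be the unique equilibrium pair of the mean-field Langevin descent-ascent dynamics $$\begin{cases}\partial_t\mu^x_t=\nabla\cdot\big(\mu^x_t\nabla\int_{\mathcal Y}k(\cdot,y)\,d\mu^y_t(y)\big)+\tau\Delta\mu^x_t\\ \partial_t\mu^y_t=-\nabla\cdot\big(\mu^y_t\nabla\int_{\mathcal X}k(x,\cdot)\,d\mu^x_t(x)\big)+\tau\Delta\mu^y_t.\end{cases}$$ Suppose $\nu^x$ and $\nu^y$ satisfy the Poincaré inequality with constants $c^x_{\mathrm{PI}}$ and $c^y_{\mathrm{PI}}$ respectively, and let $c_{\mathrm{PI}}=\min\{c^x_{\mathrm{PI}},c^y_{\mathrm{PI}}\}$. Then for any $0<\varepsilon<1$, if $$\chi^2(\mu^x_0\|\nu^x)+\chi^2(\mu^y_0\|\nu^y)\le\frac{\tau^2c_{\mathrm{PI}}^2\varepsilon^2}{4M_{11}^2},$$ then the dynamics satisfies, for all $t\ge0$, $$\chi^2(\mu^x_t\|\nu^x)+\chi^2(\mu^y_t\|\nu^y)\le\Big(1+\frac{M_{11}^2}{\tau^2c_{\mathrm{PI}}^2\varepsilon^2}\Big)e^{-2\tau c_{\mathrm{PI}}(1-\varepsilon)t}\Big(\chi^2(\m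u^x_0\|\nu^x)+\chi^2(\mu^y_0\|\nu^y)\Big).$$
   Context: $\mu^x_t$, $\mu^y_t$ are probability measures on $\mathcal X$, $\mathcal Y$. The equilibrium pair $(\nu^x,\nu^y)$ is the unique saddle point of $\min_{\mu^x}\max_{\mu^y}\iint k\,d\mu^xd\mu^y+\tau H(\mu^x)-\tau H(\mu^y)$, where $H(\mu)=\int\log\frac{d\mu}{dx}\,d\mu$; it is characterized by $\tau\log\nu^x=-\int_{\mathcal Y}k(\cdot,y)\,d\nu^y(y)+\text{const}$ and $\tau\log\nu^y=\int_{\mathcal X}k(x,\cdot)\,d\nu^x(x)+\text{const}$ (densities with respect to Lebesgue measure). $\chi^2(\mu\|\nu)=\int(\frac{d\mu}{d\nu}-1)^2d\nu$ (equal to $+\infty$ if $\mu\not\ll\nu$). $\nu$ satisfies the Poincaré inequality with constant $c$ if $\int|f|^2d\nu\le c^{-1}\int\|\nabla f\|^2d\nu$ for all $f$ with $\int f\,d\nu=0$. $\|\cdot\|_{\mathrm{op}}$ is the Euclidean operator norm. If $M_{11}=0$ the smallness threshold is read as $+\infty$. *)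

theory Defs
  imports "HOL-Probability.Probability"
begin

text \<open>
  The flat torus is \<open>\<real>\<^sup>d / \<int>\<^sup>d\<close>.  Functions on it are represented by functions on the covering
  space that are 1-periodic in every coordinate.  Measures on it are represented by measures on
  the half-open unit cell: the quotient map restricted to the cell is a Borel isomorphism onto
  the torus that carries Lebesgue measure on the cell to Lebesgue measure on the torus.  For a
  function on a product type, periodicity refers to the coordinates of both factors, so the
  product of two tori is again an instance.
\<close>

definition torus_cell :: "'a::euclidean_space set" where
  "torus_cell = {x. \<forall>b\<in>Basis. 0 \<le> x \<bullet> b \<and> x \<bullet> b < 1}"

definition torus_periodic :: "('a::euclidean_space \<Rightarrow> 'b) \<Rightarrow> bool" where
  "torus_periodic f \<longleftrightarrow> (\<forall>x. \<forall>b\<in>Basis. f (x + b) = f x)"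

definition torus_lebesgue :: "'a::euclidean_space measure" where
  "torus_lebesgue = restrict_space lborel torus_cell"

definition torus_prob_measure :: "'a::euclidean_space measure \<Rightarrow> bool" where
  "torus_prob_measure \<mu> \<longleftrightarrow> prob_space \<mu> \<and> sets \<mu> = sets (restrict_space borel torus_cell)"

definition pderivative :: "'a::euclidean_space \<Rightarrow> ('a \<Rightarrow> real) \<Rightarrow> 'a \<Rightarrow> real" where
  "pderivative b f x = frechet_derivative f (at x) b"

primrec C_k :: "nat \<Rightarrow> ('a::euclidean_space \<Rightarrow> real) \<Rightarrow> bool" where
  "C_k 0 f \<longleftrightarrow> continuous_on UNIV f"
| "C_k (Suc n) f \<longleftrightarrow> f differentiable_on UNIV \<and> (\<forall>b\<in>Basis. C_k n (pderivative b f))"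

definition C_infinity :: "('a::euclidean_space \<Rightarrow> real) \<Rightarrow> bool" where
  "C_infinity f \<longleftrightarrow> (\<forall>n. C_k n f)"

definition gradient :: "('a::euclidean_space \<Rightarrow> real) \<Rightarrow> 'a \<Rightarrow> 'a" where
  "gradient f x = (\<Sum>b\<in>Basis. pderivative b f x *\<^sub>R b)"

definition laplacian :: "('a::euclidean_space \<Rightarrow> real) \<Rightarrow> 'a \<Rightarrow> real" where
  "laplacian f x = (\<Sum>b\<in>Basis. pderivative b (pderivative b f) x)"

text \<open>
  The matrix \<open>\<nabla>\<^sub>x\<nabla>\<^sub>y k(z)\<close>, as a linear map from the tangent space of the second torus to that of
  the first.
\<close>

definition mixed_hessian ::
  "('a::euclidean_space \<times> 'b::euclidean_space \<Rightarrow> real) \<Rightarrow> 'a \<times> 'b \<Rightarrow> 'b \<Rightarrow> 'a" where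
  "mixed_hessian k z v =
     (\<Sum>b\<in>Basis. \<Sum>c\<in>Basis. (pderivative (b, 0) (pderivative (0, c) k) z * (v \<bullet> c)) *\<^sub>R b)"

definition M11 :: "('a::euclidean_space \<times> 'b::euclidean_space \<Rightarrow> real) \<Rightarrow> real" where
  "M11 k = (SUP z. onorm (mixed_hessian k z))"

text \<open>
  The negative part of \<open>log d\<mu>/dx\<close> is always \<open>\<mu>\<close>-integrable, since \<open>u log u\<close> is bounded below and
  the torus has finite volume.  Hence \<open>finite_entropy\<close> holds exactly when the extended-real entropy
  is not \<open>+\<infinity>\<close>; the real number \<open>boltzmann_entropy \<mu>\<close> is meaningful only then.
\<close>

definition log_density :: "'a::euclidean_space measure \<Rightarrow> 'a \<Rightarrow> real" where
  "log_density \<mu> x = ln (enn2real (RN_deriv torus_lebesgue \<mu> x))"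

definition finite_entropy :: "'a::euclidean_space measure \<Rightarrow> bool" where
  "finite_entropy \<mu> \<longleftrightarrow> absolutely_continuous torus_lebesgue \<mu> \<and> integrable \<mu> (log_density \<mu>)"

definition boltzmann_entropy :: "'a::euclidean_space measure \<Rightarrow> real" where
  "boltzmann_entropy \<mu> = (\<integral>x. log_density \<mu> x \<partial>\<mu>)"

definition payoff ::
  "real \<Rightarrow> ('a::euclidean_space \<times> 'b::euclidean_space \<Rightarrow> real)
    \<Rightarrow> 'a measure \<Rightarrow> 'b measure \<Rightarrow> real" where
  "payoff \<tau> k \<mu>x \<mu>y = (\<integral>x. (\<integral>y. k (x, y) \<partial>\<mu>y) \<partial>\<mu>x) + \<tau> * boltzmann_entropy \<mu>x - \<tau> * boltzmann_entropy \<mu>y"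

text \<open>
  Competitors of infinite entropy give the payoff \<open>+\<infinity>\<close> (for \<open>\<mu>x\<close>) or \<open>-\<infinity>\<close> (for \<open>\<mu>y\<close>) against an
  opponent of finite entropy, so restricting to finite entropy loses nothing.
\<close>

definition equilibrium ::
  "real \<Rightarrow> ('a::euclidean_space \<times> 'b::euclidean_space \<Rightarrow> real)
    \<Rightarrow> 'a measure \<Rightarrow> 'b measure \<Rightarrow> bool" where
  "equilibrium \<tau> k \<nu>x \<nu>y \<longleftrightarrow>
     torus_prob_measure \<nu>x \<and> finite_entropy \<nu>x \<and>
     torus_prob_measure \<nu>y \<and> finite_entropy \<nu>y \<and>
     (\<forall>\<mu>x. torus_prob_measure \<mu>x \<and> finite_entropy \<mu>x \<longrightarrow>
        payoff \<tau> k \<nu>x \<nu>y \<le> payoff \<tau> k \<mu>x \<nu>y) \<and>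
     (\<forall>\<mu>y. torus_prob_measure \<mu>y \<and> finite_entropy \<mu>y \<longrightarrow>
        payoff \<tau> k \<nu>x \<mu>y \<le> payoff \<tau> k \<nu>x \<nu>y)"

text \<open>
  Distributional solutions on \<open>[0, \<infinity>)\<close>: the equations are integrated against smooth test
  functions in space and over \<open>[0, t]\<close> in time.  Weak continuity in time, including attainment
  of the initial values at time 0, follows from the integrated form.
\<close>

definition langevin_descent_ascent ::
  "real \<Rightarrow> ('a::euclidean_space \<times> 'b::euclidean_space \<Rightarrow> real)
    \<Rightarrow> (real \<Rightarrow> 'a measure) \<Rightarrow> (real \<Rightarrow> 'b measure) \<Rightarrow> bool" where
  "langevin_descent_ascent \<tau> k \<mu>x \<mu>y \<longleftrightarrow>
     (\<forall>t\<ge>0. torus_prob_measure (\<mu>x t) \<and> torus_prob_measure (\<mu>y t)) \<and>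
     (\<forall>\<phi>. C_infinity \<phi> \<and> torus_periodic \<phi> \<longrightarrow> (\<forall>t\<ge>0.
        ((\<lambda>s. - (\<integral>x. gradient \<phi> x \<bullet> gradient (\<lambda>x. \<integral>y. k (x, y) \<partial>\<mu>y s) x \<partial>\<mu>x s)
              + \<tau> * (\<integral>x. laplacian \<phi> x \<partial>\<mu>x s))
          has_integral ((\<integral>x. \<phi> x \<partial>\<mu>x t) - (\<integral>x. \<phi> x \<partial>\<mu>x 0))) {0..t})) \<and>
     (\<forall>\<psi>. C_infinity \<psi> \<and> torus_periodic \<psi> \<longrightarrow> (\<forall>t\<ge>0.
        ((\<lambda>s. (\<integral>y. gradient \<psi> y \<bullet> gradient (\<lambda>y. \<integral>x. k (x, y) \<partial>\<mu>x s) y \<partial>\<mu>y s)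
              + \<tau> * (\<integral>y. laplacian \<psi> y \<partial>\<mu>y s))
          has_integral ((\<integral>y. \<psi> y \<partial>\<mu>y t) - (\<integral>y. \<psi> y \<partial>\<mu>y 0))) {0..t}))"

definition chi2 :: "'a measure \<Rightarrow> 'a measure \<Rightarrow> ennreal" where
  "chi2 \<mu> \<nu> =
     (if absolutely_continuous \<nu> \<mu>
      then \<integral>\<^sup>+x. ennreal ((enn2real (RN_deriv \<nu> \<mu> x) - 1)\<^sup>2) \<partial>\<nu>
      else \<infinity>)"

definition poincare_inequality :: "'a::euclidean_space measure \<Rightarrow> real \<Rightarrow> bool" where
  "poincare_inequality \<nu> c \<longleftrightarrow>
     0 < c \<and>
     (\<forall>f. C_k 1 f \<and> torus_periodic f \<and> (\<integral>x. f x \<partial>\<nu>) = 0 \<longrightarrow>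
        (\<integral>x. \<bar>f x\<bar>\<^sup>2 \<partial>\<nu>) \<le> inverse c * (\<integral>x. (norm (gradient f x))\<^sup>2 \<partial>\<nu>))"

end

theory Submission
  imports Defs
begin

text \<open>
  The flow is only a distributional solution, so the estimate is carried out for the convolutions
  \<open>p\<close>, \<open>q\<close> of the two measures with trigonometric polynomials: these kernels have
  finite-dimensional spans of translates, so the weak formulation turns all quantities of interest
  into Lipschitz functions of time.  Let \<open>n\<close>, \<open>m\<close> be the Gibbs densities of the equilibrium and
  \<open>f = p/n - 1\<close>, \<open>g = q/m - 1\<close>.  In the derivative of \<open>X = \<integral>f\<^sup>2 n + \<integral>g\<^sup>2 m\<close> the interaction
  terms do not cancel, but in the derivative of the squared dual norm \<open>Y\<close> of \<open>(f, g)\<close>, the analogue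
  of \<open>H\<^sup>-\<^sup>1\<close>, they do.  With \<open>r = M/(\<tau>c\<epsilon>)\<close>, the function \<open>X + r\<^sup>2 c Y\<close> therefore decays at the rate
  \<open>2\<tau>c(1 - \<epsilon>)\<close> as long as it stays below the smallness threshold, and \<open>Y \<le> X/c\<close> gives the prefactor
  \<open>1 + r\<^sup>2\<close>.  As the kernels concentrate, the commutator errors vanish by uniform continuity of \<open>\<nabla>k\<close>,
  the mollified initial divergence is controlled by Cauchy-Schwarz, and the divergence at time \<open>t\<close>
  is recovered by lower semicontinuity.
\<close>

section \<open>Integration on the flat torus\<close>

text \<open>In the derivative of \<open>X\<close> the gradient of the drift perturbation
  \<open>Kg\<close> is tested against the gradient of \<open>f\<close>, and the two players produce
  unrelated quantities. Testing against the gradient of \<open>u\<close> with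
  \<open>- div (n grad u) = n f\<close> turns the same term into the plain pairing of
  \<open>Kg\<close> with \<open>f\<close> in the weight \<open>n\<close>, which the other player
  repeats with the opposite sign by Fubini. This is the purpose of \<open>Y\<close>. No elliptic
  equation is solved: for a fixed kernel of finite rank, \<open>f\<close> and \<open>Kg\<close>
  range over fixed finite-dimensional spaces, and a Gram-Schmidt basis for the Dirichlet form is
  enough. The mixed derivative enters once, through the pointwise bound of the gradient of
  \<open>Kg\<close> by \<open>M / sqrt c\<close> times the norm of \<open>g\<close>. As for the
  threshold: initially \<open>r^2 X \<le> 1/4\<close>, hence
  \<open>r^2 (X + r^2 c Y) \<le> (1 + r^2) / 4\<close>; the estimates run with 11/40 instead of 1/4,
  and the spare 1/40 pays for the mollification errors. One locale serves both players, with
  \<open>k\<close> and with the transpose of \<open>- k\<close>; the overview's \<open>r\<close> is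
  \<open>q\<close> in the code.\<close>

lemma torus_cell_borel [measurable]: "(torus_cell :: 'a::euclidean_space set) \<in> sets borel"
proof -
  have "torus_cell = (\<Inter>b\<in>Basis. {x::'a. 0 \<le> x \<bullet> b} \<inter> {x. x \<bullet> b < 1})"
    by (auto simp: torus_cell_def)
  also have "\<dots> \<in> sets borel"
    by (intro sets.finite_INT sets.Int) (auto simp: nonempty_Basis)
  finally show ?thesis .
qed

lemma torus_cell_subset_cbox: "(torus_cell :: 'a::euclidean_space set) \<subseteq> cbox 0 One"
  by (auto simp: torus_cell_def mem_box less_imp_le)

lemma emeasure_torus_cell: "emeasure lborel (torus_cell :: 'a::euclidean_space set) = 1"
proof (rule antisym)
  have "emeasure lborel (torus_cell::'a set) \<le> emeasure lborel (cbox 0 One :: 'a set)"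
    by (intro emeasure_mono torus_cell_subset_cbox) auto
  then show "emeasure lborel (torus_cell::'a set) \<le> 1"
    by (subst (asm) emeasure_lborel_cbox) auto
  have "(box 0 One :: 'a set) \<subseteq> torus_cell"
    by (auto simp: torus_cell_def mem_box less_imp_le)
  then have "emeasure lborel (box 0 One :: 'a set) \<le> emeasure lborel (torus_cell::'a set)"
    by (intro emeasure_mono) auto
  then show "1 \<le> emeasure lborel (torus_cell::'a set)"
    by (subst (asm) emeasure_lborel_box) auto
qed

lemma torus_prob_measure_lebesgue: "torus_prob_measure (torus_lebesgue :: 'a::euclidean_space measure)"
  unfolding torus_prob_measure_def
proof
  show "prob_space (torus_lebesgue :: 'a measure)"
    by (rule prob_spaceI)
      (simp add: torus_lebesgue_def space_restrict_space emeasure_restrict_space emeasure_torus_cell)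
  show "sets torus_lebesgue = sets (restrict_space borel (torus_cell::'a set))"
    unfolding torus_lebesgue_def by (intro sets_restrict_space_cong) simp
qed

lemma
  assumes "torus_prob_measure \<mu>"
  shows torus_prob_space: "prob_space \<mu>"
    and torus_prob_sets: "sets \<mu> = sets (restrict_space borel torus_cell)"
    and torus_prob_space_eq: "space \<mu> = torus_cell"
    and torus_prob_finite: "finite_measure \<mu>"
    and torus_prob_measure_space: "measure \<mu> (space \<mu>) = 1"
proof -
  show p: "prob_space \<mu>" and s: "sets \<mu> = sets (restrict_space borel torus_cell)"
    using assms by (auto simp: torus_prob_measure_def)
  from sets_eq_imp_space_eq[OF s] show "space \<mu> = torus_cell"
    by (simp add: space_restrict_space)
  show "finite_measure \<mu>" using p by (simp add: prob_space.finite_measure)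
  show "measure \<mu> (space \<mu>) = 1" using p by (simp add: prob_space.prob_space)
qed

lemma torus_prob_measurable:
  assumes "torus_prob_measure \<mu>" "f \<in> borel \<rightarrow>\<^sub>M N"
  shows "f \<in> \<mu> \<rightarrow>\<^sub>M N"
proof -
  have "f \<in> restrict_space borel torus_cell \<rightarrow>\<^sub>M N" using assms(2) by (rule measurable_restrict_space1)
  then show ?thesis using measurable_cong_sets[OF torus_prob_sets[OF assms(1)] refl] by blast
qed

lemma continuous_bounded_on_cell:
  fixes f :: "'a::euclidean_space \<Rightarrow> 'b::real_normed_vector"
  assumes "continuous_on UNIV f"
  obtains B where "B > 0" "\<And>x. x \<in> torus_cell \<Longrightarrow> norm (f x) \<le> B"
proof -
  have "compact (f ` cbox 0 One)"
    by (intro compact_continuous_image continuous_on_subset[OF assms]) auto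
  then have "bounded (f ` cbox 0 One)" by (rule compact_imp_bounded)
  then obtain B where "B > 0" "\<And>x. x \<in> cbox 0 One \<Longrightarrow> norm (f x) \<le> B"
    unfolding bounded_pos by auto
  with that torus_cell_subset_cbox show ?thesis by blast
qed

lemma torus_integrable_bounded:
  fixes f :: "'a::euclidean_space \<Rightarrow> 'b::{banach, second_countable_topology}"
  assumes "torus_prob_measure \<mu>" "f \<in> borel_measurable borel"
    and "\<And>x. x \<in> torus_cell \<Longrightarrow> norm (f x) \<le> B"
  shows "integrable \<mu> f"
proof -
  interpret finite_measure \<mu> using assms(1) by (rule torus_prob_finite)
  show ?thesis
    by (rule integrable_const_bound[where B=B])
      (use assms torus_prob_space_eq[OF assms(1)] in \<open>auto intro!: torus_prob_measurable AE_I2\<close>)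
qed

lemma torus_integrable_continuous:
  fixes f :: "'a::euclidean_space \<Rightarrow> 'b::{banach, second_countable_topology}"
  assumes "torus_prob_measure \<mu>" "continuous_on UNIV f"
  shows "integrable \<mu> f"
proof -
  obtain B where "\<And>x. x \<in> torus_cell \<Longrightarrow> norm (f x) \<le> B"
    using continuous_bounded_on_cell[OF assms(2)] by metis
  then show ?thesis
    by (intro torus_integrable_bounded[where B=B] assms borel_measurable_continuous_onI)
qed

lemma torus_integral_norm_bound:
  fixes f :: "'a::euclidean_space \<Rightarrow> 'b::{banach, second_countable_topology}"
  assumes "torus_prob_measure \<mu>" and B: "\<And>x. x \<in> torus_cell \<Longrightarrow> norm (f x) \<le> B" and "B \<ge> 0"
  shows "norm (\<integral>x. f x \<partial>\<mu>) \<le> B"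
proof (cases "integrable \<mu> f")
  case True
  interpret prob_space \<mu> using assms(1) by (rule torus_prob_space)
  have "norm (\<integral>x. f x \<partial>\<mu>) \<le> (\<integral>x. norm (f x) \<partial>\<mu>)" by (rule integral_norm_bound)
  also have "\<dots> \<le> (\<integral>x. B \<partial>\<mu>)"
    by (intro integral_mono True integrable_norm)
      (use B torus_prob_space_eq[OF assms(1)] in auto)
  finally show ?thesis by (simp add: prob_space)
next
  case False then show ?thesis using \<open>B \<ge> 0\<close> by (simp add: not_integrable_integral_eq)
qed

lemma torus_integral_cong:
  assumes "torus_prob_measure \<mu>" "\<And>x. x \<in> torus_cell \<Longrightarrow> f x = g x"
  shows "(\<integral>x. f x \<partial>\<mu>) = (\<integral>x. g x \<partial>\<mu>)"
  by (intro Bochner_Integration.integral_cong) (use assms torus_prob_space_eq in auto)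

lemma torus_periodicD:
  "torus_periodic f \<Longrightarrow> b \<in> Basis \<Longrightarrow> f (x + b) = f x"
  by (simp add: torus_periodic_def)

lemma torus_periodic_int_multiple:
  assumes "torus_periodic f" "b \<in> Basis"
  shows "f (x + of_int z *\<^sub>R b) = f x"
proof -
  have nat: "f (y + real n *\<^sub>R b) = f y" for n y
  proof (induction n)
    case (Suc n)
    have "f (y + real (Suc n) *\<^sub>R b) = f ((y + real n *\<^sub>R b) + b)"
      by (simp add: algebra_simps)
    then show ?case using Suc assms by (simp add: torus_periodicD)
  qed simp
  show ?thesis
  proof (cases "z \<ge> 0")
    case True
    then show ?thesis using nat[of x "nat z"] by simp
  next
    case False
    then show ?thesis using nat[of "x + of_int z *\<^sub>R b" "nat (-z)"] by (simp add: algebra_simps)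
  qed
qed

lemma torus_periodic_lattice:
  fixes f :: "'a::euclidean_space \<Rightarrow> 'b"
  assumes "torus_periodic f"
  shows "f (x + (\<Sum>b\<in>Basis. of_int (z b) *\<^sub>R b)) = f x"
proof -
  have "f (x + (\<Sum>b\<in>A. of_int (z b) *\<^sub>R b)) = f x" if "finite A" "A \<subseteq> Basis" for A
    using that
  proof (induction A arbitrary: x)
    case (insert b A)
    have "f (x + (\<Sum>b\<in>insert b A. of_int (z b) *\<^sub>R b))
        = f ((x + of_int (z b) *\<^sub>R b) + (\<Sum>b\<in>A. of_int (z b) *\<^sub>R b))"
      using insert by (simp add: algebra_simps)
    then show ?case using insert assms by (simp add: torus_periodic_int_multiple)
  qed simp
  then show ?thesis by simp
qed

text \<open>The representative of a point in the half-open cell, that is, the quotient map onto the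
  torus in this encoding of it.\<close>

definition torus_frac :: "'a::euclidean_space \<Rightarrow> 'a" where
  "torus_frac x = (\<Sum>b\<in>Basis. frac (x \<bullet> b) *\<^sub>R b)"

lemma torus_frac_in_cell: "torus_frac x \<in> torus_cell"
  by (auto simp: torus_frac_def torus_cell_def inner_sum_left_Basis frac_lt_1)

lemma torus_frac_inner: "b \<in> Basis \<Longrightarrow> torus_frac x \<bullet> b = frac (x \<bullet> b)"
  by (simp add: torus_frac_def inner_sum_left_Basis)

lemma torus_frac_id: "x \<in> torus_cell \<Longrightarrow> torus_frac x = x"
  by (rule euclidean_eqI) (auto simp: torus_frac_inner torus_cell_def frac_eq)

lemma torus_periodic_frac:
  assumes "torus_periodic f"
  shows "f (torus_frac x) = f x"
proof -
  have "torus_frac x = x + (\<Sum>b\<in>Basis. of_int (- \<lfloor>x \<bullet> b\<rfloor>) *\<^sub>R b)"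
    by (rule euclidean_eqI)
      (auto simp: torus_frac_def inner_sum_left_Basis inner_add_left frac_def inner_diff_left sum_negf)
  then show ?thesis using torus_periodic_lattice[OF assms] by metis
qed

lemma torus_periodic_of_frac: "torus_periodic (\<lambda>x. f (torus_frac x))"
proof -
  have "torus_frac (x + b) = torus_frac x" if "b \<in> Basis" for x b :: 'a
    by (rule euclidean_eqI)
      (use that in \<open>auto simp: torus_frac_inner inner_add_left inner_Basis frac_1_eq\<close>)
  then show ?thesis by (simp add: torus_periodic_def)
qed

lemma torus_periodic_bounded:
  fixes f :: "'a::euclidean_space \<Rightarrow> 'b::real_normed_vector"
  assumes "continuous_on UNIV f" "torus_periodic f"
  obtains B where "B > 0" "\<And>x. norm (f x) \<le> B"
proof -
  obtain B where "B > 0" "\<And>x. x \<in> torus_cell \<Longrightarrow> norm (f x) \<le> B"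
    using continuous_bounded_on_cell[OF assms(1)] by metis
  with that show ?thesis
    using torus_periodic_frac[OF assms(2)] torus_frac_in_cell by metis
qed

text \<open>By periodicity only the fractional part \<open>r\<close> of the shift matters. The
  shifted cell, with side \<open>[r, 1 + r)\<close> along \<open>b\<close>, is cut at 1, and the
  piece beyond 1 is moved back by one period to fill \<open>[0, r)\<close>.\<close>

lemma torus_nn_integral_translate_coord:
  fixes f :: "'a::euclidean_space \<Rightarrow> ennreal"
  assumes [measurable]: "f \<in> borel_measurable borel" and per: "torus_periodic f" and b: "b \<in> Basis"
  shows "(\<integral>\<^sup>+x. f (x + s *\<^sub>R b) \<partial>torus_lebesgue) = (\<integral>\<^sup>+x. f x \<partial>torus_lebesgue)"
proof -
  have cellI: "(\<integral>\<^sup>+x. g x \<partial>torus_lebesgue) = (\<integral>\<^sup>+x. g x * indicator torus_cell x \<partial>lborel)"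
    for g :: "'a \<Rightarrow> ennreal"
    unfolding torus_lebesgue_def by (rule nn_integral_restrict_space) simp
  define r where "r = frac s"
  have r: "0 \<le> r" "r < 1" by (auto simp: r_def frac_lt_1)
  have red: "f (x + s *\<^sub>R b) = f (x + r *\<^sub>R b)" for x
  proof -
    have "f (x + s *\<^sub>R b) = f ((x + r *\<^sub>R b) + of_int \<lfloor>s\<rfloor> *\<^sub>R b)"
      by (simp add: r_def frac_def algebra_simps)
    then show ?thesis using torus_periodic_int_multiple[OF per b] by metis
  qed
  \<comment> \<open>\<open>C l u\<close> is the cell with its side along \<open>b\<close> replaced
    by \<open>[l, u)\<close>; a translation along \<open>b\<close> only moves \<open>l\<close> and
    \<open>u\<close>.\<close>
  define C where "C = (\<lambda>l u. {x::'a. (\<forall>c\<in>Basis. c \<noteq> b \<longrightarrow> 0 \<le> x \<bullet> c \<and> x \<bullet> c < 1) \<and> l \<le> x \<bullet> b \<and> x \<bullet> b < u})"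
  have C_borel [measurable]: "C l u \<in> sets borel" for l u
  proof -
    have "C l u = (\<Inter>c\<in>Basis. {x::'a. c \<noteq> b \<longrightarrow> 0 \<le> x \<bullet> c \<and> x \<bullet> c < 1}) \<inter> {x. l \<le> x \<bullet> b} \<inter> {x. x \<bullet> b < u}"
      by (auto simp: C_def)
    moreover have "{x::'a. c \<noteq> b \<longrightarrow> 0 \<le> x \<bullet> c \<and> x \<bullet> c < 1} \<in> sets borel" for c
      by measurable
    ultimately show ?thesis by (auto intro!: sets.Int sets.finite_INT)
  qed
  have cell: "torus_cell = C 0 1" using b by (auto simp: C_def torus_cell_def)
  have shift: "indicator (C l u) (x - t *\<^sub>R b) = (indicator (C (l + t) (u + t)) x :: ennreal)" for l u t x
  proof -
    have "(x - t *\<^sub>R b) \<bullet> c = (if c = b then x \<bullet> b - t else x \<bullet> c)" if "c \<in> Basis" for c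
      using that b by (auto simp: inner_diff_left inner_Basis)
    then have "x - t *\<^sub>R b \<in> C l u \<longleftrightarrow> x \<in> C (l + t) (u + t)"
      using b by (auto simp: C_def)
    then show ?thesis by (simp add: indicator_def)
  qed
  have tr: "(\<integral>\<^sup>+x. g (x + t *\<^sub>R b) * indicator (C l u) x \<partial>lborel)
      = (\<integral>\<^sup>+x. g x * indicator (C (l + t) (u + t)) x \<partial>lborel)"
    if [measurable]: "g \<in> borel_measurable borel" for g :: "'a \<Rightarrow> ennreal" and t l u
  proof -
    have "(\<integral>\<^sup>+x. g x * indicator (C (l + t) (u + t)) x \<partial>lborel)
      = (\<integral>\<^sup>+x. g x * indicator (C (l + t) (u + t)) x \<partial>distr lborel borel ((+) (t *\<^sub>R b)))"
      by (simp add: lborel_distr_plus)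
    also have "\<dots> = (\<integral>\<^sup>+x. g (t *\<^sub>R b + x) * indicator (C (l + t) (u + t)) (t *\<^sub>R b + x) \<partial>lborel)"
      by (rule nn_integral_distr) simp_all
    also have "\<dots> = (\<integral>\<^sup>+x. g (x + t *\<^sub>R b) * indicator (C l u) x \<partial>lborel)"
    proof (intro nn_integral_cong)
      fix x :: 'a
      have "indicator (C (l + t) (u + t)) (t *\<^sub>R b + x) = (indicator (C l u) x :: ennreal)"
        using shift[of l u "t *\<^sub>R b + x" t] by simp
      then show "g (t *\<^sub>R b + x) * indicator (C (l + t) (u + t)) (t *\<^sub>R b + x)
          = g (x + t *\<^sub>R b) * indicator (C l u) x"
        by (simp add: add.commute)
    qed
    finally show ?thesis by simp
  qed
  have split: "(\<integral>\<^sup>+x. f x * indicator (C l u) x \<partial>lborel)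
      = (\<integral>\<^sup>+x. f x * indicator (C l m) x \<partial>lborel) + (\<integral>\<^sup>+x. f x * indicator (C m u) x \<partial>lborel)"
    if "l \<le> m" "m \<le> u" for l m u
  proof -
    have "indicator (C l u) x = (indicator (C l m) x + indicator (C m u) x :: ennreal)" for x
      using that by (auto simp: C_def indicator_def)
    then show ?thesis
      by (simp add: distrib_left nn_integral_add)
  qed
  have "(\<integral>\<^sup>+x. f (x + s *\<^sub>R b) \<partial>torus_lebesgue) = (\<integral>\<^sup>+x. f (x + r *\<^sub>R b) * indicator (C 0 1) x \<partial>lborel)"
    unfolding cellI red cell ..
  also have "\<dots> = (\<integral>\<^sup>+x. f x * indicator (C r (1 + r)) x \<partial>lborel)"
    using tr[of f r 0 1] by simp
  also have "\<dots> = (\<integral>\<^sup>+x. f x * indicator (C r 1) x \<partial>lborel) + (\<integral>\<^sup>+x. f x * indicator (C 1 (1 + r)) x \<partial>lborel)"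
    using r by (intro split) auto
  also have "(\<integral>\<^sup>+x. f x * indicator (C 1 (1 + r)) x \<partial>lborel)
      = (\<integral>\<^sup>+x. f (x + 1 *\<^sub>R b) * indicator (C 0 r) x \<partial>lborel)"
    using tr[of f 1 0 r] by (simp add: add.commute[of r 1])
  also have "\<dots> = (\<integral>\<^sup>+x. f x * indicator (C 0 r) x \<partial>lborel)"
    by (simp add: torus_periodicD[OF per b])
  also have "(\<integral>\<^sup>+x. f x * indicator (C r 1) x \<partial>lborel) + (\<integral>\<^sup>+x. f x * indicator (C 0 r) x \<partial>lborel)
      = (\<integral>\<^sup>+x. f x * indicator (C 0 1) x \<partial>lborel)"
    by (subst add.commute) (rule split[of 0 r 1, symmetric], use r in auto)
  finally show ?thesis unfolding cellI cell .
qed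

lemma torus_nn_integral_translate:
  fixes f :: "'a::euclidean_space \<Rightarrow> ennreal"
  assumes f: "f \<in> borel_measurable borel" and per: "torus_periodic f"
  shows "(\<integral>\<^sup>+x. f (x + a) \<partial>torus_lebesgue) = (\<integral>\<^sup>+x. f x \<partial>torus_lebesgue)"
proof -
  have "(\<integral>\<^sup>+x. f (x + (\<Sum>b\<in>A. (a \<bullet> b) *\<^sub>R b)) \<partial>torus_lebesgue) = (\<integral>\<^sup>+x. f x \<partial>torus_lebesgue)"
    if "finite A" "A \<subseteq> Basis" for A
    using that
  proof (induction A)
    case (insert b A)
    define c where "c = (\<Sum>b\<in>A. (a \<bullet> b) *\<^sub>R b)"
    define g where "g = (\<lambda>x. f (x + c))"
    have g: "g \<in> borel_measurable borel" unfolding g_def using f by measurable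
    have gp: "torus_periodic g"
      using per unfolding g_def torus_periodic_def by (metis add.assoc add.commute)
    have "(\<integral>\<^sup>+x. f (x + (\<Sum>b\<in>insert b A. (a \<bullet> b) *\<^sub>R b)) \<partial>torus_lebesgue)
        = (\<integral>\<^sup>+x. g (x + (a \<bullet> b) *\<^sub>R b) \<partial>torus_lebesgue)"
      using insert by (simp add: g_def c_def algebra_simps)
    also have "\<dots> = (\<integral>\<^sup>+x. g x \<partial>torus_lebesgue)"
      using insert by (intro torus_nn_integral_translate_coord g gp) auto
    finally show ?case using insert by (simp add: g_def c_def)
  qed simp
  from this[of Basis] show ?thesis by (simp add: euclidean_representation)
qed

text \<open>Invariance as an identity of measures: Bochner integrals with any codomain inherit it
  through \<open>integral_distr\<close>, whereas the two preceding lemmas reach nonnegative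
  integrands.\<close>

lemma torus_distr_translate:
  "distr torus_lebesgue (restrict_space borel torus_cell) (\<lambda>x. torus_frac (x + a))
    = (torus_lebesgue :: 'a::euclidean_space measure)"
proof (rule measure_eqI)
  have frac_m: "torus_frac \<in> borel \<rightarrow>\<^sub>M (borel :: 'a measure)"
    unfolding torus_frac_def frac_def by measurable
  have m: "(\<lambda>x. torus_frac (x + a)) \<in> torus_lebesgue \<rightarrow>\<^sub>M restrict_space borel (torus_cell :: 'a set)"
    by (intro measurable_restrict_space2 torus_prob_measurable[OF torus_prob_measure_lebesgue]
        measurable_compose[OF _ frac_m]) (auto simp: torus_frac_in_cell)
  show "sets (distr torus_lebesgue (restrict_space borel torus_cell) (\<lambda>x. torus_frac (x + a)))
      = sets (torus_lebesgue :: 'a measure)"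
    by (simp add: torus_prob_sets[OF torus_prob_measure_lebesgue])
  fix A assume "A \<in> sets (distr torus_lebesgue (restrict_space borel torus_cell) (\<lambda>x::'a. torus_frac (x + a)))"
  then have A: "A \<in> sets (restrict_space borel torus_cell)" by simp
  then have A': "A \<in> sets borel" "A \<subseteq> torus_cell"
    by (auto simp: sets_restrict_space_iff)
  have "emeasure (distr torus_lebesgue (restrict_space borel torus_cell) (\<lambda>x. torus_frac (x + a))) A
    = (\<integral>\<^sup>+x. indicator A x \<partial>distr torus_lebesgue (restrict_space borel torus_cell) (\<lambda>x. torus_frac (x + a)))"
    using A by (intro nn_integral_indicator[symmetric]) simp
  also have "\<dots> = (\<integral>\<^sup>+x. indicator A (torus_frac (x + a)) \<partial>torus_lebesgue)"
    using A by (intro nn_integral_distr m) auto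
  also have "\<dots> = (\<integral>\<^sup>+x. indicator A (torus_frac x) \<partial>torus_lebesgue)"
    by (rule torus_nn_integral_translate)
      (use A' in \<open>auto intro!: torus_periodic_of_frac measurable_compose[OF frac_m]\<close>)
  also have "\<dots> = (\<integral>\<^sup>+x. indicator A x \<partial>torus_lebesgue)"
    by (intro nn_integral_cong)
      (simp add: torus_frac_id torus_prob_space_eq[OF torus_prob_measure_lebesgue])
  also have "\<dots> = emeasure torus_lebesgue A"
    using A by (intro nn_integral_indicator) (simp add: torus_prob_sets[OF torus_prob_measure_lebesgue])
  finally show "emeasure (distr torus_lebesgue (restrict_space borel torus_cell) (\<lambda>x. torus_frac (x + a))) A
    = emeasure torus_lebesgue A" .
qed

lemma torus_integral_translate:
  fixes f :: "'a::euclidean_space \<Rightarrow> 'b::{banach, second_countable_topology}"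
  assumes "f \<in> borel_measurable borel" and per: "torus_periodic f"
  shows "(\<integral>x. f (x + a) \<partial>torus_lebesgue) = (\<integral>x. f x \<partial>torus_lebesgue)"
proof -
  have frac_m: "torus_frac \<in> borel \<rightarrow>\<^sub>M (borel :: 'a measure)"
    unfolding torus_frac_def frac_def by measurable
  have m: "(\<lambda>x. torus_frac (x + a)) \<in> torus_lebesgue \<rightarrow>\<^sub>M restrict_space borel (torus_cell :: 'a set)"
    by (intro measurable_restrict_space2 torus_prob_measurable[OF torus_prob_measure_lebesgue]
        measurable_compose[OF _ frac_m]) (auto simp: torus_frac_in_cell)
  have "(\<integral>x. f x \<partial>torus_lebesgue)
      = (\<integral>x. f x \<partial>distr torus_lebesgue (restrict_space borel torus_cell) (\<lambda>x. torus_frac (x + a)))"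
    by (simp add: torus_distr_translate)
  also have "\<dots> = (\<integral>x. f (torus_frac (x + a)) \<partial>torus_lebesgue)"
    by (intro integral_distr m measurable_restrict_space1 assms)
  finally show ?thesis by (simp add: torus_periodic_frac[OF per])
qed

lemma continuous_torus_integral:
  fixes f :: "'c::euclidean_space \<Rightarrow> 'a::euclidean_space \<Rightarrow> 'b::{banach, second_countable_topology}"
  assumes \<mu>: "torus_prob_measure \<mu>" and f: "continuous_on UNIV (\<lambda>(x, y). f x y)"
  shows "continuous_on UNIV (\<lambda>x. \<integral>y. f x y \<partial>\<mu>)"
  unfolding continuous_on_sequentially
proof safe
  fix u :: "nat \<Rightarrow> 'c" and a assume u: "u \<longlonglongrightarrow> a"
  interpret finite_measure \<mu> using \<mu> by (rule torus_prob_finite)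
  have slice: "continuous_on UNIV (f x)" for x
  proof -
    have "continuous_on UNIV (\<lambda>y. case (x, y) of (x, y) \<Rightarrow> f x y)"
      by (rule continuous_on_compose2[OF f]) (auto intro: continuous_on_Pair)
    then show ?thesis by simp
  qed
  \<comment> \<open>A convergent sequence stays in a compact set, so a single constant dominates all
    the integrands on the closed cube.\<close>
  from u have "bounded (range u)" by (rule convergent_imp_bounded)
  then have "compact (closure (range u))" by (simp add: compact_closure)
  then have "compact ((\<lambda>(x, y). f x y) ` (closure (range u) \<times> cbox 0 One))"
    by (intro compact_continuous_image continuous_on_subset[OF f] compact_Times) auto
  then have "bounded ((\<lambda>(x, y). f x y) ` (closure (range u) \<times> cbox 0 One))"
    by (rule compact_imp_bounded)
  then obtain B where B: "\<And>x y. x \<in> closure (range u) \<Longrightarrow> y \<in> cbox 0 One \<Longrightarrow> norm (f x y) \<le> B"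
    unfolding bounded_iff by fastforce
  have "(\<lambda>n. \<integral>y. f (u n) y \<partial>\<mu>) \<longlonglongrightarrow> (\<integral>y. f a y \<partial>\<mu>)"
  proof (rule integral_dominated_convergence[where w="\<lambda>_. B"])
    show "f a \<in> borel_measurable \<mu>" "\<And>n. f (u n) \<in> borel_measurable \<mu>"
      by (intro torus_prob_measurable[OF \<mu>] borel_measurable_continuous_onI slice)+
    have "(\<lambda>n. f (u n) y) \<longlonglongrightarrow> f a y" for y
    proof -
      have "continuous_on UNIV (\<lambda>x. f x y)"
      proof -
        have "continuous_on UNIV (\<lambda>x. case (x, y) of (x, y) \<Rightarrow> f x y)"
          by (rule continuous_on_compose2[OF f]) (auto intro: continuous_on_Pair)
        then show ?thesis by simp
      qed
      then show ?thesis using u by (auto simp: continuous_on_sequentially o_def)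
    qed
    then show "AE y in \<mu>. (\<lambda>n. f (u n) y) \<longlonglongrightarrow> f a y" by simp
    show "AE y in \<mu>. norm (f (u n) y) \<le> B" for n
    proof (rule AE_I2)
      fix y assume "y \<in> space \<mu>"
      then have "y \<in> cbox 0 One" using torus_prob_space_eq[OF \<mu>] torus_cell_subset_cbox by blast
      moreover have "u n \<in> closure (range u)" by (rule subsetD[OF closure_subset]) simp
      ultimately show "norm (f (u n) y) \<le> B" by (rule B[rotated])
    qed
  qed simp
  then show "((\<lambda>x. \<integral>y. f x y \<partial>\<mu>) \<circ> u) \<longlonglongrightarrow> (\<integral>y. f a y \<partial>\<mu>)" by (simp add: o_def)
qed

lemma torus_Fubini:
  fixes f :: "'c::euclidean_space \<Rightarrow> 'a::euclidean_space \<Rightarrow> 'b::{banach, second_countable_topology}"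
  assumes \<mu>: "torus_prob_measure \<mu>" and \<kappa>: "torus_prob_measure \<kappa>"
    and f: "continuous_on UNIV (\<lambda>(x, y). f x y)"
  shows "(\<integral>x. (\<integral>y. f x y \<partial>\<mu>) \<partial>\<kappa>) = (\<integral>y. (\<integral>x. f x y \<partial>\<kappa>) \<partial>\<mu>)"
proof -
  interpret A: prob_space \<mu> using \<mu> by (rule torus_prob_space)
  interpret B: prob_space \<kappa> using \<kappa> by (rule torus_prob_space)
  interpret pair_prob_space \<kappa> \<mu> ..
  have m: "(\<lambda>(x, y). f x y) \<in> borel_measurable (\<kappa> \<Otimes>\<^sub>M \<mu>)"
  proof -
    have "(\<lambda>z. (fst z, snd z)) \<in> \<kappa> \<Otimes>\<^sub>M \<mu> \<rightarrow>\<^sub>M borel \<Otimes>\<^sub>M borel"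
      by (intro measurable_Pair measurable_compose[OF measurable_fst] measurable_compose[OF measurable_snd]
          torus_prob_measurable[OF \<mu>] torus_prob_measurable[OF \<kappa>]) auto
    moreover have "(\<lambda>(x, y). f x y) \<in> borel_measurable (borel \<Otimes>\<^sub>M borel)"
      unfolding borel_prod by (rule borel_measurable_continuous_onI[OF f])
    ultimately show ?thesis using measurable_compose by fastforce
  qed
  have "compact ((\<lambda>(x, y). f x y) ` (cbox 0 One \<times> cbox 0 One))"
    by (intro compact_continuous_image continuous_on_subset[OF f] compact_Times) auto
  then have "bounded ((\<lambda>(x, y). f x y) ` (cbox 0 One \<times> cbox 0 One))"
    by (rule compact_imp_bounded)
  then obtain K where K: "\<And>x y. x \<in> cbox 0 One \<Longrightarrow> y \<in> cbox 0 One \<Longrightarrow> norm (f x y) \<le> K"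
    unfolding bounded_iff by fastforce
  have "integrable (\<kappa> \<Otimes>\<^sub>M \<mu>) (\<lambda>(x, y). f x y)"
  proof (rule integrable_const_bound[where B=K, OF AE_I2 m])
    fix z assume "z \<in> space (\<kappa> \<Otimes>\<^sub>M \<mu>)"
    then have "fst z \<in> cbox 0 One" "snd z \<in> cbox 0 One"
      using torus_prob_space_eq[OF \<mu>] torus_prob_space_eq[OF \<kappa>] torus_cell_subset_cbox
      by (auto simp: space_pair_measure)
    then show "norm (case z of (x, y) \<Rightarrow> f x y) \<le> K" using K by (simp add: case_prod_beta)
  qed
  from Fubini_integral[OF this] show ?thesis by simp
qed

section \<open>Continuously differentiable functions\<close>

text \<open>The gradient is carried as an explicit argument so that the calculus rules compose by
  resolution; \<open>gradient\<close> and \<open>C_k 1\<close> are recovered from it by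
  \<open>C1_gradient\<close> and \<open>C1_imp_C_k\<close>.\<close>

definition C1 :: "('a::euclidean_space \<Rightarrow> real) \<Rightarrow> ('a \<Rightarrow> 'a) \<Rightarrow> bool" where
  "C1 f g \<longleftrightarrow> continuous_on UNIV g \<and> (\<forall>x. (f has_derivative (\<lambda>h. g x \<bullet> h)) (at x))"

lemma C1_has_derivative: "C1 f g \<Longrightarrow> (f has_derivative (\<lambda>h. g x \<bullet> h)) (at x)"
  by (simp add: C1_def)

lemma C1_grad_continuous: "C1 f g \<Longrightarrow> continuous_on UNIV g"
  by (simp add: C1_def)

lemma C1_continuous: "C1 f g \<Longrightarrow> continuous_on UNIV f"
  by (meson C1_has_derivative continuous_at_imp_continuous_on has_derivative_continuous)

lemma pderivative_eq:
  "(f has_derivative (\<lambda>h. g \<bullet> h)) (at x) \<Longrightarrow> pderivative b f x = g \<bullet> b"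
  unfolding pderivative_def by (metis frechet_derivative_at)

lemma gradient_eq:
  assumes "(f has_derivative (\<lambda>h. g \<bullet> h)) (at x)"
  shows "gradient f x = g"
  unfolding gradient_def pderivative_eq[OF assms] by (simp add: euclidean_representation)

lemma C1_gradient: "C1 f g \<Longrightarrow> gradient f = g"
  by (intro ext gradient_eq C1_has_derivative)

lemma C1_imp_C_k:
  assumes "C1 f g"
  shows "C_k 1 f"
proof -
  have "f differentiable_on UNIV"
    unfolding differentiable_on_def differentiable_def
    using C1_has_derivative[OF assms] has_derivative_at_withinI by blast
  moreover have "pderivative b f = (\<lambda>x. g x \<bullet> b)" for b
    by (intro ext pderivative_eq C1_has_derivative assms)
  ultimately show ?thesis
    using C1_grad_continuous[OF assms] by (auto intro!: continuous_intros)
qed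

lemma differentiable_gradient:
  assumes "f differentiable (at x)"
  shows "(f has_derivative (\<lambda>h. gradient f x \<bullet> h)) (at x)"
proof -
  from assms have d: "(f has_derivative frechet_derivative f (at x)) (at x)"
    by (simp add: frechet_derivative_works)
  then have lin: "linear (frechet_derivative f (at x))" by (rule has_derivative_linear)
  have "frechet_derivative f (at x) h = gradient f x \<bullet> h" for h
  proof -
    have "frechet_derivative f (at x) h = frechet_derivative f (at x) (\<Sum>b\<in>Basis. (h \<bullet> b) *\<^sub>R b)"
      by (simp add: euclidean_representation)
    also have "\<dots> = (\<Sum>b\<in>Basis. (h \<bullet> b) * frechet_derivative f (at x) b)"
      by (simp add: linear_sum[OF lin] linear_scale[OF lin])
    also have "\<dots> = gradient f x \<bullet> h"
      by (simp add: gradient_def pderivative_def inner_sum_left inner_commute[of h] mult.commute)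
    finally show ?thesis .
  qed
  then have "frechet_derivative f (at x) = (\<lambda>h. gradient f x \<bullet> h)" by (rule ext)
  with d show ?thesis by simp
qed

lemma C_k_imp_C1:
  assumes "C_k 1 f"
  shows "C1 f (gradient f)"
proof -
  have f: "f differentiable_on UNIV" "\<And>b. b \<in> Basis \<Longrightarrow> continuous_on UNIV (pderivative b f)"
    using assms by auto
  have "continuous_on UNIV (gradient f)"
    unfolding gradient_def by (intro continuous_intros f)
  moreover have "(f has_derivative (\<lambda>h. gradient f x \<bullet> h)) (at x)" for x
    using f(1) by (intro differentiable_gradient) (simp add: differentiable_on_def)
  ultimately show ?thesis by (simp add: C1_def)
qed

lemma C1_const: "C1 (\<lambda>x. c) (\<lambda>x. 0)"
  by (auto simp: C1_def)

lemma C1_add: "C1 f f' \<Longrightarrow> C1 g g' \<Longrightarrow> C1 (\<lambda>x. f x + g x) (\<lambda>x. f' x + g' x)"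
  by (auto simp: C1_def inner_add_left intro!: continuous_intros has_derivative_add)

lemma C1_mult:
  "C1 f f' \<Longrightarrow> C1 g g' \<Longrightarrow> C1 (\<lambda>x. f x * g x) (\<lambda>x. g x *\<^sub>R f' x + f x *\<^sub>R g' x)"
  using C1_continuous[of f f'] C1_continuous[of g g']
  by (auto simp: C1_def inner_add_left fun_eq_iff intro!: continuous_intros derivative_eq_intros)

lemma C1_cmult: "C1 f f' \<Longrightarrow> C1 (\<lambda>x. c * f x) (\<lambda>x. c *\<^sub>R f' x)"
  using C1_mult[OF C1_const[of c]] by simp

lemma C1_minus: "C1 f f' \<Longrightarrow> C1 (\<lambda>x. - f x) (\<lambda>x. - f' x)"
  using C1_cmult[of f f' "-1"] by simp

lemma C1_diff: "C1 f f' \<Longrightarrow> C1 g g' \<Longrightarrow> C1 (\<lambda>x. f x - g x) (\<lambda>x. f' x - g' x)"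
  using C1_add[OF _ C1_minus, of f f' g g'] by simp

lemma C1_sum:
  "(\<And>i. i \<in> I \<Longrightarrow> C1 (f i) (f' i)) \<Longrightarrow> C1 (\<lambda>x. \<Sum>i\<in>I. f i x) (\<lambda>x. \<Sum>i\<in>I. f' i x)"
  by (induction I rule: infinite_finite_induct) (auto intro: C1_const C1_add)

lemma C1_exp: "C1 f f' \<Longrightarrow> C1 (\<lambda>x. exp (f x)) (\<lambda>x. exp (f x) *\<^sub>R f' x)"
  using C1_continuous[of f f']
  by (auto simp: C1_def fun_eq_iff intro!: continuous_intros derivative_eq_intros)

lemma C1_translate: "C1 f f' \<Longrightarrow> C1 (\<lambda>x. f (x + a)) (\<lambda>x. f' (x + a))"
proof -
  assume f: "C1 f f'"
  have "((\<lambda>x. f (x + a)) has_derivative (\<lambda>h. f' (x + a) \<bullet> h)) (at x)" for x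
    by (rule has_derivative_compose[OF _ C1_has_derivative[OF f], where f="\<lambda>x. x + a"])
      (auto intro!: derivative_eq_intros)
  moreover have "continuous_on UNIV (\<lambda>x. f' (x + a))"
    by (rule continuous_on_compose2[OF C1_grad_continuous[OF f]]) (auto intro!: continuous_intros)
  ultimately show ?thesis by (simp add: C1_def)
qed

lemma C1_unique: "C1 f g \<Longrightarrow> C1 f h \<Longrightarrow> g = h"
  by (metis C1_gradient)

text \<open>Translation by a period does not change \<open>f\<close> as a function, so uniqueness of
  the gradient forces the translate of \<open>g\<close> to equal \<open>g\<close>.\<close>

lemma C1_periodic_grad:
  assumes "C1 f g" "torus_periodic f"
  shows "torus_periodic g"
proof -
  have "g (x + b) = g x" if b: "b \<in> Basis" for x b
  proof -
    have "(\<lambda>x. f (x + b)) = f" using assms(2) b by (auto simp: torus_periodic_def)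
    with C1_translate[OF assms(1), of b] have "C1 f (\<lambda>x. g (x + b))" by simp
    from C1_unique[OF assms(1) this] show ?thesis by metis
  qed
  then show ?thesis by (simp add: torus_periodic_def)
qed

lemma C1_difference_bound:
  assumes "C1 f g" "\<And>x. norm (g x) \<le> B"
  shows "\<bar>f x - f y\<bar> \<le> B * norm (x - y)"
proof -
  have "norm (f x - f y) \<le> B * norm (x - y)"
  proof (rule differentiable_bound[of UNIV f "\<lambda>x h. g x \<bullet> h"])
    show "onorm (\<lambda>h. g x \<bullet> h) \<le> B" for x
      by (rule onorm_le) (metis Cauchy_Schwarz_ineq2 assms(2) mult_right_mono norm_ge_zero order_trans real_norm_def)
  qed (auto intro: has_derivative_at_withinI C1_has_derivative assms)
  then show ?thesis by simp
qed

lemma continuous_on_slices: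
  assumes "continuous_on UNIV (\<lambda>(x, y). f x y)"
  shows "continuous_on UNIV (\<lambda>y. f x y)" "continuous_on UNIV (\<lambda>x. f x y)"
proof -
  have "continuous_on UNIV (\<lambda>y. case (x, y) of (x, y) \<Rightarrow> f x y)"
    by (rule continuous_on_compose2[OF assms]) (auto intro: continuous_on_Pair)
  then show "continuous_on UNIV (\<lambda>y. f x y)" by simp
  have "continuous_on UNIV (\<lambda>x. case (x, y) of (x, y) \<Rightarrow> f x y)"
    by (rule continuous_on_compose2[OF assms]) (auto intro: continuous_on_Pair)
  then show "continuous_on UNIV (\<lambda>x. f x y)" by simp
qed

text \<open>\<open>fx\<close> is uniformly continuous on a unit ball times the closed cube. The
  linearization error of the integrand is therefore at most \<open>e * norm (z - x)\<close>
  uniformly in \<open>y\<close>, and integrating it against a probability measure keeps this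
  bound.\<close>

lemma C1_torus_integral:
  fixes f :: "'c::euclidean_space \<Rightarrow> 'a::euclidean_space \<Rightarrow> real"
  assumes \<mu>: "torus_prob_measure \<mu>" and f: "continuous_on UNIV (\<lambda>(x, y). f x y)"
    and fx: "continuous_on UNIV (\<lambda>(x, y). fx x y)"
    and d: "\<And>y. C1 (\<lambda>x. f x y) (\<lambda>x. fx x y)"
  shows "C1 (\<lambda>x. \<integral>y. f x y \<partial>\<mu>) (\<lambda>x. \<integral>y. fx x y \<partial>\<mu>)"
  unfolding C1_def
proof (intro conjI allI)
  show "continuous_on UNIV (\<lambda>x. \<integral>y. fx x y \<partial>\<mu>)" by (rule continuous_torus_integral[OF \<mu> fx])
  fix x
  show "((\<lambda>x. \<integral>y. f x y \<partial>\<mu>) has_derivative (\<lambda>h. (\<integral>y. fx x y \<partial>\<mu>) \<bullet> h)) (at x)"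
    unfolding has_derivative_at_alt
  proof (intro conjI allI impI)
    show "bounded_linear ((\<bullet>) (\<integral>y. fx x y \<partial>\<mu>))" by (rule bounded_linear_inner_right)
    fix e :: real assume "0 < e"
    have "uniformly_continuous_on (cball x 1 \<times> cbox 0 One) (\<lambda>(x, y). fx x y)"
      by (intro compact_uniformly_continuous continuous_on_subset[OF fx] compact_Times) auto
    from this[unfolded uniformly_continuous_on_def, rule_format, OF \<open>0 < e\<close>]
    obtain d0 where d0: "d0 > 0" "\<And>z z'. z \<in> cball x 1 \<times> cbox 0 One \<Longrightarrow> z' \<in> cball x 1 \<times> cbox 0 One
        \<Longrightarrow> dist z' z < d0 \<Longrightarrow> dist (case z' of (x, y) \<Rightarrow> fx x y) (case z of (x, y) \<Rightarrow> fx x y) < e"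
      by blast
    define d1 where "d1 = min d0 1"
    have unif: "norm (fx z y - fx x y) \<le> e" if "norm (z - x) < d1" "y \<in> cbox 0 One" for z y
      using d0(2)[of "(x, y)" "(z, y)"] that
      by (auto simp: d1_def dist_Pair_Pair dist_norm norm_minus_commute mem_cball)
    show "\<exists>d>0. \<forall>z. norm (z - x) < d \<longrightarrow>
        norm ((\<integral>y. f z y \<partial>\<mu>) - (\<integral>y. f x y \<partial>\<mu>) - (\<integral>y. fx x y \<partial>\<mu>) \<bullet> (z - x)) \<le> e * norm (z - x)"
    proof (intro exI[of _ d1] conjI allI impI)
      show "d1 > 0" using d0 by (simp add: d1_def)
      fix z assume z: "norm (z - x) < d1"
      have pt: "norm (f z y - f x y - fx x y \<bullet> (z - x)) \<le> e * norm (z - x)" if y: "y \<in> torus_cell" for y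
      proof -
        have y': "y \<in> cbox 0 One" using y torus_cell_subset_cbox by blast
        have "norm (f z y - f x y - fx x y \<bullet> (z - x)) \<le> norm (z - x) * e"
        proof (rule differentiable_bound_linearization[of x z "ball x d1" "\<lambda>x. f x y" "\<lambda>x h. fx x y \<bullet> h"])
          fix t :: real assume "t \<in> {0..1}"
          then have "norm (t *\<^sub>R (z - x)) \<le> norm (z - x)" by (simp add: mult_left_le_one_le)
          then show "x + t *\<^sub>R (z - x) \<in> ball x d1" using z by (simp add: dist_norm norm_minus_commute)
        next
          fix w assume "w \<in> ball x d1"
          then have w: "norm (w - x) < d1" by (simp add: dist_norm norm_minus_commute)
          show "((\<lambda>x. f x y) has_derivative (\<bullet>) (fx w y)) (at w within ball x d1)"
            by (rule has_derivative_at_withinI[OF C1_has_derivative[OF d]])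
          have "onorm (\<lambda>h. fx w y \<bullet> h - fx x y \<bullet> h) \<le> e"
          proof (rule onorm_le)
            fix h
            have "norm (fx w y \<bullet> h - fx x y \<bullet> h) = \<bar>(fx w y - fx x y) \<bullet> h\<bar>" by (simp add: inner_diff_left)
            also have "\<dots> \<le> norm (fx w y - fx x y) * norm h" by (rule Cauchy_Schwarz_ineq2)
            also have "\<dots> \<le> e * norm h" by (intro mult_right_mono unif w y') simp
            finally show "norm (fx w y \<bullet> h - fx x y \<bullet> h) \<le> e * norm h" .
          qed
          then show "onorm ((\<bullet>) (fx w y) - (\<bullet>) (fx x y)) \<le> e" by (simp add: fun_diff_def)
        next
          show "x \<in> ball x d1" using \<open>d1 > 0\<close> by simp
        qed
        then show ?thesis by (simp add: mult.commute)
      qed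
      have i: "integrable \<mu> (f z)" for z
        by (intro torus_integrable_continuous \<mu> continuous_on_slices[OF f])
      have j: "integrable \<mu> (fx x)"
        by (intro torus_integrable_continuous \<mu> continuous_on_slices[OF fx])
      have "(\<integral>y. f z y \<partial>\<mu>) - (\<integral>y. f x y \<partial>\<mu>) - (\<integral>y. fx x y \<partial>\<mu>) \<bullet> (z - x)
          = (\<integral>y. f z y - f x y - fx x y \<bullet> (z - x) \<partial>\<mu>)"
        using i[of z] i[of x] j by simp
      also have "norm \<dots> \<le> e * norm (z - x)"
        using \<open>0 < e\<close> by (intro torus_integral_norm_bound \<mu> pt) auto
      finally show "norm ((\<integral>y. f z y \<partial>\<mu>) - (\<integral>y. f x y \<partial>\<mu>) - (\<integral>y. fx x y \<partial>\<mu>) \<bullet> (z - x)) \<le> e * norm (z - x)" .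
    qed
  qed
qed

text \<open>The square of \<open>sin (pi * t)\<close> vanishes exactly at the integers and so
  measures the distance modulo the lattice without choosing representatives; the mollifiers are
  concentrated in the same terms. Moving \<open>x\<close> into the cell and \<open>y\<close> to its
  nearest lattice translate reduces the claim to uniform continuity on a compact box.\<close>

lemma torus_periodic_uniformly_continuous:
  fixes F :: "'a::euclidean_space \<Rightarrow> 'b::metric_space"
  assumes F: "continuous_on UNIV F" and per: "torus_periodic F" and "0 < \<eta>"
  obtains \<delta> where "0 < \<delta>"
    "\<And>x y. \<forall>b\<in>Basis. (sin (pi * ((x - y) \<bullet> b)))\<^sup>2 < \<delta> \<Longrightarrow> dist (F x) (F y) < \<eta>"
proof -
  \<comment> \<open>The representative of \<open>x\<close> lies in the unit cube and that of
    \<open>y\<close> within 1/2 of it in every coordinate, so this box contains both.\<close>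
  have "uniformly_continuous_on (cbox (- One) (2 *\<^sub>R One)) F"
    by (intro compact_uniformly_continuous continuous_on_subset[OF F]) auto
  from this[unfolded uniformly_continuous_on_def, rule_format, OF \<open>0 < \<eta>\<close>]
  obtain d0 where d0: "d0 > 0" "\<And>z z'. z \<in> cbox (- One) (2 *\<^sub>R One) \<Longrightarrow> z' \<in> cbox (- One) (2 *\<^sub>R One)
      \<Longrightarrow> dist z' z < d0 \<Longrightarrow> dist (F z') (F z) < \<eta>"
    by blast
  \<comment> \<open>The cap 1/2 keeps \<open>pi * \<zeta>\<close> in the range where the sine
    increases; the other bound makes the sum of the coordinate differences smaller than
    \<open>d0\<close>.\<close>
  define \<zeta> where "\<zeta> = min (1/2) (d0 / (2 * DIM('a)))"
  have \<zeta>: "0 < \<zeta>" "\<zeta> \<le> 1/2" "DIM('a) * \<zeta> < d0"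
  proof -
    show "0 < \<zeta>" "\<zeta> \<le> 1/2" using d0(1) by (auto simp: \<zeta>_def)
    have "DIM('a) * \<zeta> \<le> DIM('a) * (d0 / (2 * DIM('a)))" by (intro mult_left_mono) (auto simp: \<zeta>_def)
    also have "\<dots> < d0" using d0(1) by simp
    finally show "DIM('a) * \<zeta> < d0" .
  qed
  have sin\<zeta>: "0 < sin (pi * \<zeta>)"
    by (rule sin_gt_zero) (use \<zeta> in \<open>auto simp: mult_less_cancel_left1\<close>)
  show ?thesis
  proof (rule that[of "(sin (pi * \<zeta>))\<^sup>2"])
    show "0 < (sin (pi * \<zeta>))\<^sup>2" using sin\<zeta> by simp
    fix x y :: 'a assume "\<forall>b\<in>Basis. (sin (pi * ((x - y) \<bullet> b)))\<^sup>2 < (sin (pi * \<zeta>))\<^sup>2"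
    then have *: "(sin (pi * ((x - y) \<bullet> b)))\<^sup>2 < (sin (pi * \<zeta>))\<^sup>2" if "b \<in> Basis" for b using that by blast
    \<comment> \<open>Rounding selects the lattice translate of \<open>y\<close> nearest to
      \<open>x\<close>, so every coordinate difference is at most 1/2 in absolute value and the
      monotonicity of the sine can be used.\<close>
    define z where "z = (\<lambda>b. round ((x - y) \<bullet> b))"
    define fl where "fl = (\<Sum>b\<in>Basis. of_int (- \<lfloor>x \<bullet> b\<rfloor>) *\<^sub>R b)"
    define S where "S = (\<Sum>b\<in>Basis. of_int (z b) *\<^sub>R b :: 'a)"
    have flb: "fl \<bullet> b = of_int (- \<lfloor>x \<bullet> b\<rfloor>)" if "b \<in> Basis" for b
      unfolding fl_def using that by (rule inner_sum_left_Basis)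
    have Sb: "S \<bullet> b = of_int (z b)" if "b \<in> Basis" for b
      unfolding S_def using that by (rule inner_sum_left_Basis)
    define x' where "x' = x + fl"
    define y' where "y' = (y + S) + fl"
    have Fx: "F x' = F x" unfolding x'_def fl_def by (rule torus_periodic_lattice[OF per])
    have Fy: "F y' = F y" unfolding y'_def fl_def S_def by (simp only: torus_periodic_lattice[OF per])
    have x'b: "x' \<bullet> b = frac (x \<bullet> b)" if "b \<in> Basis" for b
      using flb[OF that] by (simp add: x'_def inner_add_left frac_def)
    have r: "\<bar>(x' - y') \<bullet> b\<bar> \<le> \<zeta>" if b: "b \<in> Basis" for b
    proof (rule ccontr)
      assume n: "\<not> \<bar>(x' - y') \<bullet> b\<bar> \<le> \<zeta>"
      have e: "(x' - y') \<bullet> b = (x - y) \<bullet> b - of_int (z b)"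
        by (simp add: x'_def y'_def inner_add_left inner_diff_left Sb[OF b])
      have h: "\<bar>(x' - y') \<bullet> b\<bar> \<le> 1/2"
        unfolding e z_def using of_int_round_abs_le[of "(x - y) \<bullet> b"] by (simp add: abs_minus_commute)
      have sinz: "sin (pi * of_int (z b)) = (0::real)" by (metis mult.commute sin_zero_iff_int2)
      have "sin (pi * ((x - y) \<bullet> b)) = sin (pi * ((x' - y') \<bullet> b) + pi * of_int (z b))"
        unfolding e by (simp add: algebra_simps)
      also have "\<dots> = sin (pi * ((x' - y') \<bullet> b)) * cos (pi * of_int (z b))"
        using sinz by (simp add: sin_add)
      finally have "(sin (pi * ((x - y) \<bullet> b)))\<^sup>2 = (sin (pi * ((x' - y') \<bullet> b)))\<^sup>2 * (cos (pi * of_int (z b)))\<^sup>2"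
        by (simp add: power_mult_distrib)
      also have "(cos (pi * of_int (z b)))\<^sup>2 = (1::real)"
        using sin_cos_squared_add[of "pi * of_int (z b)"] sinz by simp
      finally have s: "(sin (pi * ((x - y) \<bullet> b)))\<^sup>2 = (sin (pi * \<bar>(x' - y') \<bullet> b\<bar>))\<^sup>2"
        by (simp add: abs_if power2_eq_square)
      have "sin (pi * \<zeta>) \<le> sin (pi * \<bar>(x' - y') \<bullet> b\<bar>)"
      proof (rule sin_monotone_2pi_le)
        show "- (pi / 2) \<le> pi * \<zeta>"
          by (rule order_trans[of _ 0]) (use \<zeta> in auto)
        show "pi * \<zeta> \<le> pi * \<bar>(x' - y') \<bullet> b\<bar>" using n by (intro mult_left_mono) auto
        show "pi * \<bar>(x' - y') \<bullet> b\<bar> \<le> pi / 2" using mult_left_mono[OF h, of pi] by simp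
      qed
      then have "(sin (pi * \<zeta>))\<^sup>2 \<le> (sin (pi * \<bar>(x' - y') \<bullet> b\<bar>))\<^sup>2"
        using sin\<zeta> by (intro power_mono) auto
      with s *[OF b] show False by simp
    qed
    have "norm (x' - y') \<le> (\<Sum>b\<in>Basis. \<bar>(x' - y') \<bullet> b\<bar>)" by (rule norm_le_l1)
    also have "\<dots> \<le> DIM('a) * \<zeta>" using sum_bounded_above[of Basis "\<lambda>b. \<bar>(x' - y') \<bullet> b\<bar>" \<zeta>] r by simp
    also have "\<dots> < d0" by (rule \<zeta>)
    finally have nd: "dist x' y' < d0" by (simp add: dist_norm)
    have x'bd: "0 \<le> x' \<bullet> b \<and> x' \<bullet> b \<le> 1" if "b \<in> Basis" for b
      using x'b[OF that] frac_lt_1[of "x \<bullet> b"] by simp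
    have "dist (F x') (F y') < \<eta>"
    proof (rule d0(2))
      show "dist x' y' < d0" by (rule nd)
      have "- 1 \<le> x' \<bullet> b \<and> x' \<bullet> b \<le> 2" if "b \<in> Basis" for b using x'bd[OF that] by linarith
      then show "x' \<in> cbox (- One) (2 *\<^sub>R One)" by (auto simp: mem_box)
      have "- 1 \<le> y' \<bullet> b \<and> y' \<bullet> b \<le> 2" if "b \<in> Basis" for b
        using x'bd[OF that] r[OF that] \<zeta>(2) by (auto simp: inner_diff_left abs_le_iff)
      then show "y' \<in> cbox (- One) (2 *\<^sub>R One)" by (auto simp: mem_box)
    qed
    then show "dist (F x) (F y) < \<eta>" by (simp add: Fx Fy)
  qed
qed

section \<open>Trigonometric mollifiers\<close>

text \<open>The free phase makes sines instances of the same generator, so derivatives and addition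
  formulas stay in the class without a second clause.\<close>

inductive trig_poly :: "('a::euclidean_space \<Rightarrow> real) \<Rightarrow> bool" where
  cos: "b \<in> Basis \<Longrightarrow> trig_poly (\<lambda>x. cos (2 * pi * (x \<bullet> b) + \<theta>))"
| const: "trig_poly (\<lambda>x. c)"
| add: "trig_poly f \<Longrightarrow> trig_poly g \<Longrightarrow> trig_poly (\<lambda>x. f x + g x)"
| mult: "trig_poly f \<Longrightarrow> trig_poly g \<Longrightarrow> trig_poly (\<lambda>x. f x * g x)"

lemma trig_poly_sum: "(\<And>i. i \<in> I \<Longrightarrow> trig_poly (f i)) \<Longrightarrow> trig_poly (\<lambda>x. \<Sum>i\<in>I. f i x)"
  by (induction I rule: infinite_finite_induct) (auto intro: trig_poly.intros)

lemma trig_poly_prod: "(\<And>i. i \<in> I \<Longrightarrow> trig_poly (f i)) \<Longrightarrow> trig_poly (\<lambda>x. \<Prod>i\<in>I. f i x)"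
  by (induction I rule: infinite_finite_induct) (auto intro: trig_poly.intros)

lemma trig_poly_power: "trig_poly f \<Longrightarrow> trig_poly (\<lambda>x. f x ^ n)"
  by (induction n) (auto intro: trig_poly.intros)

lemma trig_poly_periodic: "trig_poly f \<Longrightarrow> torus_periodic f"
proof (induction rule: trig_poly.induct)
  case (cos b \<theta>)
  have "cos (2 * pi * ((x + c) \<bullet> b) + \<theta>) = cos (2 * pi * (x \<bullet> b) + \<theta>)" if "c \<in> Basis" for x c
  proof (cases "c = b")
    case True
    have "cos (2 * pi * ((x + c) \<bullet> b) + \<theta>) = cos ((2 * pi * (x \<bullet> b) + \<theta>) + 2 * pi)"
      using True that by (simp add: inner_add_left algebra_simps)
    then show ?thesis by simp
  qed (use cos that in \<open>simp add: inner_add_left inner_Basis\<close>)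
  then show ?case by (simp add: torus_periodic_def)
qed (auto simp: torus_periodic_def)

text \<open>Differentiating a cosine advances its phase by \<open>pi / 2\<close>, so the class is
  closed under partial derivatives; smoothness of every order follows by iteration.\<close>

lemma trig_poly_gradient:
  assumes "trig_poly f"
  obtains g where "C1 f g" "\<And>b. trig_poly (\<lambda>x. g x \<bullet> b)"
proof -
  from assms have "\<exists>g. C1 f g \<and> (\<forall>b. trig_poly (\<lambda>x. g x \<bullet> b))"
  proof (induction rule: trig_poly.induct)
    case (cos b \<theta>)
    define g where "g = (\<lambda>x. (2 * pi * cos (2 * pi * (x \<bullet> b) + (\<theta> + pi / 2))) *\<^sub>R b)"
    have "C1 (\<lambda>x. cos (2 * pi * (x \<bullet> b) + \<theta>)) g"
      unfolding C1_def g_def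
    proof (intro conjI allI)
      fix x
      have "cos (2 * pi * (x \<bullet> b) + (\<theta> + pi / 2)) = - sin (2 * pi * (x \<bullet> b) + \<theta>)"
        using minus_sin_cos_eq[of "2 * pi * (x \<bullet> b) + \<theta>"] by (simp add: add.assoc)
      then show "((\<lambda>x. cos (2 * pi * (x \<bullet> b) + \<theta>)) has_derivative
          (\<bullet>) ((2 * pi * cos (2 * pi * (x \<bullet> b) + (\<theta> + pi / 2))) *\<^sub>R b)) (at x)"
        by (auto intro!: derivative_eq_intros simp: fun_eq_iff inner_commute)
    qed (auto intro!: continuous_intros)
    moreover have "trig_poly (\<lambda>x. g x \<bullet> c)" for c
    proof -
      have "(\<lambda>x. g x \<bullet> c) = (\<lambda>x. (2 * pi * (b \<bullet> c)) * cos (2 * pi * (x \<bullet> b) + (\<theta> + pi / 2)))"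
        by (auto simp: g_def)
      moreover have "trig_poly (\<lambda>x. (2 * pi * (b \<bullet> c)) * cos (2 * pi * (x \<bullet> b) + (\<theta> + pi / 2)))"
        by (intro trig_poly.mult trig_poly.const trig_poly.cos cos)
      ultimately show ?thesis by metis
    qed
    ultimately show ?case by blast
  next
    case (const c)
    have "trig_poly (\<lambda>x::'a. 0 \<bullet> b)" for b :: 'a using trig_poly.const[of 0] by simp
    then show ?case using C1_const[of c] by blast
  next
    case (add f g)
    then obtain f' g' where *: "C1 f f'" "C1 g g'" "\<And>b. trig_poly (\<lambda>x. f' x \<bullet> b)" "\<And>b. trig_poly (\<lambda>x. g' x \<bullet> b)"
      by blast
    have "trig_poly (\<lambda>x. (f' x + g' x) \<bullet> b)" for b
      unfolding inner_add_left by (intro trig_poly.add *)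
    with C1_add[OF *(1,2)] show ?case by blast
  next
    case (mult f g)
    then obtain f' g' where *: "C1 f f'" "C1 g g'" "\<And>b. trig_poly (\<lambda>x. f' x \<bullet> b)" "\<And>b. trig_poly (\<lambda>x. g' x \<bullet> b)"
      by blast
    have "trig_poly (\<lambda>x. (g x *\<^sub>R f' x + f x *\<^sub>R g' x) \<bullet> b)" for b
      unfolding inner_add_left inner_scaleR_left
      by (intro trig_poly.add trig_poly.mult * mult(1,2))
    with C1_mult[OF *(1,2)] show ?case by blast
  qed
  with that show ?thesis by blast
qed

lemma trig_poly_C_infinity:
  assumes "trig_poly f"
  shows "C_infinity f"
proof -
  have "C_k n f" if "trig_poly f" for n and f :: "'a \<Rightarrow> real"
    using that
  proof (induction n arbitrary: f)
    case 0
    obtain g where "C1 f g" using trig_poly_gradient[OF 0] by blast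
    then show ?case using C1_continuous by auto
  next
    case (Suc n)
    obtain g where g: "C1 f g" "\<And>b. trig_poly (\<lambda>x. g x \<bullet> b)" using trig_poly_gradient[OF Suc.prems] by blast
    have "pderivative b f = (\<lambda>x. g x \<bullet> b)" for b
      by (intro ext pderivative_eq C1_has_derivative g)
    moreover have "f differentiable_on UNIV" using C1_imp_C_k[OF g(1)] by simp
    ultimately show ?case using Suc.IH[OF g(2)] by simp
  qed
  with assms show ?thesis by (simp add: C_infinity_def)
qed

lemma trig_poly_continuous: "trig_poly f \<Longrightarrow> continuous_on UNIV f"
  by (metis C1_continuous trig_poly_gradient)

text \<open>The cosine addition formula separates the variables of a generator. Separated kernels
  are closed under sums, by concatenating the lists of terms, and under products, by multiplying the
  terms pairwise. This is what turns a mollified density into finitely many scalar functions of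
  time.\<close>

lemma trig_poly_translation_finite_rank:
  assumes "trig_poly f"
  obtains m :: nat and \<alpha> \<beta> where "\<And>j. j < m \<Longrightarrow> trig_poly (\<alpha> j)" "\<And>j. j < m \<Longrightarrow> trig_poly (\<beta> j)"
    "\<And>x y. f (x - y) = (\<Sum>j<m. \<alpha> j x * \<beta> j y)"
proof -
  define FR where "FR = (\<lambda>K::'a \<Rightarrow> 'a \<Rightarrow> real. \<exists>l. (\<forall>(a, b)\<in>set l. trig_poly a \<and> trig_poly b) \<and>
      (\<forall>x y. K x y = (\<Sum>(a, b)\<leftarrow>l. a x * b y)))"
  have FR_add: "FR (\<lambda>x y. K x y + K' x y)" if "FR K" "FR K'" for K K'
  proof -
    from that obtain l l' where "\<forall>(a, b)\<in>set l. trig_poly a \<and> trig_poly b"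
      "\<forall>x y. K x y = (\<Sum>(a, b)\<leftarrow>l. a x * b y)" "\<forall>(a, b)\<in>set l'. trig_poly a \<and> trig_poly b"
      "\<forall>x y. K' x y = (\<Sum>(a, b)\<leftarrow>l'. a x * b y)" unfolding FR_def by blast
    then show ?thesis unfolding FR_def by (intro exI[of _ "l @ l'"]) auto
  qed
  have FR_scale: "FR (\<lambda>x y. (a x * b y) * K x y)" if ab: "trig_poly a" "trig_poly b" and "FR K" for a b K
  proof -
    from \<open>FR K\<close> obtain l where l: "\<forall>(a, b)\<in>set l. trig_poly a \<and> trig_poly b"
      "\<forall>x y. K x y = (\<Sum>(a, b)\<leftarrow>l. a x * b y)" unfolding FR_def by blast
    have "(a x * b y) * K x y = (\<Sum>(a, b)\<leftarrow>map (\<lambda>(a', b'). (\<lambda>x. a x * a' x, \<lambda>y. b y * b' y)) l. a x * b y)" for x y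
      unfolding l(2)[rule_format] sum_list_const_mult[symmetric] map_map o_def
      by (auto simp: algebra_simps intro!: arg_cong[where f=sum_list])
    then show ?thesis unfolding FR_def
      by (intro exI[of _ "map (\<lambda>(a', b'). (\<lambda>x. a x * a' x, \<lambda>y. b y * b' y)) l"])
        (use l ab in \<open>auto intro: trig_poly.mult\<close>)
  qed
  have FR_mult: "FR (\<lambda>x y. K' x y * K x y)" if "FR K'" "FR K" for K K'
  proof -
    from \<open>FR K'\<close> obtain l where l: "\<forall>(a, b)\<in>set l. trig_poly a \<and> trig_poly b"
      "\<forall>x y. K' x y = (\<Sum>(a, b)\<leftarrow>l. a x * b y)" unfolding FR_def by blast
    have "FR (\<lambda>x y. (\<Sum>(a, b)\<leftarrow>l. a x * b y) * K x y)" using l(1)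
    proof (induction l)
      case Nil
      then show ?case unfolding FR_def by (intro exI[of _ Nil]) simp
    next
      case (Cons z l)
      obtain a b where z: "z = (a, b)" by (cases z)
      have "FR (\<lambda>x y. (a x * b y) * K x y + (\<Sum>(a, b)\<leftarrow>l. a x * b y) * K x y)"
        using Cons z \<open>FR K\<close> by (intro FR_add FR_scale) auto
      then show ?case by (simp add: z algebra_simps)
    qed
    then show ?thesis using l(2) by simp
  qed
  have "FR (\<lambda>x y. f (x - y))"
    using assms
  proof (induction rule: trig_poly.induct)
    case (cos b \<theta>)
    let ?l = "[(\<lambda>x. cos (2 * pi * (x \<bullet> b) + \<theta>), \<lambda>y. cos (2 * pi * (y \<bullet> b) + 0)),
        (\<lambda>x. cos (2 * pi * (x \<bullet> b) + (\<theta> - pi / 2)), \<lambda>y. cos (2 * pi * (y \<bullet> b) + - (pi / 2)))]"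
    have "cos (2 * pi * ((x - y) \<bullet> b) + \<theta>) = (\<Sum>(a, b)\<leftarrow>?l. a x * b y)" for x y
    proof -
      have "2 * pi * ((x - y) \<bullet> b) + \<theta> = (2 * pi * (x \<bullet> b) + \<theta>) - 2 * pi * (y \<bullet> b)"
        by (simp add: inner_diff_left algebra_simps)
      moreover have "cos (2 * pi * (x \<bullet> b) + (\<theta> - pi / 2)) = sin (2 * pi * (x \<bullet> b) + \<theta>)"
        by (simp add: cos_diff add_diff_eq)
      moreover have "cos (2 * pi * (y \<bullet> b) + - (pi / 2)) = sin (2 * pi * (y \<bullet> b))"
        by (simp add: cos_diff)
      ultimately show ?thesis
        using cos_diff[of "2 * pi * (x \<bullet> b) + \<theta>" "2 * pi * (y \<bullet> b)"]
        by (simp add: diff_add_eq)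
    qed
    then show ?case unfolding FR_def using cos
      using trig_poly.cos[OF cos, of \<theta>] trig_poly.cos[OF cos, of "\<theta> - pi / 2"]
        trig_poly.cos[OF cos, of 0] trig_poly.cos[OF cos, of "- (pi / 2)"]
      by (intro exI[of _ ?l]) auto
  next
    case (const c)
    then show ?case unfolding FR_def
      by (intro exI[of _ "[(\<lambda>_. c, \<lambda>_. 1)]"]) (auto intro: trig_poly.const)
  next
    case (add f g) then show ?case by (intro FR_add)
  next
    case (mult f g) then show ?case by (intro FR_mult)
  qed
  then obtain l where l: "\<forall>(a, b)\<in>set l. trig_poly a \<and> trig_poly b"
    "\<And>x y. f (x - y) = (\<Sum>(a, b)\<leftarrow>l. a x * b y)" unfolding FR_def by blast
  show ?thesis
  proof (rule that[of "length l" "\<lambda>j. fst (l ! j)" "\<lambda>j. snd (l ! j)"])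
    show "trig_poly (fst (l ! j))" "trig_poly (snd (l ! j))" if "j < length l" for j
      using l(1) nth_mem[OF that] by auto
    show "f (x - y) = (\<Sum>j<length l. fst (l ! j) x * snd (l ! j) y)" for x y
      unfolding l(2) by (simp add: sum_list_sum_nth atLeast0LessThan case_prod_beta)
  qed
qed

text \<open>The kernel is a normalized high power of \<open>h\<close>, the product of the squared
  cosines of \<open>pi * (z \<bullet> b)\<close>. Away from the lattice
  \<open>h \<le> 1 - d\<close>, while \<open>h\<close> exceeds \<open>1 - d/2\<close> on a set of
  positive measure; the tail relative to the mass therefore decays geometrically in the
  exponent.\<close>

lemma trig_mollifier_exists:
  assumes "0 < \<delta>" "0 < \<eta>"
  obtains \<rho> :: "'a::euclidean_space \<Rightarrow> real" where "trig_poly \<rho>" "\<And>z. 0 \<le> \<rho> z"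
    "(\<integral>z. \<rho> z \<partial>torus_lebesgue) = 1"
    "\<And>z b. b \<in> Basis \<Longrightarrow> \<delta> \<le> (sin (pi * (z \<bullet> b)))\<^sup>2 \<Longrightarrow> \<rho> z \<le> \<eta>"
    "\<And>z. \<rho> (- z) = \<rho> z"
proof -
  \<comment> \<open>The cap 1/2 keeps \<open>1 - d\<close> and \<open>1 - d/2\<close> positive, as
    needed for the comparison of their powers.\<close>
  define d where "d = min \<delta> (1/2)"
  have d: "0 < d" "d \<le> 1/2" "d \<le> \<delta>" using assms by (auto simp: d_def)
  define h where "h = (\<lambda>z::'a. \<Prod>b\<in>Basis. (1/2 + 1/2 * cos (2 * pi * (z \<bullet> b) + 0)))"
  have h_trig: "trig_poly h" unfolding h_def
    by (intro trig_poly_prod trig_poly.add trig_poly.mult trig_poly.const trig_poly.cos)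
  note L = torus_prob_measure_lebesgue
  have fac: "1/2 + 1/2 * cos (2 * pi * (z \<bullet> b) + 0) = 1 - (sin (pi * (z \<bullet> b)))\<^sup>2" for z b :: 'a
    using cos_double_sin[of "pi * (z \<bullet> b)"] by (simp add: mult.assoc field_simps)
  have fac01: "0 \<le> 1/2 + 1/2 * cos (2 * pi * (z \<bullet> b) + 0) \<and> 1/2 + 1/2 * cos (2 * pi * (z \<bullet> b) + 0) \<le> 1" for z b :: 'a
    using cos_le_one[of "2 * pi * (z \<bullet> b)"] cos_ge_minus_one[of "2 * pi * (z \<bullet> b)"]
    by (simp only: add_0_right) linarith
  have h0: "0 \<le> h z" for z unfolding h_def by (intro prod_nonneg) (use fac01 in blast)
  have h_far: "h z \<le> 1 - d" if "b \<in> Basis" "\<delta> \<le> (sin (pi * (z \<bullet> b)))\<^sup>2" for z b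
  proof -
    have "h z = (1/2 + 1/2 * cos (2 * pi * (z \<bullet> b) + 0)) * (\<Prod>b\<in>Basis - {b}. (1/2 + 1/2 * cos (2 * pi * (z \<bullet> b) + 0)))"
      unfolding h_def using that by (intro prod.remove) auto
    also have "\<dots> \<le> (1/2 + 1/2 * cos (2 * pi * (z \<bullet> b) + 0)) * 1"
      by (intro mult_left_mono prod_le_1) (use fac01 in blast)+
    also have "\<dots> \<le> 1 - d" unfolding fac using that d by simp
    finally show ?thesis .
  qed
  define A where "A = {z. 1 - d/2 < h z}"
  have "open A" unfolding A_def
    by (intro open_Collect_less continuous_intros trig_poly_continuous[OF h_trig])
  moreover have "0 \<in> A" using d by (simp add: A_def h_def)
  ultimately obtain e where e: "e > 0" "ball 0 e \<subseteq> A" by (meson open_contains_ball)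
  \<comment> \<open>A cube of side \<open>k\<close> at the corner 0 of the cell lies in
    \<open>A\<close>, which is how \<open>A\<close> gets positive measure inside the half-open
    cell.\<close>
  define k where "k = min 1 (e / (2 * DIM('a)))"
  have k: "0 < k" "k \<le> 1" using e by (auto simp: k_def)
  have box: "box 0 (k *\<^sub>R One) \<subseteq> A \<inter> (torus_cell :: 'a set)"
  proof
    fix z :: 'a assume z: "z \<in> box 0 (k *\<^sub>R One)"
    then have zb: "0 < z \<bullet> b \<and> z \<bullet> b < k" if "b \<in> Basis" for b using that by (auto simp: mem_box)
    have "norm z \<le> (\<Sum>b\<in>Basis. \<bar>z \<bullet> b\<bar>)" by (rule norm_le_l1)
    also have "\<dots> \<le> DIM('a) * k"
      using sum_bounded_above[of Basis "\<lambda>b. \<bar>z \<bullet> b\<bar>" k] zb by fastforce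
    also have "\<dots> \<le> DIM('a) * (e / (2 * DIM('a)))" by (intro mult_left_mono) (auto simp: k_def)
    also have "\<dots> < e" using e by simp
    finally have "z \<in> A" using e by auto
    moreover have "z \<in> torus_cell" using zb k unfolding torus_cell_def by fastforce
    ultimately show "z \<in> A \<inter> torus_cell" by blast
  qed
  define v where "v = measure torus_lebesgue (A \<inter> torus_cell)"
  interpret prob_space "torus_lebesgue :: 'a measure" by (rule torus_prob_space[OF L])
  have Am: "A \<inter> torus_cell \<in> sets torus_lebesgue"
    using \<open>open A\<close> by (auto simp: torus_prob_sets[OF L] sets_restrict_space)
  have v: "0 < v"
  proof -
    have B: "(box 0 (k *\<^sub>R One) :: 'a set) \<in> sets torus_lebesgue"
      unfolding torus_prob_sets[OF L] by (subst sets_restrict_space_iff) (use box in auto)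
    have "0 < k ^ DIM('a)" using k by simp
    also have "k ^ DIM('a) = measure lborel (box 0 (k *\<^sub>R One :: 'a))"
      using k by (simp add: measure_lborel_box_eq inner_Basis)
    also have "\<dots> = measure torus_lebesgue (box 0 (k *\<^sub>R One :: 'a))"
      using box by (auto simp: torus_lebesgue_def measure_restrict_space)
    also have "\<dots> \<le> v" unfolding v_def by (intro finite_measure_mono box Am)
    finally show ?thesis .
  qed
  define I where "I = (\<lambda>n. \<integral>z. h z ^ n \<partial>torus_lebesgue)"
  have hn_int: "integrable torus_lebesgue (\<lambda>z. h z ^ n)" for n
    by (intro torus_integrable_continuous L trig_poly_continuous trig_poly_power h_trig)
  have I: "(1 - d/2) ^ n * v \<le> I n" for n
  proof -
    have "(1 - d/2) ^ n * v = (\<integral>z. (1 - d/2) ^ n * indicator (A \<inter> torus_cell) z \<partial>torus_lebesgue)"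
      using Am by (simp add: v_def)
    also have "\<dots> \<le> I n" unfolding I_def
    proof (rule integral_mono)
      show "integrable torus_lebesgue (\<lambda>z. (1 - d/2) ^ n * indicator (A \<inter> torus_cell) z)"
        using Am by (intro integrable_mult_right integrable_real_indicator) (simp_all add: less_top[symmetric])
      fix z :: 'a
      show "(1 - d/2) ^ n * indicator (A \<inter> torus_cell) z \<le> h z ^ n"
      proof (cases "z \<in> A")
        case True
        then have "(1 - d/2) ^ n \<le> h z ^ n" using d by (intro power_mono) (auto simp: A_def)
        then show ?thesis using h0[of z] by (auto simp: indicator_def)
      qed (use h0[of z] in simp)
    qed (rule hn_int)
    finally show ?thesis .
  qed
  define r where "r = (1 - d) / (1 - d/2)"
  have r: "0 \<le> r" "r < 1" using d by (auto simp: r_def field_simps)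
  have "(\<lambda>n. r ^ n) \<longlonglongrightarrow> 0" using r by (intro LIMSEQ_realpow_zero)
  then obtain n where n: "r ^ n < \<eta> * v"
    using order_tendstoD(2)[of "\<lambda>n. r ^ n" 0 sequentially "\<eta> * v"] assms v
    by (auto simp: eventually_sequentially)
  have pos: "0 < (1 - d/2) ^ n * v" using v d by simp
  then have In: "0 < I n" using I[of n] by linarith
  show ?thesis
  proof (rule that[of "\<lambda>z. inverse (I n) * h z ^ n"])
    show "trig_poly (\<lambda>z. inverse (I n) * h z ^ n)"
      by (intro trig_poly.mult trig_poly.const trig_poly_power h_trig)
    show "0 \<le> inverse (I n) * h z ^ n" for z using In h0[of z] by simp
    show "(\<integral>z. inverse (I n) * h z ^ n \<partial>torus_lebesgue) = 1"
      using In unfolding I_def by simp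
    fix z b :: 'a assume "b \<in> Basis" "\<delta> \<le> (sin (pi * (z \<bullet> b)))\<^sup>2"
    then have "h z ^ n \<le> (1 - d) ^ n" using h_far h0 by (intro power_mono)
    then have "inverse (I n) * h z ^ n \<le> (1 - d) ^ n / I n"
      using In by (simp add: divide_inverse mult.commute mult_right_mono)
    also have "\<dots> \<le> (1 - d) ^ n / ((1 - d/2) ^ n * v)"
      using I[of n] pos d by (intro divide_left_mono) auto
    also have "\<dots> = r ^ n / v" by (simp add: r_def power_divide)
    also have "\<dots> \<le> \<eta>" using n v by (simp add: field_simps)
    finally show "inverse (I n) * h z ^ n \<le> \<eta>" .
  next
    show "inverse (I n) * h (- z) ^ n = inverse (I n) * h z ^ n" for z
      by (simp add: h_def)
  qed
qed

section \<open>Cauchy-Schwarz and orthogonalization\<close>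

text \<open>The sign of \<open>c\<close> has to be derived: a negative leading coefficient would
  make the quadratic negative for large \<open>s\<close>. For positive \<open>c\<close> the
  minimizer \<open>s = - b / c\<close> gives the claim, and for \<open>c = 0\<close> the linear term
  must vanish.\<close>

lemma nonneg_quadratic_discriminant:
  fixes a b c :: real
  assumes "\<And>s. 0 \<le> a + 2 * s * b + s\<^sup>2 * c"
  shows "b\<^sup>2 \<le> a * c"
proof (cases "c = 0")
  case True
  have "b = 0"
  proof (rule ccontr)
    assume "b \<noteq> 0"
    then show False using assms[of "- (a + 1) / (2 * b)"] True by (simp add: field_simps)
  qed
  then show ?thesis using True by simp
next
  case False
  have "0 \<le> c"
  proof (rule ccontr)
    assume "\<not> 0 \<le> c"
    then have c: "c < 0" by simp
    have a0: "0 \<le> a" using assms[of 0] by simp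
    \<comment> \<open>Chosen with \<open>s \<ge> 1\<close> and
      \<open>s * (- c) \<ge> 2 * abs b + a + 1\<close>, so that the quadratic term outweighs the
      other two.\<close>
    define s where "s = (2 * \<bar>b\<bar> + a + 1) / (- c) + 1"
    have s: "1 \<le> s" "s * (- c) \<ge> 2 * \<bar>b\<bar> + a + 1"
      using c a0 by (auto simp: s_def field_simps divide_nonneg_pos)
    have "2 * s * b \<le> s * (2 * \<bar>b\<bar>)" using s by simp
    moreover have "s * (2 * \<bar>b\<bar> + a + 1) \<le> s * (s * (- c))" using s by (intro mult_left_mono) auto
    moreover have "a \<le> s * a" using s a0 by (simp add: mult_le_cancel_right1)
    moreover have "s * (2 * \<bar>b\<bar> + a + 1) = s * (2 * \<bar>b\<bar>) + s * a + s" by (simp add: distrib_left)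
    moreover have "s\<^sup>2 * c = - (s * (s * (- c)))" by (simp add: power2_eq_square)
    ultimately show False using assms[of s] s(1) by linarith
  qed
  with False have c: "0 < c" by simp
  have "0 \<le> a + 2 * (- b / c) * b + (- b / c)\<^sup>2 * c" by (rule assms)
  also have "\<dots> = a - b\<^sup>2 / c" using c by (simp add: power2_eq_square field_simps)
  finally show ?thesis using c by (simp add: field_simps)
qed

lemma integral_Cauchy_Schwarz:
  fixes f g :: "'a \<Rightarrow> real"
  assumes "integrable M (\<lambda>x. (f x)\<^sup>2)" "integrable M (\<lambda>x. (g x)\<^sup>2)" "integrable M (\<lambda>x. f x * g x)"
  shows "\<bar>\<integral>x. f x * g x \<partial>M\<bar> \<le> sqrt (\<integral>x. (f x)\<^sup>2 \<partial>M) * sqrt (\<integral>x. (g x)\<^sup>2 \<partial>M)"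
proof -
  have "(\<integral>x. f x * g x \<partial>M)\<^sup>2 \<le> (\<integral>x. (f x)\<^sup>2 \<partial>M) * (\<integral>x. (g x)\<^sup>2 \<partial>M)"
  proof (rule nonneg_quadratic_discriminant)
    fix s
    have "0 \<le> (\<integral>x. (f x + s * g x)\<^sup>2 \<partial>M)" by (rule integral_nonneg_AE) simp
    also have "\<dots> = (\<integral>x. (f x)\<^sup>2 + 2 * s * (f x * g x) + s\<^sup>2 * (g x)\<^sup>2 \<partial>M)"
      by (intro Bochner_Integration.integral_cong refl) (simp add: power2_eq_square algebra_simps)
    also have "\<dots> = (\<integral>x. (f x)\<^sup>2 \<partial>M) + 2 * s * (\<integral>x. f x * g x \<partial>M) + s\<^sup>2 * (\<integral>x. (g x)\<^sup>2 \<partial>M)"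
      using assms by simp
    finally show "0 \<le> \<dots>" .
  qed
  then have "sqrt ((\<integral>x. f x * g x \<partial>M)\<^sup>2) \<le> sqrt ((\<integral>x. (f x)\<^sup>2 \<partial>M) * (\<integral>x. (g x)\<^sup>2 \<partial>M))"
    by (rule real_sqrt_le_mono)
  then show ?thesis by (simp add: real_sqrt_mult)
qed

text \<open>\<open>B\<close> is only positive semidefinite, so the members of \<open>F\<close> are
  reached up to null vectors: each residual has zero energy. In the application \<open>B\<close> is
  a Dirichlet form, in which constants are null.\<close>

lemma gram_schmidt:
  fixes B :: "('a \<Rightarrow> real) \<Rightarrow> ('a \<Rightarrow> real) \<Rightarrow> real"
  assumes S0: "(\<lambda>x. 0) \<in> S" and Sadd: "\<And>f g. f \<in> S \<Longrightarrow> g \<in> S \<Longrightarrow> (\<lambda>x. f x + g x) \<in> S"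
    and Sscale: "\<And>c f. f \<in> S \<Longrightarrow> (\<lambda>x. c * f x) \<in> S"
    and sym: "\<And>f g. f \<in> S \<Longrightarrow> g \<in> S \<Longrightarrow> B f g = B g f"
    and add: "\<And>f g h. f \<in> S \<Longrightarrow> g \<in> S \<Longrightarrow> h \<in> S \<Longrightarrow> B (\<lambda>x. f x + g x) h = B f h + B g h"
    and scale: "\<And>c f h. f \<in> S \<Longrightarrow> h \<in> S \<Longrightarrow> B (\<lambda>x. c * f x) h = c * B f h"
    and nonneg: "\<And>f. f \<in> S \<Longrightarrow> 0 \<le> B f f"
    and F: "finite F" "F \<subseteq> S"
  obtains Q where "finite Q" "Q \<subseteq> S" "\<And>e e'. e \<in> Q \<Longrightarrow> e' \<in> Q \<Longrightarrow> B e e' = (if e = e' then 1 else 0)"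
    "\<And>\<phi>. \<phi> \<in> F \<Longrightarrow> B (\<lambda>x. \<phi> x - (\<Sum>e\<in>Q. B \<phi> e * e x)) (\<lambda>x. \<phi> x - (\<Sum>e\<in>Q. B \<phi> e * e x)) = 0"
proof -
  have B0: "B (\<lambda>x. 0) h = 0" if "h \<in> S" for h
    using scale[OF S0 that, of 0] by simp
  have Ssum: "(\<lambda>x. \<Sum>e\<in>Q. c e * e x) \<in> S" if "finite Q" "Q \<subseteq> S" for Q c
    using that by (induction Q) (auto intro: S0 Sadd Sscale)
  have Bsum: "B (\<lambda>x. \<Sum>e\<in>Q. c e * e x) h = (\<Sum>e\<in>Q. c e * B e h)" if "finite Q" "Q \<subseteq> S" "h \<in> S" for Q c h
    using that
  proof (induction Q)
    case (insert e Q)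
    then have "B (\<lambda>x. c e * e x + (\<Sum>e\<in>Q. c e * e x)) h = c e * B e h + (\<Sum>e\<in>Q. c e * B e h)"
      using add[of "\<lambda>x. c e * e x" "\<lambda>x. \<Sum>e\<in>Q. c e * e x" h] Sscale Ssum scale by simp
    then show ?case using insert by simp
  qed (simp add: B0)
  have Sdiff: "(\<lambda>x. f x - g x) \<in> S" if "f \<in> S" "g \<in> S" for f g
    using Sadd[OF that(1) Sscale[OF that(2), of "-1"]] by simp
  have Bdiff: "B (\<lambda>x. f x - g x) h = B f h - B g h" if "f \<in> S" "g \<in> S" "h \<in> S" for f g h
    using add[OF that(1) Sscale[OF that(2), of "-1"] that(3)] scale[OF that(2,3), of "-1"] by simp
  \<comment> \<open>Cauchy-Schwarz for a semidefinite form: null vectors are orthogonal to all of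
    \<open>S\<close>.\<close>
  have CS: "B f g = 0" if "f \<in> S" "g \<in> S" "B f f = 0" for f g
  proof -
    have "(B f g)\<^sup>2 \<le> B g g * B f f"
    proof (rule nonneg_quadratic_discriminant)
      fix s
      have sf: "(\<lambda>x. s * f x) \<in> S" by (rule Sscale[OF that(1)])
      have "0 \<le> B (\<lambda>x. g x + s * f x) (\<lambda>x. g x + s * f x)" by (intro nonneg Sadd sf that)
      also have "\<dots> = B g (\<lambda>x. g x + s * f x) + B (\<lambda>x. s * f x) (\<lambda>x. g x + s * f x)"
        by (intro add sf that Sadd)
      also have "B g (\<lambda>x. g x + s * f x) = B g g + s * B f g"
        using sym[OF that(2) Sadd[OF that(2) sf]] add[OF that(2) sf that(2)] scale[OF that(1,2), of s] by simp
      also have "B (\<lambda>x. s * f x) (\<lambda>x. g x + s * f x) = s * B f g + s * (s * B f f)"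
        using scale[OF that(1) Sadd[OF that(2) sf], of s] sym[OF that(1) Sadd[OF that(2) sf]]
          add[OF that(2) sf that(1)] scale[OF that(1,1), of s] sym[OF that(1,2)] by (simp add: distrib_left)
      finally show "0 \<le> B g g + 2 * s * B f g + s\<^sup>2 * B f f"
        by (simp add: power2_eq_square algebra_simps)
    qed
    with that(3) show ?thesis by simp
  qed
  define good where "good = (\<lambda>F Q. finite Q \<and> Q \<subseteq> S \<and> (\<forall>e\<in>Q. \<forall>e'\<in>Q. B e e' = (if e = e' then 1 else 0)) \<and>
    (\<forall>\<phi>\<in>F. B (\<lambda>x. \<phi> x - (\<Sum>e\<in>Q. B \<phi> e * e x)) (\<lambda>x. \<phi> x - (\<Sum>e\<in>Q. B \<phi> e * e x)) = 0))"
  have "\<exists>Q. good F Q"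
    using F
  proof (induction F)
    case empty
    then show ?case by (intro exI[of _ "{}"]) (simp add: good_def)
  next
    case (insert \<phi> F)
    have \<phi>S: "\<phi> \<in> S" "F \<subseteq> S" using insert.prems by auto
    obtain Q where good: "good F Q" using insert.IH[OF \<phi>S(2)] by blast
    have Q: "finite Q" "Q \<subseteq> S" using good by (simp_all add: good_def)
    have orthonormal: "B e e' = (if e = e' then 1 else 0)" if "e \<in> Q" "e' \<in> Q" for e e'
      using good that by (simp add: good_def)
    have res: "B (\<lambda>x. \<phi> x - (\<Sum>e\<in>Q. B \<phi> e * e x)) (\<lambda>x. \<phi> x - (\<Sum>e\<in>Q. B \<phi> e * e x)) = 0"
      if "\<phi> \<in> F" for \<phi>
      using good that by (simp add: good_def)
    define \<psi> where "\<psi> = (\<lambda>x. \<phi> x - (\<Sum>e\<in>Q. B \<phi> e * e x))"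
    have \<psi>S: "\<psi> \<in> S" unfolding \<psi>_def by (intro Sdiff Ssum \<phi>S Q)
    have orth: "B (\<lambda>x. \<xi> x - (\<Sum>e\<in>Q. B \<xi> e * e x)) e' = 0" if "\<xi> \<in> S" "e' \<in> Q" for \<xi> e'
    proof -
      have "B (\<lambda>x. \<xi> x - (\<Sum>e\<in>Q. B \<xi> e * e x)) e' = B \<xi> e' - (\<Sum>e\<in>Q. B \<xi> e * B e e')"
        using that Q by (simp add: Bdiff Ssum Bsum subsetD)
      also have "(\<Sum>e\<in>Q. B \<xi> e * B e e') = (\<Sum>e\<in>Q. if e = e' then B \<xi> e' else 0)"
        using that orthonormal by (intro sum.cong) simp_all
      also have "\<dots> = B \<xi> e'" using that Q(1) by simp
      finally show ?thesis by simp
    qed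
    show ?case
    proof (cases "B \<psi> \<psi> = 0")
      case True
      then have "good (insert \<phi> F) Q" using good by (simp add: good_def \<psi>_def)
      then show ?thesis by blast
    next
      case False
      with nonneg[OF \<psi>S] have pos: "0 < B \<psi> \<psi>" by simp
      define e0 where "e0 = (\<lambda>x. (1 / sqrt (B \<psi> \<psi>)) * \<psi> x)"
      have e0S: "e0 \<in> S" unfolding e0_def by (rule Sscale[OF \<psi>S])
      have e0_left: "B e0 h = B \<psi> h / sqrt (B \<psi> \<psi>)" if "h \<in> S" for h
        unfolding e0_def using scale[OF \<psi>S that, of "1 / sqrt (B \<psi> \<psi>)"] by simp
      have \<psi>e0: "B \<psi> e0 = sqrt (B \<psi> \<psi>)"
        using e0_left[OF \<psi>S] sym[OF \<psi>S e0S] pos by (simp add: real_div_sqrt)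
      have e00: "B e0 e0 = 1" using e0_left[OF e0S] \<psi>e0 pos by simp
      have e0Q: "B e0 e = 0" "B e e0 = 0" if "e \<in> Q" for e
      proof -
        have eS: "e \<in> S" using that Q by auto
        show "B e0 e = 0" using e0_left[OF eS] orth[OF \<phi>S(1) that] by (simp add: \<psi>_def)
        then show "B e e0 = 0" using sym[OF e0S eS] by simp
      qed
      have e0_notin: "e0 \<notin> Q" using e0Q e00 by force
      \<comment> \<open>The residuals of the functions treated before are null, hence orthogonal to
        \<open>e0\<close>; enlarging the basis does not change their expansions.\<close>
      have old: "B \<xi> e0 = 0" if "\<xi> \<in> F" for \<xi>
      proof -
        have \<xi>S: "\<xi> \<in> S" using that \<phi>S by auto
        have "B (\<lambda>x. \<xi> x - (\<Sum>e\<in>Q. B \<xi> e * e x)) e0 = 0"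
          by (rule CS[OF Sdiff[OF \<xi>S Ssum[OF Q]] e0S res[OF that]])
        also have "B (\<lambda>x. \<xi> x - (\<Sum>e\<in>Q. B \<xi> e * e x)) e0 = B \<xi> e0 - (\<Sum>e\<in>Q. B \<xi> e * B e e0)"
          using \<xi>S Q e0S by (simp add: Bdiff Ssum Bsum)
        also have "(\<Sum>e\<in>Q. B \<xi> e * B e e0) = 0" by (intro sum.neutral) (use e0Q in auto)
        finally show ?thesis by simp
      qed
      have new: "B \<phi> e0 = sqrt (B \<psi> \<psi>)"
      proof -
        have "B \<psi> e0 = B \<phi> e0 - (\<Sum>e\<in>Q. B \<phi> e * B e e0)"
          unfolding \<psi>_def using \<phi>S Q e0S by (simp add: Bdiff Ssum Bsum)
        also have "(\<Sum>e\<in>Q. B \<phi> e * B e e0) = 0" by (intro sum.neutral) (use e0Q in auto)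
        finally show ?thesis using \<psi>e0 by simp
      qed
      have resid_new: "(\<lambda>x. \<phi> x - (\<Sum>e\<in>insert e0 Q. B \<phi> e * e x)) = (\<lambda>x. 0)"
      proof
        fix x
        have "\<phi> x - (\<Sum>e\<in>insert e0 Q. B \<phi> e * e x) = \<psi> x - B \<phi> e0 * e0 x"
          using Q e0_notin by (simp add: \<psi>_def)
        also have "\<dots> = 0"
        proof -
          have "e0 x = \<psi> x / sqrt (B \<psi> \<psi>)" by (simp add: e0_def)
          then show ?thesis unfolding new using pos by simp
        qed
        finally show "\<phi> x - (\<Sum>e\<in>insert e0 Q. B \<phi> e * e x) = 0" .
      qed
      have resid_old: "(\<lambda>x. \<xi> x - (\<Sum>e\<in>insert e0 Q. B \<xi> e * e x)) = (\<lambda>x. \<xi> x - (\<Sum>e\<in>Q. B \<xi> e * e x))"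
        if "\<xi> \<in> F" for \<xi>
        using Q e0_notin old[OF that] by simp
      have "B e e' = (if e = e' then 1 else 0)" if "e \<in> insert e0 Q" "e' \<in> insert e0 Q" for e e'
      proof (cases "e = e0")
        case True
        then show ?thesis using that e00 e0Q(1)[of e'] e0_notin by (cases "e' = e0") auto
      next
        case False
        then show ?thesis using that orthonormal[of e e'] e0Q(2)[of e] by (cases "e' = e0") auto
      qed
      moreover have "B (\<lambda>x. \<xi> x - (\<Sum>e\<in>insert e0 Q. B \<xi> e * e x)) (\<lambda>x. \<xi> x - (\<Sum>e\<in>insert e0 Q. B \<xi> e * e x)) = 0"
        if "\<xi> \<in> insert \<phi> F" for \<xi>
      proof (cases "\<xi> = \<phi>")
        case True then show ?thesis by (simp only: resid_new B0[OF S0])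
      next
        case False
        with that have "\<xi> \<in> F" by simp
        then show ?thesis by (simp only: resid_old res)
      qed
      ultimately have "good (insert \<phi> F) (insert e0 Q)"
        unfolding good_def using Q e0S by (intro conjI ballI) simp_all
      then show ?thesis by blast
    qed
  qed
  then obtain Q where "good F Q" by blast
  then show ?thesis by (intro that[of Q]) (simp_all add: good_def)
qed

section \<open>Functions of time with an integrable rate\<close>

text \<open>Absolute continuity with a bounded derivative, in integrated form. The gauge integral is
  the one of the weak formulation, and the bounds on the whole half-line are included so that the
  notion is closed under products.\<close>

definition has_rate :: "(real \<Rightarrow> real) \<Rightarrow> (real \<Rightarrow> real) \<Rightarrow> bool" where
  "has_rate f r \<longleftrightarrow> (\<exists>B. \<forall>s\<ge>0. \<bar>f s\<bar> \<le> B \<and> \<bar>r s\<bar> \<le> B) \<and>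
     (\<forall>t\<ge>0. (r has_integral (f t - f 0)) {0..t})"

lemma has_rate_const: "has_rate (\<lambda>t. c) (\<lambda>t. 0)"
  unfolding has_rate_def by (auto intro!: exI[of _ "\<bar>c\<bar>"])

lemma has_rate_add:
  assumes "has_rate f r" "has_rate g q"
  shows "has_rate (\<lambda>t. f t + g t) (\<lambda>t. r t + q t)"
proof -
  obtain B C where "\<forall>s\<ge>0. \<bar>f s\<bar> \<le> B \<and> \<bar>r s\<bar> \<le> B" "\<forall>s\<ge>0. \<bar>g s\<bar> \<le> C \<and> \<bar>q s\<bar> \<le> C"
    using assms unfolding has_rate_def by blast
  then have "\<forall>s\<ge>0. \<bar>f s + g s\<bar> \<le> B + C \<and> \<bar>r s + q s\<bar> \<le> B + C"
    by (meson abs_triangle_ineq add_mono order_trans)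
  moreover have "((\<lambda>t. r t + q t) has_integral (f t + g t - (f 0 + g 0))) {0..t}" if "t \<ge> 0" for t
    using has_integral_add[of r "f t - f 0" "{0..t}" q "g t - g 0"] assms that
    by (simp add: has_rate_def algebra_simps)
  ultimately show ?thesis unfolding has_rate_def by blast
qed

lemma has_rate_interval:
  assumes "has_rate f r" "0 \<le> s" "s \<le> t"
  shows "(r has_integral (f t - f s)) {s..t}"
proof -
  have s: "(r has_integral (f s - f 0)) {0..s}" and t: "(r has_integral (f t - f 0)) {0..t}"
    using assms by (auto simp: has_rate_def)
  have "r integrable_on {s..t}"
    by (rule integrable_subinterval_real[OF has_integral_integrable[OF t]]) (use assms in auto)
  then obtain i where i: "(r has_integral i) {s..t}" by blast
  have "(r has_integral (f s - f 0 + i)) {0..t}"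
    using has_integral_combine[OF assms(2,3) s i] .
  with t have "f s - f 0 + i = f t - f 0" by (rule has_integral_unique[rotated])
  then have "i = f t - f s" by simp
  with i show ?thesis by simp
qed

lemma has_rate_Lipschitz:
  assumes "has_rate f r" and B: "\<And>s. 0 \<le> s \<Longrightarrow> \<bar>r s\<bar> \<le> B" and "0 \<le> s" "0 \<le> t"
  shows "\<bar>f t - f s\<bar> \<le> B * \<bar>t - s\<bar>"
proof -
  have *: "\<bar>f t - f s\<bar> \<le> B * (t - s)" if "0 \<le> s" "s \<le> t" for s t
  proof -
    have "norm (f t - f s) \<le> B * measure lborel (cbox s t)"
    proof (rule has_integral_bound)
      show "0 \<le> B" using B[of 0] abs_ge_zero[of "r 0"] by linarith
      show "(r has_integral f t - f s) (cbox s t)" using has_rate_interval[OF assms(1) that] by simp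
      show "norm (r x) \<le> B" if "x \<in> cbox s t" for x using B[of x] that \<open>0 \<le> s\<close> by simp
    qed
    then show ?thesis using that by simp
  qed
  show ?thesis
  proof (cases "s \<le> t")
    case True
    then show ?thesis using *[of s t] assms(3) by simp
  next
    case False
    then show ?thesis using *[of t s] assms(4) by (simp add: abs_minus_commute[of "f t"])
  qed
qed

lemma has_rate_continuous:
  assumes "has_rate f r"
  shows "continuous_on {0..} f"
proof -
  obtain B where B: "\<And>s. s \<ge> 0 \<Longrightarrow> \<bar>r s\<bar> \<le> B" using assms unfolding has_rate_def by blast
  then have "0 \<le> B" using order_trans[OF abs_ge_zero] by blast
  then have "B-lipschitz_on {0..} f"
    by (intro lipschitz_onI) (use has_rate_Lipschitz[OF assms B] in \<open>auto simp: dist_real_def\<close>)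
  then show ?thesis by (rule lipschitz_on_continuous_on)
qed

text \<open>The difference \<open>D\<close> between the product and the integral of its expected
  rate changes by at most a constant times \<open>(t - s)^2\<close>. It has derivative zero and is
  constant, which is the product rule without pointwise differentiability.\<close>

lemma has_rate_mult:
  assumes f: "has_rate f r" and g: "has_rate g q"
  shows "has_rate (\<lambda>t. f t * g t) (\<lambda>t. f t * q t + g t * r t)"
proof -
  obtain B0 C0 where "\<forall>s\<ge>0. \<bar>f s\<bar> \<le> B0 \<and> \<bar>r s\<bar> \<le> B0" "\<forall>s\<ge>0. \<bar>g s\<bar> \<le> C0 \<and> \<bar>q s\<bar> \<le> C0"
    using assms unfolding has_rate_def by blast
  then obtain B where B: "\<And>s. s \<ge> 0 \<Longrightarrow> \<bar>f s\<bar> \<le> B" "\<And>s. s \<ge> 0 \<Longrightarrow> \<bar>r s\<bar> \<le> B"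
    "\<And>s. s \<ge> 0 \<Longrightarrow> \<bar>g s\<bar> \<le> B" "\<And>s. s \<ge> 0 \<Longrightarrow> \<bar>q s\<bar> \<le> B"
    using that[of "max B0 C0"] by (auto simp: le_max_iff_disj)
  have B0: "0 \<le> B" using B(1)[of 0] abs_ge_zero[of "f 0"] by linarith
  define h where "h = (\<lambda>t. f t * q t + g t * r t)"
  have h_bd: "\<bar>h s\<bar> \<le> B * B + B * B" if "s \<ge> 0" for s
  proof -
    have "\<bar>h s\<bar> \<le> \<bar>f s\<bar> * \<bar>q s\<bar> + \<bar>g s\<bar> * \<bar>r s\<bar>"
      unfolding h_def abs_mult[symmetric] by (rule abs_triangle_ineq)
    also have "\<dots> \<le> B * B + B * B" by (intro add_mono mult_mono B that B0 abs_ge_zero)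
    finally show ?thesis .
  qed
  \<comment> \<open>A bounded gauge-integrable rate is absolutely integrable; this is what permits
    multiplying it by a continuous bounded factor.\<close>
  have ai: "r absolutely_integrable_on {s..t}" if "has_rate f r" "\<And>s. s \<ge> 0 \<Longrightarrow> \<bar>r s\<bar> \<le> B" "0 \<le> s" "s \<le> t" for f r s t
    by (rule absolutely_integrable_integrable_bound[where g="\<lambda>_. B"])
      (use that has_rate_interval[OF that(1,3,4)] in auto)
  have prod: "(\<lambda>t. f t * q t) integrable_on {s..t}"
    if f: "has_rate f r" and q: "has_rate g q" "\<And>s. s \<ge> 0 \<Longrightarrow> \<bar>q s\<bar> \<le> B" "\<And>s. s \<ge> 0 \<Longrightarrow> \<bar>f s\<bar> \<le> B" and st: "0 \<le> s" "s \<le> t"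
    for f r g q s t
  proof -
    have "(\<lambda>t. f t * q t) absolutely_integrable_on {s..t}"
    proof (rule absolutely_integrable_bounded_measurable_product_real)
      show "f \<in> borel_measurable (lebesgue_on {s..t})"
        by (intro continuous_imp_measurable_on_sets_lebesgue continuous_on_subset[OF has_rate_continuous[OF f]])
          (use st in auto)
      show "bounded (f ` {s..t})" using that(4) st by (intro boundedI[where B=B]) auto
      show "q absolutely_integrable_on {s..t}" by (rule ai[OF q(1,2) st])
    qed simp
    then show ?thesis by (rule set_lebesgue_integral_eq_integral)
  qed
  have h_int: "h integrable_on {s..t}" if "0 \<le> s" "s \<le> t" for s t
    unfolding h_def using prod[OF f g B(4,1) that] prod[OF g f B(2,3) that]
    by (rule integrable_add)
  define D where "D = (\<lambda>t. f t * g t - integral {0..t} h)"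
  have D_le: "\<bar>D t - D s\<bar> \<le> 2 * B * B * (t - s)\<^sup>2" if "0 \<le> s" "s \<le> t" for s t
  proof -
    have I: "(h has_integral (integral {0..t} h - integral {0..s} h)) {s..t}"
    proof -
      have "integral {0..s} h + integral {s..t} h = integral {0..t} h"
        by (rule Henstock_Kurzweil_Integration.integral_combine) (use that h_int in auto)
      then have "integral {s..t} h = integral {0..t} h - integral {0..s} h" by simp
      then show ?thesis using integrable_integral[OF h_int[OF that]] by simp
    qed
    \<comment> \<open>Freezing \<open>f\<close> at the left end and \<open>g\<close> at the right
      end makes the increment of the product exact: it is
      \<open>f s * (g t - g s) + g t * (f t - f s)\<close>. The remainder consists of Lipschitz
      increments times bounded rates.\<close>
    have "((\<lambda>u. f s * q u + g t * r u - h u) has_integral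
        (f s * (g t - g s) + g t * (f t - f s) - (integral {0..t} h - integral {0..s} h))) {s..t}"
      by (rule has_integral_diff[OF has_integral_add[OF has_integral_mult_right[OF has_rate_interval[OF g that]]
          has_integral_mult_right[OF has_rate_interval[OF f that]]] I])
    moreover have "f s * (g t - g s) + g t * (f t - f s) - (integral {0..t} h - integral {0..s} h) = D t - D s"
      by (simp add: D_def algebra_simps)
    ultimately have "((\<lambda>u. f s * q u + g t * r u - h u) has_integral (D t - D s)) (cbox s t)" by simp
    moreover have "norm (f s * q u + g t * r u - h u) \<le> 2 * B * B * (t - s)" if u: "u \<in> cbox s t" for u
    proof -
      have u': "0 \<le> u" "0 \<le> t" "s \<le> u" "u \<le> t" using u \<open>0 \<le> s\<close> by auto
      have "f s * q u + g t * r u - h u = (f s - f u) * q u + (g t - g u) * r u"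
        by (simp add: h_def algebra_simps)
      also have "norm \<dots> \<le> \<bar>f s - f u\<bar> * \<bar>q u\<bar> + \<bar>g t - g u\<bar> * \<bar>r u\<bar>"
        unfolding real_norm_def abs_mult[symmetric] by (rule abs_triangle_ineq)
      also have "\<dots> \<le> (B * (t - s)) * B + (B * (t - s)) * B"
      proof (intro add_mono mult_mono B u')
        have "\<bar>f s - f u\<bar> \<le> B * \<bar>s - u\<bar>" by (rule has_rate_Lipschitz[OF f B(2)]) (use u' \<open>0 \<le> s\<close> in auto)
        also have "\<dots> \<le> B * (t - s)" using u' B0 by (intro mult_left_mono) auto
        finally show "\<bar>f s - f u\<bar> \<le> B * (t - s)" .
        have "\<bar>g t - g u\<bar> \<le> B * \<bar>t - u\<bar>" by (rule has_rate_Lipschitz[OF g B(4)]) (use u' in auto)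
        also have "\<dots> \<le> B * (t - s)" using u' B0 by (intro mult_left_mono) auto
        finally show "\<bar>g t - g u\<bar> \<le> B * (t - s)" .
      qed (use B0 \<open>s \<le> t\<close> in auto)
      also have "\<dots> = 2 * B * B * (t - s)" by (simp add: algebra_simps)
      finally show ?thesis .
    qed
    ultimately have "norm (D t - D s) \<le> 2 * B * B * (t - s) * measure lborel (cbox s t)"
      by (intro has_integral_bound) (use B0 that in auto)
    then show ?thesis using that by (simp add: power2_eq_square mult.assoc)
  qed
  have D_abs: "\<bar>D t - D s\<bar> \<le> 2 * B * B * (t - s)\<^sup>2" if "0 \<le> s" "0 \<le> t" for s t
    using D_le[of s t] D_le[of t s] that
    by (cases "s \<le> t") (auto simp: abs_minus_commute[of "D s"] power2_commute[of s])
  have "\<exists>c. \<forall>t\<in>{0..}. D t = c"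
  proof (rule has_derivative_zero_constant)
    fix s :: real assume s: "s \<in> {0..}"
    show "(D has_derivative (\<lambda>h. 0)) (at s within {0..})"
      unfolding has_derivative_within_alt
    proof (intro conjI allI impI)
      fix e :: real assume "0 < e"
      define K where "K = 2 * B * B + 1"
      have K: "0 < K" "2 * B * B \<le> K" using B0 by (auto simp: K_def add_nonneg_pos)
      show "\<exists>d>0. \<forall>y\<in>{0..}. norm (y - s) < d \<longrightarrow> norm (D y - D s - 0) \<le> e * norm (y - s)"
      proof (intro exI[of _ "e / K"] conjI ballI impI)
        fix y assume y: "y \<in> {0..}" "norm (y - s) < e / K"
        have "norm (D y - D s - 0) \<le> 2 * B * B * (y - s)\<^sup>2" using D_abs[of s y] s y by simp
        also have "\<dots> \<le> K * (\<bar>y - s\<bar> * \<bar>y - s\<bar>)"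
          using K by (auto simp: power2_eq_square intro!: mult_right_mono)
        also have "\<dots> \<le> K * (e / K * \<bar>y - s\<bar>)"
          using y K by (intro mult_left_mono mult_right_mono) auto
        also have "\<dots> = e * norm (y - s)" using K by simp
        finally show "norm (D y - D s - 0) \<le> e * norm (y - s)" .
      qed (use \<open>0 < e\<close> K in auto)
    qed simp
  qed simp
  then obtain c where c: "\<And>t. 0 \<le> t \<Longrightarrow> D t = c" by auto
  have "(h has_integral (f t * g t - f 0 * g 0)) {0..t}" if "0 \<le> t" for t
  proof -
    have "integral {0..t} h = f t * g t - f 0 * g 0"
      using c[OF that] c[of 0] by (simp add: D_def)
    with integrable_integral[OF h_int[of 0 t]] that show ?thesis by simp
  qed
  moreover have "\<bar>f s * g s\<bar> \<le> B * B + B * B" if "0 \<le> s" for s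
  proof -
    have "\<bar>f s * g s\<bar> \<le> B * B" unfolding abs_mult by (intro mult_mono B that B0) auto
    then show ?thesis using B0 by (simp add: add_increasing)
  qed
  ultimately show ?thesis
    unfolding has_rate_def h_def[symmetric] using h_bd by blast
qed

lemma has_rate_cmult:
  assumes "has_rate f r"
  shows "has_rate (\<lambda>t. c * f t) (\<lambda>t. c * r t)"
  using has_rate_mult[OF has_rate_const[of c] assms] by simp

lemma has_rate_sum:
  "(\<And>i. i \<in> I \<Longrightarrow> has_rate (f i) (r i)) \<Longrightarrow> has_rate (\<lambda>t. \<Sum>i\<in>I. f i t) (\<lambda>t. \<Sum>i\<in>I. r i t)"
  by (induction I rule: infinite_finite_induct) (auto intro: has_rate_add has_rate_const[of 0, simplified])

lemma has_rate_cong: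
  assumes "has_rate f r" "\<And>t. 0 \<le> t \<Longrightarrow> f t = g t" "\<And>t. 0 \<le> t \<Longrightarrow> r t = q t"
  shows "has_rate g q"
proof -
  have "(q has_integral (g t - g 0)) {0..t}" if "0 \<le> t" for t
    by (rule has_integral_eq[of _ r]) (use assms that in \<open>auto simp: has_rate_def\<close>)
  then show ?thesis using assms unfolding has_rate_def by auto
qed

text \<open>The differential inequality is only available below the level \<open>L\<close>; the comparison function
  stays below \<open>L\<close>, so the solution never leaves the region where it holds.\<close>

lemma has_rate_comparison:
  assumes \<Phi>: "has_rate \<Phi> r" and "0 < l" "\<Phi> 0 \<le> \<Phi>0" "0 \<le> \<Phi>0" "0 \<le> \<beta>" and L: "\<Phi>0 + \<beta> / l < L"
    and r: "\<And>s. 0 \<le> s \<Longrightarrow> \<Phi> s \<le> L \<Longrightarrow> r s \<le> - l * \<Phi> s + \<beta>" and "0 \<le> t"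
  shows "\<Phi> t \<le> \<Phi>0 * exp (- l * t) + \<beta> / l"
proof (rule ccontr)
  define z where "z = (\<lambda>t. \<Phi>0 * exp (- l * t) + \<beta> / l)"
  assume "\<not> \<Phi> t \<le> \<Phi>0 * exp (- l * t) + \<beta> / l"
  then have bad: "z t < \<Phi> t" by (simp add: z_def)
  have zL: "z s < L" if "0 \<le> s" for s
  proof -
    have "\<Phi>0 * exp (- l * s) \<le> \<Phi>0 * 1" using assms that by (intro mult_left_mono) auto
    then show ?thesis using L by (simp add: z_def)
  qed
  have z_cont: "continuous_on S z" for S unfolding z_def by (intro continuous_intros)
  have \<Phi>_cont: "continuous_on {0..} \<Phi>" by (rule has_rate_continuous[OF \<Phi>])
  \<comment> \<open>Its maximum \<open>s0\<close> is the last time at which the comparison function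
    \<open>z\<close> is not exceeded. Shortly afterwards \<open>\<Phi>\<close> lies above
    \<open>z\<close> but, by continuity, still below \<open>L\<close>, so the differential
    inequality applies there.\<close>
  define S where "S = {s \<in> {0..t}. \<Phi> s - z s \<le> 0}"
  have "closed S" unfolding S_def
    by (intro continuous_on_closed_Collect_le
        continuous_on_diff continuous_on_subset[OF \<Phi>_cont] z_cont continuous_on_const) auto
  moreover have "bounded S" by (rule bounded_subset[of "{0..t}"]) (auto simp: S_def)
  ultimately have "compact S" by (simp add: compact_eq_bounded_closed)
  moreover have "0 \<in> S" using assms by (auto simp: S_def z_def add_increasing2)
  ultimately obtain s0 where s0: "s0 \<in> S" "\<And>s. s \<in> S \<Longrightarrow> s \<le> s0"
    using compact_attains_sup[of S] by blast
  then have s0': "0 \<le> s0" "s0 < t" "\<Phi> s0 \<le> z s0" using bad by (auto simp: S_def less_le)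
  have above: "z u < \<Phi> u" if "s0 < u" "u \<le> t" for u
    using s0(2)[of u] that s0' by (force simp: S_def)
  have "continuous (at s0 within {0..}) \<Phi>"
    using \<Phi>_cont s0' by (simp add: continuous_on_eq_continuous_within)
  moreover have "\<Phi> s0 < L" using s0' zL[of s0] by simp
  ultimately obtain d where d: "d > 0" "\<And>u. 0 \<le> u \<Longrightarrow> dist u s0 < d \<Longrightarrow> dist (\<Phi> u) (\<Phi> s0) < L - \<Phi> s0"
    unfolding continuous_within_eps_delta by (metis atLeast_iff diff_gt_0_iff_gt)
  define t2 where "t2 = min t (s0 + d / 2)"
  have t2: "s0 < t2" "t2 \<le> t" "0 \<le> t2" using s0' d by (auto simp: t2_def)
  have below: "\<Phi> u \<le> L" if "s0 \<le> u" "u \<le> t2" for u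
    using d(2)[of u] that s0' d(1) by (auto simp: t2_def dist_real_def)
  \<comment> \<open>At \<open>s0\<close> itself \<open>\<Phi> \<le> z\<close>, which is the wrong
    direction for comparing the rates; changing one value leaves the integral as it is.\<close>
  define r' where "r' = (\<lambda>u. if u = s0 then - l * z s0 + \<beta> else r u)"
  have "(r' has_integral (\<Phi> t2 - \<Phi> s0)) {s0..t2}"
  proof (rule has_integral_spike_finite[of "{s0}" _ _ r])
    show "(r has_integral (\<Phi> t2 - \<Phi> s0)) {s0..t2}" by (rule has_rate_interval[OF \<Phi>]) (use s0' t2 in auto)
  qed (auto simp: r'_def)
  moreover have "((\<lambda>u. - l * z u + \<beta>) has_integral (z t2 - z s0)) {s0..t2}"
  proof (rule fundamental_theorem_of_calculus)
    show "(z has_vector_derivative - l * z x + \<beta>) (at x within {s0..t2})" for x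
      unfolding z_def using \<open>0 < l\<close>
      by (auto intro!: derivative_eq_intros simp: has_real_derivative_iff_has_vector_derivative[symmetric] algebra_simps)
  qed (use t2 in auto)
  moreover have "r' u \<le> - l * z u + \<beta>" if "u \<in> {s0..t2}" for u
  proof (cases "u = s0")
    case False
    then have "r u \<le> - l * \<Phi> u + \<beta>" using that s0' by (intro r below) auto
    also have "\<dots> \<le> - l * z u + \<beta>" using above[of u] False that t2 \<open>0 < l\<close> by simp
    finally show ?thesis using False by (simp add: r'_def)
  qed (simp add: r'_def)
  ultimately have "\<Phi> t2 - \<Phi> s0 \<le> z t2 - z s0" by (rule has_integral_le)
  then have "\<Phi> t2 \<le> z t2" using s0' by simp
  with above[of t2] t2 show False by simp
qed

lemma torus_lebesgue_integrable:
  fixes f :: "'a::euclidean_space \<Rightarrow> 'b::{banach, second_countable_topology}"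
  shows "continuous_on UNIV f \<Longrightarrow> integrable torus_lebesgue f"
  by (rule torus_integrable_continuous[OF torus_prob_measure_lebesgue])

section \<open>The Lyapunov inequality\<close>

text \<open>Which quantity the hypothesis controls depends on \<open>q\<close>: for
  \<open>q \<ge> 1\<close> it bounds \<open>F^2\<close> by 11/20, for \<open>q < 1\<close> it bounds
  \<open>q^2 G^2\<close> by 11/20. Young's inequality, with a weight adapted to the case, then fits
  under the common coefficients 9/10 and 1/2.\<close>

lemma cross_term_bound:
  fixes q F G d :: real
  assumes q: "0 \<le> q" and F: "0 \<le> F" "F \<le> d" and G: "0 \<le> G"
    and small: "q\<^sup>2 * (F\<^sup>2 + G\<^sup>2) \<le> 11/40 * (1 + q\<^sup>2)"
  shows "q * G * sqrt (1 + F\<^sup>2) * d \<le> 9/10 * d\<^sup>2 + 1/2 * (q\<^sup>2 * G\<^sup>2)"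
proof -
  define s where "s = sqrt (1 + F\<^sup>2)"
  have s2: "s\<^sup>2 = 1 + F\<^sup>2" by (simp add: s_def)
  have sq: "(q * G * s)\<^sup>2 = q\<^sup>2 * G\<^sup>2 + q\<^sup>2 * G\<^sup>2 * F\<^sup>2"
    by (simp add: power_mult_distrib s2 distrib_left)
  have young: "q * G * s * d \<le> l * d\<^sup>2 + (q * G * s)\<^sup>2 / (4 * l)" if "l > 0" for l
  proof -
    have "0 \<le> (2 * l * d - q * G * s)\<^sup>2 / (4 * l)" using that by simp
    also have "\<dots> = l * d\<^sup>2 + (q * G * s)\<^sup>2 / (4 * l) - q * G * s * d"
      using that by (simp add: power2_eq_square field_simps)
    finally show ?thesis by simp
  qed
  have Fd: "F\<^sup>2 \<le> d\<^sup>2" using F by (intro power_mono)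
  show ?thesis
  proof (cases "q \<ge> 1")
    case True
    then have q2: "1 \<le> q\<^sup>2" by simp
    have "q\<^sup>2 * F\<^sup>2 \<le> q\<^sup>2 * (F\<^sup>2 + G\<^sup>2)" by (intro mult_left_mono) auto
    also have "\<dots> \<le> 11/20 * q\<^sup>2" using small q2 by simp
    finally have "q\<^sup>2 * F\<^sup>2 \<le> q\<^sup>2 * (11/20)" by simp
    moreover have "0 < q\<^sup>2" using q2 by linarith
    ultimately have "F\<^sup>2 \<le> 11/20" by (simp only: mult_le_cancel_left_pos)
    then have "(q\<^sup>2 * G\<^sup>2) * F\<^sup>2 \<le> (q\<^sup>2 * G\<^sup>2) * (11/20)" by (intro mult_left_mono) auto
    \<comment> \<open>With weight 9/10 the square is multiplied by 5/18, and 5/18 times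
      \<open>1 + 11/20\<close> is 31/72, below 1/2.\<close>
    moreover have "q * G * s * d \<le> 9/10 * d\<^sup>2 + (q * G * s)\<^sup>2 * (5/18)" using young[of "9/10"] by simp
    moreover have "0 \<le> q\<^sup>2 * G\<^sup>2" "0 \<le> d\<^sup>2" by simp_all
    ultimately show ?thesis using sq unfolding s_def[symmetric] by linarith
  next
    case False
    then have q2: "q\<^sup>2 \<le> 1" using q by (simp add: power_le_one)
    have "q\<^sup>2 * G\<^sup>2 \<le> q\<^sup>2 * (F\<^sup>2 + G\<^sup>2)" by (intro mult_left_mono) auto
    also have "\<dots> \<le> 11/20" using small q2 by simp
    finally have "(q\<^sup>2 * G\<^sup>2) * F\<^sup>2 \<le> (11/20) * d\<^sup>2" using Fd by (intro mult_mono) auto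
    \<comment> \<open>With weight 3/5 the factor is 5/12, below 1/2, and the term in
      \<open>d^2\<close> has the total coefficient \<open>3/5 + 5/12 * 11/20 = 199/240\<close>,
      below 9/10.\<close>
    moreover have "q * G * s * d \<le> 3/5 * d\<^sup>2 + (q * G * s)\<^sup>2 * (5/12)" using young[of "3/5"] by simp
    moreover have "0 \<le> q\<^sup>2 * G\<^sup>2" "0 \<le> d\<^sup>2" by simp_all
    ultimately show ?thesis using sq unfolding s_def[symmetric] by linarith
  qed
qed

text \<open>As \<open>u \<le> F\<close> and \<open>v \<le> G\<close>, the sum in the hypothesis is
  at least \<open>1 + q^2\<close> times \<open>u^2 + v^2\<close>. The factor \<open>1 + q^2\<close>
  divides out and leaves \<open>q^2 (u^2 + v^2) \<le> 11/40\<close>, hence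
  \<open>q (u + v) \<le> 4/5\<close> because 11/20 is below 16/25.\<close>

lemma dual_term_bound:
  fixes q F G u v :: real
  assumes q: "0 \<le> q" and nn: "0 \<le> F" "0 \<le> G" "0 \<le> u" "0 \<le> v" and le: "u \<le> F" "v \<le> G"
    and small: "q\<^sup>2 * (F\<^sup>2 + G\<^sup>2 + q\<^sup>2 * (u\<^sup>2 + v\<^sup>2)) \<le> 11/40 * (1 + q\<^sup>2)"
  shows "q * F * G * (u + v) \<le> 2/5 * (F\<^sup>2 + G\<^sup>2)"
proof -
  have "u\<^sup>2 \<le> F\<^sup>2" "v\<^sup>2 \<le> G\<^sup>2" using nn le by (auto intro!: power_mono)
  then have "q\<^sup>2 * ((1 + q\<^sup>2) * (u\<^sup>2 + v\<^sup>2)) \<le> q\<^sup>2 * (F\<^sup>2 + G\<^sup>2 + q\<^sup>2 * (u\<^sup>2 + v\<^sup>2))"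
    by (intro mult_left_mono) (auto simp: distrib_right)
  with small have "(1 + q\<^sup>2) * (q\<^sup>2 * (u\<^sup>2 + v\<^sup>2)) \<le> (1 + q\<^sup>2) * (11/40)"
    by (simp add: algebra_simps)
  moreover have "0 < 1 + q\<^sup>2" by (simp add: add_pos_nonneg)
  ultimately have a: "q\<^sup>2 * (u\<^sup>2 + v\<^sup>2) \<le> 11/40" by (simp only: mult_le_cancel_left_pos)
  have "(q * (u + v))\<^sup>2 = q\<^sup>2 * (u\<^sup>2 + v\<^sup>2) + q\<^sup>2 * (u\<^sup>2 + v\<^sup>2) - q\<^sup>2 * (u - v)\<^sup>2"
    by (simp add: power2_eq_square algebra_simps)
  moreover have "0 \<le> q\<^sup>2 * (u - v)\<^sup>2" by simp
  ultimately have "(q * (u + v))\<^sup>2 \<le> 11/20" using a by linarith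
  also have "(11/20::real) \<le> (4/5)\<^sup>2" by (simp add: power2_eq_square)
  finally have "(q * (u + v))\<^sup>2 \<le> (4/5)\<^sup>2" .
  then have b: "q * (u + v) \<le> 4/5" by (rule power2_le_imp_le) simp
  have "0 \<le> (F - G)\<^sup>2" by simp
  then have "F * G \<le> 1/2 * (F\<^sup>2 + G\<^sup>2)" by (simp add: power2_eq_square algebra_simps)
  then have "(q * (u + v)) * (F * G) \<le> 4/5 * (1/2 * (F\<^sup>2 + G\<^sup>2))"
    by (rule mult_mono[OF b]) (use q nn in auto)
  then show ?thesis by (simp add: algebra_simps)
qed

text \<open>Young's inequality; it trades a mollification error, linear in a norm, for a small share
  of the dissipation plus a constant.\<close>

lemma absorb_error:
  fixes a x E :: real
  assumes "0 < a"
  shows "E * x \<le> a * x\<^sup>2 + E\<^sup>2 / (4 * a)"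
proof -
  have "0 \<le> (2 * a * x - E)\<^sup>2 / (4 * a)" using assms by simp
  also have "\<dots> = a * x\<^sup>2 + E\<^sup>2 / (4 * a) - E * x"
    using assms by (simp add: power2_eq_square field_simps)
  finally show ?thesis by simp
qed

text \<open>The two \<open>\<kappa>\<close>-terms are the linear interaction between the players: it cancels in the dual norm.
  The weight \<open>q\<^sup>2 c\<close> of the dual norm is what makes its dissipation absorb the interaction in the
  \<open>L\<^sup>2\<close> norm.\<close>

lemma lyapunov_rate_bound:
  fixes \<tau> c \<epsilon> M q F G D D' U U' E \<kappa> :: real
  assumes par: "0 < \<tau>" "0 < c" "0 < \<epsilon>" "\<epsilon> < 1" "0 \<le> M" and q: "q = M / (\<tau> * c * \<epsilon>)"
    and nn: "0 \<le> F" "0 \<le> G" "0 \<le> D" "0 \<le> D'" "0 \<le> U" "0 \<le> U'" "0 \<le> E"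
    and poinc: "c * F\<^sup>2 \<le> D\<^sup>2" "c * G\<^sup>2 \<le> D'\<^sup>2" "c * U\<^sup>2 \<le> F\<^sup>2" "c * U'\<^sup>2 \<le> G\<^sup>2"
    and small: "q\<^sup>2 * (F\<^sup>2 + G\<^sup>2 + q\<^sup>2 * c * (U\<^sup>2 + U'\<^sup>2)) \<le> 11/40 * (1 + q\<^sup>2)"
    and X1: "X1 \<le> 2 * (- \<tau> * D\<^sup>2 + M / sqrt c * G * sqrt (1 + F\<^sup>2) * D + E * D)"
    and X2: "X2 \<le> 2 * (- \<tau> * D'\<^sup>2 + M / sqrt c * F * sqrt (1 + G\<^sup>2) * D' + E * D')"
    and Y1: "Y1 \<le> 2 * (- \<tau> * F\<^sup>2 - \<kappa> + M / sqrt c * G * F * U + E * U)"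
    and Y2: "Y2 \<le> 2 * (- \<tau> * G\<^sup>2 + \<kappa> + M / sqrt c * F * G * U' + E * U')"
  shows "X1 + X2 + q\<^sup>2 * c * (Y1 + Y2)
    \<le> - (2 * \<tau> * c * (1 - \<epsilon>)) * (F\<^sup>2 + G\<^sup>2 + q\<^sup>2 * c * (U\<^sup>2 + U'\<^sup>2)) + 10 * (1 + q\<^sup>2) * E\<^sup>2 / (\<epsilon> * \<tau>)"
proof -
  \<comment> \<open>Gradient norms are divided by \<open>sqrt c\<close> and dual norms multiplied by
    it. The Poincare inequalities become \<open>F \<le> d\<close> and \<open>u \<le> F\<close>, and
    \<open>T = \<tau> c\<close> is the only scale left.\<close>
  define r where "r = sqrt c"
  have r: "0 < r" "r\<^sup>2 = c" using par by (auto simp: r_def)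
  define d where "d = D / r"
  define d' where "d' = D' / r"
  define u where "u = r * U"
  define u' where "u' = r * U'"
  define T where "T = \<tau> * c"
  have T: "0 < T" using par by (simp add: T_def)
  have q0: "0 \<le> q" unfolding q using par by simp
  have MqT: "M = T * \<epsilon> * q" using par by (simp add: q T_def)
  have Dd: "D = r * d" "D' = r * d'" using r by (simp_all add: d_def d'_def)
  have uU: "c * U\<^sup>2 = u\<^sup>2" "c * U'\<^sup>2 = u'\<^sup>2" by (simp_all add: u_def u'_def power_mult_distrib r)
  have dD: "D\<^sup>2 = c * d\<^sup>2" "D'\<^sup>2 = c * d'\<^sup>2" by (simp_all add: Dd power_mult_distrib r)
  have nn': "0 \<le> d" "0 \<le> d'" "0 \<le> u" "0 \<le> u'" using nn r by (simp_all add: d_def d'_def u_def u'_def)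
  have le: "F \<le> d" "G \<le> d'" "u \<le> F" "u' \<le> G"
  proof -
    have "F\<^sup>2 \<le> d\<^sup>2" "G\<^sup>2 \<le> d'\<^sup>2" using poinc(1,2) par unfolding dD by auto
    then show "F \<le> d" "G \<le> d'" using nn' by (auto intro: power2_le_imp_le)
    have "u\<^sup>2 \<le> F\<^sup>2" "u'\<^sup>2 \<le> G\<^sup>2" using poinc(3,4) unfolding uU by auto
    then show "u \<le> F" "u' \<le> G" using nn by (auto intro: power2_le_imp_le)
  qed
  have small': "q\<^sup>2 * (F\<^sup>2 + G\<^sup>2 + q\<^sup>2 * (u\<^sup>2 + u'\<^sup>2)) \<le> 11/40 * (1 + q\<^sup>2)"
    using small unfolding uU[symmetric] by (simp add: algebra_simps)
  have "q\<^sup>2 * (F\<^sup>2 + G\<^sup>2) \<le> q\<^sup>2 * (F\<^sup>2 + G\<^sup>2 + q\<^sup>2 * (u\<^sup>2 + u'\<^sup>2))" by (intro mult_left_mono) auto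
  with small' have small2: "q\<^sup>2 * (F\<^sup>2 + G\<^sup>2) \<le> 11/40 * (1 + q\<^sup>2)" by linarith
  have c1: "q * G * sqrt (1 + F\<^sup>2) * d \<le> 9/10 * d\<^sup>2 + 1/2 * (q\<^sup>2 * G\<^sup>2)"
    by (rule cross_term_bound) (use q0 nn le small2 in auto)
  have c2: "q * F * sqrt (1 + G\<^sup>2) * d' \<le> 9/10 * d'\<^sup>2 + 1/2 * (q\<^sup>2 * F\<^sup>2)"
    by (rule cross_term_bound) (use q0 nn le small2 in \<open>auto simp: add.commute\<close>)
  have c3: "q * F * G * (u + u') \<le> 2/5 * (F\<^sup>2 + G\<^sup>2)"
    by (rule dual_term_bound) (use q0 nn nn' le small' in auto)
  define e where "e = E / (\<tau> * r)"
  have Ee: "E = \<tau> * r * e" using par r by (simp add: e_def)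
  have er: "E * D = T * (e * d)" "E * D' = T * (e * d')"
    unfolding Ee Dd T_def r(2)[symmetric] by (simp_all add: power2_eq_square)
  have eu: "c * (E * U) = T * (e * u)" "c * (E * U') = T * (e * u')"
    unfolding Ee u_def u'_def T_def by (simp_all add: algebra_simps)
  have mr: "M / sqrt c * G * sqrt (1 + F\<^sup>2) * D = T * (\<epsilon> * (q * G * sqrt (1 + F\<^sup>2) * d))"
    "M / sqrt c * F * sqrt (1 + G\<^sup>2) * D' = T * (\<epsilon> * (q * F * sqrt (1 + G\<^sup>2) * d'))"
    unfolding MqT Dd r_def[symmetric] using r by simp_all
  have cr: "c / sqrt c = r" using par by (simp add: r_def real_div_sqrt)
  have mu: "c * (M / sqrt c * G * F * U) = T * (\<epsilon> * (q * F * G * u))"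
    "c * (M / sqrt c * F * G * U') = T * (\<epsilon> * (q * F * G * u'))"
  proof -
    have "c * (M / sqrt c * x) = (c / sqrt c) * (M * x)" for x by simp
    then have *: "c * (M / sqrt c * x) = r * (M * x)" for x unfolding cr .
    show "c * (M / sqrt c * G * F * U) = T * (\<epsilon> * (q * F * G * u))"
      using *[of "G * F * U"] by (simp add: MqT u_def algebra_simps)
    show "c * (M / sqrt c * F * G * U') = T * (\<epsilon> * (q * F * G * u'))"
      using *[of "F * G * U'"] by (simp add: MqT u'_def algebra_simps)
  qed
  \<comment> \<open>A tenth of \<open>\<epsilon>\<close> is reserved for the errors; the bounds
    9/10, 1/2 and 2/5 of the other terms are chosen to leave exactly this room.\<close>
  have e1: "e * x \<le> \<epsilon> / 10 * x\<^sup>2 + e\<^sup>2 / (4 * (\<epsilon> / 10))" for x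
    using par by (intro absorb_error) simp
  define P where "P = F\<^sup>2 + G\<^sup>2"
  define Q where "Q = u\<^sup>2 + u'\<^sup>2"
  define W where "W = d\<^sup>2 + d'\<^sup>2"
  define k where "k = e\<^sup>2 / (4 * (\<epsilon> / 10))"
  have PW: "P \<le> W" unfolding P_def W_def using le nn by (intro add_mono power_mono)
  have QP: "Q \<le> P" unfolding P_def Q_def using le nn' by (intro add_mono power_mono)
  \<comment> \<open>The dissipation \<open>W\<close> pays \<open>9/10 * \<epsilon>\<close> to the
    interaction and \<open>\<epsilon> / 10\<close> to the error; the remaining part of the
    interaction is charged to \<open>q^2 P\<close>, which the dual norm supplies.\<close>
  have X: "X1 + X2 \<le> 2 * T * (- W + \<epsilon> * (9/10 * W + 1/2 * (q\<^sup>2 * P)) + (\<epsilon> / 10 * W + 2 * k))"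
  proof -
    have "X1 + X2 \<le> 2 * (T * (- d\<^sup>2 + \<epsilon> * (q * G * sqrt (1 + F\<^sup>2) * d) + e * d))
        + 2 * (T * (- d'\<^sup>2 + \<epsilon> * (q * F * sqrt (1 + G\<^sup>2) * d') + e * d'))"
      using add_mono[OF X1 X2] unfolding mr er dD by (simp add: T_def algebra_simps)
    also have "\<dots> \<le> 2 * (T * (- d\<^sup>2 + \<epsilon> * (9/10 * d\<^sup>2 + 1/2 * (q\<^sup>2 * G\<^sup>2)) + (\<epsilon> / 10 * d\<^sup>2 + k)))
        + 2 * (T * (- d'\<^sup>2 + \<epsilon> * (9/10 * d'\<^sup>2 + 1/2 * (q\<^sup>2 * F\<^sup>2)) + (\<epsilon> / 10 * d'\<^sup>2 + k)))"
      using c1 c2 e1[of d] e1[of d'] T par unfolding k_def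
      by (intro add_mono mult_left_mono) auto
    also have "\<dots> = 2 * T * (- W + \<epsilon> * (9/10 * W + 1/2 * (q\<^sup>2 * P)) + (\<epsilon> / 10 * W + 2 * k))"
      unfolding W_def P_def by (simp add: field_simps)
    finally show ?thesis .
  qed
  \<comment> \<open>The two \<open>\<kappa>\<close>-terms cancel in this sum. Only the quadratic
    remainder of the interaction survives, and \<open>dual_term_bound\<close> charges it with 2/5 of
    \<open>P\<close>.\<close>
  have Y: "c * (Y1 + Y2) \<le> 2 * T * (- P + \<epsilon> * (2/5 * P) + (\<epsilon> / 10 * Q + 2 * k))"
  proof -
    have "c * (Y1 + Y2) \<le> c * (2 * (- \<tau> * F\<^sup>2 - \<kappa> + M / sqrt c * G * F * U + E * U) +
        2 * (- \<tau> * G\<^sup>2 + \<kappa> + M / sqrt c * F * G * U' + E * U'))"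
      using par by (intro mult_left_mono add_mono Y1 Y2) auto
    also have "\<dots> = 2 * (- T * P + (c * (M / sqrt c * G * F * U) + c * (M / sqrt c * F * G * U'))
        + (c * (E * U) + c * (E * U')))"
      by (simp add: T_def P_def algebra_simps)
    also have "\<dots> = 2 * T * (- P + \<epsilon> * (q * F * G * (u + u')) + (e * u + e * u'))"
      unfolding mu eu by (simp add: algebra_simps)
    also have "\<dots> \<le> 2 * T * (- P + \<epsilon> * (2/5 * P) + ((\<epsilon> / 10 * u\<^sup>2 + k) + (\<epsilon> / 10 * u'\<^sup>2 + k)))"
      using c3 e1[of u] e1[of u'] T par unfolding k_def P_def
      by (intro add_mono mult_left_mono) auto
    also have "\<dots> = 2 * T * (- P + \<epsilon> * (2/5 * P) + (\<epsilon> / 10 * Q + 2 * k))"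
      by (simp add: Q_def algebra_simps)
    finally show ?thesis .
  qed
  have "X1 + X2 + q\<^sup>2 * c * (Y1 + Y2) \<le> 2 * T * (- W + \<epsilon> * (9/10 * W + 1/2 * (q\<^sup>2 * P)) + (\<epsilon> / 10 * W + 2 * k))
      + q\<^sup>2 * (2 * T * (- P + \<epsilon> * (2/5 * P) + (\<epsilon> / 10 * Q + 2 * k)))"
    using add_mono[OF X mult_left_mono[OF Y, of "q\<^sup>2"]] by (simp add: mult.assoc)
  also have "\<dots> = 2 * T * (- (1 - \<epsilon>) * W - q\<^sup>2 * ((1 - 9/10 * \<epsilon>) * P - \<epsilon> / 10 * Q) + 2 * (1 + q\<^sup>2) * k)"
    by (simp add: algebra_simps)
  \<comment> \<open>The charges against \<open>q^2 P\<close> are \<open>\<epsilon> / 2\<close> from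
    the \<open>L^2\<close> part and \<open>2/5 * \<epsilon>\<close> from the dual part, together
    \<open>9/10 * \<epsilon>\<close>. The last \<open>\<epsilon> / 10\<close> meets the error
    through \<open>Q \<le> P\<close>, so the factor \<open>1 - \<epsilon>\<close> is left on both
    levels.\<close>
  also have "\<dots> \<le> 2 * T * (- (1 - \<epsilon>) * P - q\<^sup>2 * ((1 - \<epsilon>) * Q) + 2 * (1 + q\<^sup>2) * k)"
  proof -
    have "(1 - \<epsilon>) * P \<le> (1 - \<epsilon>) * W" using PW par by (intro mult_left_mono) auto
    moreover have "q\<^sup>2 * ((1 - \<epsilon>) * Q) \<le> q\<^sup>2 * ((1 - 9/10 * \<epsilon>) * P - \<epsilon> / 10 * Q)"
    proof (intro mult_left_mono)
      have "(1 - 9/10 * \<epsilon>) * Q \<le> (1 - 9/10 * \<epsilon>) * P" using QP par by (intro mult_left_mono) auto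
      then show "(1 - \<epsilon>) * Q \<le> (1 - 9/10 * \<epsilon>) * P - \<epsilon> / 10 * Q" by (simp add: algebra_simps)
    qed simp
    ultimately show ?thesis using T by (intro mult_left_mono) (linarith, simp)
  qed
  also have "\<dots> = - (2 * \<tau> * c * (1 - \<epsilon>)) * (F\<^sup>2 + G\<^sup>2 + q\<^sup>2 * c * (U\<^sup>2 + U'\<^sup>2)) + 4 * T * (1 + q\<^sup>2) * k"
  proof -
    have "Q = c * (U\<^sup>2 + U'\<^sup>2)" by (simp add: Q_def uU[symmetric] distrib_left)
    then show ?thesis by (simp add: T_def P_def algebra_simps)
  qed
  \<comment> \<open>Four error terms, two of them weighted by \<open>q^2\<close>, each contribute
    \<open>k = 10 * e^2 / (4 * \<epsilon>)\<close>; undoing the scaling of \<open>e\<close> gives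
    the constant 10.\<close>
  also have "4 * T * (1 + q\<^sup>2) * k = 10 * (1 + q\<^sup>2) * E\<^sup>2 / (\<epsilon> * \<tau>)"
    unfolding k_def e_def T_def r(2)[symmetric] using par r by (simp add: power2_eq_square field_simps)
  finally show ?thesis .
qed

text \<open>A small step from \<open>y\<close> in the direction of the gradient itself realizes its
  norm as a difference quotient. If that norm exceeded \<open>L\<close>, half of the gap would serve
  as the linearization error.\<close>

lemma C1_gradient_bound:
  assumes f: "C1 f f'" and L: "\<And>y y'. \<bar>f y - f y'\<bar> \<le> L * norm (y - y')" and "0 \<le> L"
  shows "norm (f' y) \<le> L"
proof (rule ccontr)
  assume "\<not> norm (f' y) \<le> L"
  then have v: "L < norm (f' y)" by simp
  define v where "v = f' y"
  define e where "e = (norm v - L) / 2"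
  have e: "0 < e" "L + e < norm v" "0 < norm v" using v \<open>0 \<le> L\<close> by (auto simp: e_def v_def field_simps)
  from C1_has_derivative[OF f, of y, unfolded has_derivative_at_alt] e(1)
  obtain d where d: "0 < d" "\<And>z. norm (z - y) < d \<Longrightarrow> norm (f z - f y - v \<bullet> (z - y)) \<le> e * norm (z - y)"
    unfolding v_def by blast
  define t where "t = d / (2 * norm v)"
  have t: "0 < t" "t * norm v < d" using d e by (auto simp: t_def)
  have "norm (f (y + t *\<^sub>R v) - f y - v \<bullet> (t *\<^sub>R v)) \<le> e * (t * norm v)"
    using d(2)[of "y + t *\<^sub>R v"] t by simp
  moreover have "\<bar>f (y + t *\<^sub>R v) - f y\<bar> \<le> L * (t * norm v)"
    using L[of "y + t *\<^sub>R v" y] t by simp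
  moreover have "v \<bullet> (t *\<^sub>R v) = (t * norm v) * norm v"
    by (simp add: power2_norm_eq_inner[symmetric] power2_eq_square)
  ultimately have "(t * norm v) * norm v \<le> (L + e) * (t * norm v)"
    unfolding distrib_right real_norm_def by linarith
  then have "(t * norm v) * norm v \<le> (t * norm v) * (L + e)" by (simp only: mult.commute)
  moreover have "0 < t * norm v" using t e by simp
  ultimately have "norm v \<le> L + e" by (simp only: mult_le_cancel_left_pos)
  with e show False by simp
qed

section \<open>Weighted estimates, the drift perturbation and the dual norm\<close>

abbreviation LI :: "('a::euclidean_space \<Rightarrow> real) \<Rightarrow> real" where
  "LI f \<equiv> (\<integral>x. f x \<partial>torus_lebesgue)"

lemma weighted_Cauchy_Schwarz:
  fixes f g n :: "'a::euclidean_space \<Rightarrow> real"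
  assumes [continuous_intros]: "continuous_on UNIV f" "continuous_on UNIV g" "continuous_on UNIV n"
    and n: "\<And>x. 0 \<le> n x"
  shows "\<bar>LI (\<lambda>x. f x * g x * n x)\<bar> \<le> sqrt (LI (\<lambda>x. (f x)\<^sup>2 * n x)) * sqrt (LI (\<lambda>x. (g x)\<^sup>2 * n x))"
proof -
  have "\<bar>LI (\<lambda>x. (f x * sqrt (n x)) * (g x * sqrt (n x)))\<bar>
    \<le> sqrt (LI (\<lambda>x. (f x * sqrt (n x))\<^sup>2)) * sqrt (LI (\<lambda>x. (g x * sqrt (n x))\<^sup>2))"
    by (intro integral_Cauchy_Schwarz torus_lebesgue_integrable continuous_intros)
  moreover have "(f x * sqrt (n x)) * (g x * sqrt (n x)) = f x * g x * n x"
    "(f x * sqrt (n x))\<^sup>2 = (f x)\<^sup>2 * n x" "(g x * sqrt (n x))\<^sup>2 = (g x)\<^sup>2 * n x" for x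
    using n[of x] by (simp_all add: power_mult_distrib mult.assoc mult.left_commute)
  ultimately show ?thesis by simp
qed

definition weighted_poincare :: "('a::euclidean_space \<Rightarrow> real) \<Rightarrow> real \<Rightarrow> bool" where
  "weighted_poincare n c \<longleftrightarrow> 0 < c \<and> (\<forall>f f'. C1 f f' \<and> torus_periodic f \<and> LI (\<lambda>x. f x * n x) = 0 \<longrightarrow>
     c * LI (\<lambda>x. (f x)\<^sup>2 * n x) \<le> LI (\<lambda>x. (norm (f' x))\<^sup>2 * n x))"

definition prob_density :: "('a::euclidean_space \<Rightarrow> real) \<Rightarrow> bool" where
  "prob_density n \<longleftrightarrow> continuous_on UNIV n \<and> torus_periodic n \<and> (\<forall>x. 0 < n x) \<and> LI n = 1"

lemma prob_densityD:
  assumes "prob_density n"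
  shows "continuous_on UNIV n" "0 < n x" "0 \<le> n x" "LI n = 1" "torus_periodic n"
  using assms by (auto simp: prob_density_def less_imp_le)

text \<open>A mean-zero \<open>g\<close> annihilates constants, so \<open>f\<close> may be replaced
  by \<open>f\<close> minus its mean, to which the Poincare inequality applies; Cauchy-Schwarz does
  the rest. In other words, the dual norm of \<open>g\<close> is at most its \<open>L^2\<close> norm
  divided by \<open>sqrt c\<close>.\<close>

lemma weighted_poincare_dual:
  assumes n: "prob_density n" and P: "weighted_poincare n c"
    and f: "C1 f f'" "torus_periodic f" and g: "continuous_on UNIV g" "LI (\<lambda>x. g x * n x) = 0"
  shows "sqrt c * \<bar>LI (\<lambda>x. f x * g x * n x)\<bar> \<le> sqrt (LI (\<lambda>x. (norm (f' x))\<^sup>2 * n x)) * sqrt (LI (\<lambda>x. (g x)\<^sup>2 * n x))"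
proof -
  note nc[continuous_intros] = prob_densityD(1)[OF n] and n0 = prob_densityD(3)[OF n]
  note fc[continuous_intros] = C1_continuous[OF f(1)] C1_grad_continuous[OF f(1)] g(1)
  have c: "0 < c" using P by (simp add: weighted_poincare_def)
  define m where "m = LI (\<lambda>x. f x * n x)"
  define h where "h = (\<lambda>x. f x - m)"
  have h: "C1 h f'" using C1_diff[OF f(1) C1_const[of m]] by (simp add: h_def)
  have [continuous_intros]: "continuous_on UNIV h" by (rule C1_continuous[OF h])
  have hp: "torus_periodic h" using f(2) by (simp add: h_def torus_periodic_def)
  have "LI (\<lambda>x. h x * n x) = LI (\<lambda>x. f x * n x - m * n x)" by (simp add: h_def left_diff_distrib)
  also have "\<dots> = LI (\<lambda>x. f x * n x) - LI (\<lambda>x. m * n x)"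
    by (intro Bochner_Integration.integral_diff torus_lebesgue_integrable continuous_intros)
  also have "\<dots> = 0" by (simp add: m_def prob_densityD(4)[OF n])
  finally have h0: "LI (\<lambda>x. h x * n x) = 0" .
  have Ph: "c * LI (\<lambda>x. (h x)\<^sup>2 * n x) \<le> LI (\<lambda>x. (norm (f' x))\<^sup>2 * n x)"
    using P h hp h0 unfolding weighted_poincare_def by blast
  have "LI (\<lambda>x. h x * g x * n x) = LI (\<lambda>x. f x * g x * n x - m * (g x * n x))"
    by (simp add: h_def algebra_simps)
  also have "\<dots> = LI (\<lambda>x. f x * g x * n x) - LI (\<lambda>x. m * (g x * n x))"
    by (intro Bochner_Integration.integral_diff torus_lebesgue_integrable continuous_intros)
  also have "\<dots> = LI (\<lambda>x. f x * g x * n x)" by (simp add: g(2))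
  finally have "sqrt c * \<bar>LI (\<lambda>x. f x * g x * n x)\<bar> = sqrt c * \<bar>LI (\<lambda>x. h x * g x * n x)\<bar>" by simp
  also have "\<dots> \<le> sqrt c * (sqrt (LI (\<lambda>x. (h x)\<^sup>2 * n x)) * sqrt (LI (\<lambda>x. (g x)\<^sup>2 * n x)))"
    using c by (intro mult_left_mono weighted_Cauchy_Schwarz continuous_intros n0) auto
  also have "\<dots> = sqrt (c * LI (\<lambda>x. (h x)\<^sup>2 * n x)) * sqrt (LI (\<lambda>x. (g x)\<^sup>2 * n x))"
    by (simp add: real_sqrt_mult)
  also have "\<dots> \<le> sqrt (LI (\<lambda>x. (norm (f' x))\<^sup>2 * n x)) * sqrt (LI (\<lambda>x. (g x)\<^sup>2 * n x))"
    using Ph n0 by (intro mult_right_mono real_sqrt_le_mono) auto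
  finally show ?thesis .
qed

text \<open>The difference of the potential at \<open>x\<close> and \<open>x'\<close> pairs
  \<open>g\<close> with \<open>y \<mapsto> k x y - k x' y\<close>, whose gradient is at most
  \<open>M * norm (x - x')\<close> by the mixed bound. Poincare duality in \<open>y\<close> makes
  the potential Lipschitz, and its gradient inherits the constant. Only the mixed derivative of
  \<open>k\<close> is felt because \<open>g\<close> has mean zero.\<close>

lemma drift_bound:
  fixes k :: "'a::euclidean_space \<Rightarrow> 'b::euclidean_space \<Rightarrow> real"
  assumes n: "prob_density n" and P: "weighted_poincare n c"
    and k: "\<And>x. C1 (k x) (ky x)" "\<And>x. torus_periodic (k x)"
    and SD: "\<And>x x' y y'. \<bar>k x' y' - k x y' - k x' y + k x y\<bar> \<le> M * norm (x' - x) * norm (y' - y)" and "0 \<le> M"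
    and g: "continuous_on UNIV g" "LI (\<lambda>y. g y * n y) = 0"
    and b: "C1 (\<lambda>x. LI (\<lambda>y. k x y * (g y * n y))) b"
  shows "norm (b x) \<le> M / sqrt c * sqrt (LI (\<lambda>y. (g y)\<^sup>2 * n y))"
proof (rule C1_gradient_bound[OF b])
  note nc[continuous_intros] = prob_densityD(1)[OF n] and n0 = prob_densityD(3)[OF n]
  note [continuous_intros] = C1_continuous[OF k(1)] g(1)
  have c: "0 < c" using P by (simp add: weighted_poincare_def)
  define G where "G = sqrt (LI (\<lambda>y. (g y)\<^sup>2 * n y))"
  have G: "0 \<le> G" unfolding G_def using n0 by simp
  then show "0 \<le> M / sqrt c * sqrt (LI (\<lambda>y. (g y)\<^sup>2 * n y))"
    unfolding G_def[symmetric] using \<open>0 \<le> M\<close> c by simp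
  fix x x' :: 'a
  define f where "f = (\<lambda>y. k x y - k x' y)"
  define f' where "f' = (\<lambda>y. ky x y - ky x' y)"
  have f: "C1 f f'" unfolding f_def f'_def by (intro C1_diff k)
  have [continuous_intros]: "continuous_on UNIV f'" by (rule C1_grad_continuous[OF f])
  have fp: "torus_periodic f" using k(2) by (simp add: f_def torus_periodic_def)
  have nf: "norm (f' y) \<le> M * norm (x - x')" for y
  proof (rule C1_gradient_bound[OF f])
    show "\<bar>f y - f y'\<bar> \<le> M * norm (x - x') * norm (y - y')" for y y'
      using SD[of x y x' y'] by (simp add: f_def algebra_simps)
  qed (use \<open>0 \<le> M\<close> in simp)
  have "LI (\<lambda>y. (norm (f' y))\<^sup>2 * n y) \<le> LI (\<lambda>y. (M * norm (x - x'))\<^sup>2 * n y)"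
    by (intro integral_mono torus_lebesgue_integrable continuous_intros mult_right_mono power_mono nf n0) auto
  also have "\<dots> = (M * norm (x - x'))\<^sup>2" by (simp add: prob_densityD(4)[OF n])
  finally have "sqrt (LI (\<lambda>y. (norm (f' y))\<^sup>2 * n y)) \<le> sqrt ((M * norm (x - x'))\<^sup>2)" by (rule real_sqrt_le_mono)
  then have D: "sqrt (LI (\<lambda>y. (norm (f' y))\<^sup>2 * n y)) \<le> M * norm (x - x')" using \<open>0 \<le> M\<close> by simp
  have "LI (\<lambda>y. k x y * (g y * n y)) - LI (\<lambda>y. k x' y * (g y * n y))
      = LI (\<lambda>y. k x y * (g y * n y) - k x' y * (g y * n y))"
    by (intro Bochner_Integration.integral_diff[symmetric] torus_lebesgue_integrable continuous_intros)
  also have "\<dots> = LI (\<lambda>y. f y * g y * n y)" by (simp add: f_def algebra_simps)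
  finally have eq: "LI (\<lambda>y. k x y * (g y * n y)) - LI (\<lambda>y. k x' y * (g y * n y)) = LI (\<lambda>y. f y * g y * n y)" .
  have "sqrt c * \<bar>LI (\<lambda>y. f y * g y * n y)\<bar> \<le> sqrt (LI (\<lambda>y. (norm (f' y))\<^sup>2 * n y)) * G"
    unfolding G_def by (rule weighted_poincare_dual[OF n P f fp g])
  also have "\<dots> \<le> M * norm (x - x') * G" by (intro mult_right_mono D G)
  finally show "\<bar>LI (\<lambda>y. k x y * (g y * n y)) - LI (\<lambda>y. k x' y * (g y * n y))\<bar>
      \<le> M / sqrt c * sqrt (LI (\<lambda>y. (g y)\<^sup>2 * n y)) * norm (x - x')"
    unfolding eq G_def[symmetric] using c by (simp add: field_simps)
qed

text \<open>A finite-dimensional substitute for the inverse of the weighted Laplacian: only the test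
  functions in \<open>F\<close> are ever paired with \<open>u\<close>.\<close>

lemma dirichlet_dual_basis:
  fixes n :: "'a::euclidean_space \<Rightarrow> real"
  assumes n: "prob_density n" and P: "weighted_poincare n c"
    and F: "finite F" "\<And>\<phi>. \<phi> \<in> F \<Longrightarrow> C_k 1 \<phi> \<and> torus_periodic \<phi>"
  obtains Q where "finite Q" "\<And>e. e \<in> Q \<Longrightarrow> C_k 1 e \<and> torus_periodic e"
    "\<And>f u. continuous_on UNIV f \<Longrightarrow> LI (\<lambda>x. f x * n x) = 0 \<Longrightarrow>
      u = (\<lambda>x. \<Sum>e\<in>Q. LI (\<lambda>x. e x * f x * n x) * e x) \<Longrightarrow>
      (\<forall>\<phi>\<in>F. LI (\<lambda>x. (gradient u x \<bullet> gradient \<phi> x) * n x) = LI (\<lambda>x. \<phi> x * f x * n x)) \<and>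
      LI (\<lambda>x. (norm (gradient u x))\<^sup>2 * n x) = (\<Sum>e\<in>Q. (LI (\<lambda>x. e x * f x * n x))\<^sup>2) \<and>
      LI (\<lambda>x. u x * f x * n x) = (\<Sum>e\<in>Q. (LI (\<lambda>x. e x * f x * n x))\<^sup>2)"
proof -
  note nc[continuous_intros] = prob_densityD(1)[OF n] and n0 = prob_densityD(3)[OF n]
  define S where "S = {\<phi>::'a \<Rightarrow> real. C_k 1 \<phi> \<and> torus_periodic \<phi>}"
  define B where "B = (\<lambda>f g. LI (\<lambda>x. (gradient f x \<bullet> gradient g x) * n x))"
  have SC: "C1 f (gradient f)" "torus_periodic f" if "f \<in> S" for f
    using that by (auto simp: S_def intro: C_k_imp_C1)
  have Sc[continuous_intros]: "continuous_on UNIV f" "continuous_on UNIV (gradient f)" if "f \<in> S" for f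
    using C1_continuous[OF SC(1)[OF that]] C1_grad_continuous[OF SC(1)[OF that]] .
  have SI: "f \<in> S" if "C1 f f'" "torus_periodic f" for f f'
    using that C1_imp_C_k by (auto simp: S_def)
  have S0: "(\<lambda>x. 0) \<in> S" by (rule SI[OF C1_const]) (simp add: torus_periodic_def)
  have Sadd: "(\<lambda>x. f x + g x) \<in> S" if "f \<in> S" "g \<in> S" for f g
    by (rule SI[OF C1_add[OF SC(1)[OF that(1)] SC(1)[OF that(2)]]])
      (use SC(2)[OF that(1)] SC(2)[OF that(2)] in \<open>simp add: torus_periodic_def\<close>)
  have Sscale: "(\<lambda>x. c * f x) \<in> S" if "f \<in> S" for c f
    by (rule SI[OF C1_cmult[OF SC(1)[OF that]]]) (use SC(2)[OF that] in \<open>simp add: torus_periodic_def\<close>)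
  have Gadd: "gradient (\<lambda>x. f x + g x) = (\<lambda>x. gradient f x + gradient g x)" if "f \<in> S" "g \<in> S" for f g
    by (rule C1_gradient[OF C1_add[OF SC(1)[OF that(1)] SC(1)[OF that(2)]]])
  have Gscale: "gradient (\<lambda>x. c * f x) = (\<lambda>x. c *\<^sub>R gradient f x)" if "f \<in> S" for c f
    by (rule C1_gradient[OF C1_cmult[OF SC(1)[OF that]]])
  have sym: "B f g = B g f" for f g by (simp add: B_def inner_commute)
  have add: "B (\<lambda>x. f x + g x) h = B f h + B g h" if "f \<in> S" "g \<in> S" "h \<in> S" for f g h
    unfolding B_def Gadd[OF that(1,2)] inner_add_left distrib_right
    by (intro Bochner_Integration.integral_add torus_lebesgue_integrable continuous_intros that)
  have scale: "B (\<lambda>x. c * f x) h = c * B f h" if "f \<in> S" for c f h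
    unfolding B_def Gscale[OF that] by (simp add: mult.assoc)
  have nonneg: "0 \<le> B f f" for f unfolding B_def using n0 by (intro integral_nonneg_AE) auto
  have FS: "F \<subseteq> S" using F by (auto simp: S_def)
  obtain Q where Q: "finite Q" "Q \<subseteq> S" and orth: "\<And>e e'. e \<in> Q \<Longrightarrow> e' \<in> Q \<Longrightarrow> B e e' = (if e = e' then 1 else 0)"
    and res: "\<And>\<phi>. \<phi> \<in> F \<Longrightarrow> B (\<lambda>x. \<phi> x - (\<Sum>e\<in>Q. B \<phi> e * e x)) (\<lambda>x. \<phi> x - (\<Sum>e\<in>Q. B \<phi> e * e x)) = 0"
  proof (rule gram_schmidt[of S B F, OF S0 Sadd Sscale sym add scale nonneg F(1) FS])
    fix Q assume "finite Q" "Q \<subseteq> S" "\<And>e e'. e \<in> Q \<Longrightarrow> e' \<in> Q \<Longrightarrow> B e e' = (if e = e' then 1 else 0)"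
      "\<And>\<phi>. \<phi> \<in> F \<Longrightarrow> B (\<lambda>x. \<phi> x - (\<Sum>e\<in>Q. B \<phi> e * e x)) (\<lambda>x. \<phi> x - (\<Sum>e\<in>Q. B \<phi> e * e x)) = 0"
    then show ?thesis by (rule that)
  qed
  have QS: "e \<in> S" if "e \<in> Q" for e using Q that by auto
  have B0: "B (\<lambda>x. 0) h = 0" for h using scale[OF S0, of 0 h] by simp
  have sumS: "(\<lambda>x. \<Sum>e\<in>Q'. a e * e x) \<in> S" if "finite Q'" "Q' \<subseteq> S" for Q' a
    using that by (induction Q') (auto intro: S0 Sadd Sscale)
  have Bsum: "B (\<lambda>x. \<Sum>e\<in>Q'. a e * e x) h = (\<Sum>e\<in>Q'. a e * B e h)" if "finite Q'" "Q' \<subseteq> S" "h \<in> S" for Q' a h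
    using that
  proof (induction Q')
    case (insert e Q')
    then have "B (\<lambda>x. a e * e x + (\<Sum>e\<in>Q'. a e * e x)) h = a e * B e h + (\<Sum>e\<in>Q'. a e * B e h)"
      using add[of "\<lambda>x. a e * e x" "\<lambda>x. \<Sum>e\<in>Q'. a e * e x" h] Sscale sumS scale by simp
    then show ?case using insert by simp
  qed (simp add: B0)
  show ?thesis
  proof (rule that[of Q])
    show "finite Q" by fact
    show "C_k 1 e \<and> torus_periodic e" if "e \<in> Q" for e using QS[OF that] by (simp add: S_def)
    fix f u :: "'a \<Rightarrow> real"
    assume f[continuous_intros]: "continuous_on UNIV f" and f0: "LI (\<lambda>x. f x * n x) = 0"
      and u: "u = (\<lambda>x. \<Sum>e\<in>Q. LI (\<lambda>x. e x * f x * n x) * e x)"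
    \<comment> \<open>The coordinates of \<open>u\<close>: by orthonormality,
      \<open>B u e = l e\<close> says that \<open>u\<close> solves the weak equation on the basis
      functions.\<close>
    define l where "l = (\<lambda>e. LI (\<lambda>x. e x * f x * n x))"
    have u': "u = (\<lambda>x. \<Sum>e\<in>Q. l e * e x)" by (simp add: u l_def)
    have uS: "u \<in> S" unfolding u' by (intro sumS Q)
    have lsum: "LI (\<lambda>x. (\<Sum>e\<in>Q. a e * e x) * f x * n x) = (\<Sum>e\<in>Q. a e * l e)" for a
    proof -
      have "LI (\<lambda>x. (\<Sum>e\<in>Q. a e * e x) * f x * n x) = LI (\<lambda>x. \<Sum>e\<in>Q. a e * (e x * f x * n x))"
        by (simp add: sum_distrib_left sum_distrib_right mult_ac)
      also have "\<dots> = (\<Sum>e\<in>Q. LI (\<lambda>x. a e * (e x * f x * n x)))"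
        by (intro Bochner_Integration.integral_sum torus_lebesgue_integrable continuous_intros QS)
      finally show ?thesis by (simp add: l_def)
    qed
    have "B u \<phi> = LI (\<lambda>x. \<phi> x * f x * n x)" if "\<phi> \<in> F" for \<phi>
    proof -
      have \<phi>S: "\<phi> \<in> S" using that FS by auto
      define \<psi> where "\<psi> = (\<lambda>x. \<phi> x - (\<Sum>e\<in>Q. B \<phi> e * e x))"
      have \<psi>S: "\<psi> \<in> S" using Sadd[OF \<phi>S Sscale[OF sumS[OF Q], of "-1" "B \<phi>"]] by (simp add: \<psi>_def)
      \<comment> \<open>The residual has zero Dirichlet energy, so by
        \<open>weighted_poincare_dual\<close> it pairs to zero with the mean-zero \<open>f\<close>;
        the identity passes from the basis to all of \<open>F\<close>.\<close>
      have "B \<psi> \<psi> = 0" unfolding \<psi>_def by (rule res[OF that])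
      then have "LI (\<lambda>x. (norm (gradient \<psi> x))\<^sup>2 * n x) = 0"
        by (simp add: B_def power2_norm_eq_inner)
      then have "sqrt c * \<bar>LI (\<lambda>x. \<psi> x * f x * n x)\<bar> \<le> 0"
        using weighted_poincare_dual[OF n P SC[OF \<psi>S] f f0] by simp
      moreover have "0 < sqrt c" using P by (simp add: weighted_poincare_def)
      ultimately have \<psi>0: "LI (\<lambda>x. \<psi> x * f x * n x) = 0" by (simp add: mult_le_0_iff)
      have "LI (\<lambda>x. \<phi> x * f x * n x) = LI (\<lambda>x. \<psi> x * f x * n x + (\<Sum>e\<in>Q. B \<phi> e * e x) * f x * n x)"
        by (simp add: \<psi>_def algebra_simps)
      also have "\<dots> = LI (\<lambda>x. \<psi> x * f x * n x) + LI (\<lambda>x. (\<Sum>e\<in>Q. B \<phi> e * e x) * f x * n x)"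
        by (intro Bochner_Integration.integral_add torus_lebesgue_integrable continuous_intros \<psi>S QS)
      also have "\<dots> = (\<Sum>e\<in>Q. B \<phi> e * l e)" by (simp add: \<psi>0 lsum)
      also have "\<dots> = (\<Sum>e\<in>Q. l e * B e \<phi>)" by (intro sum.cong refl) (simp add: sym[of \<phi>])
      also have "\<dots> = B u \<phi>" unfolding u' by (rule Bsum[OF Q \<phi>S, symmetric])
      finally show ?thesis by simp
    qed
    moreover have "B u u = (\<Sum>e\<in>Q. (l e)\<^sup>2)"
    proof -
      \<comment> \<open>Parseval: energy of \<open>u\<close>, its pairing with \<open>f\<close> and
        the sum of squared coordinates all coincide.\<close>
      have Bue: "B e u = l e" if "e \<in> Q" for e
      proof -
        have "B e u = B u e" by (rule sym)
        also have "\<dots> = (\<Sum>e'\<in>Q. l e' * B e' e)" unfolding u' by (rule Bsum[OF Q QS[OF that]])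
        also have "\<dots> = (\<Sum>e'\<in>Q. if e' = e then l e else 0)"
          using that by (intro sum.cong refl) (simp add: orth)
        also have "\<dots> = l e" using that Q by simp
        finally show ?thesis .
      qed
      have "B u u = (\<Sum>e\<in>Q. l e * B e u)" by (subst u') (rule Bsum[OF Q uS])
      also have "\<dots> = (\<Sum>e\<in>Q. (l e)\<^sup>2)" by (intro sum.cong refl) (simp add: Bue power2_eq_square)
      finally show ?thesis .
    qed
    moreover have "LI (\<lambda>x. u x * f x * n x) = (\<Sum>e\<in>Q. (l e)\<^sup>2)"
      unfolding u' lsum by (simp add: power2_eq_square)
    ultimately show "(\<forall>\<phi>\<in>F. LI (\<lambda>x. (gradient u x \<bullet> gradient \<phi> x) * n x) = LI (\<lambda>x. \<phi> x * f x * n x)) \<and>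
      LI (\<lambda>x. (norm (gradient u x))\<^sup>2 * n x) = (\<Sum>e\<in>Q. (LI (\<lambda>x. e x * f x * n x))\<^sup>2) \<and>
      LI (\<lambda>x. u x * f x * n x) = (\<Sum>e\<in>Q. (LI (\<lambda>x. e x * f x * n x))\<^sup>2)"
      unfolding B_def l_def power2_norm_eq_inner by blast
  qed
qed

text \<open>The flux \<open>w\<close> splits into diffusion, drift and error, and the drift is
  treated in two ways. The first estimate bounds it as a whole through the \<open>L^2\<close> norm
  of \<open>1 + f\<close>. The second isolates the part linear in the perturbation, without taking
  absolute values, because this part will cancel between the players.\<close>

lemma flux_estimates:
  fixes n f \<phi> p :: "'a::euclidean_space \<Rightarrow> real"
  assumes n: "prob_density n" and \<phi>': "continuous_on UNIV \<phi>'" and f: "C1 f f'" and f0: "LI (\<lambda>x. f x * n x) = 0"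
    and b: "continuous_on UNIV b" "\<And>x. norm (b x) \<le> \<beta>" and p: "\<And>x. p x = n x * (1 + f x)" "\<And>x. 0 \<le> p x"
    and w: "continuous_on UNIV w" "\<And>x. w x = \<tau> *\<^sub>R (n x *\<^sub>R f' x) + p x *\<^sub>R b x + r x"
    and r: "\<And>x. norm (r x) \<le> \<eta> * (1 + p x)" and "0 \<le> \<eta>"
    and \<Phi>: "\<Phi> = sqrt (LI (\<lambda>x. (norm (\<phi>' x))\<^sup>2 * n x))" and F: "F = sqrt (LI (\<lambda>x. (f x)\<^sup>2 * n x))"
    and C: "C = sqrt (LI (\<lambda>x. (1 + inverse (n x))\<^sup>2 * n x))"
  shows "- LI (\<lambda>x. \<phi>' x \<bullet> w x) \<le> - \<tau> * LI (\<lambda>x. (\<phi>' x \<bullet> f' x) * n x) + \<beta> * sqrt (1 + F\<^sup>2) * \<Phi> + \<eta> * (C + F) * \<Phi>"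
    and "- LI (\<lambda>x. \<phi>' x \<bullet> w x) \<le> - \<tau> * LI (\<lambda>x. (\<phi>' x \<bullet> f' x) * n x)
      - LI (\<lambda>x. (\<phi>' x \<bullet> b x) * n x) + \<beta> * F * \<Phi> + \<eta> * (C + F) * \<Phi>"
proof -
  note nc[continuous_intros] = prob_densityD(1)[OF n] and n0 = prob_densityD(3)[OF n]
    and npos = prob_densityD(2)[OF n]
  note [continuous_intros] = \<phi>' b(1) C1_continuous[OF f] C1_grad_continuous[OF f] w(1)
  have nz: "n x \<noteq> 0" for x using npos[of x] by simp
  have r_eq: "r = (\<lambda>x. w x - \<tau> *\<^sub>R (n x *\<^sub>R f' x) - (n x * (1 + f x)) *\<^sub>R b x)"
    by (auto simp: w(2) p(1))
  have rc[continuous_intros]: "continuous_on UNIV r" unfolding r_eq by (intro continuous_intros)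
  have invc[continuous_intros]: "continuous_on UNIV (\<lambda>x. inverse (n x))"
    by (intro continuous_intros) (use nz in auto)
  have F2: "F\<^sup>2 = LI (\<lambda>x. (f x)\<^sup>2 * n x)" unfolding F using n0 by simp
  have F0: "0 \<le> F" and \<Phi>0: "0 \<le> \<Phi>" and C0: "0 \<le> C" unfolding F \<Phi> C using n0 by auto
  have split: "LI (\<lambda>x. \<phi>' x \<bullet> w x) = \<tau> * LI (\<lambda>x. (\<phi>' x \<bullet> f' x) * n x)
      + LI (\<lambda>x. (\<phi>' x \<bullet> b x) * (1 + f x) * n x) + LI (\<lambda>x. \<phi>' x \<bullet> r x)"
  proof -
    have "LI (\<lambda>x. \<phi>' x \<bullet> w x) = LI (\<lambda>x. \<tau> * ((\<phi>' x \<bullet> f' x) * n x) + (\<phi>' x \<bullet> b x) * (1 + f x) * n x + \<phi>' x \<bullet> r x)"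
      unfolding w(2) p(1) by (simp add: inner_add_right mult_ac)
    also have "\<dots> = LI (\<lambda>x. \<tau> * ((\<phi>' x \<bullet> f' x) * n x)) + LI (\<lambda>x. (\<phi>' x \<bullet> b x) * (1 + f x) * n x) + LI (\<lambda>x. \<phi>' x \<bullet> r x)"
      by (subst Bochner_Integration.integral_add Bochner_Integration.integral_add;
          (intro torus_lebesgue_integrable continuous_intros)?)+ (simp add: Bochner_Integration.integral_add)
    finally show ?thesis by simp
  qed
  have split2: "LI (\<lambda>x. (\<phi>' x \<bullet> b x) * (1 + f x) * n x)
      = LI (\<lambda>x. (\<phi>' x \<bullet> b x) * n x) + LI (\<lambda>x. (\<phi>' x \<bullet> b x) * f x * n x)"
  proof -
    have "LI (\<lambda>x. (\<phi>' x \<bullet> b x) * (1 + f x) * n x) = LI (\<lambda>x. (\<phi>' x \<bullet> b x) * n x + (\<phi>' x \<bullet> b x) * f x * n x)"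
      by (simp add: algebra_simps)
    also have "\<dots> = LI (\<lambda>x. (\<phi>' x \<bullet> b x) * n x) + LI (\<lambda>x. (\<phi>' x \<bullet> b x) * f x * n x)"
      by (intro Bochner_Integration.integral_add torus_lebesgue_integrable continuous_intros)
    finally show ?thesis .
  qed
  have \<beta>0: "0 \<le> \<beta>" using b(2) norm_ge_zero order_trans by blast
  have drift: "\<bar>LI (\<lambda>x. (\<phi>' x \<bullet> b x) * h x * n x)\<bar> \<le> \<beta> * sqrt (LI (\<lambda>x. (h x)\<^sup>2 * n x)) * \<Phi>"
    if [continuous_intros]: "continuous_on UNIV h" for h
  proof -
    have "\<bar>LI (\<lambda>x. (\<phi>' x \<bullet> b x) * h x * n x)\<bar> \<le> LI (\<lambda>x. \<bar>(\<phi>' x \<bullet> b x) * h x * n x\<bar>)"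
      by (rule integral_abs_bound)
    also have "\<dots> \<le> LI (\<lambda>x. \<beta> * (norm (\<phi>' x) * \<bar>h x\<bar> * n x))"
    proof (intro integral_mono torus_lebesgue_integrable continuous_intros)
      fix x
      have "\<bar>\<phi>' x \<bullet> b x\<bar> \<le> norm (\<phi>' x) * norm (b x)" by (rule Cauchy_Schwarz_ineq2)
      also have "\<dots> \<le> norm (\<phi>' x) * \<beta>" by (intro mult_left_mono b) simp
      finally have "\<bar>\<phi>' x \<bullet> b x\<bar> * (\<bar>h x\<bar> * n x) \<le> (norm (\<phi>' x) * \<beta>) * (\<bar>h x\<bar> * n x)"
        using n0[of x] by (intro mult_right_mono) auto
      then show "\<bar>(\<phi>' x \<bullet> b x) * h x * n x\<bar> \<le> \<beta> * (norm (\<phi>' x) * \<bar>h x\<bar> * n x)"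
        using n0[of x] by (simp add: abs_mult mult_ac)
    qed
    also have "\<dots> \<le> \<beta> * \<bar>LI (\<lambda>x. norm (\<phi>' x) * \<bar>h x\<bar> * n x)\<bar>"
      using \<beta>0 by (simp add: mult_left_mono)
    also have "\<dots> \<le> \<beta> * (sqrt (LI (\<lambda>x. (norm (\<phi>' x))\<^sup>2 * n x)) * sqrt (LI (\<lambda>x. \<bar>h x\<bar>\<^sup>2 * n x)))"
      by (intro mult_left_mono weighted_Cauchy_Schwarz continuous_intros n0 \<beta>0)
    finally show ?thesis by (simp add: \<Phi> mult_ac)
  qed
  \<comment> \<open>The cross term vanishes because \<open>f\<close> has mean zero; this is where
    \<open>sqrt (1 + F^2)\<close> comes from.\<close>
  have one: "LI (\<lambda>x. (1 + f x)\<^sup>2 * n x) = 1 + F\<^sup>2"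
  proof -
    have "LI (\<lambda>x. (1 + f x)\<^sup>2 * n x) = LI (\<lambda>x. n x + (2 * (f x * n x) + (f x)\<^sup>2 * n x))"
      by (simp add: power2_eq_square algebra_simps)
    also have "\<dots> = LI n + LI (\<lambda>x. 2 * (f x * n x) + (f x)\<^sup>2 * n x)"
      by (intro Bochner_Integration.integral_add torus_lebesgue_integrable continuous_intros)
    also have "LI (\<lambda>x. 2 * (f x * n x) + (f x)\<^sup>2 * n x) = LI (\<lambda>x. 2 * (f x * n x)) + LI (\<lambda>x. (f x)\<^sup>2 * n x)"
      by (intro Bochner_Integration.integral_add torus_lebesgue_integrable continuous_intros)
    finally show ?thesis by (simp add: f0 F2 prob_densityD(4)[OF n])
  qed
  have "\<bar>LI (\<lambda>x. \<phi>' x \<bullet> r x)\<bar> \<le> LI (\<lambda>x. \<bar>\<phi>' x \<bullet> r x\<bar>)" by (rule integral_abs_bound)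
  also have "\<dots> \<le> LI (\<lambda>x. \<eta> * (norm (\<phi>' x) * (1 + inverse (n x)) * n x) + \<eta> * (norm (\<phi>' x) * \<bar>f x\<bar> * n x))"
  proof (intro integral_mono torus_lebesgue_integrable continuous_intros)
    fix x
    have "\<bar>\<phi>' x \<bullet> r x\<bar> \<le> norm (\<phi>' x) * norm (r x)" by (rule Cauchy_Schwarz_ineq2)
    also have "\<dots> \<le> norm (\<phi>' x) * (\<eta> * (1 + p x))" by (intro mult_left_mono r) simp
    \<comment> \<open>Writing 1 as \<open>inverse (n x) * n x\<close> brings the error into the
      weight \<open>n\<close>: Cauchy-Schwarz then produces the constant \<open>C\<close> from
      \<open>1 + inverse n\<close> and the norm \<open>F\<close> from \<open>f\<close>.\<close>
    also have "\<dots> \<le> norm (\<phi>' x) * (\<eta> * ((1 + inverse (n x)) * n x + \<bar>f x\<bar> * n x))"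
    proof (intro mult_left_mono \<open>0 \<le> \<eta>\<close> norm_ge_zero)
      have "n x * f x \<le> n x * \<bar>f x\<bar>" using n0[of x] by (intro mult_left_mono) auto
      then show "1 + p x \<le> (1 + inverse (n x)) * n x + \<bar>f x\<bar> * n x"
        unfolding p using nz[of x] by (simp add: algebra_simps)
    qed
    finally show "\<bar>\<phi>' x \<bullet> r x\<bar> \<le> \<eta> * (norm (\<phi>' x) * (1 + inverse (n x)) * n x) + \<eta> * (norm (\<phi>' x) * \<bar>f x\<bar> * n x)"
      by (simp add: algebra_simps)
  qed (use nz in auto)
  also have "\<dots> = \<eta> * LI (\<lambda>x. norm (\<phi>' x) * (1 + inverse (n x)) * n x) + \<eta> * LI (\<lambda>x. norm (\<phi>' x) * \<bar>f x\<bar> * n x)"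
    using nz by (subst Bochner_Integration.integral_add) (auto intro!: torus_lebesgue_integrable continuous_intros)
  also have "\<dots> \<le> \<eta> * (\<Phi> * C) + \<eta> * (\<Phi> * F)"
  proof (intro add_mono mult_left_mono \<open>0 \<le> \<eta>\<close>)
    have "\<bar>LI (\<lambda>x. norm (\<phi>' x) * (1 + inverse (n x)) * n x)\<bar> \<le> \<Phi> * C"
      unfolding \<Phi> C by (intro weighted_Cauchy_Schwarz continuous_intros n0) (use nz in auto)
    then show "LI (\<lambda>x. norm (\<phi>' x) * (1 + inverse (n x)) * n x) \<le> \<Phi> * C" by simp
    have "\<bar>LI (\<lambda>x. norm (\<phi>' x) * \<bar>f x\<bar> * n x)\<bar> \<le> \<Phi> * sqrt (LI (\<lambda>x. \<bar>f x\<bar>\<^sup>2 * n x))"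
      unfolding \<Phi> by (intro weighted_Cauchy_Schwarz continuous_intros n0)
    then show "LI (\<lambda>x. norm (\<phi>' x) * \<bar>f x\<bar> * n x) \<le> \<Phi> * F" by (simp add: F)
  qed
  finally have err: "\<bar>LI (\<lambda>x. \<phi>' x \<bullet> r x)\<bar> \<le> \<eta> * (C + F) * \<Phi>" by (simp add: algebra_simps)
  have "\<bar>LI (\<lambda>x. (\<phi>' x \<bullet> b x) * (1 + f x) * n x)\<bar> \<le> \<beta> * sqrt (1 + F\<^sup>2) * \<Phi>"
    using drift[of "\<lambda>x. 1 + f x"] unfolding one by (simp add: continuous_intros)
  with err show "- LI (\<lambda>x. \<phi>' x \<bullet> w x) \<le> - \<tau> * LI (\<lambda>x. (\<phi>' x \<bullet> f' x) * n x) + \<beta> * sqrt (1 + F\<^sup>2) * \<Phi> + \<eta> * (C + F) * \<Phi>"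
    unfolding split by linarith
  have "\<bar>LI (\<lambda>x. (\<phi>' x \<bullet> b x) * f x * n x)\<bar> \<le> \<beta> * F * \<Phi>"
    using drift[of f] unfolding F by (simp add: continuous_intros)
  with err show "- LI (\<lambda>x. \<phi>' x \<bullet> w x) \<le> - \<tau> * LI (\<lambda>x. (\<phi>' x \<bullet> f' x) * n x)
      - LI (\<lambda>x. (\<phi>' x \<bullet> b x) * n x) + \<beta> * F * \<Phi> + \<eta> * (C + F) * \<Phi>"
    unfolding split split2 by linarith
qed

section \<open>Mollification\<close>

lemma C1_reflect:
  assumes "C1 f f'"
  shows "C1 (\<lambda>y. f (x - y)) (\<lambda>y. - f' (x - y))"
proof -
  have "((\<lambda>y. f (x - y)) has_derivative (\<lambda>h. f' (x - y) \<bullet> (- h))) (at y)" for y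
    by (rule has_derivative_compose[OF _ C1_has_derivative[OF assms], where f="\<lambda>y. x - y"])
      (auto intro!: derivative_eq_intros)
  then have "((\<lambda>y. f (x - y)) has_derivative (\<lambda>h. (- f' (x - y)) \<bullet> h)) (at y)" for y
    by simp
  moreover have "continuous_on UNIV (\<lambda>y. - f' (x - y))"
    by (intro continuous_intros continuous_on_compose2[OF C1_grad_continuous[OF assms]]) auto
  ultimately show ?thesis by (simp add: C1_def)
qed

text \<open>The convolution of a kernel with a measure. Values may be vectors, so that the gradient
  of a mollified density is the mollification by the gradient of the kernel.\<close>

definition mollify :: "('a::euclidean_space \<Rightarrow> 'b::{banach, second_countable_topology}) \<Rightarrow> 'a measure \<Rightarrow> 'a \<Rightarrow> 'b" where
  "mollify \<rho> \<mu> x = (\<integral>y. \<rho> (x - y) \<partial>\<mu>)"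

lemma continuous_mollify:
  assumes "torus_prob_measure \<mu>" "continuous_on UNIV \<rho>"
  shows "continuous_on UNIV (mollify \<rho> \<mu>)"
proof -
  have "continuous_on UNIV (\<lambda>x. \<integral>y. \<rho> (x - y) \<partial>\<mu>)"
    by (rule continuous_torus_integral[OF assms(1)])
      (auto simp: case_prod_beta intro!: continuous_intros continuous_on_compose2[OF assms(2)])
  then show ?thesis by (simp add: mollify_def[abs_def])
qed

lemma C1_mollify:
  assumes "torus_prob_measure \<mu>" "C1 \<rho> \<rho>'"
  shows "C1 (mollify \<rho> \<mu>) (mollify \<rho>' \<mu>)"
proof -
  have "C1 (\<lambda>x. \<integral>y. \<rho> (x - y) \<partial>\<mu>) (\<lambda>x. \<integral>y. \<rho>' (x - y) \<partial>\<mu>)"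
  proof (rule C1_torus_integral[OF assms(1)])
    show "continuous_on UNIV (\<lambda>(x, y). \<rho> (x - y))" "continuous_on UNIV (\<lambda>(x, y). \<rho>' (x - y))"
      by (auto simp: case_prod_beta intro!: continuous_intros continuous_on_compose2[OF C1_continuous[OF assms(2)]]
          continuous_on_compose2[OF C1_grad_continuous[OF assms(2)]])
    show "C1 (\<lambda>x. \<rho> (x - y)) (\<lambda>x. \<rho>' (x - y))" for y
      using C1_translate[OF assms(2), of "- y"] by simp
  qed
  then show ?thesis by (simp add: mollify_def[abs_def])
qed

lemma mollify_periodic:
  fixes \<rho> :: "'a::euclidean_space \<Rightarrow> 'b::{banach, second_countable_topology}"
  assumes "torus_periodic \<rho>"
  shows "torus_periodic (mollify \<rho> \<mu>)"
  unfolding torus_periodic_def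
proof (intro allI ballI)
  fix x b :: 'a assume b: "b \<in> Basis"
  have "\<rho> (x + b - y) = \<rho> (x - y)" for y
    using torus_periodicD[OF assms b, of "x - y"] by (simp add: diff_add_eq)
  then show "mollify \<rho> \<mu> (x + b) = mollify \<rho> \<mu> x" by (simp add: mollify_def)
qed

lemma mollify_nonneg:
  fixes \<rho> :: "'a::euclidean_space \<Rightarrow> real"
  shows "(\<And>z. 0 \<le> \<rho> z) \<Longrightarrow> 0 \<le> mollify \<rho> \<mu> x"
  unfolding mollify_def by (rule integral_nonneg_AE) simp

lemma LI_translate_kernel:
  assumes "continuous_on UNIV \<rho>" "torus_periodic \<rho>"
  shows "LI (\<lambda>x. \<rho> (x - y)) = LI \<rho>"
  using torus_integral_translate[OF borel_measurable_continuous_onI[OF assms(1)] assms(2), of "- y"] by simp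

lemma LI_mollify_mult:
  assumes \<mu>: "torus_prob_measure \<mu>" and \<rho>: "continuous_on UNIV \<rho>" and \<phi>: "continuous_on UNIV \<phi>"
  shows "LI (\<lambda>x. \<phi> x * mollify \<rho> \<mu> x) = (\<integral>y. LI (\<lambda>x. \<phi> x * \<rho> (x - y)) \<partial>\<mu>)"
proof -
  have "LI (\<lambda>x. \<phi> x * mollify \<rho> \<mu> x) = LI (\<lambda>x. \<integral>y. \<phi> x * \<rho> (x - y) \<partial>\<mu>)"
    by (simp add: mollify_def)
  also have "\<dots> = (\<integral>y. LI (\<lambda>x. \<phi> x * \<rho> (x - y)) \<partial>\<mu>)"
    by (rule torus_Fubini[OF \<mu> torus_prob_measure_lebesgue])
      (auto simp: case_prod_beta intro!: continuous_intros continuous_on_compose2[OF \<rho>] continuous_on_compose2[OF \<phi>])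
  finally show ?thesis .
qed

lemma LI_mollify:
  assumes \<mu>: "torus_prob_measure \<mu>" and \<rho>: "continuous_on UNIV \<rho>" "torus_periodic \<rho>"
  shows "LI (mollify \<rho> \<mu>) = LI \<rho>"
  using LI_mollify_mult[OF \<mu> \<rho>(1), of "\<lambda>_. 1"] torus_prob_measure_space[OF \<mu>]
  by (simp add: LI_translate_kernel[OF \<rho>])

text \<open>Translating the variable of integration puts the first derivative on
  \<open>\<phi>\<close>; translated back, the second one falls on the kernel. One derivative of
  \<open>\<phi>\<close> thus suffices for the Laplacian of its mollification.\<close>

lemma mollified_test_function:
  fixes \<phi> :: "'a::euclidean_space \<Rightarrow> real"
  assumes \<rho>: "C1 \<rho> \<rho>'" "torus_periodic \<rho>" and \<phi>: "C1 \<phi> \<phi>'" "torus_periodic \<phi>"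
    and \<Phi>: "\<Phi> = (\<lambda>y. LI (\<lambda>x. \<phi> x * \<rho> (x - y)))"
  shows "gradient \<Phi> = (\<lambda>y. \<integral>x. \<rho> (x - y) *\<^sub>R \<phi>' x \<partial>torus_lebesgue)"
    and "laplacian \<Phi> = (\<lambda>y. - LI (\<lambda>x. \<phi>' x \<bullet> \<rho>' (x - y)))"
proof -
  note c = C1_continuous[OF \<rho>(1)] C1_grad_continuous[OF \<rho>(1)] C1_continuous[OF \<phi>(1)] C1_grad_continuous[OF \<phi>(1)]
  note L = torus_prob_measure_lebesgue
  note cc = continuous_intros continuous_on_compose2[OF c(1)] continuous_on_compose2[OF c(2)]
    continuous_on_compose2[OF c(3)] continuous_on_compose2[OF c(4)]
  have \<phi>'p: "torus_periodic \<phi>'" by (rule C1_periodic_grad[OF \<phi>])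
  have "\<Phi> = (\<lambda>y. LI (\<lambda>x. \<phi> (x + y) * \<rho> x))"
  proof
    fix y
    have "LI (\<lambda>x. \<phi> (x + y) * \<rho> ((x + y) - y)) = LI (\<lambda>x. \<phi> x * \<rho> (x - y))"
    proof (rule torus_integral_translate)
      show "(\<lambda>x. \<phi> x * \<rho> (x - y)) \<in> borel_measurable borel"
        by (intro borel_measurable_continuous_onI cc) auto
      show "torus_periodic (\<lambda>x. \<phi> x * \<rho> (x - y))"
        using \<rho>(2) \<phi>(2) by (simp add: torus_periodic_def diff_add_eq[symmetric])
    qed
    then show "\<Phi> y = LI (\<lambda>x. \<phi> (x + y) * \<rho> x)" by (simp add: \<Phi>)
  qed
  moreover have "C1 (\<lambda>y. LI (\<lambda>x. \<phi> (x + y) * \<rho> x)) (\<lambda>y. \<integral>x. \<rho> x *\<^sub>R \<phi>' (x + y) \<partial>torus_lebesgue)"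
  proof (rule C1_torus_integral[OF L])
    show "C1 (\<lambda>y. \<phi> (x + y) * \<rho> x) (\<lambda>y. \<rho> x *\<^sub>R \<phi>' (x + y))" for x
      using C1_cmult[OF C1_translate[OF \<phi>(1), of x], of "\<rho> x"] by (simp add: mult.commute add.commute)
  qed (auto simp: case_prod_beta intro!: cc)
  moreover have "(\<integral>x. \<rho> x *\<^sub>R \<phi>' (x + y) \<partial>torus_lebesgue) = (\<integral>x. \<rho> (x - y) *\<^sub>R \<phi>' x \<partial>torus_lebesgue)" for y
  proof -
    have "(\<integral>x. \<rho> ((x + y) - y) *\<^sub>R \<phi>' (x + y) \<partial>torus_lebesgue) = (\<integral>x. \<rho> (x - y) *\<^sub>R \<phi>' x \<partial>torus_lebesgue)"
    proof (rule torus_integral_translate)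
      show "(\<lambda>x. \<rho> (x - y) *\<^sub>R \<phi>' x) \<in> borel_measurable borel"
        by (intro borel_measurable_continuous_onI cc) auto
      show "torus_periodic (\<lambda>x. \<rho> (x - y) *\<^sub>R \<phi>' x)"
        using \<rho>(2) \<phi>'p by (simp add: torus_periodic_def diff_add_eq[symmetric])
    qed
    then show ?thesis by simp
  qed
  ultimately have G: "C1 \<Phi> (\<lambda>y. \<integral>x. \<rho> (x - y) *\<^sub>R \<phi>' x \<partial>torus_lebesgue)" by simp
  then show grad: "gradient \<Phi> = (\<lambda>y. \<integral>x. \<rho> (x - y) *\<^sub>R \<phi>' x \<partial>torus_lebesgue)" by (rule C1_gradient)
  have int1: "integrable torus_lebesgue (\<lambda>x. \<rho> (x - y) *\<^sub>R \<phi>' x)" for y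
    by (intro torus_lebesgue_integrable cc) auto
  have second: "pderivative b (pderivative b \<Phi>) y = LI (\<lambda>x. - ((\<phi>' x \<bullet> b) * (\<rho>' (x - y) \<bullet> b)))" for b y
  proof -
    have "pderivative b \<Phi> = (\<lambda>y. LI (\<lambda>x. (\<phi>' x \<bullet> b) * \<rho> (x - y)))"
    proof
      fix y
      have "pderivative b \<Phi> y = (\<integral>x. \<rho> (x - y) *\<^sub>R \<phi>' x \<partial>torus_lebesgue) \<bullet> b"
        by (rule pderivative_eq[OF C1_has_derivative[OF G]])
      also have "\<dots> = LI (\<lambda>x. (\<rho> (x - y) *\<^sub>R \<phi>' x) \<bullet> b)"
        by (rule integral_inner_left[symmetric]) (rule int1)
      finally show "pderivative b \<Phi> y = LI (\<lambda>x. (\<phi>' x \<bullet> b) * \<rho> (x - y))" by (simp add: mult.commute)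
    qed
    moreover have C: "C1 (\<lambda>y. LI (\<lambda>x. (\<phi>' x \<bullet> b) * \<rho> (x - y)))
        (\<lambda>y. \<integral>x. (\<phi>' x \<bullet> b) *\<^sub>R (- \<rho>' (x - y)) \<partial>torus_lebesgue)"
    proof (rule C1_torus_integral[OF L])
      show "C1 (\<lambda>y. (\<phi>' x \<bullet> b) * \<rho> (x - y)) (\<lambda>y. (\<phi>' x \<bullet> b) *\<^sub>R (- \<rho>' (x - y)))" for x
        by (rule C1_cmult[OF C1_reflect[OF \<rho>(1)]])
    qed (auto simp: case_prod_beta intro!: cc)
    ultimately have "pderivative b (pderivative b \<Phi>) y = (\<integral>x. (\<phi>' x \<bullet> b) *\<^sub>R (- \<rho>' (x - y)) \<partial>torus_lebesgue) \<bullet> b"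
      using pderivative_eq[OF C1_has_derivative[OF C]] by simp
    also have "\<dots> = LI (\<lambda>x. ((\<phi>' x \<bullet> b) *\<^sub>R (- \<rho>' (x - y))) \<bullet> b)"
      by (rule integral_inner_left[symmetric]) (intro torus_lebesgue_integrable cc, auto)
    finally show ?thesis by simp
  qed
  show "laplacian \<Phi> = (\<lambda>y. - LI (\<lambda>x. \<phi>' x \<bullet> \<rho>' (x - y)))"
  proof
    fix y
    have "laplacian \<Phi> y = (\<Sum>b\<in>Basis. LI (\<lambda>x. - ((\<phi>' x \<bullet> b) * (\<rho>' (x - y) \<bullet> b))))"
      by (simp only: laplacian_def second)
    also have "\<dots> = LI (\<lambda>x. \<Sum>b\<in>Basis. - ((\<phi>' x \<bullet> b) * (\<rho>' (x - y) \<bullet> b)))"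
      by (rule Bochner_Integration.integral_sum[symmetric]) (intro torus_lebesgue_integrable cc, auto)
    also have "\<dots> = LI (\<lambda>x. - (\<phi>' x \<bullet> \<rho>' (x - y)))"
    proof (intro Bochner_Integration.integral_cong refl)
      fix x
      show "(\<Sum>b\<in>Basis. - ((\<phi>' x \<bullet> b) * (\<rho>' (x - y) \<bullet> b))) = - (\<phi>' x \<bullet> \<rho>' (x - y))"
        using euclidean_inner[of "\<phi>' x" "\<rho>' (x - y)"] by (simp only: sum_negf)
    qed
    finally show "laplacian \<Phi> y = - LI (\<lambda>x. \<phi>' x \<bullet> \<rho>' (x - y))" by simp
  qed
qed

text \<open>Fubini moves the kernel from the test function to the measure, and the weak form becomes
  the pairing of \<open>\<phi>'\<close> with a continuous flux. The drift part of this flux is the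
  mollification of drift times measure, not the drift times the mollified density: the commutator
  arises here.\<close>

lemma mollified_weak_rate:
  fixes \<phi> :: "'a::euclidean_space \<Rightarrow> real"
  assumes \<mu>: "torus_prob_measure \<mu>" and \<rho>: "C1 \<rho> \<rho>'" "torus_periodic \<rho>" and \<phi>: "C1 \<phi> \<phi>'" "torus_periodic \<phi>"
    and \<Phi>: "\<Phi> = (\<lambda>y. LI (\<lambda>x. \<phi> x * \<rho> (x - y)))" and D: "continuous_on UNIV D"
  shows "- (\<integral>y. gradient \<Phi> y \<bullet> D y \<partial>\<mu>) + \<tau> * (\<integral>y. laplacian \<Phi> y \<partial>\<mu>)
    = - LI (\<lambda>x. \<phi>' x \<bullet> ((\<integral>y. \<rho> (x - y) *\<^sub>R D y \<partial>\<mu>) + \<tau> *\<^sub>R mollify \<rho>' \<mu> x))"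
proof -
  note c = C1_continuous[OF \<rho>(1)] C1_grad_continuous[OF \<rho>(1)] C1_continuous[OF \<phi>(1)] C1_grad_continuous[OF \<phi>(1)]
  note L = torus_prob_measure_lebesgue
  note cc = continuous_intros continuous_on_compose2[OF c(1)] continuous_on_compose2[OF c(2)]
    continuous_on_compose2[OF c(3)] continuous_on_compose2[OF c(4)] continuous_on_compose2[OF D]
  have wc: "continuous_on UNIV (\<lambda>x. \<integral>y. \<rho> (x - y) *\<^sub>R D y \<partial>\<mu>)"
    by (rule continuous_torus_integral[OF \<mu>]) (auto simp: case_prod_beta intro!: cc)
  have mc: "continuous_on UNIV (mollify \<rho>' \<mu>)" by (rule continuous_mollify[OF \<mu> c(2)])
  have "(\<integral>y. gradient \<Phi> y \<bullet> D y \<partial>\<mu>) = (\<integral>y. LI (\<lambda>x. \<rho> (x - y) * (\<phi>' x \<bullet> D y)) \<partial>\<mu>)"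
  proof (intro Bochner_Integration.integral_cong refl)
    fix y
    have "(\<integral>x. \<rho> (x - y) *\<^sub>R \<phi>' x \<partial>torus_lebesgue) \<bullet> D y = LI (\<lambda>x. (\<rho> (x - y) *\<^sub>R \<phi>' x) \<bullet> D y)"
      by (rule integral_inner_left[symmetric]) (intro torus_lebesgue_integrable cc, auto)
    then show "gradient \<Phi> y \<bullet> D y = LI (\<lambda>x. \<rho> (x - y) * (\<phi>' x \<bullet> D y))"
      unfolding mollified_test_function(1)[OF \<rho> \<phi> \<Phi>] by simp
  qed
  also have "\<dots> = LI (\<lambda>x. \<integral>y. \<rho> (x - y) * (\<phi>' x \<bullet> D y) \<partial>\<mu>)"
    by (rule torus_Fubini[OF \<mu> L, symmetric]) (auto simp: case_prod_beta intro!: cc)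
  also have "\<dots> = LI (\<lambda>x. \<phi>' x \<bullet> (\<integral>y. \<rho> (x - y) *\<^sub>R D y \<partial>\<mu>))"
  proof (intro Bochner_Integration.integral_cong refl)
    fix x
    have "\<phi>' x \<bullet> (\<integral>y. \<rho> (x - y) *\<^sub>R D y \<partial>\<mu>) = (\<integral>y. \<phi>' x \<bullet> (\<rho> (x - y) *\<^sub>R D y) \<partial>\<mu>)"
      by (rule integral_inner_right[symmetric]) (intro torus_integrable_continuous[OF \<mu>] cc, auto)
    then show "(\<integral>y. \<rho> (x - y) * (\<phi>' x \<bullet> D y) \<partial>\<mu>) = \<phi>' x \<bullet> (\<integral>y. \<rho> (x - y) *\<^sub>R D y \<partial>\<mu>)" by simp
  qed
  finally have 1: "(\<integral>y. gradient \<Phi> y \<bullet> D y \<partial>\<mu>) = LI (\<lambda>x. \<phi>' x \<bullet> (\<integral>y. \<rho> (x - y) *\<^sub>R D y \<partial>\<mu>))" .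
  have "(\<integral>y. laplacian \<Phi> y \<partial>\<mu>) = - (\<integral>y. LI (\<lambda>x. \<phi>' x \<bullet> \<rho>' (x - y)) \<partial>\<mu>)"
    unfolding mollified_test_function(2)[OF \<rho> \<phi> \<Phi>] by simp
  also have "(\<integral>y. LI (\<lambda>x. \<phi>' x \<bullet> \<rho>' (x - y)) \<partial>\<mu>) = LI (\<lambda>x. \<integral>y. \<phi>' x \<bullet> \<rho>' (x - y) \<partial>\<mu>)"
    by (rule torus_Fubini[OF \<mu> L, symmetric]) (auto simp: case_prod_beta intro!: cc)
  also have "\<dots> = LI (\<lambda>x. \<phi>' x \<bullet> mollify \<rho>' \<mu> x)"
  proof (intro Bochner_Integration.integral_cong refl)
    fix x
    have "\<phi>' x \<bullet> (\<integral>y. \<rho>' (x - y) \<partial>\<mu>) = (\<integral>y. \<phi>' x \<bullet> \<rho>' (x - y) \<partial>\<mu>)"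
      by (rule integral_inner_right[symmetric]) (intro torus_integrable_continuous[OF \<mu>] cc, auto)
    then show "(\<integral>y. \<phi>' x \<bullet> \<rho>' (x - y) \<partial>\<mu>) = \<phi>' x \<bullet> mollify \<rho>' \<mu> x" by (simp add: mollify_def)
  qed
  finally have 2: "(\<integral>y. laplacian \<Phi> y \<partial>\<mu>) = - LI (\<lambda>x. \<phi>' x \<bullet> mollify \<rho>' \<mu> x)" .
  have "LI (\<lambda>x. \<phi>' x \<bullet> ((\<integral>y. \<rho> (x - y) *\<^sub>R D y \<partial>\<mu>) + \<tau> *\<^sub>R mollify \<rho>' \<mu> x))
      = LI (\<lambda>x. \<phi>' x \<bullet> (\<integral>y. \<rho> (x - y) *\<^sub>R D y \<partial>\<mu>) + \<tau> * (\<phi>' x \<bullet> mollify \<rho>' \<mu> x))"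
    by (simp add: inner_add_right)
  also have "\<dots> = LI (\<lambda>x. \<phi>' x \<bullet> (\<integral>y. \<rho> (x - y) *\<^sub>R D y \<partial>\<mu>)) + LI (\<lambda>x. \<tau> * (\<phi>' x \<bullet> mollify \<rho>' \<mu> x))"
    by (intro Bochner_Integration.integral_add torus_lebesgue_integrable continuous_intros wc mc c)
  finally show ?thesis by (simp add: 1 2)
qed

section \<open>The mollified dynamics\<close>

lemma C1_inverse:
  assumes f: "C1 f f'" and nz: "\<And>x. f x \<noteq> 0"
  shows "C1 (\<lambda>x. inverse (f x)) (\<lambda>x. - (inverse (f x) * inverse (f x)) *\<^sub>R f' x)"
proof -
  have "((\<lambda>x. inverse (f x)) has_derivative (\<bullet>) (- (inverse (f x) * inverse (f x)) *\<^sub>R f' x)) (at x)" for x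
    by (rule has_derivative_eq_rhs[OF Deriv.has_derivative_inverse[OF nz C1_has_derivative[OF f]]])
      (auto simp: fun_eq_iff)
  moreover have "continuous_on UNIV (\<lambda>x. - (inverse (f x) * inverse (f x)) *\<^sub>R f' x)"
    using C1_continuous[OF f] C1_grad_continuous[OF f] nz by (intro continuous_intros) auto
  ultimately show ?thesis unfolding C1_def by blast
qed

lemma trig_poly_laplacian_continuous:
  assumes "trig_poly f"
  shows "continuous_on UNIV (laplacian f)"
proof -
  have "C_k (Suc (Suc 0)) f" using trig_poly_C_infinity[OF assms] unfolding C_infinity_def by blast
  then show ?thesis unfolding laplacian_def[abs_def] by (intro continuous_intros) simp
qed

lemma trig_poly_gradient_continuous: "trig_poly f \<Longrightarrow> continuous_on UNIV (gradient f)"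
  by (metis C1_grad_continuous C1_gradient trig_poly_gradient)

lemma gradient_laplacian_sum:
  assumes "\<And>j. j \<in> J \<Longrightarrow> trig_poly (\<beta> j)"
  shows "gradient (\<lambda>y. \<Sum>j\<in>J. a j * \<beta> j y) = (\<lambda>y. \<Sum>j\<in>J. a j *\<^sub>R gradient (\<beta> j) y)"
    and "laplacian (\<lambda>y. \<Sum>j\<in>J. a j * \<beta> j y) = (\<lambda>y. \<Sum>j\<in>J. a j * laplacian (\<beta> j) y)"
proof -
  have "\<exists>g. C1 (\<beta> j) g \<and> (\<forall>b. trig_poly (\<lambda>x. g x \<bullet> b))" if "j \<in> J" for j
    using trig_poly_gradient[OF assms[OF that]] by blast
  then obtain G where G: "\<And>j. j \<in> J \<Longrightarrow> C1 (\<beta> j) (G j)" "\<And>j b. j \<in> J \<Longrightarrow> trig_poly (\<lambda>x. G j x \<bullet> b)"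
    by metis
  have S: "C1 (\<lambda>y. \<Sum>j\<in>J. a j * \<beta> j y) (\<lambda>y. \<Sum>j\<in>J. a j *\<^sub>R G j y)"
    by (intro C1_sum C1_cmult G)
  show "gradient (\<lambda>y. \<Sum>j\<in>J. a j * \<beta> j y) = (\<lambda>y. \<Sum>j\<in>J. a j *\<^sub>R gradient (\<beta> j) y)"
    unfolding C1_gradient[OF S] by (intro ext sum.cong refl) (simp add: C1_gradient[OF G(1)])
  have "pderivative b (pderivative b (\<lambda>y. \<Sum>j\<in>J. a j * \<beta> j y)) y = (\<Sum>j\<in>J. a j * pderivative b (pderivative b (\<beta> j)) y)" for b y
  proof -
    have 1: "pderivative b (\<beta> j) = (\<lambda>y. G j y \<bullet> b)" if "j \<in> J" for j
      by (intro ext pderivative_eq C1_has_derivative G that)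
    have 2: "pderivative b (\<lambda>y. \<Sum>j\<in>J. a j * \<beta> j y) = (\<lambda>y. \<Sum>j\<in>J. a j * (G j y \<bullet> b))"
      using pderivative_eq[OF C1_has_derivative[OF S], of b] by (auto simp: inner_sum_left)
    have "\<exists>h. C1 (\<lambda>y. G j y \<bullet> b) h" if "j \<in> J" for j
      using trig_poly_gradient[OF G(2)[OF that]] by blast
    then obtain H where H: "\<And>j. j \<in> J \<Longrightarrow> C1 (\<lambda>y. G j y \<bullet> b) (H j)" by metis
    have S2: "C1 (\<lambda>y. \<Sum>j\<in>J. a j * (G j y \<bullet> b)) (\<lambda>y. \<Sum>j\<in>J. a j *\<^sub>R H j y)"
      by (intro C1_sum C1_cmult H)
    have "pderivative b (pderivative b (\<lambda>y. \<Sum>j\<in>J. a j * \<beta> j y)) y = (\<Sum>j\<in>J. a j *\<^sub>R H j y) \<bullet> b"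
      unfolding 2 by (rule pderivative_eq[OF C1_has_derivative[OF S2]])
    also have "\<dots> = (\<Sum>j\<in>J. a j * pderivative b (pderivative b (\<beta> j)) y)"
      unfolding inner_sum_left
      by (intro sum.cong refl) (simp add: 1 pderivative_eq[OF C1_has_derivative[OF H]])
    finally show ?thesis .
  qed
  then show "laplacian (\<lambda>y. \<Sum>j\<in>J. a j * \<beta> j y) = (\<lambda>y. \<Sum>j\<in>J. a j * laplacian (\<beta> j) y)"
    unfolding laplacian_def by (auto simp: sum_distrib_left intro: sum.swap)
qed

text \<open>One player against the other: the maximizing player is the instance with
  \<open>\<lambda>y x. - k x y\<close> and exchanged roles. \<open>k_mixed\<close> is the integrated
  form of the bound on the mixed derivative, \<open>n_grad\<close> is the Gibbs relation after
  differentiation, and \<open>flow\<close> has the gradient of the mean-field potential already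
  written as an integral of \<open>kx\<close>.\<close>

locale torus_side =
  fixes \<tau> c M :: real
    and k :: "'a::euclidean_space \<Rightarrow> 'b::euclidean_space \<Rightarrow> real" and kx :: "'a \<Rightarrow> 'b \<Rightarrow> 'a" and ky :: "'a \<Rightarrow> 'b \<Rightarrow> 'b"
    and n :: "'a \<Rightarrow> real" and n' :: "'a \<Rightarrow> 'a" and m :: "'b \<Rightarrow> real"
    and \<mu> :: "real \<Rightarrow> 'a measure" and \<kappa> :: "real \<Rightarrow> 'b measure"
  assumes tau: "0 < \<tau>" and M: "0 \<le> M"
    and k_cont: "continuous_on UNIV (\<lambda>(x, y). k x y)" and kx_cont: "continuous_on UNIV (\<lambda>(x, y). kx x y)"
    and k_C1x: "\<And>y. C1 (\<lambda>x. k x y) (\<lambda>x. kx x y)" and k_C1y: "\<And>x. C1 (k x) (ky x)"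
    and k_perx: "\<And>y. torus_periodic (\<lambda>x. k x y)" and k_pery: "\<And>x. torus_periodic (k x)"
    and k_mixed: "\<And>x x' y y'. \<bar>k x' y' - k x y' - k x' y + k x y\<bar> \<le> M * norm (x' - x) * norm (y' - y)"
    and n_dens: "prob_density n" and m_dens: "prob_density m" and n_C1: "C1 n n'"
    and n_grad: "\<And>x. n' x = - (n x / \<tau>) *\<^sub>R (\<integral>y. m y *\<^sub>R kx x y \<partial>torus_lebesgue)"
    and n_poincare: "weighted_poincare n c" and m_poincare: "weighted_poincare m c"
    and mu: "\<And>t. 0 \<le> t \<Longrightarrow> torus_prob_measure (\<mu> t)" and kappa: "\<And>t. 0 \<le> t \<Longrightarrow> torus_prob_measure (\<kappa> t)"
    and flow: "\<And>\<phi> t. trig_poly \<phi> \<Longrightarrow> 0 \<le> t \<Longrightarrow>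
      ((\<lambda>s. - (\<integral>x. gradient \<phi> x \<bullet> (\<integral>y. kx x y \<partial>\<kappa> s) \<partial>\<mu> s) + \<tau> * (\<integral>x. laplacian \<phi> x \<partial>\<mu> s))
        has_integral ((\<integral>x. \<phi> x \<partial>\<mu> t) - (\<integral>x. \<phi> x \<partial>\<mu> 0))) {0..t}"
begin

definition D :: "real \<Rightarrow> 'a \<Rightarrow> 'a" where "D s x = (\<integral>y. kx x y \<partial>\<kappa> s)"

definition R :: "('a \<Rightarrow> real) \<Rightarrow> real \<Rightarrow> real" where
  "R \<phi> s = - (\<integral>x. gradient \<phi> x \<bullet> D s x \<partial>\<mu> s) + \<tau> * (\<integral>x. laplacian \<phi> x \<partial>\<mu> s)"

lemma n_pos: "0 < n x" and n_cont: "continuous_on UNIV n" and m_pos: "0 < m y" and m_cont: "continuous_on UNIV m"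
  using n_dens m_dens by (auto simp: prob_density_def)

lemma D_continuous: "0 \<le> s \<Longrightarrow> continuous_on UNIV (D s)"
  unfolding D_def[abs_def] by (rule continuous_torus_integral[OF kappa kx_cont])

lemma R_sum:
  assumes \<beta>: "\<And>j. j \<in> J \<Longrightarrow> trig_poly (\<beta> j)" and s: "0 \<le> s"
  shows "R (\<lambda>y. \<Sum>j\<in>J. a j * \<beta> j y) s = (\<Sum>j\<in>J. a j * R (\<beta> j) s)"
proof -
  note I = torus_integrable_continuous[OF mu[OF s]]
  note [continuous_intros] = D_continuous[OF s]
  have 1: "(\<integral>x. (\<Sum>j\<in>J. a j *\<^sub>R gradient (\<beta> j) x) \<bullet> D s x \<partial>\<mu> s) = (\<Sum>j\<in>J. a j * (\<integral>x. gradient (\<beta> j) x \<bullet> D s x \<partial>\<mu> s))"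
  proof -
    have "(\<integral>x. (\<Sum>j\<in>J. a j *\<^sub>R gradient (\<beta> j) x) \<bullet> D s x \<partial>\<mu> s) = (\<integral>x. (\<Sum>j\<in>J. a j * (gradient (\<beta> j) x \<bullet> D s x)) \<partial>\<mu> s)"
      by (simp add: inner_sum_left)
    also have "\<dots> = (\<Sum>j\<in>J. \<integral>x. a j * (gradient (\<beta> j) x \<bullet> D s x) \<partial>\<mu> s)"
      by (intro Bochner_Integration.integral_sum I continuous_intros trig_poly_gradient_continuous \<beta>)
    finally show ?thesis by simp
  qed
  have 2: "(\<integral>x. (\<Sum>j\<in>J. a j * laplacian (\<beta> j) x) \<partial>\<mu> s) = (\<Sum>j\<in>J. a j * (\<integral>x. laplacian (\<beta> j) x \<partial>\<mu> s))"
  proof -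
    have "(\<integral>x. (\<Sum>j\<in>J. a j * laplacian (\<beta> j) x) \<partial>\<mu> s) = (\<Sum>j\<in>J. \<integral>x. a j * laplacian (\<beta> j) x \<partial>\<mu> s)"
      by (intro Bochner_Integration.integral_sum I continuous_intros trig_poly_laplacian_continuous \<beta>)
    then show ?thesis by simp
  qed
  have grad: "gradient (\<lambda>y. \<Sum>j\<in>J. a j * \<beta> j y) = (\<lambda>y. \<Sum>j\<in>J. a j *\<^sub>R gradient (\<beta> j) y)"
    by (rule gradient_laplacian_sum(1)) (rule \<beta>)
  have lap: "laplacian (\<lambda>y. \<Sum>j\<in>J. a j * \<beta> j y) = (\<lambda>y. \<Sum>j\<in>J. a j * laplacian (\<beta> j) y)"
    by (rule gradient_laplacian_sum(2)) (rule \<beta>)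
  show ?thesis
    unfolding R_def grad lap 1 2
    by (simp add: right_diff_distrib sum_subtractf sum_distrib_left mult_ac)
qed

lemma trig_rate:
  assumes \<phi>: "trig_poly \<phi>"
  shows "has_rate (\<lambda>t. \<integral>x. \<phi> x \<partial>\<mu> t) (R \<phi>)"
proof -
  obtain B0 where B0: "0 < B0" "\<And>x. x \<in> torus_cell \<Longrightarrow> norm (\<phi> x) \<le> B0"
    using continuous_bounded_on_cell[OF trig_poly_continuous[OF \<phi>]] by blast
  obtain B1 where B1: "0 < B1" "\<And>x. x \<in> torus_cell \<Longrightarrow> norm (gradient \<phi> x) \<le> B1"
    using continuous_bounded_on_cell[OF trig_poly_gradient_continuous[OF \<phi>]] by blast
  obtain B2 where B2: "0 < B2" "\<And>x. x \<in> torus_cell \<Longrightarrow> norm (laplacian \<phi> x) \<le> B2"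
    using continuous_bounded_on_cell[OF trig_poly_laplacian_continuous[OF \<phi>]] by blast
  have "compact ((\<lambda>(x, y). kx x y) ` (cbox 0 One \<times> cbox 0 One))"
    by (intro compact_continuous_image continuous_on_subset[OF kx_cont] compact_Times) auto
  then have "bounded ((\<lambda>(x, y). kx x y) ` (cbox 0 One \<times> cbox 0 One))"
    by (rule compact_imp_bounded)
  then obtain K where K: "0 < K" "\<And>x y. x \<in> cbox 0 One \<Longrightarrow> y \<in> cbox 0 One \<Longrightarrow> norm (kx x y) \<le> K"
    unfolding bounded_pos by fastforce
  have Db: "norm (D s x) \<le> K" if "0 \<le> s" "x \<in> torus_cell" for s x
    unfolding D_def
  proof (rule torus_integral_norm_bound[OF kappa[OF that(1)]])
    fix y :: 'b assume "y \<in> torus_cell"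
    then show "norm (kx x y) \<le> K"
      by (intro K(2) subsetD[OF torus_cell_subset_cbox] that(2))
  qed (use K in simp)
  have f: "\<bar>\<integral>x. \<phi> x \<partial>\<mu> s\<bar> \<le> B0" if "0 \<le> s" for s
    using torus_integral_norm_bound[OF mu[OF that], of \<phi> B0] B0 by simp
  have r: "\<bar>R \<phi> s\<bar> \<le> B1 * K + \<tau> * B2" if s: "0 \<le> s" for s
  proof -
    have "\<bar>\<integral>x. gradient \<phi> x \<bullet> D s x \<partial>\<mu> s\<bar> \<le> B1 * K"
    proof -
      have "norm (\<integral>x. gradient \<phi> x \<bullet> D s x \<partial>\<mu> s) \<le> B1 * K"
      proof (rule torus_integral_norm_bound[OF mu[OF s]])
        fix x :: 'a assume x: "x \<in> torus_cell"
        have "\<bar>gradient \<phi> x \<bullet> D s x\<bar> \<le> norm (gradient \<phi> x) * norm (D s x)" by (rule Cauchy_Schwarz_ineq2)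
        also have "\<dots> \<le> B1 * K" using B1 K Db[OF s x] x by (intro mult_mono) auto
        finally show "norm (gradient \<phi> x \<bullet> D s x) \<le> B1 * K" by simp
      qed (use B1 K in simp)
      then show ?thesis by simp
    qed
    moreover have "\<bar>\<tau> * (\<integral>x. laplacian \<phi> x \<partial>\<mu> s)\<bar> \<le> \<tau> * B2"
      using torus_integral_norm_bound[OF mu[OF s], of "laplacian \<phi>" B2] B2 tau by (simp add: abs_mult)
    ultimately show ?thesis unfolding R_def by linarith
  qed
  have "\<exists>B. \<forall>s\<ge>0. \<bar>\<integral>x. \<phi> x \<partial>\<mu> s\<bar> \<le> B \<and> \<bar>R \<phi> s\<bar> \<le> B"
  proof (intro exI allI impI conjI)
    fix s :: real assume "0 \<le> s"
    then show "\<bar>\<integral>x. \<phi> x \<partial>\<mu> s\<bar> \<le> max B0 (B1 * K + \<tau> * B2)" "\<bar>R \<phi> s\<bar> \<le> max B0 (B1 * K + \<tau> * B2)"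
      using f r by (simp_all add: le_max_iff_disj)
  qed
  moreover have "(R \<phi> has_integral ((\<integral>x. \<phi> x \<partial>\<mu> t) - (\<integral>x. \<phi> x \<partial>\<mu> 0))) {0..t}" if "0 \<le> t" for t
    using flow[OF \<phi> that] unfolding R_def[abs_def] D_def .
  ultimately show ?thesis unfolding has_rate_def by blast
qed

end

text \<open>\<open>close\<close> collects two commutator errors: the average of a product in place
  of a product of averages, and the opponent in place of its mollification. The bound contains
  \<open>1 + mollify \<rho> (\<mu> s) x\<close> since the near part of the kernel contributes its
  own mass times the oscillation of the drift.\<close>

locale mollified_side = torus_side \<tau> c M k kx ky n n' m \<mu> \<kappa>
  for \<tau> c M :: real
    and k :: "'a::euclidean_space \<Rightarrow> 'b::euclidean_space \<Rightarrow> real" and kx :: "'a \<Rightarrow> 'b \<Rightarrow> 'a" and ky :: "'a \<Rightarrow> 'b \<Rightarrow> 'b"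
    and n :: "'a \<Rightarrow> real" and n' :: "'a \<Rightarrow> 'a" and m :: "'b \<Rightarrow> real"
    and \<mu> :: "real \<Rightarrow> 'a measure" and \<kappa> :: "real \<Rightarrow> 'b measure" +
  fixes \<rho> :: "'a \<Rightarrow> real" and \<rho>' :: "'a \<Rightarrow> 'a" and \<sigma> :: "'b \<Rightarrow> real" and \<eta> :: real
  assumes rho: "trig_poly \<rho>" "\<And>z. 0 \<le> \<rho> z" "LI \<rho> = 1" and rho': "C1 \<rho> \<rho>'"
    and sigma: "trig_poly \<sigma>" "\<And>z. 0 \<le> \<sigma> z" "LI \<sigma> = 1" and eta: "0 \<le> \<eta>"
    and close: "\<And>s x. 0 \<le> s \<Longrightarrow>
      norm ((\<integral>y. \<rho> (x - y) *\<^sub>R D s y \<partial>\<mu> s) - mollify \<rho> (\<mu> s) x *\<^sub>R (\<integral>y. mollify \<sigma> (\<kappa> s) y *\<^sub>R kx x y \<partial>torus_lebesgue))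
        \<le> \<eta> * (1 + mollify \<rho> (\<mu> s) x)"
begin

text \<open>Of the following, \<open>p\<close> and \<open>q\<close> are the mollified densities and
  \<open>f\<close>, \<open>g\<close> their relative deviations from equilibrium. \<open>W\<close> is
  the flux in \<open>dp/dt = div W\<close>, \<open>Kg\<close> is the potential created by the
  opponent's deviation, and \<open>b\<close> is its gradient.\<close>

definition p :: "real \<Rightarrow> 'a \<Rightarrow> real" where "p s = mollify \<rho> (\<mu> s)"
definition q :: "real \<Rightarrow> 'b \<Rightarrow> real" where "q s = mollify \<sigma> (\<kappa> s)"
definition f :: "real \<Rightarrow> 'a \<Rightarrow> real" where "f s x = p s x * inverse (n x) - 1"
definition g :: "real \<Rightarrow> 'b \<Rightarrow> real" where "g s y = q s y * inverse (m y) - 1"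
definition w :: "real \<Rightarrow> 'a \<Rightarrow> 'a" where "w s x = (\<integral>y. \<rho> (x - y) *\<^sub>R D s y \<partial>\<mu> s)"
definition W :: "real \<Rightarrow> 'a \<Rightarrow> 'a" where "W s x = w s x + \<tau> *\<^sub>R mollify \<rho>' (\<mu> s) x"
definition b :: "real \<Rightarrow> 'a \<Rightarrow> 'a" where "b s x = (\<integral>y. (g s y * m y) *\<^sub>R kx x y \<partial>torus_lebesgue)"
definition Kg :: "real \<Rightarrow> 'a \<Rightarrow> real" where "Kg s x = LI (\<lambda>y. k x y * (g s y * m y))"

lemma inv_n: "C1 (\<lambda>x. inverse (n x)) (\<lambda>x. - (inverse (n x) * inverse (n x)) *\<^sub>R n' x)"
  by (rule C1_inverse[OF n_C1]) (use n_pos in \<open>metis less_irrefl\<close>)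

context
  fixes s :: real assumes s: "0 \<le> s"
begin

lemma p_C1: "C1 (p s) (mollify \<rho>' (\<mu> s))"
  unfolding p_def by (rule C1_mollify[OF mu[OF s] rho'])

lemma p_periodic: "torus_periodic (p s)"
  unfolding p_def by (rule mollify_periodic[OF trig_poly_periodic[OF rho(1)]])

lemma p_nonneg: "0 \<le> p s x"
  unfolding p_def by (rule mollify_nonneg[OF rho(2)])

lemma p_integral: "LI (p s) = 1"
  unfolding p_def using LI_mollify[OF mu[OF s] trig_poly_continuous trig_poly_periodic] rho by metis

lemma q_continuous: "continuous_on UNIV (q s)"
  unfolding q_def by (rule continuous_mollify[OF kappa[OF s] trig_poly_continuous[OF sigma(1)]])

lemma q_integral: "LI (q s) = 1"
  unfolding q_def using LI_mollify[OF kappa[OF s] trig_poly_continuous trig_poly_periodic] sigma by metis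

lemma p_f: "p s x = n x * (1 + f s x)"
  using n_pos[of x] by (simp add: f_def)

lemma q_g: "g s y * m y = q s y - m y"
  using m_pos[of y] by (simp add: g_def left_diff_distrib)

lemma f_C1: "C1 (f s) (gradient (f s))"
proof -
  have "C1 (\<lambda>x. p s x * inverse (n x) - 1)
     (\<lambda>x. (inverse (n x) *\<^sub>R mollify \<rho>' (\<mu> s) x + p s x *\<^sub>R (- (inverse (n x) * inverse (n x)) *\<^sub>R n' x)) - 0)"
    by (intro C1_diff C1_mult C1_const p_C1 inv_n)
  then have X: "C1 (f s) (\<lambda>x. inverse (n x) *\<^sub>R mollify \<rho>' (\<mu> s) x + p s x *\<^sub>R (- (inverse (n x) * inverse (n x)) *\<^sub>R n' x) - 0)"
    by (simp only: f_def[abs_def])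
  then show ?thesis using C1_gradient[OF X] by simp
qed

lemma f_periodic: "torus_periodic (f s)"
  using p_periodic prob_densityD(5)[OF n_dens] by (simp add: f_def torus_periodic_def)

lemma g_continuous: "continuous_on UNIV (g s)"
proof -
  have "m y \<noteq> 0" for y using m_pos[of y] by simp
  then show ?thesis
    unfolding g_def[abs_def] by (intro continuous_intros q_continuous m_cont) simp
qed

lemma f_mean: "LI (\<lambda>x. f s x * n x) = 0"
proof -
  have "f s x * n x = p s x - n x" for x using n_pos[of x] by (simp add: f_def left_diff_distrib)
  then have "LI (\<lambda>x. f s x * n x) = LI (\<lambda>x. p s x - n x)" by simp
  also have "\<dots> = LI (p s) - LI n"
    by (intro Bochner_Integration.integral_diff torus_lebesgue_integrable C1_continuous[OF p_C1] n_cont)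
  finally show ?thesis by (simp add: p_integral prob_densityD(4)[OF n_dens])
qed

lemma g_mean: "LI (\<lambda>y. g s y * m y) = 0"
proof -
  have "LI (\<lambda>y. g s y * m y) = LI (q s) - LI m"
    unfolding q_g by (intro Bochner_Integration.integral_diff torus_lebesgue_integrable q_continuous m_cont)
  then show ?thesis by (simp add: q_integral prob_densityD(4)[OF m_dens])
qed

lemma Kh_C1:
  assumes h: "continuous_on UNIV h"
  shows "C1 (\<lambda>x. LI (\<lambda>y. k x y * h y)) (\<lambda>x. \<integral>y. h y *\<^sub>R kx x y \<partial>torus_lebesgue)"
proof (rule C1_torus_integral[OF torus_prob_measure_lebesgue])
  have "continuous_on UNIV (\<lambda>z. h (snd z))" by (intro continuous_on_compose2[OF h] continuous_intros) auto
  then show "continuous_on UNIV (\<lambda>(x, y). k x y * h y)" "continuous_on UNIV (\<lambda>(x, y). h y *\<^sub>R kx x y)"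
    using k_cont kx_cont unfolding case_prod_beta by (auto intro!: continuous_intros)
  show "C1 (\<lambda>x. k x y * h y) (\<lambda>x. h y *\<^sub>R kx x y)" for y
    using C1_cmult[OF k_C1x, of "h y" y] by (simp only: mult.commute)
qed

lemma Kh_periodic: "torus_periodic (\<lambda>x. LI (\<lambda>y. k x y * h y))"
  using k_perx by (simp add: torus_periodic_def)

lemma Kg_C1: "C1 (Kg s) (b s)"
  unfolding Kg_def[abs_def] b_def[abs_def]
  by (rule Kh_C1) (intro continuous_intros g_continuous m_cont)

lemma b_bound: "norm (b s x) \<le> M / sqrt c * sqrt (LI (\<lambda>y. (g s y)\<^sup>2 * m y))"
proof -
  have "C1 (\<lambda>x. LI (\<lambda>y. k x y * (g s y * m y))) (b s)"
    using Kg_C1 by (simp only: Kg_def[abs_def])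
  from drift_bound[OF m_dens m_poincare k_C1y k_pery k_mixed M g_continuous g_mean this]
  show ?thesis .
qed

lemma w_continuous: "continuous_on UNIV (w s)"
  unfolding w_def[abs_def]
  by (rule continuous_torus_integral[OF mu[OF s]])
    (auto simp: case_prod_beta intro!: continuous_intros continuous_on_compose2[OF trig_poly_continuous[OF rho(1)]]
      continuous_on_compose2[OF D_continuous[OF s]])

lemma W_continuous: "continuous_on UNIV (W s)"
  unfolding W_def[abs_def]
  by (intro continuous_intros w_continuous C1_grad_continuous[OF p_C1])

text \<open>Writing \<open>p = n (1 + f)\<close>, the gradient of \<open>n\<close> in the diffusion
  cancels the transport by the equilibrium drift, by the Gibbs relation. What remains is the
  weighted gradient of \<open>f\<close>, the drift perturbation \<open>b\<close> and the commutator
  error.\<close>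

lemma W_decomposition:
  "W s x = \<tau> *\<^sub>R (n x *\<^sub>R gradient (f s) x) + p s x *\<^sub>R b s x
    + (w s x - p s x *\<^sub>R (\<integral>y. q s y *\<^sub>R kx x y \<partial>torus_lebesgue))"
proof -
  have "C1 (\<lambda>x. n x * (1 + f s x)) (\<lambda>x. (1 + f s x) *\<^sub>R n' x + n x *\<^sub>R (0 + gradient (f s) x))"
    by (intro C1_mult C1_add C1_const n_C1 f_C1)
  moreover have "(\<lambda>x. n x * (1 + f s x)) = p s" using p_f by auto
  ultimately have "C1 (p s) (\<lambda>x. (1 + f s x) *\<^sub>R n' x + n x *\<^sub>R (0 + gradient (f s) x))" by simp
  from C1_unique[OF p_C1 this]
  have p': "mollify \<rho>' (\<mu> s) x = (1 + f s x) *\<^sub>R n' x + n x *\<^sub>R gradient (f s) x" by simp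
  define V where "V = (\<integral>y. m y *\<^sub>R kx x y \<partial>torus_lebesgue)"
  define Dq where "Dq = (\<integral>y. q s y *\<^sub>R kx x y \<partial>torus_lebesgue)"
  have [continuous_intros]: "continuous_on UNIV (kx x)" by (rule continuous_on_slices[OF kx_cont])
  have "b s x = (\<integral>y. q s y *\<^sub>R kx x y - m y *\<^sub>R kx x y \<partial>torus_lebesgue)"
    unfolding b_def q_g by (simp add: scaleR_diff_left)
  also have "\<dots> = Dq - V" unfolding Dq_def V_def
    by (intro Bochner_Integration.integral_diff torus_lebesgue_integrable continuous_intros q_continuous m_cont)
  finally have bV: "b s x = Dq - V" .
  have "\<tau> *\<^sub>R ((1 + f s x) *\<^sub>R n' x) = - (p s x *\<^sub>R V)"
    unfolding n_grad V_def[symmetric] p_f using tau by simp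
  then show ?thesis
    unfolding W_def p' scaleR_add_right bV Dq_def[symmetric] by (simp add: scaleR_diff_right)
qed

end

end

context mollified_side begin

lemma W_test:
  assumes s: "0 \<le> s" and \<phi>: "C1 \<phi> \<phi>'" "torus_periodic \<phi>"
  shows "R (\<lambda>y. LI (\<lambda>x. \<phi> x * \<rho> (x - y))) s = - LI (\<lambda>x. \<phi>' x \<bullet> W s x)"
  unfolding R_def W_def w_def
  by (rule mollified_weak_rate[OF mu[OF s] rho' trig_poly_periodic[OF rho(1)] \<phi> refl D_continuous[OF s]])

lemma rank_sum:
  assumes ab: "\<And>x y. \<rho> (x - y) = (\<Sum>j<N. \<alpha> j x * \<beta> j y)"
    and \<alpha>: "\<And>j. j < N \<Longrightarrow> trig_poly (\<alpha> j)" and \<phi>: "continuous_on UNIV \<phi>"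
  shows "(\<lambda>y. LI (\<lambda>x. \<phi> x * \<rho> (x - y))) = (\<lambda>y. \<Sum>j<N. LI (\<lambda>x. \<phi> x * \<alpha> j x) * \<beta> j y)"
proof
  fix y
  have "LI (\<lambda>x. \<phi> x * \<rho> (x - y)) = LI (\<lambda>x. \<Sum>j<N. \<beta> j y * (\<phi> x * \<alpha> j x))"
    unfolding ab by (simp add: sum_distrib_left mult_ac)
  also have "\<dots> = (\<Sum>j<N. LI (\<lambda>x. \<beta> j y * (\<phi> x * \<alpha> j x)))"
    by (intro Bochner_Integration.integral_sum torus_lebesgue_integrable continuous_intros \<phi> trig_poly_continuous \<alpha>) simp
  finally show "LI (\<lambda>x. \<phi> x * \<rho> (x - y)) = (\<Sum>j<N. LI (\<lambda>x. \<phi> x * \<alpha> j x) * \<beta> j y)"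
    by (simp add: mult.commute)
qed

text \<open>Mollifying a merely \<open>C1\<close> function by a kernel of finite rank gives a
  trigonometric polynomial, hence an admissible test function for the flow.\<close>

lemma test_rate:
  assumes \<phi>: "C1 \<phi> \<phi>'" "torus_periodic \<phi>"
  shows "has_rate (\<lambda>t. LI (\<lambda>x. \<phi> x * p t x)) (\<lambda>s. - LI (\<lambda>x. \<phi>' x \<bullet> W s x))"
proof -
  obtain N :: nat and \<alpha> \<beta> where ab: "\<And>j. j < N \<Longrightarrow> trig_poly (\<alpha> j)" "\<And>j. j < N \<Longrightarrow> trig_poly (\<beta> j)"
    "\<And>x y. \<rho> (x - y) = (\<Sum>j<N. \<alpha> j x * \<beta> j y)"
    using trig_poly_translation_finite_rank[OF rho(1)] by metis
  define \<Phi> where "\<Phi> = (\<lambda>y. LI (\<lambda>x. \<phi> x * \<rho> (x - y)))"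
  have "\<Phi> = (\<lambda>y. \<Sum>j<N. LI (\<lambda>x. \<phi> x * \<alpha> j x) * \<beta> j y)"
    unfolding \<Phi>_def by (rule rank_sum[OF ab(3)]) (auto intro: ab C1_continuous[OF \<phi>(1)])
  then have "trig_poly \<Phi>"
    by (auto intro!: trig_poly_sum trig_poly.mult trig_poly.const ab)
  from trig_rate[OF this] show ?thesis
  proof (rule has_rate_cong)
    fix t :: real assume t: "0 \<le> t"
    show "(\<integral>x. \<Phi> x \<partial>\<mu> t) = LI (\<lambda>x. \<phi> x * p t x)"
      unfolding \<Phi>_def p_def
      by (rule LI_mollify_mult[OF mu[OF t] trig_poly_continuous[OF rho(1)] C1_continuous[OF \<phi>(1)], symmetric])
    show "R \<Phi> t = - LI (\<lambda>x. \<phi>' x \<bullet> W t x)"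
      unfolding \<Phi>_def by (rule W_test[OF t \<phi>])
  qed
qed

lemma p_rank:
  assumes ab: "\<And>x y. \<rho> (x - y) = (\<Sum>j<N. \<alpha> j x * \<beta> j y)"
    and \<beta>: "\<And>j. j < N \<Longrightarrow> trig_poly (\<beta> j)" and t: "0 \<le> t"
  shows "p t x = (\<Sum>j<N. (\<integral>y. \<beta> j y \<partial>\<mu> t) * \<alpha> j x)"
proof -
  have "p t x = (\<integral>y. (\<Sum>j<N. \<alpha> j x * \<beta> j y) \<partial>\<mu> t)" by (simp add: p_def mollify_def ab)
  also have "\<dots> = (\<Sum>j<N. \<integral>y. \<alpha> j x * \<beta> j y \<partial>\<mu> t)"
    by (intro Bochner_Integration.integral_sum torus_integrable_continuous[OF mu[OF t]] continuous_intros
        trig_poly_continuous \<beta>) simp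
  finally show ?thesis by (simp add: mult.commute)
qed

text \<open>With \<open>p\<close> a finite sum of \<open>c j t * \<alpha> j x\<close>, the integral
  of \<open>p^2 / n\<close> is a finite sum of products of \<open>c j\<close> and
  \<open>LI (a j * p)\<close>, to which the product rule applies. This integral is 1 more than the
  squared norm of \<open>f\<close>. The two halves of the product rule agree since the form is
  symmetric, whence the factor 2.\<close>

lemma L2_rate:
  "has_rate (\<lambda>t. LI (\<lambda>x. (f t x)\<^sup>2 * n x)) (\<lambda>s. 2 * (- LI (\<lambda>x. gradient (f s) x \<bullet> W s x)))"
proof -
  obtain N :: nat and \<alpha> \<beta> where ab: "\<And>j. j < N \<Longrightarrow> trig_poly (\<alpha> j)" "\<And>j. j < N \<Longrightarrow> trig_poly (\<beta> j)"
    "\<And>x y. \<rho> (x - y) = (\<Sum>j<N. \<alpha> j x * \<beta> j y)"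
    using trig_poly_translation_finite_rank[OF rho(1)] by metis
  define a where "a = (\<lambda>j x. \<alpha> j x * inverse (n x))"
  define c where "c = (\<lambda>j t. \<integral>y. \<beta> j y \<partial>\<mu> t)"
  note invc = C1_continuous[OF inv_n]
  have a: "C1 (a j) (gradient (a j))" "torus_periodic (a j)" if j: "j < N" for j
  proof -
    obtain g where g: "C1 (\<alpha> j) g" using trig_poly_gradient[OF ab(1)[OF j]] by blast
    have "C1 (a j) (\<lambda>x. inverse (n x) *\<^sub>R g x + \<alpha> j x *\<^sub>R (- (inverse (n x) * inverse (n x)) *\<^sub>R n' x))"
      unfolding a_def by (intro C1_mult g inv_n)
    from C1_gradient[OF this] this show "C1 (a j) (gradient (a j))" by simp
    show "torus_periodic (a j)"
      using trig_poly_periodic[OF ab(1)[OF j]] prob_densityD(5)[OF n_dens]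
      by (simp add: a_def torus_periodic_def)
  qed
  have pn: "p t x * inverse (n x) = (\<Sum>j<N. c j t * a j x)" if "0 \<le> t" for t x
    by (simp add: p_rank[OF ab(3) ab(2) that] c_def a_def sum_distrib_right mult.assoc)
  have fa: "f t = (\<lambda>x. (\<Sum>j<N. c j t * a j x) - 1)" if "0 \<le> t" for t
    by (intro ext) (simp only: f_def pn[OF that])
  have ca: "has_rate (\<lambda>t. c j t * LI (\<lambda>x. a j x * p t x))
      (\<lambda>s. c j s * (- LI (\<lambda>x. gradient (a j) x \<bullet> W s x)) + LI (\<lambda>x. a j x * p s x) * R (\<beta> j) s)" if "j < N" for j
    unfolding c_def by (rule has_rate_mult[OF trig_rate[OF ab(2)[OF that]] test_rate[OF a[OF that]]])
  have "has_rate (\<lambda>t. (\<Sum>j<N. c j t * LI (\<lambda>x. a j x * p t x)) + -1)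
      (\<lambda>s. (\<Sum>j<N. c j s * (- LI (\<lambda>x. gradient (a j) x \<bullet> W s x)) + LI (\<lambda>x. a j x * p s x) * R (\<beta> j) s) + 0)"
    by (intro has_rate_add has_rate_sum has_rate_const ca) simp
  then show ?thesis
  proof (rule has_rate_cong)
    fix t :: real assume t: "0 \<le> t"
    note pc = C1_continuous[OF p_C1[OF t]] and fc = C1_continuous[OF f_C1[OF t]]
    \<comment> \<open>The terms linear in \<open>f\<close> integrate to zero and \<open>n\<close>
      integrates to 1, which accounts for the added constant.\<close>
    have sq: "LI (\<lambda>x. p t x * inverse (n x) * p t x) = LI (\<lambda>x. (f t x)\<^sup>2 * n x) + 1"
    proof -
      have "p t x * inverse (n x) * p t x = (f t x)\<^sup>2 * n x + (2 * (f t x * n x) + n x)" for x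
      proof -
        have "p t x * inverse (n x) = 1 + f t x" by (simp add: f_def)
        then show ?thesis unfolding p_f[OF t] by (simp add: power2_eq_square algebra_simps)
      qed
      then have "LI (\<lambda>x. p t x * inverse (n x) * p t x) = LI (\<lambda>x. (f t x)\<^sup>2 * n x + (2 * (f t x * n x) + n x))" by simp
      also have "\<dots> = LI (\<lambda>x. (f t x)\<^sup>2 * n x) + LI (\<lambda>x. 2 * (f t x * n x) + n x)"
        by (intro Bochner_Integration.integral_add torus_lebesgue_integrable continuous_intros fc n_cont)
      also have "LI (\<lambda>x. 2 * (f t x * n x) + n x) = LI (\<lambda>x. 2 * (f t x * n x)) + LI n"
        by (intro Bochner_Integration.integral_add torus_lebesgue_integrable continuous_intros fc n_cont)
      finally show ?thesis by (simp add: f_mean[OF t] prob_densityD(4)[OF n_dens])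
    qed
    have "(\<Sum>j<N. c j t * LI (\<lambda>x. a j x * p t x)) = (\<Sum>j<N. LI (\<lambda>x. c j t * a j x * p t x))"
      by (simp add: mult.assoc)
    also have "\<dots> = LI (\<lambda>x. \<Sum>j<N. c j t * a j x * p t x)"
      by (intro Bochner_Integration.integral_sum[symmetric] torus_lebesgue_integrable continuous_intros pc
          C1_continuous[OF a(1)]) simp
    also have "\<dots> = LI (\<lambda>x. p t x * inverse (n x) * p t x)" by (simp add: pn[OF t] sum_distrib_right)
    finally show "(\<Sum>j<N. c j t * LI (\<lambda>x. a j x * p t x)) + -1 = LI (\<lambda>x. (f t x)\<^sup>2 * n x)"
      by (simp add: sq)
    define F where "F = (\<lambda>x. \<Sum>j<N. c j t * a j x)"
    have F: "C1 F (\<lambda>x. \<Sum>j<N. c j t *\<^sub>R gradient (a j) x)"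
      unfolding F_def
    proof (rule C1_sum)
      show "C1 (\<lambda>x. c j t * a j x) (\<lambda>x. c j t *\<^sub>R gradient (a j) x)" if "j \<in> {..<N}" for j
        using that by (intro C1_cmult a(1)) simp
    qed
    have Fp: "torus_periodic F" using a(2) by (simp add: F_def torus_periodic_def)
    have "f t = (\<lambda>x. F x - 1)" by (simp add: fa[OF t] F_def)
    then have "C1 (f t) (\<lambda>x. (\<Sum>j<N. c j t *\<^sub>R gradient (a j) x) - 0)"
      by (simp only:) (intro C1_diff C1_const F)
    then have gf: "gradient (f t) = (\<lambda>x. \<Sum>j<N. c j t *\<^sub>R gradient (a j) x)"
      using C1_gradient by fastforce
    have 1: "(\<Sum>j<N. c j t * (- LI (\<lambda>x. gradient (a j) x \<bullet> W t x))) = - LI (\<lambda>x. gradient (f t) x \<bullet> W t x)"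
    proof -
      have "(\<Sum>j<N. c j t * (- LI (\<lambda>x. gradient (a j) x \<bullet> W t x)))
          = - (\<Sum>j<N. LI (\<lambda>x. c j t * (gradient (a j) x \<bullet> W t x)))"
        by (simp add: sum_negf)
      also have "(\<Sum>j<N. LI (\<lambda>x. c j t * (gradient (a j) x \<bullet> W t x))) = LI (\<lambda>x. \<Sum>j<N. c j t * (gradient (a j) x \<bullet> W t x))"
        by (intro Bochner_Integration.integral_sum[symmetric] torus_lebesgue_integrable continuous_intros
            W_continuous[OF t] C1_grad_continuous[OF a(1)]) simp
      finally show ?thesis by (simp add: gf inner_sum_left)
    qed
    \<comment> \<open>The other half of the product rule: the coefficients recombine into one test
      function, the mollification of \<open>F = p / n\<close>, and \<open>W_test\<close> evaluates
      its rate.\<close>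
    have "R (\<lambda>y. \<Sum>j<N. LI (\<lambda>x. F x * \<alpha> j x) * \<beta> j y) t = - LI (\<lambda>x. gradient (f t) x \<bullet> W t x)"
    proof -
      have "(\<lambda>y. LI (\<lambda>x. F x * \<rho> (x - y))) = (\<lambda>y. \<Sum>j<N. LI (\<lambda>x. F x * \<alpha> j x) * \<beta> j y)"
        by (rule rank_sum[OF ab(3)]) (auto intro: ab C1_continuous[OF F])
      then show ?thesis using W_test[OF t F Fp] unfolding gf by simp
    qed
    moreover have "R (\<lambda>y. \<Sum>j<N. LI (\<lambda>x. F x * \<alpha> j x) * \<beta> j y) t = (\<Sum>j<N. LI (\<lambda>x. F x * \<alpha> j x) * R (\<beta> j) t)"
      by (rule R_sum[OF _ t]) (simp add: ab)
    moreover have "F x * \<alpha> j x = a j x * p t x" for j x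
      unfolding F_def pn[OF t, symmetric] by (simp add: a_def mult_ac)
    ultimately have 2: "(\<Sum>j<N. LI (\<lambda>x. a j x * p t x) * R (\<beta> j) t) = - LI (\<lambda>x. gradient (f t) x \<bullet> W t x)" by simp
    show "(\<Sum>j<N. c j t * (- LI (\<lambda>x. gradient (a j) x \<bullet> W t x)) + LI (\<lambda>x. a j x * p t x) * R (\<beta> j) t) + 0
        = 2 * (- LI (\<lambda>x. gradient (f t) x \<bullet> W t x))"
      unfolding sum.distrib 1 2 by simp
  qed
qed

text \<open>What the Lyapunov argument needs from one player: \<open>D\<close> is the weighted
  gradient norm of \<open>f\<close>, \<open>Y\<close> its squared dual norm and \<open>U\<close> the
  root of \<open>Y\<close>. In the rate of \<open>Y\<close> the pairing of \<open>Kg\<close> with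
  \<open>f\<close> is kept as an exact term, since the other player must cancel it.\<close>

lemma side_rates:
  obtains Y y' where
    "has_rate (\<lambda>t. LI (\<lambda>x. (f t x)\<^sup>2 * n x)) (\<lambda>s. 2 * (- LI (\<lambda>x. gradient (f s) x \<bullet> W s x)))"
    "has_rate Y y'"
    "\<And>s. 0 \<le> s \<Longrightarrow> \<exists>D U. 0 \<le> D \<and> 0 \<le> U \<and> U\<^sup>2 = Y s \<and>
      c * LI (\<lambda>x. (f s x)\<^sup>2 * n x) \<le> D\<^sup>2 \<and> c * U\<^sup>2 \<le> LI (\<lambda>x. (f s x)\<^sup>2 * n x) \<and>
      2 * (- LI (\<lambda>x. gradient (f s) x \<bullet> W s x)) \<le> 2 * (- \<tau> * D\<^sup>2
        + M / sqrt c * sqrt (LI (\<lambda>y. (g s y)\<^sup>2 * m y)) * sqrt (1 + LI (\<lambda>x. (f s x)\<^sup>2 * n x)) * D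
        + \<eta> * (sqrt (LI (\<lambda>x. (1 + inverse (n x))\<^sup>2 * n x)) + sqrt (LI (\<lambda>x. (f s x)\<^sup>2 * n x))) * D) \<and>
      y' s \<le> 2 * (- \<tau> * LI (\<lambda>x. (f s x)\<^sup>2 * n x) - LI (\<lambda>x. Kg s x * f s x * n x)
        + M / sqrt c * sqrt (LI (\<lambda>y. (g s y)\<^sup>2 * m y)) * sqrt (LI (\<lambda>x. (f s x)\<^sup>2 * n x)) * U
        + \<eta> * (sqrt (LI (\<lambda>x. (1 + inverse (n x))\<^sup>2 * n x)) + sqrt (LI (\<lambda>x. (f s x)\<^sup>2 * n x))) * U)"
proof -
  obtain N :: nat and \<alpha> \<beta> where ab: "\<And>j. j < N \<Longrightarrow> trig_poly (\<alpha> j)" "\<And>j. j < N \<Longrightarrow> trig_poly (\<beta> j)"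
    "\<And>x y. \<rho> (x - y) = (\<Sum>j<N. \<alpha> j x * \<beta> j y)"
    using trig_poly_translation_finite_rank[OF rho(1)] by metis
  obtain N' :: nat and \<alpha>' \<beta>' where ab': "\<And>j. j < N' \<Longrightarrow> trig_poly (\<alpha>' j)" "\<And>j. j < N' \<Longrightarrow> trig_poly (\<beta>' j)"
    "\<And>x y. \<sigma> (x - y) = (\<Sum>j<N'. \<alpha>' j x * \<beta>' j y)"
    using trig_poly_translation_finite_rank[OF sigma(1)] by metis
  define a where "a = (\<lambda>j x. \<alpha> j x * inverse (n x))"
  define h where "h = (\<lambda>j x. LI (\<lambda>y. k x y * \<alpha>' j y))"
  define v where "v = (\<lambda>x. LI (\<lambda>y. k x y * m y))"
  \<comment> \<open>The functions on which the weak equation for \<open>u\<close> will be used: at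
    all times \<open>f\<close> is a combination of 1 and the \<open>a j\<close>, and
    \<open>Kg\<close> a combination of \<open>v\<close> and the \<open>h j\<close>.\<close>
  define G where "G = insert (\<lambda>x. 1) (insert v (a ` {..<N} \<union> h ` {..<N'}))"
  have a: "C_k 1 (a j) \<and> torus_periodic (a j)" if j: "j < N" for j
  proof
    obtain g where g: "C1 (\<alpha> j) g" using trig_poly_gradient[OF ab(1)[OF j]] by blast
    have "C1 (a j) (\<lambda>x. inverse (n x) *\<^sub>R g x + \<alpha> j x *\<^sub>R (- (inverse (n x) * inverse (n x)) *\<^sub>R n' x))"
      unfolding a_def by (intro C1_mult g inv_n)
    then show "C_k 1 (a j)" by (rule C1_imp_C_k)
    show "torus_periodic (a j)"
      using trig_poly_periodic[OF ab(1)[OF j]] prob_densityD(5)[OF n_dens]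
      by (simp add: a_def torus_periodic_def)
  qed
  have h: "C_k 1 (h j) \<and> torus_periodic (h j)" if "j < N'" for j
    unfolding h_def using C1_imp_C_k[OF Kh_C1[OF order_refl trig_poly_continuous[OF ab'(1)[OF that]]]] Kh_periodic[OF order_refl]
    by blast
  have v: "C_k 1 v \<and> torus_periodic v"
    unfolding v_def using C1_imp_C_k[OF Kh_C1[OF order_refl m_cont]] Kh_periodic[OF order_refl] by blast
  have G: "finite G" "\<And>\<phi>. \<phi> \<in> G \<Longrightarrow> C_k 1 \<phi> \<and> torus_periodic \<phi>"
    using a h v C1_imp_C_k[OF C1_const[of 1]] unfolding G_def by (auto simp: torus_periodic_def)
  obtain Q where Q: "finite Q" "\<And>e. e \<in> Q \<Longrightarrow> C_k 1 e \<and> torus_periodic e"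
    and dual: "\<And>f u. continuous_on UNIV f \<Longrightarrow> LI (\<lambda>x. f x * n x) = 0 \<Longrightarrow>
      u = (\<lambda>x. \<Sum>e\<in>Q. LI (\<lambda>x. e x * f x * n x) * e x) \<Longrightarrow>
      (\<forall>\<phi>\<in>G. LI (\<lambda>x. (gradient u x \<bullet> gradient \<phi> x) * n x) = LI (\<lambda>x. \<phi> x * f x * n x)) \<and>
      LI (\<lambda>x. (norm (gradient u x))\<^sup>2 * n x) = (\<Sum>e\<in>Q. (LI (\<lambda>x. e x * f x * n x))\<^sup>2) \<and>
      LI (\<lambda>x. u x * f x * n x) = (\<Sum>e\<in>Q. (LI (\<lambda>x. e x * f x * n x))\<^sup>2)"
    by (rule dirichlet_dual_basis[OF n_dens n_poincare G]) (blast+)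
  have eC1: "C1 e (gradient e)" "torus_periodic e" if "e \<in> Q" for e
    using Q(2)[OF that] by (auto intro: C_k_imp_C1)
  define l where "l = (\<lambda>e t. LI (\<lambda>x. e x * f t x * n x))"
  have l_rate: "has_rate (l e) (\<lambda>s. - LI (\<lambda>x. gradient e x \<bullet> W s x))" if "e \<in> Q" for e
  proof -
    have "has_rate (\<lambda>t. LI (\<lambda>x. e x * p t x) + - LI (\<lambda>x. e x * n x)) (\<lambda>s. - LI (\<lambda>x. gradient e x \<bullet> W s x) + 0)"
      by (intro has_rate_add test_rate has_rate_const eC1 that)
    then show ?thesis
    proof (rule has_rate_cong)
      fix t :: real assume t: "0 \<le> t"
      have "LI (\<lambda>x. e x * f t x * n x) = LI (\<lambda>x. e x * p t x - e x * n x)"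
        using p_f[OF t] by (simp add: algebra_simps)
      also have "\<dots> = LI (\<lambda>x. e x * p t x) - LI (\<lambda>x. e x * n x)"
        by (intro Bochner_Integration.integral_diff torus_lebesgue_integrable continuous_intros
            C1_continuous[OF p_C1[OF t]] n_cont C1_continuous[OF eC1(1)[OF that]])
      finally show "LI (\<lambda>x. e x * p t x) + - LI (\<lambda>x. e x * n x) = l e t" by (simp add: l_def)
    qed simp
  qed
  define Y where "Y = (\<lambda>t. \<Sum>e\<in>Q. l e t * l e t)"
  define y' where "y' = (\<lambda>s. \<Sum>e\<in>Q. l e s * (- LI (\<lambda>x. gradient e x \<bullet> W s x)) + l e s * (- LI (\<lambda>x. gradient e x \<bullet> W s x)))"
  show ?thesis
  proof (rule that[of Y y'])
    show "has_rate (\<lambda>t. LI (\<lambda>x. (f t x)\<^sup>2 * n x)) (\<lambda>s. 2 * (- LI (\<lambda>x. gradient (f s) x \<bullet> W s x)))"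
      by (rule L2_rate)
    show "has_rate Y y'"
      unfolding Y_def y'_def by (intro has_rate_sum has_rate_mult l_rate)
    fix s :: real assume s: "0 \<le> s"
    note [continuous_intros] = C1_continuous[OF f_C1[OF s]] C1_grad_continuous[OF f_C1[OF s]]
      W_continuous[OF s] n_cont g_continuous[OF s] m_cont
    define F where "F = sqrt (LI (\<lambda>x. (f s x)\<^sup>2 * n x))"
    define D where "D = sqrt (LI (\<lambda>x. (norm (gradient (f s) x))\<^sup>2 * n x))"
    define u where "u = (\<lambda>x. \<Sum>e\<in>Q. l e s * e x)"
    define U where "U = sqrt (Y s)"
    have n0: "0 \<le> n x" for x using n_pos[of x] by simp
    have F2: "F\<^sup>2 = LI (\<lambda>x. (f s x)\<^sup>2 * n x)" and F0: "0 \<le> F" unfolding F_def using n0 by simp_all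
    have D2: "D\<^sup>2 = LI (\<lambda>x. (norm (gradient (f s) x))\<^sup>2 * n x)" and D0: "0 \<le> D" unfolding D_def using n0 by simp_all
    have Y0: "0 \<le> Y s" unfolding Y_def by (intro sum_nonneg) simp
    have U2: "U\<^sup>2 = Y s" and U0: "0 \<le> U" unfolding U_def using Y0 by simp_all
    have cpos: "0 < c" using n_poincare by (simp add: weighted_poincare_def)
    have cFD: "c * F\<^sup>2 \<le> D\<^sup>2"
      unfolding F2 D2 using n_poincare f_C1[OF s] f_periodic[OF s] f_mean[OF s]
      unfolding weighted_poincare_def by blast
    have dual_u: "\<And>\<phi>. \<phi> \<in> G \<Longrightarrow> LI (\<lambda>x. (gradient u x \<bullet> gradient \<phi> x) * n x) = LI (\<lambda>x. \<phi> x * f s x * n x)"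
      "LI (\<lambda>x. (norm (gradient u x))\<^sup>2 * n x) = Y s" "LI (\<lambda>x. u x * f s x * n x) = Y s"
      using dual[OF C1_continuous[OF f_C1[OF s]] f_mean[OF s], of u]
      by (auto simp: u_def l_def Y_def power2_eq_square)
    have uC1': "C1 u (\<lambda>x. \<Sum>e\<in>Q. l e s *\<^sub>R gradient e x)"
      unfolding u_def by (intro C1_sum C1_cmult eC1)
    then have gu: "gradient u = (\<lambda>x. \<Sum>e\<in>Q. l e s *\<^sub>R gradient e x)" by (rule C1_gradient)
    have uC1: "C1 u (gradient u)" using uC1' gu by simp
    have up: "torus_periodic u"
      unfolding torus_periodic_def u_def
      by (intro allI ballI sum.cong refl) (simp add: torus_periodicD[OF eC1(2)])
    note [continuous_intros] = C1_grad_continuous[OF uC1] C1_continuous[OF uC1]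
    \<comment> \<open>Duality tested with \<open>u\<close> itself, whose energy and pairing with
      \<open>f\<close> are both \<open>Y s\<close>, gives \<open>sqrt c * U^2 \<le> U * F\<close>;
      then \<open>U\<close> is divided out.\<close>
    have cUF: "c * U\<^sup>2 \<le> F\<^sup>2"
    proof -
      have "sqrt c * \<bar>Y s\<bar> \<le> sqrt (Y s) * F"
        using weighted_poincare_dual[OF n_dens n_poincare uC1 up C1_continuous[OF f_C1[OF s]] f_mean[OF s]]
        unfolding dual_u F_def .
      then have "U * (sqrt c * U) \<le> U * F" using U2 Y0 unfolding U_def by (simp add: power2_eq_square mult_ac)
      then have "sqrt c * U \<le> F" using U0 F0 by (cases "U = 0") (auto simp: mult_le_cancel_left_pos)
      then have "(sqrt c * U)\<^sup>2 \<le> F\<^sup>2" using U0 cpos by (intro power_mono) auto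
      then show ?thesis using cpos by (simp add: power_mult_distrib)
    qed
    \<comment> \<open>The functions on which \<open>u\<close> satisfies the weak equation. They form
      a linear space, so the generators in \<open>G\<close> suffice for \<open>f s\<close> and
      \<open>Kg s\<close>.\<close>
    define PP where "PP = (\<lambda>\<phi>. \<exists>\<phi>'. C1 \<phi> \<phi>' \<and> LI (\<lambda>x. (gradient u x \<bullet> \<phi>' x) * n x) = LI (\<lambda>x. \<phi> x * f s x * n x))"
    have PP_gen: "PP \<phi>" if "\<phi> \<in> G" for \<phi>
      unfolding PP_def using dual_u(1)[OF that] G(2)[OF that] C_k_imp_C1 by blast
    have PP_add: "PP (\<lambda>x. \<phi> x + \<psi> x)" if PPs: "PP \<phi>" "PP \<psi>" for \<phi> \<psi>
    proof -
      obtain \<phi>' \<psi>' where 1: "C1 \<phi> \<phi>'" "LI (\<lambda>x. (gradient u x \<bullet> \<phi>' x) * n x) = LI (\<lambda>x. \<phi> x * f s x * n x)"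
        and 2: "C1 \<psi> \<psi>'" "LI (\<lambda>x. (gradient u x \<bullet> \<psi>' x) * n x) = LI (\<lambda>x. \<psi> x * f s x * n x)"
        using PPs unfolding PP_def by blast
      note [continuous_intros] = C1_continuous[OF 1(1)] C1_grad_continuous[OF 1(1)] C1_continuous[OF 2(1)] C1_grad_continuous[OF 2(1)]
      have "LI (\<lambda>x. (gradient u x \<bullet> (\<phi>' x + \<psi>' x)) * n x) = LI (\<lambda>x. (\<phi> x + \<psi> x) * f s x * n x)"
        unfolding inner_add_right distrib_right
        by (subst (1 2) Bochner_Integration.integral_add)
          (auto intro!: torus_lebesgue_integrable continuous_intros simp: 1 2)
      then show ?thesis using C1_add[OF 1(1) 2(1)] unfolding PP_def by blast
    qed
    have PP_scale: "PP (\<lambda>x. r * \<phi> x)" if PPs: "PP \<phi>" for \<phi> r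
    proof -
      obtain \<phi>' where 1: "C1 \<phi> \<phi>'" "LI (\<lambda>x. (gradient u x \<bullet> \<phi>' x) * n x) = LI (\<lambda>x. \<phi> x * f s x * n x)"
        using PPs unfolding PP_def by blast
      have "LI (\<lambda>x. (gradient u x \<bullet> (r *\<^sub>R \<phi>' x)) * n x) = LI (\<lambda>x. r * \<phi> x * f s x * n x)"
        using 1(2) by (simp add: mult.assoc)
      then show ?thesis using C1_cmult[OF 1(1)] unfolding PP_def by blast
    qed
    have PP_sum: "PP (\<lambda>x. \<Sum>j\<in>J. r j * \<phi> j x)" if "finite J" "\<And>j. j \<in> J \<Longrightarrow> PP (\<phi> j)" for J :: "nat set" and r \<phi>
      using that
    proof (induction J)
      case empty
      have "PP (\<lambda>x. 0 * 1)" by (intro PP_scale PP_gen) (simp add: G_def)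
      then show ?case by simp
    next
      case (insert j J)
      then have "PP (\<lambda>x. r j * \<phi> j x + (\<Sum>j\<in>J. r j * \<phi> j x))" by (intro PP_add PP_scale) auto
      then show ?case using insert by simp
    qed
    have PPf: "PP (f s)"
    proof -
      have "f s = (\<lambda>x. (\<Sum>j<N. (\<integral>y. \<beta> j y \<partial>\<mu> s) * a j x) + (-1) * 1)"
        by (auto simp: f_def a_def p_rank[OF ab(3) ab(2) s] sum_distrib_right mult.assoc)
      moreover have "PP (\<lambda>x. (\<Sum>j<N. (\<integral>y. \<beta> j y \<partial>\<mu> s) * a j x) + (-1) * 1)"
        by (intro PP_add PP_sum PP_scale PP_gen) (auto simp: G_def)
      ultimately show ?thesis by simp
    qed
    have PPK: "PP (Kg s)"
    proof -
      have q: "q s y = (\<Sum>j<N'. (\<integral>z. \<beta>' j z \<partial>\<kappa> s) * \<alpha>' j y)" for y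
      proof -
        have "q s y = (\<integral>z. (\<Sum>j<N'. \<alpha>' j y * \<beta>' j z) \<partial>\<kappa> s)" by (simp add: q_def mollify_def ab'(3))
        also have "\<dots> = (\<Sum>j<N'. \<integral>z. \<alpha>' j y * \<beta>' j z \<partial>\<kappa> s)"
          by (intro Bochner_Integration.integral_sum torus_integrable_continuous[OF kappa[OF s]] continuous_intros
              trig_poly_continuous ab'(2)) simp
        finally show ?thesis by (simp add: mult.commute)
      qed
      have "Kg s = (\<lambda>x. (\<Sum>j<N'. (\<integral>z. \<beta>' j z \<partial>\<kappa> s) * h j x) + (-1) * v x)"
      proof
        fix x
        have kc: "continuous_on UNIV (k x)" by (rule continuous_on_slices[OF k_cont])
        have "Kg s x = LI (\<lambda>y. (\<Sum>j<N'. (\<integral>z. \<beta>' j z \<partial>\<kappa> s) * (k x y * \<alpha>' j y)) - k x y * m y)"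
          unfolding Kg_def q_g[OF s] q by (simp add: right_diff_distrib sum_distrib_left mult_ac)
        also have "\<dots> = LI (\<lambda>y. \<Sum>j<N'. (\<integral>z. \<beta>' j z \<partial>\<kappa> s) * (k x y * \<alpha>' j y)) - LI (\<lambda>y. k x y * m y)"
          by (intro Bochner_Integration.integral_diff torus_lebesgue_integrable continuous_intros kc
              trig_poly_continuous ab'(1)) simp
        also have "LI (\<lambda>y. \<Sum>j<N'. (\<integral>z. \<beta>' j z \<partial>\<kappa> s) * (k x y * \<alpha>' j y))
            = (\<Sum>j<N'. LI (\<lambda>y. (\<integral>z. \<beta>' j z \<partial>\<kappa> s) * (k x y * \<alpha>' j y)))"
          by (intro Bochner_Integration.integral_sum torus_lebesgue_integrable continuous_intros kc
              trig_poly_continuous ab'(1)) simp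
        finally show "Kg s x = (\<Sum>j<N'. (\<integral>z. \<beta>' j z \<partial>\<kappa> s) * h j x) + (-1) * v x" by (simp add: h_def v_def)
      qed
      moreover have "PP (\<lambda>x. (\<Sum>j<N'. (\<integral>z. \<beta>' j z \<partial>\<kappa> s) * h j x) + (-1) * v x)"
        by (intro PP_add PP_sum PP_scale PP_gen) (auto simp: G_def)
      ultimately show ?thesis by simp
    qed
    \<comment> \<open>In the dual norm the diffusion dissipates the full squared \<open>L^2\<close>
      norm of \<open>f\<close>; with the weight \<open>q^2 c\<close> this pays for the interaction
      in the other norm.\<close>
    have uf: "LI (\<lambda>x. (gradient u x \<bullet> gradient (f s) x) * n x) = F\<^sup>2"
    proof -
      obtain \<phi>' where "C1 (f s) \<phi>'" "LI (\<lambda>x. (gradient u x \<bullet> \<phi>' x) * n x) = LI (\<lambda>x. f s x * f s x * n x)"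
        using PPf unfolding PP_def by blast
      then show ?thesis using C1_gradient unfolding F2 by (metis (no_types, lifting) power2_eq_square Bochner_Integration.integral_cong)
    qed
    \<comment> \<open>The same identity removes both gradients from the drift term and leaves an
      \<open>L^2\<close> pairing in the weight \<open>n\<close>, whose sign change between the
      players can be seen.\<close>
    have uK: "LI (\<lambda>x. (gradient u x \<bullet> b s x) * n x) = LI (\<lambda>x. Kg s x * f s x * n x)"
    proof -
      obtain \<phi>' where "C1 (Kg s) \<phi>'" "LI (\<lambda>x. (gradient u x \<bullet> \<phi>' x) * n x) = LI (\<lambda>x. Kg s x * f s x * n x)"
        using PPK unfolding PP_def by blast
      then show ?thesis using C1_unique[OF Kg_C1[OF s]] by metis
    qed
    define C where "C = sqrt (LI (\<lambda>x. (1 + inverse (n x))\<^sup>2 * n x))"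
    define \<beta>0 where "\<beta>0 = M / sqrt c * sqrt (LI (\<lambda>y. (g s y)\<^sup>2 * m y))"
    have est: "- LI (\<lambda>x. \<phi>' x \<bullet> W s x) \<le> - \<tau> * LI (\<lambda>x. (\<phi>' x \<bullet> gradient (f s) x) * n x)
        + \<beta>0 * sqrt (1 + F\<^sup>2) * sqrt (LI (\<lambda>x. (norm (\<phi>' x))\<^sup>2 * n x)) + \<eta> * (C + F) * sqrt (LI (\<lambda>x. (norm (\<phi>' x))\<^sup>2 * n x))"
      "- LI (\<lambda>x. \<phi>' x \<bullet> W s x) \<le> - \<tau> * LI (\<lambda>x. (\<phi>' x \<bullet> gradient (f s) x) * n x)
        - LI (\<lambda>x. (\<phi>' x \<bullet> b s x) * n x) + \<beta>0 * F * sqrt (LI (\<lambda>x. (norm (\<phi>' x))\<^sup>2 * n x))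
        + \<eta> * (C + F) * sqrt (LI (\<lambda>x. (norm (\<phi>' x))\<^sup>2 * n x))"
      if \<phi>': "continuous_on UNIV \<phi>'" for \<phi>' :: "'a \<Rightarrow> 'a"
      using flux_estimates[OF n_dens \<phi>' f_C1[OF s] f_mean[OF s] C1_grad_continuous[OF Kg_C1[OF s]] b_bound[OF s]
          p_f[OF s] p_nonneg[OF s] W_continuous[OF s] W_decomposition[OF s] close[OF s, folded p_def q_def w_def] eta refl F_def C_def]
      unfolding \<beta>0_def .
    have Xest: "- LI (\<lambda>x. gradient (f s) x \<bullet> W s x) \<le> - \<tau> * D\<^sup>2 + \<beta>0 * sqrt (1 + F\<^sup>2) * D + \<eta> * (C + F) * D"
      using est(1)[OF C1_grad_continuous[OF f_C1[OF s]]] unfolding D_def[symmetric]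
      by (simp add: D2 power2_norm_eq_inner)
    have gUU: "sqrt (LI (\<lambda>x. (norm (gradient u x))\<^sup>2 * n x)) = U" by (simp add: dual_u U_def)
    have Yest: "- LI (\<lambda>x. gradient u x \<bullet> W s x) \<le> - \<tau> * F\<^sup>2 - LI (\<lambda>x. Kg s x * f s x * n x)
        + \<beta>0 * F * U + \<eta> * (C + F) * U"
      using est(2)[OF C1_grad_continuous[OF uC1]] unfolding gUU uf uK .
    have y's: "y' s = 2 * (- LI (\<lambda>x. gradient u x \<bullet> W s x))"
    proof -
      have "LI (\<lambda>x. gradient u x \<bullet> W s x) = LI (\<lambda>x. \<Sum>e\<in>Q. l e s * (gradient e x \<bullet> W s x))"
        by (simp add: gu inner_sum_left)
      also have "\<dots> = (\<Sum>e\<in>Q. LI (\<lambda>x. l e s * (gradient e x \<bullet> W s x)))"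
        by (intro Bochner_Integration.integral_sum torus_lebesgue_integrable continuous_intros
            C1_grad_continuous[OF eC1(1)])
      finally show ?thesis by (simp add: y'_def sum_negf sum.distrib sum_distrib_left)
    qed
    show "\<exists>D U. 0 \<le> D \<and> 0 \<le> U \<and> U\<^sup>2 = Y s \<and>
      c * LI (\<lambda>x. (f s x)\<^sup>2 * n x) \<le> D\<^sup>2 \<and> c * U\<^sup>2 \<le> LI (\<lambda>x. (f s x)\<^sup>2 * n x) \<and>
      2 * (- LI (\<lambda>x. gradient (f s) x \<bullet> W s x)) \<le> 2 * (- \<tau> * D\<^sup>2
        + M / sqrt c * sqrt (LI (\<lambda>y. (g s y)\<^sup>2 * m y)) * sqrt (1 + LI (\<lambda>x. (f s x)\<^sup>2 * n x)) * D
        + \<eta> * (sqrt (LI (\<lambda>x. (1 + inverse (n x))\<^sup>2 * n x)) + sqrt (LI (\<lambda>x. (f s x)\<^sup>2 * n x))) * D) \<and>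
      y' s \<le> 2 * (- \<tau> * LI (\<lambda>x. (f s x)\<^sup>2 * n x) - LI (\<lambda>x. Kg s x * f s x * n x)
        + M / sqrt c * sqrt (LI (\<lambda>y. (g s y)\<^sup>2 * m y)) * sqrt (LI (\<lambda>x. (f s x)\<^sup>2 * n x)) * U
        + \<eta> * (sqrt (LI (\<lambda>x. (1 + inverse (n x))\<^sup>2 * n x)) + sqrt (LI (\<lambda>x. (f s x)\<^sup>2 * n x))) * U)"
      unfolding C_def[symmetric] F_def[symmetric] \<beta>0_def[symmetric] y's
      unfolding F2[symmetric]
      by (rule exI[of _ D], rule exI[of _ U], intro conjI D0 U0 U2 cFD cUF mult_left_mono Xest Yest) simp_all
  qed
qed

end

text \<open>The Lyapunov function \<open>\<Phi>\<close> adds \<open>q^2 c\<close> times the two dual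
  norms to \<open>X\<close>. Its rate is bounded as long as \<open>\<Phi> \<le> L\<close>, and
  \<open>has_rate_comparison\<close> integrates the bound; \<open>l\<close> is the decay rate and
  \<open>\<beta>\<close> the source left by the mollification errors.\<close>

lemma mollified_decay:
  fixes k :: "'a::euclidean_space \<Rightarrow> 'b::euclidean_space \<Rightarrow> real"
  assumes A: "mollified_side \<tau> c M k kx ky n n' m \<mu> \<kappa> \<rho> \<rho>' \<sigma> \<eta>"
    and B: "mollified_side \<tau> c M (\<lambda>y x. - k x y) (\<lambda>y x. - ky x y) (\<lambda>y x. - kx x y) m m' n \<kappa> \<mu> \<sigma> \<sigma>' \<rho> \<eta>"
    and \<epsilon>: "0 < \<epsilon>" "\<epsilon> < 1" and q: "q = M / (\<tau> * c * \<epsilon>)"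
    and X: "X = (\<lambda>t. LI (\<lambda>x. (mollify \<rho> (\<mu> t) x * inverse (n x) - 1)\<^sup>2 * n x)
      + LI (\<lambda>y. (mollify \<sigma> (\<kappa> t) y * inverse (m y) - 1)\<^sup>2 * m y))"
    and C: "sqrt (LI (\<lambda>x. (1 + inverse (n x))\<^sup>2 * n x)) \<le> C" "sqrt (LI (\<lambda>y. (1 + inverse (m y))\<^sup>2 * m y)) \<le> C"
    and l: "l = 2 * \<tau> * c * (1 - \<epsilon>)" and \<beta>: "\<beta> = 10 * (1 + q\<^sup>2) * (\<eta> * (C + sqrt L))\<^sup>2 / (\<epsilon> * \<tau>)"
    and x0: "X 0 \<le> x0" and L: "(1 + q\<^sup>2) * x0 + \<beta> / l < L" and small: "q\<^sup>2 * L \<le> 11/40 * (1 + q\<^sup>2)"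
    and t: "0 \<le> t"
  shows "X t \<le> (1 + q\<^sup>2) * x0 * exp (- l * t) + \<beta> / l"
proof -
  interpret A: mollified_side \<tau> c M k kx ky n n' m \<mu> \<kappa> \<rho> \<rho>' \<sigma> \<eta> by (rule A)
  interpret B: mollified_side \<tau> c M "\<lambda>y x. - k x y" "\<lambda>y x. - ky x y" "\<lambda>y x. - kx x y" m m' n \<kappa> \<mu> \<sigma> \<sigma>' \<rho> \<eta>
    by (rule B)
  note tau = A.tau and M = A.M
  have c: "0 < c" using A.n_poincare by (simp add: weighted_poincare_def)
  have gB: "B.f = A.g" and fB: "B.g = A.f"
    by (auto simp: fun_eq_iff A.f_def A.g_def B.f_def B.g_def A.p_def A.q_def B.p_def B.q_def)
  define XA where "XA = (\<lambda>t. LI (\<lambda>x. (A.f t x)\<^sup>2 * n x))"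
  define XB where "XB = (\<lambda>t. LI (\<lambda>y. (A.g t y)\<^sup>2 * m y))"
  have Xeq: "X t = XA t + XB t" for t
    by (simp add: X XA_def XB_def A.f_def A.g_def A.p_def A.q_def)
  have nn: "0 \<le> n x" "0 \<le> m y" for x y using A.n_pos[of x] A.m_pos[of y] by auto
  have XA0: "0 \<le> XA t" and XB0: "0 \<le> XB t" for t unfolding XA_def XB_def using nn by simp_all
  have XA_at: "LI (\<lambda>x. (A.f s x)\<^sup>2 * n x) = XA s" and XB_at: "LI (\<lambda>y. (A.g s y)\<^sup>2 * m y) = XB s" for s
    by (simp_all add: XA_def XB_def)
  define CA where "CA = sqrt (LI (\<lambda>x. (1 + inverse (n x))\<^sup>2 * n x))"
  define CB where "CB = sqrt (LI (\<lambda>y. (1 + inverse (m y))\<^sup>2 * m y))"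
  have CAB: "0 \<le> CA" "CA \<le> C" "0 \<le> CB" "CB \<le> C" using C nn unfolding CA_def CB_def by simp_all
  obtain YA yA where RA: "has_rate XA (\<lambda>s. 2 * (- LI (\<lambda>x. gradient (A.f s) x \<bullet> A.W s x)))" "has_rate YA yA"
    and EA: "\<And>s. 0 \<le> s \<Longrightarrow> \<exists>D U. 0 \<le> D \<and> 0 \<le> U \<and> U\<^sup>2 = YA s \<and> c * XA s \<le> D\<^sup>2 \<and> c * U\<^sup>2 \<le> XA s \<and>
      2 * (- LI (\<lambda>x. gradient (A.f s) x \<bullet> A.W s x)) \<le> 2 * (- \<tau> * D\<^sup>2
        + M / sqrt c * sqrt (XB s) * sqrt (1 + XA s) * D + \<eta> * (CA + sqrt (XA s)) * D) \<and>
      yA s \<le> 2 * (- \<tau> * XA s - LI (\<lambda>x. A.Kg s x * A.f s x * n x)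
        + M / sqrt c * sqrt (XB s) * sqrt (XA s) * U + \<eta> * (CA + sqrt (XA s)) * U)"
    by (rule A.side_rates[unfolded XA_at XB_at CA_def[symmetric]]) (rule that)
  obtain YB yB where RB: "has_rate XB (\<lambda>s. 2 * (- LI (\<lambda>y. gradient (A.g s) y \<bullet> B.W s y)))" "has_rate YB yB"
    and EB: "\<And>s. 0 \<le> s \<Longrightarrow> \<exists>D U. 0 \<le> D \<and> 0 \<le> U \<and> U\<^sup>2 = YB s \<and> c * XB s \<le> D\<^sup>2 \<and> c * U\<^sup>2 \<le> XB s \<and>
      2 * (- LI (\<lambda>y. gradient (A.g s) y \<bullet> B.W s y)) \<le> 2 * (- \<tau> * D\<^sup>2
        + M / sqrt c * sqrt (XA s) * sqrt (1 + XB s) * D + \<eta> * (CB + sqrt (XB s)) * D) \<and>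
      yB s \<le> 2 * (- \<tau> * XB s - LI (\<lambda>y. B.Kg s y * A.g s y * m y)
        + M / sqrt c * sqrt (XA s) * sqrt (XB s) * U + \<eta> * (CB + sqrt (XB s)) * U)"
    by (rule B.side_rates[unfolded gB fB, unfolded XA_at XB_at CB_def[symmetric]]) (rule that)
  \<comment> \<open>Both sides are the double integral of \<open>k\<close> against the two weighted
    deviations; the opponent sees the transpose of \<open>- k\<close>, which gives the sign.\<close>
  have cancel: "LI (\<lambda>y. B.Kg s y * A.g s y * m y) = - LI (\<lambda>x. A.Kg s x * A.f s x * n x)" if s: "0 \<le> s" for s
  proof -
    note fc = C1_continuous[OF A.f_C1[OF s]] and gc = A.g_continuous[OF s]
    have "LI (\<lambda>x. A.Kg s x * A.f s x * n x) = LI (\<lambda>x. LI (\<lambda>y. k x y * (A.g s y * m y) * (A.f s x * n x)))"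
    proof (intro Bochner_Integration.integral_cong refl)
      fix x
      show "A.Kg s x * A.f s x * n x = LI (\<lambda>y. k x y * (A.g s y * m y) * (A.f s x * n x))"
        unfolding A.Kg_def integral_mult_left_zero by (simp only: mult.assoc)
    qed
    also have "\<dots> = LI (\<lambda>y. LI (\<lambda>x. k x y * (A.g s y * m y) * (A.f s x * n x)))"
    proof (rule torus_Fubini[OF torus_prob_measure_lebesgue torus_prob_measure_lebesgue])
      have "continuous_on UNIV (\<lambda>z. k (fst z) (snd z))" using A.k_cont by (simp add: case_prod_beta)
      then show "continuous_on UNIV (\<lambda>(x, y). k x y * (A.g s y * m y) * (A.f s x * n x))"
        by (auto simp: case_prod_beta intro!: continuous_intros continuous_on_compose2[OF fc] continuous_on_compose2[OF gc]
            continuous_on_compose2[OF A.n_cont] continuous_on_compose2[OF A.m_cont])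
    qed
    also have "\<dots> = LI (\<lambda>y. - (B.Kg s y * A.g s y * m y))"
    proof (intro Bochner_Integration.integral_cong refl)
      fix y
      have "B.Kg s y = - LI (\<lambda>x. k x y * (A.f s x * n x))" by (simp add: B.Kg_def fB)
      moreover have "LI (\<lambda>x. k x y * (A.g s y * m y) * (A.f s x * n x)) = LI (\<lambda>x. k x y * (A.f s x * n x)) * (A.g s y * m y)"
      proof -
        have "LI (\<lambda>x. k x y * (A.g s y * m y) * (A.f s x * n x)) = LI (\<lambda>x. k x y * (A.f s x * n x) * (A.g s y * m y))"
          by (intro Bochner_Integration.integral_cong refl) (simp only: mult_ac)
        then show ?thesis by (simp only: integral_mult_left_zero)
      qed
      ultimately show "LI (\<lambda>x. k x y * (A.g s y * m y) * (A.f s x * n x)) = - (B.Kg s y * A.g s y * m y)" by simp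
    qed
    finally show ?thesis by simp
  qed
  define \<Phi> where "\<Phi> = (\<lambda>t. (XA t + XB t) + q\<^sup>2 * c * (YA t + YB t))"
  define r where "r = (\<lambda>s. (2 * (- LI (\<lambda>x. gradient (A.f s) x \<bullet> A.W s x)) + 2 * (- LI (\<lambda>y. gradient (A.g s) y \<bullet> B.W s y)))
      + q\<^sup>2 * c * (yA s + yB s))"
  have \<Phi>_rate: "has_rate \<Phi> r"
    unfolding \<Phi>_def r_def by (intro has_rate_add has_rate_cmult RA RB)
  have Y: "0 \<le> YA s" "0 \<le> YB s" "c * YA s \<le> XA s" "c * YB s \<le> XB s" if s: "0 \<le> s" for s
  proof -
    obtain U where "U\<^sup>2 = YA s" "c * U\<^sup>2 \<le> XA s" using EA[OF s] by blast
    then show "0 \<le> YA s" "c * YA s \<le> XA s" by (metis zero_le_power2, simp)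
    obtain U' where "U'\<^sup>2 = YB s" "c * U'\<^sup>2 \<le> XB s" using EB[OF s] by blast
    then show "0 \<le> YB s" "c * YB s \<le> XB s" by (metis zero_le_power2, simp)
  qed
  have X_le: "XA s + XB s \<le> \<Phi> s" if "0 \<le> s" for s
    using Y[OF that] c by (simp add: \<Phi>_def)
  have "\<Phi> t \<le> ((1 + q\<^sup>2) * x0) * exp (- l * t) + \<beta> / l"
  proof (rule has_rate_comparison[OF \<Phi>_rate])
    show "0 < l" using tau c \<epsilon> by (simp add: l)
    \<comment> \<open>The dual norms are controlled by \<open>X\<close> through
      \<open>c * Y \<le> X\<close>: this produces the prefactor \<open>1 + q^2\<close> of the final
      estimate.\<close>
    have "q\<^sup>2 * (c * (YA 0 + YB 0)) \<le> q\<^sup>2 * (XA 0 + XB 0)"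
      using Y[of 0] by (intro mult_left_mono) (auto simp: distrib_left)
    then have "\<Phi> 0 \<le> (1 + q\<^sup>2) * X 0" unfolding \<Phi>_def Xeq by (simp add: distrib_right mult.assoc)
    also have "\<dots> \<le> (1 + q\<^sup>2) * x0" using x0 by (intro mult_left_mono) auto
    finally show "\<Phi> 0 \<le> (1 + q\<^sup>2) * x0" .
    have "0 \<le> X 0" unfolding Xeq using XA0 XB0 by simp
    then show "0 \<le> (1 + q\<^sup>2) * x0" using x0 by simp
    show "0 \<le> \<beta>" unfolding \<beta> using \<epsilon> tau by simp
    show "(1 + q\<^sup>2) * x0 + \<beta> / l < L" by (rule L)
    show "0 \<le> t" by (rule t)
    fix s :: real assume s: "0 \<le> s" and le: "\<Phi> s \<le> L"
    obtain D U where DU: "0 \<le> D" "0 \<le> U" "U\<^sup>2 = YA s" "c * XA s \<le> D\<^sup>2" "c * U\<^sup>2 \<le> XA s"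
      and X1: "2 * (- LI (\<lambda>x. gradient (A.f s) x \<bullet> A.W s x)) \<le> 2 * (- \<tau> * D\<^sup>2
        + M / sqrt c * sqrt (XB s) * sqrt (1 + XA s) * D + \<eta> * (CA + sqrt (XA s)) * D)"
      and Y1: "yA s \<le> 2 * (- \<tau> * XA s - LI (\<lambda>x. A.Kg s x * A.f s x * n x)
        + M / sqrt c * sqrt (XB s) * sqrt (XA s) * U + \<eta> * (CA + sqrt (XA s)) * U)"
      using EA[OF s] by blast
    obtain D' U' where DU': "0 \<le> D'" "0 \<le> U'" "U'\<^sup>2 = YB s" "c * XB s \<le> D'\<^sup>2" "c * U'\<^sup>2 \<le> XB s"
      and X2: "2 * (- LI (\<lambda>y. gradient (A.g s) y \<bullet> B.W s y)) \<le> 2 * (- \<tau> * D'\<^sup>2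
        + M / sqrt c * sqrt (XA s) * sqrt (1 + XB s) * D' + \<eta> * (CB + sqrt (XB s)) * D')"
      and Y2: "yB s \<le> 2 * (- \<tau> * XB s - LI (\<lambda>y. B.Kg s y * A.g s y * m y)
        + M / sqrt c * sqrt (XA s) * sqrt (XB s) * U' + \<eta> * (CB + sqrt (XB s)) * U')"
      using EB[OF s] by blast
    define F where "F = sqrt (XA s)"
    define G where "G = sqrt (XB s)"
    have F: "0 \<le> F" "XA s = F\<^sup>2" and G: "0 \<le> G" "XB s = G\<^sup>2"
      using XA0 XB0 by (simp_all add: F_def G_def)
    \<comment> \<open>Below the level \<open>L\<close> the norms in the error terms are at most
      \<open>sqrt L\<close>, so a single constant \<open>E\<close> replaces all of them.\<close>
    have "XA s \<le> L" "XB s \<le> L" using X_le[OF s] le XA0[of s] XB0[of s] by linarith+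
    then have FL: "F \<le> sqrt L" "G \<le> sqrt L" by (simp_all add: F_def G_def)
    define E where "E = \<eta> * (C + sqrt L)"
    have e: "\<eta> * (CA + F) \<le> E" "\<eta> * (CB + G) \<le> E"
      unfolding E_def using FL CAB A.eta by (auto intro!: mult_left_mono add_mono)
    have E0: "0 \<le> E" using e(1) A.eta CAB F by (meson add_nonneg_nonneg mult_nonneg_nonneg order_trans)
    have "r s \<le> - (2 * \<tau> * c * (1 - \<epsilon>)) * (F\<^sup>2 + G\<^sup>2 + q\<^sup>2 * c * (U\<^sup>2 + U'\<^sup>2)) + 10 * (1 + q\<^sup>2) * E\<^sup>2 / (\<epsilon> * \<tau>)"
      unfolding r_def
    proof (rule lyapunov_rate_bound[OF tau c \<epsilon> M q F(1) G(1) DU(1) DU'(1) DU(2) DU'(2) E0])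
      show "c * F\<^sup>2 \<le> D\<^sup>2" "c * G\<^sup>2 \<le> D'\<^sup>2" "c * U\<^sup>2 \<le> F\<^sup>2" "c * U'\<^sup>2 \<le> G\<^sup>2"
        using DU DU' F G by simp_all
      have "F\<^sup>2 + G\<^sup>2 + q\<^sup>2 * c * (U\<^sup>2 + U'\<^sup>2) = \<Phi> s" by (simp add: \<Phi>_def F G DU DU')
      then show "q\<^sup>2 * (F\<^sup>2 + G\<^sup>2 + q\<^sup>2 * c * (U\<^sup>2 + U'\<^sup>2)) \<le> 11/40 * (1 + q\<^sup>2)"
        using order_trans[OF mult_left_mono[OF le, of "q\<^sup>2"] small] by simp
      have eD: "\<eta> * (CA + F) * D \<le> E * D" "\<eta> * (CB + G) * D' \<le> E * D'"
        "\<eta> * (CA + F) * U \<le> E * U" "\<eta> * (CB + G) * U' \<le> E * U'"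
        using e DU(1,2) DU'(1,2) by (auto intro: mult_right_mono)
      note fold1 = F_def[symmetric] G_def[symmetric]
      show "2 * (- LI (\<lambda>x. gradient (A.f s) x \<bullet> A.W s x)) \<le> 2 * (- \<tau> * D\<^sup>2 + M / sqrt c * G * sqrt (1 + F\<^sup>2) * D + E * D)"
        using eD(1) by (intro order_trans[OF X1[unfolded fold1, unfolded F(2) G(2)]]) simp
      show "2 * (- LI (\<lambda>y. gradient (A.g s) y \<bullet> B.W s y)) \<le> 2 * (- \<tau> * D'\<^sup>2 + M / sqrt c * F * sqrt (1 + G\<^sup>2) * D' + E * D')"
        using eD(2) by (intro order_trans[OF X2[unfolded fold1, unfolded F(2) G(2)]]) simp
      show "yA s \<le> 2 * (- \<tau> * F\<^sup>2 - LI (\<lambda>x. A.Kg s x * A.f s x * n x) + M / sqrt c * G * F * U + E * U)"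
        using eD(3) by (intro order_trans[OF Y1[unfolded fold1, unfolded F(2) G(2)]]) simp
      show "yB s \<le> 2 * (- \<tau> * G\<^sup>2 + LI (\<lambda>x. A.Kg s x * A.f s x * n x) + M / sqrt c * F * G * U' + E * U')"
        using eD(4) by (intro order_trans[OF Y2[unfolded fold1, unfolded F(2) G(2) cancel[OF s]]]) simp
    qed
    also have "F\<^sup>2 + G\<^sup>2 + q\<^sup>2 * c * (U\<^sup>2 + U'\<^sup>2) = \<Phi> s" by (simp add: \<Phi>_def F G DU DU')
    finally show "r s \<le> - l * \<Phi> s + \<beta>" by (simp add: l \<beta> E_def)
  qed
  with X_le[OF t] show ?thesis by (simp add: Xeq)
qed

section \<open>The Gibbs form of the equilibrium\<close>

lemma torus_density:
  fixes g :: "'a::euclidean_space \<Rightarrow> real"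
  assumes g: "prob_density g"
  shows torus_density_prob: "torus_prob_measure (density torus_lebesgue (\<lambda>x. ennreal (g x)))"
    and torus_density_integral: "continuous_on UNIV f \<Longrightarrow>
      (\<integral>x. f x \<partial>density torus_lebesgue (\<lambda>x. ennreal (g x))) = LI (\<lambda>x. f x * g x)"
    and torus_density_ac: "absolutely_continuous torus_lebesgue (density torus_lebesgue (\<lambda>x. ennreal (g x)))"
    and torus_density_RN: "AE x in torus_lebesgue. enn2real (RN_deriv torus_lebesgue (density torus_lebesgue (\<lambda>x. ennreal (g x))) x) = g x"
proof -
  note L = torus_prob_measure_lebesgue
  interpret P: prob_space "torus_lebesgue :: 'a measure" by (rule torus_prob_space[OF L])
  have gm: "g \<in> borel_measurable torus_lebesgue"
    by (intro torus_prob_measurable[OF L] borel_measurable_continuous_onI prob_densityD[OF g])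
  have "(\<integral>\<^sup>+x. ennreal (g x) \<partial>torus_lebesgue) = ennreal (LI g)"
    by (intro nn_integral_eq_integral torus_lebesgue_integrable prob_densityD[OF g])
      (simp add: prob_densityD[OF g])
  then have "emeasure (density torus_lebesgue (\<lambda>x. ennreal (g x))) (space torus_lebesgue) = 1"
    using gm by (simp add: emeasure_density prob_densityD[OF g] cong: nn_integral_cong_simp)
  then have "prob_space (density torus_lebesgue (\<lambda>x. ennreal (g x)))"
    by (intro prob_spaceI) simp
  then show "torus_prob_measure (density torus_lebesgue (\<lambda>x. ennreal (g x)))"
    by (simp add: torus_prob_measure_def torus_prob_sets[OF L])
  show "(\<integral>x. f x \<partial>density torus_lebesgue (\<lambda>x. ennreal (g x))) = LI (\<lambda>x. f x * g x)"
    if "continuous_on UNIV f" for f :: "'a \<Rightarrow> real"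
    using gm prob_densityD[OF g] torus_prob_measurable[OF L borel_measurable_continuous_onI[OF that]]
    by (subst integral_real_density) (auto simp: mult.commute)
  show "absolutely_continuous torus_lebesgue (density torus_lebesgue (\<lambda>x. ennreal (g x)))"
    using gm by (intro absolutely_continuousI_density) simp
  have "AE x in torus_lebesgue. ennreal (g x) = RN_deriv torus_lebesgue (density torus_lebesgue (\<lambda>x. ennreal (g x))) x"
    using gm by (intro P.RN_deriv_unique) auto
  then show "AE x in torus_lebesgue. enn2real (RN_deriv torus_lebesgue (density torus_lebesgue (\<lambda>x. ennreal (g x))) x) = g x"
    by eventually_elim (metis enn2real_ennreal prob_densityD(3)[OF g])
qed

text \<open>The inequality \<open>ln y \<le> y - 1\<close> at \<open>y = v / u\<close>, with its
  case of equality. At \<open>u = 0\<close> the default value of \<open>ln 0\<close> is harmless,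
  since it is multiplied by zero.\<close>

lemma ln_ratio_bound:
  fixes u v :: real
  assumes "0 \<le> u" "0 < v"
  shows "u - v \<le> u * (ln u - ln v)" "u * (ln u - ln v) = u - v \<Longrightarrow> u = v"
proof -
  have "u = 0 \<or> 0 < u" using assms by auto
  then have "u - v \<le> u * (ln u - ln v) \<and> (u * (ln u - ln v) = u - v \<longrightarrow> u = v)"
  proof
    assume "u = 0" then show ?thesis using assms by simp
  next
    assume u: "0 < u"
    have le: "ln (v / u) \<le> v / u - 1" using u assms by (intro ln_le_minus_one) simp
    have ln: "ln (v / u) = ln v - ln u" using u assms by (simp add: ln_div)
    have "u * ln (v / u) \<le> u * (v / u - 1)" using le u by (intro mult_left_mono) auto
    then have 1: "u - v \<le> u * (ln u - ln v)" using u by (simp add: ln algebra_simps)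
    have "u = v" if e: "u * (ln u - ln v) = u - v"
    proof -
      have "u * ln (v / u) = u * (v / u - 1)" using e u by (simp add: ln algebra_simps)
      then have "ln (v / u) = v / u - 1" using u by simp
      then have "v / u = 1" using u assms by (intro ln_eq_minus_one) auto
      then show ?thesis using u by simp
    qed
    with 1 show ?thesis by blast
  qed
  then show "u - v \<le> u * (ln u - ln v)" "u * (ln u - ln v) = u - v \<Longrightarrow> u = v" by blast+
qed

text \<open>One competitor decides: the free energy of a measure exceeds that of the Gibbs measure
  by \<open>\<tau>\<close> times its relative entropy. A minimizer therefore has relative entropy at
  most zero, and the equality case forces its density to be \<open>n\<close> almost
  everywhere.\<close>

lemma gibbs_minimizer:
  fixes V :: "'a::euclidean_space \<Rightarrow> real"
  assumes "0 < \<tau>" and V: "continuous_on UNIV V" "torus_periodic V"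
    and \<nu>: "torus_prob_measure \<nu>" "finite_entropy \<nu>"
    and min: "\<And>\<mu>. torus_prob_measure \<mu> \<Longrightarrow> finite_entropy \<mu> \<Longrightarrow>
      (\<integral>x. V x \<partial>\<nu>) + \<tau> * boltzmann_entropy \<nu> \<le> (\<integral>x. V x \<partial>\<mu>) + \<tau> * boltzmann_entropy \<mu>"
  defines "n \<equiv> (\<lambda>x. exp (- V x / \<tau>) / LI (\<lambda>x. exp (- V x / \<tau>)))"
  shows "prob_density n" "\<nu> = density torus_lebesgue (\<lambda>x. ennreal (n x))"
proof -
  note L = torus_prob_measure_lebesgue
  interpret P: prob_space "torus_lebesgue :: 'a measure" by (rule torus_prob_space[OF L])
  define Z where "Z = LI (\<lambda>x. exp (- V x / \<tau>))"
  have ec: "continuous_on UNIV (\<lambda>x. exp (- V x / \<tau>))"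
    using \<open>0 < \<tau>\<close> by (intro continuous_intros V) simp
  obtain B where B: "0 < B" "\<And>x. norm (V x) \<le> B" using torus_periodic_bounded[OF V] by blast
  have "exp (- B / \<tau>) = LI (\<lambda>x::'a. exp (- B / \<tau>))" by (simp add: P.prob_space)
  also have "\<dots> \<le> Z" unfolding Z_def
  proof (intro integral_mono torus_lebesgue_integrable ec)
    fix x
    have "V x \<le> B" using B(2)[of x] by simp
    then show "exp (- B / \<tau>) \<le> exp (- V x / \<tau>)" using \<open>0 < \<tau>\<close> by (simp add: divide_right_mono)
  qed (intro continuous_intros)
  finally have Z: "0 < Z" by (meson exp_gt_zero less_le_trans)
  have nx: "n x = exp (- V x / \<tau>) / Z" for x by (simp add: n_def Z_def)
  have nc: "continuous_on UNIV n" unfolding nx[abs_def] using Z by (intro continuous_intros ec) simp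
  show n: "prob_density n"
    unfolding prob_density_def
  proof (intro conjI allI nc)
    show "torus_periodic n" using V(2) by (simp add: nx torus_periodic_def)
    show "0 < n x" for x using Z by (simp add: nx)
    show "LI n = 1" unfolding nx[abs_def] using Z by (simp add: Z_def)
  qed
  define \<gamma> where "\<gamma> = density torus_lebesgue (\<lambda>x. ennreal (n x))"
  have ln_n: "ln (n x) = - V x / \<tau> - ln Z" for x using Z by (simp add: nx ln_div)
  have ln_nc: "continuous_on UNIV (\<lambda>x. ln (n x))"
    unfolding ln_n using \<open>0 < \<tau>\<close> by (intro continuous_intros V) simp
  have \<gamma>: "torus_prob_measure \<gamma>" unfolding \<gamma>_def by (rule torus_density_prob[OF n])
  have n_m: "n \<in> borel_measurable torus_lebesgue"
    by (intro torus_prob_measurable[OF L] borel_measurable_continuous_onI nc)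
  have RN\<gamma>: "AE x in \<gamma>. log_density \<gamma> x = ln (n x)"
  proof -
    have "AE x in torus_lebesgue. log_density \<gamma> x = ln (n x)"
      using torus_density_RN[OF n] unfolding \<gamma>_def[symmetric] log_density_def by eventually_elim simp
    then show ?thesis unfolding \<gamma>_def using n_m by (subst AE_density) auto
  qed
  have ld_m: "log_density \<mu> \<in> borel_measurable torus_lebesgue" for \<mu> :: "'a measure"
    unfolding log_density_def[abs_def] by measurable
  have ld_m': "log_density \<mu> \<in> borel_measurable \<gamma>" for \<mu> :: "'a measure"
    using ld_m unfolding \<gamma>_def by simp
  have ln_n\<gamma>: "integrable \<gamma> (\<lambda>x. ln (n x))" by (rule torus_integrable_continuous[OF \<gamma> ln_nc])
  have fe\<gamma>: "finite_entropy \<gamma>"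
    unfolding finite_entropy_def
  proof
    show "absolutely_continuous torus_lebesgue \<gamma>" unfolding \<gamma>_def by (rule torus_density_ac[OF n])
    show "integrable \<gamma> (log_density \<gamma>)"
      by (rule integrable_cong_AE_imp[OF ln_n\<gamma> ld_m' AE_symmetric[OF RN\<gamma>]])
  qed
  have be\<gamma>: "boltzmann_entropy \<gamma> = (\<integral>x. ln (n x) \<partial>\<gamma>)"
    unfolding boltzmann_entropy_def
    by (intro integral_cong_AE RN\<gamma> ld_m' borel_measurable_integrable ln_n\<gamma>)
  have int_lnn: "(\<integral>x. ln (n x) \<partial>\<mu>) = - (\<integral>x. V x \<partial>\<mu>) / \<tau> - ln Z" if \<mu>: "torus_prob_measure \<mu>" for \<mu>
  proof -
    interpret prob_space \<mu> by (rule torus_prob_space[OF \<mu>])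
    have "integrable \<mu> V" by (rule torus_integrable_continuous[OF \<mu> V(1)])
    then show ?thesis unfolding ln_n by (simp add: prob_space)
  qed
  have free\<gamma>: "(\<integral>x. V x \<partial>\<gamma>) + \<tau> * boltzmann_entropy \<gamma> = - \<tau> * ln Z"
    unfolding be\<gamma> int_lnn[OF \<gamma>] using \<open>0 < \<tau>\<close> by (simp add: algebra_simps)
  define h where "h = (\<lambda>x. enn2real (RN_deriv torus_lebesgue \<nu> x))"
  have ac: "absolutely_continuous torus_lebesgue \<nu>" and ld: "integrable \<nu> (log_density \<nu>)"
    using \<nu>(2) by (auto simp: finite_entropy_def)
  have sets_eq: "sets \<nu> = sets torus_lebesgue"
    by (simp add: torus_prob_sets[OF \<nu>(1)] torus_prob_sets[OF L])
  have fin: "sigma_finite_measure \<nu>"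
    using torus_prob_finite[OF \<nu>(1)] by (simp add: finite_measure_def)
  have h_m[measurable]: "h \<in> borel_measurable torus_lebesgue" unfolding h_def by measurable
  have "AE x in torus_lebesgue. RN_deriv torus_lebesgue \<nu> x \<noteq> \<infinity>"
    by (rule P.RN_deriv_finite[OF fin ac sets_eq])
  then have "AE x in torus_lebesgue. RN_deriv torus_lebesgue \<nu> x = ennreal (h x)"
    by eventually_elim (simp add: h_def less_top)
  then have \<nu>h: "\<nu> = density torus_lebesgue (\<lambda>x. ennreal (h x))"
    using P.density_RN_deriv[OF ac sets_eq] density_cong[of "RN_deriv torus_lebesgue \<nu>" torus_lebesgue "\<lambda>x. ennreal (h x)"]
    by simp
  have h0: "0 \<le> h x" for x by (simp add: h_def)
  have to_L: "integrable torus_lebesgue (\<lambda>x. h x * F x) \<and> (\<integral>x. F x \<partial>\<nu>) = LI (\<lambda>x. h x * F x)"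
    if F: "integrable \<nu> F" for F
  proof -
    have Fm: "F \<in> borel_measurable torus_lebesgue"
      using borel_measurable_integrable[OF F] measurable_cong_sets[OF sets_eq refl] by blast
    show ?thesis
      using F Fm h0 unfolding \<nu>h by (auto simp: integrable_real_density integral_real_density)
  qed
  have ld_h: "log_density \<nu> = (\<lambda>x. ln (h x))" by (simp add: fun_eq_iff log_density_def h_def)
  interpret N: prob_space \<nu> by (rule torus_prob_space[OF \<nu>(1)])
  have i1: "integrable \<nu> (\<lambda>x. ln (n x))" by (rule torus_integrable_continuous[OF \<nu>(1) ln_nc])
  have i2: "integrable \<nu> (\<lambda>x. ln (h x) - ln (n x))" using ld i1 unfolding ld_h by simp
  have "\<tau> * (\<integral>x. ln (h x) - ln (n x) \<partial>\<nu>) = \<tau> * boltzmann_entropy \<nu> + ((\<integral>x. V x \<partial>\<nu>) + \<tau> * ln Z)"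
    using ld i1 \<open>0 < \<tau>\<close> unfolding boltzmann_entropy_def ld_h
    by (simp add: int_lnn[OF \<nu>(1)] algebra_simps)
  also have "\<dots> \<le> 0" using min[OF \<gamma> fe\<gamma>] free\<gamma> by simp
  finally have KL: "(\<integral>x. ln (h x) - ln (n x) \<partial>\<nu>) \<le> 0" using \<open>0 < \<tau>\<close> by (simp add: mult_le_0_iff)
  have one: "integrable \<nu> (\<lambda>x. 1 :: real)" by simp
  have hi: "integrable torus_lebesgue h" "LI h = 1" using to_L[OF one] by (simp_all add: N.prob_space)
  \<comment> \<open>Subtracting \<open>h - n\<close>, which has integral zero, makes the integrand
    of the relative entropy nonnegative at every point, so a vanishing integral makes it vanish
    almost everywhere.\<close>
  define G where "G = (\<lambda>x. h x * (ln (h x) - ln (n x)) - (h x - n x))"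
  have G0: "0 \<le> G x" for x
    using ln_ratio_bound(1)[OF h0 prob_densityD(2)[OF n], of x x] by (simp add: G_def)
  have Gi: "integrable torus_lebesgue G"
    unfolding G_def using to_L[OF i2] hi torus_lebesgue_integrable[OF nc] by simp
  have "LI G = (\<integral>x. ln (h x) - ln (n x) \<partial>\<nu>) - (LI h - LI n)"
    unfolding G_def using to_L[OF i2] hi torus_lebesgue_integrable[OF nc] by simp
  also have "\<dots> \<le> 0" using KL by (simp add: hi prob_densityD(4)[OF n])
  finally have "LI G = 0" using integral_nonneg_AE[of G torus_lebesgue] G0 by (simp add: order_antisym)
  then have "AE x in torus_lebesgue. G x = 0"
    using integral_nonneg_eq_0_iff_AE[OF Gi] G0 by simp
  then have "AE x in torus_lebesgue. h x = n x"
    by eventually_elim (rule ln_ratio_bound(2)[OF h0 prob_densityD(2)[OF n]], simp add: G_def)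
  then have "AE x in torus_lebesgue. ennreal (h x) = ennreal (n x)" by eventually_elim simp
  then show "\<nu> = density torus_lebesgue (\<lambda>x. ennreal (n x))"
    using n_m by (subst \<nu>h) (intro density_cong, auto)
qed

section \<open>Semicontinuity of the chi-squared divergence\<close>

text \<open>The sets approximable in both measures at once are closed under complements and
  countable unions and contain the positivity sets of continuous periodic functions, so only
  coordinate half-spaces need an argument. Periodicity is the obstacle: a continuous periodic
  function takes the same value on opposite faces of the cell, while the half-open cell
  distinguishes them.\<close>

lemma continuous_approx_indicator:
  fixes \<mu> \<nu> :: "'a::euclidean_space measure" and \<epsilon> :: real
  assumes \<mu>: "torus_prob_measure \<mu>" and \<nu>: "torus_prob_measure \<nu>" and A: "A \<in> sets borel" and "0 < \<epsilon>"
  obtains \<phi> where "continuous_on UNIV \<phi>" "torus_periodic \<phi>" "\<And>x. 0 \<le> \<phi> x \<and> \<phi> x \<le> 1"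
    "(\<integral>x. \<bar>\<phi> x - indicator A x\<bar> \<partial>\<mu>) < \<epsilon>" "(\<integral>x. \<bar>\<phi> x - indicator A x\<bar> \<partial>\<nu>) < \<epsilon>"
proof -
  define ok where "ok = (\<lambda>A \<epsilon> \<phi>. continuous_on UNIV \<phi> \<and> torus_periodic \<phi> \<and> (\<forall>x::'a. 0 \<le> \<phi> x \<and> \<phi> x \<le> (1::real)) \<and>
    (\<integral>x. \<bar>\<phi> x - indicator A x\<bar> \<partial>\<mu>) < \<epsilon> \<and> (\<integral>x. \<bar>\<phi> x - indicator A x\<bar> \<partial>\<nu>) < \<epsilon>)"
  define good where "good = (\<lambda>A. A \<in> sets borel \<and> (\<forall>\<epsilon>>0. \<exists>\<phi>. ok A \<epsilon> \<phi>))"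
  have int: "integrable \<kappa> (\<lambda>x. \<bar>\<phi> x - indicator A x\<bar>)"
    if "torus_prob_measure \<kappa>" "continuous_on UNIV \<phi>" "\<And>x. 0 \<le> \<phi> x \<and> \<phi> x \<le> (1::real)" "A \<in> sets borel"
    for \<kappa> :: "'a measure" and \<phi> A
  proof (rule torus_integrable_bounded[OF that(1), where B=1])
    have "\<phi> \<in> borel_measurable borel" by (rule borel_measurable_continuous_onI[OF that(2)])
    then show "(\<lambda>x. \<bar>\<phi> x - indicator A x\<bar>) \<in> borel_measurable borel" using that(4) by measurable
    show "norm \<bar>\<phi> x - indicator A x\<bar> \<le> 1" for x using that(3)[of x] by (auto simp: indicator_def)
  qed
  have indi: "integrable \<kappa> (indicator A :: 'a \<Rightarrow> real)" if "torus_prob_measure \<kappa>" "A \<in> sets borel" for \<kappa> A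
    by (rule torus_integrable_bounded[OF that(1), where B=1]) (use that in \<open>auto simp: indicator_def\<close>)
  have compl: "good (- A)" if "good A" for A
  proof -
    have "\<exists>\<phi>. ok (- A) \<epsilon> \<phi>" if "0 < \<epsilon>" for \<epsilon>
    proof -
      obtain \<phi> where \<phi>: "ok A \<epsilon> \<phi>" using \<open>good A\<close> \<open>0 < \<epsilon>\<close> unfolding good_def by blast
      have "\<bar>1 - \<phi> x - indicator (- A) x\<bar> = \<bar>\<phi> x - indicator A x\<bar>" for x by (auto simp: indicator_def)
      then have "ok (- A) \<epsilon> (\<lambda>x. 1 - \<phi> x)"
        using \<phi> unfolding ok_def by (auto simp: torus_periodic_def intro!: continuous_intros)
      then show ?thesis by blast
    qed
    then show ?thesis using that unfolding good_def by auto
  qed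
  have union: "good (A \<union> B)" if "good A" "good B" for A B
  proof -
    have AB: "A \<in> sets borel" "B \<in> sets borel" using that by (auto simp: good_def)
    have "\<exists>\<phi>. ok (A \<union> B) \<epsilon> \<phi>" if "0 < \<epsilon>" for \<epsilon>
    proof -
      have "0 < \<epsilon> / 2" using that by simp
      then obtain \<phi> \<psi> where \<phi>: "ok A (\<epsilon> / 2) \<phi>" and \<psi>: "ok B (\<epsilon> / 2) \<psi>"
        using \<open>good A\<close> \<open>good B\<close> unfolding good_def by blast
      have le: "(\<integral>x. \<bar>max (\<phi> x) (\<psi> x) - indicator (A \<union> B) x\<bar> \<partial>\<kappa>)
          \<le> (\<integral>x. \<bar>\<phi> x - indicator A x\<bar> \<partial>\<kappa>) + (\<integral>x. \<bar>\<psi> x - indicator B x\<bar> \<partial>\<kappa>)"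
        if \<kappa>: "torus_prob_measure \<kappa>" for \<kappa>
      proof -
        have i1: "integrable \<kappa> (\<lambda>x. \<bar>\<phi> x - indicator A x\<bar>)" and i2: "integrable \<kappa> (\<lambda>x. \<bar>\<psi> x - indicator B x\<bar>)"
          using \<phi> \<psi> AB by (auto simp: ok_def intro!: int[OF \<kappa>])
        have i3: "integrable \<kappa> (\<lambda>x. \<bar>max (\<phi> x) (\<psi> x) - indicator (A \<union> B) x\<bar>)"
          using \<phi> \<psi> AB by (intro int[OF \<kappa>]) (auto simp: ok_def le_max_iff_disj intro!: continuous_intros)
        have "(\<integral>x. \<bar>max (\<phi> x) (\<psi> x) - indicator (A \<union> B) x\<bar> \<partial>\<kappa>)
            \<le> (\<integral>x. \<bar>\<phi> x - indicator A x\<bar> + \<bar>\<psi> x - indicator B x\<bar> \<partial>\<kappa>)"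
          by (intro integral_mono i3 Bochner_Integration.integrable_add i1 i2)
            (use \<phi> \<psi> in \<open>auto simp: ok_def indicator_def abs_if max_def\<close>)
        then show ?thesis using i1 i2 by simp
      qed
      have "ok (A \<union> B) \<epsilon> (\<lambda>x. max (\<phi> x) (\<psi> x))"
        using \<phi> \<psi> le[OF \<mu>] le[OF \<nu>] unfolding ok_def
        by (auto simp: torus_periodic_def le_max_iff_disj intro!: continuous_intros)
      then show ?thesis by blast
    qed
    then show ?thesis using AB unfolding good_def by auto
  qed
  have pos: "good {x. 0 < F x}" if F: "continuous_on UNIV F" "torus_periodic F" for F :: "'a \<Rightarrow> real"
  proof -
    \<comment> \<open>Multiples of \<open>F\<close> clamped to \<open>[0, 1]\<close> converge
      pointwise to the indicator of its positivity set.\<close>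
    define \<phi> where "\<phi> = (\<lambda>j x. min 1 (max 0 (real j * F x)))"
    have S: "{x. 0 < F x} \<in> sets borel"
      using borel_measurable_continuous_onI[OF F(1)] by measurable
    have \<phi>c: "continuous_on UNIV (\<phi> j)" for j unfolding \<phi>_def by (intro continuous_intros F)
    have \<phi>b: "0 \<le> \<phi> j x \<and> \<phi> j x \<le> 1" for j x by (simp add: \<phi>_def)
    have ptw: "(\<lambda>j. \<bar>\<phi> j x - indicator {x. 0 < F x} x\<bar>) \<longlonglongrightarrow> 0" for x
    proof (cases "0 < F x")
      case True
      obtain J where J: "1 < real J * F x" using reals_Archimedean3[OF True] by blast
      have "\<bar>\<phi> j x - indicator {x. 0 < F x} x\<bar> = 0" if "J \<le> j" for j
      proof -
        have "real J * F x \<le> real j * F x" using that True by (intro mult_right_mono) auto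
        with J have "1 \<le> real j * F x" by linarith
        then have "\<phi> j x = 1" by (simp add: \<phi>_def)
        with True show ?thesis by simp
      qed
      then show ?thesis by (intro tendsto_eventually) (auto simp: eventually_sequentially)
    next
      case False
      then have "real j * F x \<le> 0" for j by (simp add: mult_nonneg_nonpos)
      then have "\<phi> j x = 0" for j by (simp add: \<phi>_def max_absorb1)
      with False show ?thesis by simp
    qed
    have lim: "(\<lambda>j. \<integral>x. \<bar>\<phi> j x - indicator {x. 0 < F x} x\<bar> \<partial>\<kappa>) \<longlonglongrightarrow> 0" if \<kappa>: "torus_prob_measure \<kappa>" for \<kappa>
    proof -
      interpret prob_space \<kappa> by (rule torus_prob_space[OF \<kappa>])
      have "(\<lambda>j. \<integral>x. \<bar>\<phi> j x - indicator {x. 0 < F x} x\<bar> \<partial>\<kappa>) \<longlonglongrightarrow> (\<integral>x. 0 \<partial>\<kappa>)"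
      proof (rule integral_dominated_convergence[where w="\<lambda>_. 1"])
        show "(\<lambda>x. \<bar>\<phi> j x - indicator {x. 0 < F x} x\<bar>) \<in> borel_measurable \<kappa>" for j
          by (rule borel_measurable_integrable[OF int[OF \<kappa> \<phi>c \<phi>b S]])
        show "AE x in \<kappa>. norm \<bar>\<phi> j x - indicator {x. 0 < F x} x\<bar> \<le> 1" for j
          using \<phi>b by (intro AE_I2) (auto simp: indicator_def)
      qed (use ptw in auto)
      then show ?thesis by simp
    qed
    have "\<exists>\<phi>. ok {x. 0 < F x} \<epsilon> \<phi>" if "0 < \<epsilon>" for \<epsilon>
    proof -
      have "eventually (\<lambda>j. (\<integral>x. \<bar>\<phi> j x - indicator {x. 0 < F x} x\<bar> \<partial>\<mu>) < \<epsilon> \<and>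
          (\<integral>x. \<bar>\<phi> j x - indicator {x. 0 < F x} x\<bar> \<partial>\<nu>) < \<epsilon>) sequentially"
        using order_tendstoD(2)[OF lim[OF \<mu>] that] order_tendstoD(2)[OF lim[OF \<nu>] that] by (rule eventually_conj)
      then obtain j where "(\<integral>x. \<bar>\<phi> j x - indicator {x. 0 < F x} x\<bar> \<partial>\<mu>) < \<epsilon>"
          "(\<integral>x. \<bar>\<phi> j x - indicator {x. 0 < F x} x\<bar> \<partial>\<nu>) < \<epsilon>"
        using eventually_happens'[OF sequentially_bot] by blast
      moreover have "torus_periodic (\<phi> j)" using F(2) by (simp add: \<phi>_def torus_periodic_def)
      ultimately have "ok {x. 0 < F x} \<epsilon> (\<phi> j)" using \<phi>c \<phi>b by (simp add: ok_def)
      then show ?thesis by blast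
    qed
    with S show ?thesis by (simp add: good_def)
  qed
  \<comment> \<open>The measures live on the cell, so sets that agree there are interchangeable; a
    half-space may be replaced by the trace of a periodic set.\<close>
  have cong: "good B" if "good A" "B \<in> sets borel" "A \<inter> torus_cell = B \<inter> torus_cell" for A B
  proof -
    have "(\<integral>x. \<bar>\<phi> x - indicator A x\<bar> \<partial>\<kappa>) = (\<integral>x. \<bar>\<phi> x - indicator B x\<bar> \<partial>\<kappa>)"
      if "torus_prob_measure \<kappa>" for \<phi> :: "'a \<Rightarrow> real" and \<kappa>
      by (rule torus_integral_cong[OF that]) (use \<open>A \<inter> torus_cell = B \<inter> torus_cell\<close> in \<open>auto simp: indicator_def\<close>)
    then have "ok A \<epsilon> \<phi> \<Longrightarrow> ok B \<epsilon> \<phi>" for \<epsilon> \<phi> using \<mu> \<nu> unfolding ok_def by simp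
    with that(1,2) show ?thesis unfolding good_def by blast
  qed
  have empty: "good {}" using pos[of "\<lambda>_. 0"] by (simp add: torus_periodic_def)
  have half: "good {x. x \<bullet> b < a}" if b: "b \<in> Basis" for a :: real and b :: 'a
  proof -
    have S: "{x. x \<bullet> b < a} \<in> sets borel" by measurable
    consider "a \<le> 0" | "1 \<le> a" | "0 < a" "a < 1" by linarith
    then show ?thesis
    proof cases
      case 1
      then show ?thesis by (intro cong[OF empty S]) (use b in \<open>force simp: torus_cell_def\<close>)
    next
      case 2
      then show ?thesis
        using compl[OF empty] by (intro cong[OF _ S, of UNIV]) (use b in \<open>force simp: torus_cell_def\<close>)+
    next
      case 3
      \<comment> \<open>On the cell, \<open>F\<close> is twice
        \<open>sin (pi * t) * sin (pi * (a - t))\<close> with \<open>t = x \<bullet> b\<close>,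
        which is positive exactly for \<open>0 < t < a\<close>. The face \<open>t = 0\<close>, also
        in the half-space, is the zero set of \<open>G\<close>.\<close>
      define F where "F = (\<lambda>x. cos (2 * pi * (x \<bullet> b) + - (pi * a)) + - cos (pi * a))"
      define G where "G = (\<lambda>x. 1/2 + (- 1/2) * cos (2 * pi * (x \<bullet> b) + 0))"
      have FG: "trig_poly F" "trig_poly G" unfolding F_def G_def
        by (intro trig_poly.add trig_poly.mult trig_poly.const trig_poly.cos b)+
      have F_eq: "F x = 2 * (sin (pi * (x \<bullet> b)) * sin (pi * (a - x \<bullet> b)))" for x
      proof -
        have e: "pi * (x \<bullet> b) - pi * (a - x \<bullet> b) = 2 * pi * (x \<bullet> b) + - (pi * a)"
          "pi * (x \<bullet> b) + pi * (a - x \<bullet> b) = pi * a" by (simp_all add: algebra_simps)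
        show ?thesis
          using sin_times_sin[of "pi * (x \<bullet> b)" "pi * (a - x \<bullet> b)"] unfolding F_def e by simp
      qed
      have G_eq: "G x = (sin (pi * (x \<bullet> b)))\<^sup>2" for x
        using cos_double_sin[of "pi * (x \<bullet> b)"] by (simp add: G_def mult.assoc field_simps)
      have "good (- {x. 0 < G x} \<union> {x. 0 < F x})"
        by (intro union compl pos trig_poly_continuous trig_poly_periodic FG)
      then show ?thesis
      proof (rule cong[OF _ S])
        have "(\<not> 0 < G x \<or> 0 < F x) \<longleftrightarrow> x \<bullet> b < a" if x: "x \<in> torus_cell" for x
        proof -
          have t: "0 \<le> x \<bullet> b" "x \<bullet> b < 1" using x b by (auto simp: torus_cell_def)
          show ?thesis
          proof (cases "x \<bullet> b = 0")
            case True then show ?thesis using 3 by (simp add: G_eq)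
          next
            case False
            have s1: "0 < sin (pi * (x \<bullet> b))" using t False by (intro sin_gt_zero) auto
            then have "0 < G x" by (simp add: G_eq)
            moreover have "0 < F x \<longleftrightarrow> x \<bullet> b < a"
            proof
              assume "x \<bullet> b < a"
              then have "0 < sin (pi * (a - x \<bullet> b))" using t 3 by (intro sin_gt_zero) auto
              then show "0 < F x" using s1 by (simp add: F_eq)
            next
              assume "0 < F x"
              then have s2: "0 < sin (pi * (a - x \<bullet> b))" using s1 by (simp add: F_eq zero_less_mult_iff)
              show "x \<bullet> b < a"
              proof (rule ccontr)
                assume "\<not> x \<bullet> b < a"
                then have "0 \<le> sin (pi * (x \<bullet> b - a))" using t 3 by (intro sin_ge_zero) auto
                moreover have "sin (pi * (a - x \<bullet> b)) = - sin (pi * (x \<bullet> b - a))"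
                  by (simp add: sin_minus[symmetric] algebra_simps del: sin_minus)
                ultimately show False using s2 by simp
              qed
            qed
            ultimately show ?thesis by simp
          qed
        qed
        then show "(- {x. 0 < G x} \<union> {x. 0 < F x}) \<inter> torus_cell = {x. x \<bullet> b < a} \<inter> torus_cell" by auto
      qed
    qed
  qed
  have count: "good (\<Union>i::nat. A i)" if g: "\<And>i. good (A i)" for A
  proof -
    \<comment> \<open>Finite unions are approximable and converge to the countable one in both
      \<open>L^1\<close> spaces by dominated convergence; half of the tolerance goes to each
      step.\<close>
    have fin: "good (\<Union>i<N. A i)" for N
      by (induction N) (auto simp: lessThan_Suc empty intro!: union g)
    have AS: "A i \<in> sets borel" for i using g by (auto simp: good_def)
    have S: "(\<Union>i. A i) \<in> sets borel" "(\<Union>i<N. A i) \<in> sets borel" for N using AS by auto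
    have lim: "(\<lambda>N. \<integral>x. \<bar>indicator (\<Union>i<N. A i) x - indicator (\<Union>i. A i) x :: real\<bar> \<partial>\<kappa>) \<longlonglongrightarrow> 0"
      if \<kappa>: "torus_prob_measure \<kappa>" for \<kappa>
    proof -
      interpret prob_space \<kappa> by (rule torus_prob_space[OF \<kappa>])
      have "(\<lambda>N. \<integral>x. \<bar>indicator (\<Union>i<N. A i) x - indicator (\<Union>i. A i) x :: real\<bar> \<partial>\<kappa>) \<longlonglongrightarrow> (\<integral>x. 0 \<partial>\<kappa>)"
      proof (rule integral_dominated_convergence[where w="\<lambda>_. 1"])
        show "(\<lambda>x. \<bar>indicator (\<Union>i<N. A i) x - indicator (\<Union>i. A i) x\<bar> :: real) \<in> borel_measurable \<kappa>" for N
          by (intro borel_measurable_integrable integrable_abs Bochner_Integration.integrable_diff indi[OF \<kappa>] S)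
        have "(\<lambda>N. \<bar>indicator (\<Union>i<N. A i) x - indicator (\<Union>i. A i) x :: real\<bar>) \<longlonglongrightarrow> 0" for x
        proof (cases "x \<in> (\<Union>i. A i)")
          case True
          then obtain i where "x \<in> A i" by blast
          then have "\<bar>indicator (\<Union>i<N. A i) x - indicator (\<Union>i. A i) x :: real\<bar> = 0" if "Suc i \<le> N" for N
            using that by (auto simp: indicator_def)
          then show ?thesis by (intro tendsto_eventually) (auto simp: eventually_sequentially)
        qed (auto simp: indicator_def)
        then show "AE x in \<kappa>. (\<lambda>N. \<bar>indicator (\<Union>i<N. A i) x - indicator (\<Union>i. A i) x :: real\<bar>) \<longlonglongrightarrow> 0" by simp
      qed (auto simp: indicator_def)
      then show ?thesis by simp
    qed
    have "\<exists>\<phi>. ok (\<Union>i. A i) \<epsilon> \<phi>" if "0 < \<epsilon>" for \<epsilon>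
    proof -
      have e2: "0 < \<epsilon> / 2" using that by simp
      have "eventually (\<lambda>N. (\<integral>x. \<bar>indicator (\<Union>i<N. A i) x - indicator (\<Union>i. A i) x :: real\<bar> \<partial>\<mu>) < \<epsilon> / 2 \<and>
          (\<integral>x. \<bar>indicator (\<Union>i<N. A i) x - indicator (\<Union>i. A i) x :: real\<bar> \<partial>\<nu>) < \<epsilon> / 2) sequentially"
        using order_tendstoD(2)[OF lim[OF \<mu>] e2] order_tendstoD(2)[OF lim[OF \<nu>] e2] by (rule eventually_conj)
      then obtain N where N: "(\<integral>x. \<bar>indicator (\<Union>i<N. A i) x - indicator (\<Union>i. A i) x :: real\<bar> \<partial>\<mu>) < \<epsilon> / 2"
          "(\<integral>x. \<bar>indicator (\<Union>i<N. A i) x - indicator (\<Union>i. A i) x :: real\<bar> \<partial>\<nu>) < \<epsilon> / 2"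
        using eventually_happens'[OF sequentially_bot] by blast
      obtain \<phi> where \<phi>: "ok (\<Union>i<N. A i) (\<epsilon> / 2) \<phi>" using fin e2 unfolding good_def by blast
      have le: "(\<integral>x. \<bar>\<phi> x - indicator (\<Union>i. A i) x\<bar> \<partial>\<kappa>)
          \<le> (\<integral>x. \<bar>\<phi> x - indicator (\<Union>i<N. A i) x\<bar> \<partial>\<kappa>) + (\<integral>x. \<bar>indicator (\<Union>i<N. A i) x - indicator (\<Union>i. A i) x\<bar> \<partial>\<kappa>)"
        if \<kappa>: "torus_prob_measure \<kappa>" for \<kappa>
      proof -
        have i1: "integrable \<kappa> (\<lambda>x. \<bar>\<phi> x - indicator (\<Union>i<N. A i) x\<bar>)" "integrable \<kappa> (\<lambda>x. \<bar>\<phi> x - indicator (\<Union>i. A i) x\<bar>)"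
          using \<phi> S by (auto simp: ok_def intro!: int[OF \<kappa>])
        have i2: "integrable \<kappa> (\<lambda>x. \<bar>indicator (\<Union>i<N. A i) x - indicator (\<Union>i. A i) x :: real\<bar>)"
          using S by (intro integrable_abs Bochner_Integration.integrable_diff indi[OF \<kappa>])
        have "(\<integral>x. \<bar>\<phi> x - indicator (\<Union>i. A i) x\<bar> \<partial>\<kappa>)
            \<le> (\<integral>x. \<bar>\<phi> x - indicator (\<Union>i<N. A i) x\<bar> + \<bar>indicator (\<Union>i<N. A i) x - indicator (\<Union>i. A i) x\<bar> \<partial>\<kappa>)"
          by (intro integral_mono i1 i2 Bochner_Integration.integrable_add) linarith
        then show ?thesis using i1 i2 by simp
      qed
      have "ok (\<Union>i. A i) \<epsilon> \<phi>"
        using \<phi> le[OF \<mu>] le[OF \<nu>] N unfolding ok_def by auto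
      then show ?thesis by blast
    qed
    with S show ?thesis by (simp add: good_def)
  qed
  have "A \<in> sigma_sets UNIV ((\<lambda>(a, i). {x::'a. x \<bullet> i < a}) ` (UNIV \<times> Basis))"
  proof -
    have "A \<in> sets (sigma UNIV ((\<lambda>(a, i). {x::'a. x \<bullet> i < a}) ` (UNIV \<times> Basis)))"
      using A borel_eq_halfspace_less by metis
    then show ?thesis by simp
  qed
  then have "good A"
  proof (induction rule: sigma_sets.induct)
    case (Basic a) then show ?case using half by auto
  next
    case (Compl a) then show ?case using compl by (simp add: Compl_eq_Diff_UNIV)
  qed (auto intro: empty count)
  with \<open>0 < \<epsilon>\<close> obtain \<phi> where "ok A \<epsilon> \<phi>" unfolding good_def by blast
  with that show ?thesis unfolding ok_def by blast
qed

text \<open>The dual bound first forces absolute continuity, by testing with approximate indicators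
  of null sets. With the density \<open>h\<close> at hand, testing with truncations of
  \<open>h - 1\<close> makes the bound self-improving, and Fatou removes the truncation.\<close>

lemma chi2_le_of_dual_bound:
  fixes \<mu> \<nu> :: "'a::euclidean_space measure"
  assumes \<mu>: "torus_prob_measure \<mu>" and \<nu>: "torus_prob_measure \<nu>" and "0 \<le> r"
    and dual: "\<And>\<phi>. continuous_on UNIV \<phi> \<Longrightarrow> torus_periodic \<phi> \<Longrightarrow>
      \<bar>(\<integral>x. \<phi> x \<partial>\<mu>) - (\<integral>x. \<phi> x \<partial>\<nu>)\<bar> \<le> r * sqrt (\<integral>x. (\<phi> x)\<^sup>2 \<partial>\<nu>)"
  shows "chi2 \<mu> \<nu> \<le> ennreal (r\<^sup>2)"
proof -
  interpret M: prob_space \<mu> by (rule torus_prob_space[OF \<mu>])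
  interpret N: prob_space \<nu> by (rule torus_prob_space[OF \<nu>])
  have sets_eq: "sets \<mu> = sets \<nu>" by (simp add: torus_prob_sets[OF \<mu>] torus_prob_sets[OF \<nu>])
  have meas: "f \<in> borel_measurable \<mu> \<longleftrightarrow> f \<in> borel_measurable \<nu>" for f :: "'a \<Rightarrow> real"
    using measurable_cong_sets[OF sets_eq refl] by blast
  have borel: "A \<in> sets borel" if "A \<in> sets \<nu>" for A
    using that unfolding torus_prob_sets[OF \<nu>] by (simp add: sets_restrict_space_iff)
  have ac: "absolutely_continuous \<nu> \<mu>"
    unfolding absolutely_continuous_def
  proof
    fix A assume "A \<in> null_sets \<nu>"
    then have A: "A \<in> sets \<nu>" "measure \<nu> A = 0" by (auto simp: measure_def)
    then have A\<mu>: "A \<in> sets \<mu>" by (simp add: sets_eq)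
    \<comment> \<open>For \<open>\<phi>\<close> with values in \<open>[0, 1]\<close> the integral of
      its square is at most that of \<open>\<phi>\<close>, which is at most
      \<open>\<epsilon>\<close> under \<open>\<nu>\<close>; the dual bound then contributes
      \<open>r * sqrt \<epsilon>\<close>.\<close>
    have bound: "measure \<mu> A \<le> \<epsilon> + (\<epsilon> + r * sqrt \<epsilon>)" if e: "0 < \<epsilon>" for \<epsilon>
    proof -
      obtain \<phi> where \<phi>: "continuous_on UNIV \<phi>" "torus_periodic \<phi>" "\<And>x. 0 \<le> \<phi> x \<and> \<phi> x \<le> 1"
        and \<phi>\<mu>: "(\<integral>x. \<bar>\<phi> x - indicator A x\<bar> \<partial>\<mu>) < \<epsilon>" and \<phi>\<nu>: "(\<integral>x. \<bar>\<phi> x - indicator A x\<bar> \<partial>\<nu>) < \<epsilon>"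
        by (rule continuous_approx_indicator[OF \<mu> \<nu> borel[OF A(1)] e]) (rule that)
      have i\<mu>: "integrable \<mu> \<phi>" "integrable \<mu> (indicator A :: 'a \<Rightarrow> real)"
        using A\<mu> by (auto intro!: torus_integrable_continuous[OF \<mu> \<phi>(1)] simp: less_top[symmetric])
      have i\<nu>: "integrable \<nu> \<phi>" "integrable \<nu> (indicator A :: 'a \<Rightarrow> real)"
        using A by (auto intro!: torus_integrable_continuous[OF \<nu> \<phi>(1)] simp: less_top[symmetric])
      have "\<bar>(\<integral>x. \<phi> x - indicator A x \<partial>\<mu>)\<bar> \<le> (\<integral>x. \<bar>\<phi> x - indicator A x\<bar> \<partial>\<mu>)" by (rule integral_abs_bound)
      then have 1: "measure \<mu> A \<le> (\<integral>x. \<phi> x \<partial>\<mu>) + \<epsilon>" using \<phi>\<mu> i\<mu> A\<mu> by simp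
      have "\<bar>(\<integral>x. \<phi> x - indicator A x \<partial>\<nu>)\<bar> \<le> (\<integral>x. \<bar>\<phi> x - indicator A x\<bar> \<partial>\<nu>)" by (rule integral_abs_bound)
      then have 2: "(\<integral>x. \<phi> x \<partial>\<nu>) \<le> \<epsilon>" using \<phi>\<nu> i\<nu> A by simp
      have "(\<integral>x. (\<phi> x)\<^sup>2 \<partial>\<nu>) \<le> (\<integral>x. \<phi> x \<partial>\<nu>)"
        using \<phi>(3) by (intro integral_mono i\<nu> torus_integrable_continuous[OF \<nu>] continuous_intros \<phi>(1))
          (auto simp: power2_eq_square mult_left_le)
      with 2 have "sqrt (\<integral>x. (\<phi> x)\<^sup>2 \<partial>\<nu>) \<le> sqrt \<epsilon>" by (intro real_sqrt_le_mono) linarith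
      then have "r * sqrt (\<integral>x. (\<phi> x)\<^sup>2 \<partial>\<nu>) \<le> r * sqrt \<epsilon>" using \<open>0 \<le> r\<close> by (intro mult_left_mono)
      with dual[OF \<phi>(1,2)] 1 2 show ?thesis by linarith
    qed
    have lim: "((\<lambda>\<epsilon>. \<epsilon> + (\<epsilon> + r * sqrt \<epsilon>)) \<longlongrightarrow> 0 + (0 + r * sqrt 0)) (at_right 0)"
      by (intro tendsto_intros)
    have "measure \<mu> A \<le> 0 + (0 + r * sqrt 0)"
    proof (rule tendsto_lowerbound[OF lim])
      show "eventually (\<lambda>\<epsilon>. measure \<mu> A \<le> \<epsilon> + (\<epsilon> + r * sqrt \<epsilon>)) (at_right 0)"
        by (rule eventually_at_rightI[of 0 1]) (simp_all only: bound greaterThanLessThan_iff zero_less_one)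
    qed simp
    then have "measure \<mu> A = 0" using measure_nonneg[of \<mu> A] by simp
    then show "A \<in> null_sets \<mu>" using A\<mu> by (auto simp: M.emeasure_eq_measure)
  qed
  define h where "h = (\<lambda>x. enn2real (RN_deriv \<nu> \<mu> x))"
  have h0: "0 \<le> h x" for x by (simp add: h_def)
  have hm[measurable]: "h \<in> borel_measurable \<nu>" unfolding h_def by measurable
  have "AE x in \<nu>. RN_deriv \<nu> \<mu> x \<noteq> \<infinity>"
    by (rule N.RN_deriv_finite[OF M.sigma_finite_measure_axioms ac sets_eq])
  then have "AE x in \<nu>. RN_deriv \<nu> \<mu> x = ennreal (h x)"
    by eventually_elim (simp add: h_def less_top)
  then have \<mu>h: "\<mu> = density \<nu> (\<lambda>x. ennreal (h x))"
    using N.density_RN_deriv[OF ac sets_eq] density_cong[of "RN_deriv \<nu> \<mu>" \<nu> "\<lambda>x. ennreal (h x)"] by simp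
  have int\<mu>: "integrable \<mu> F \<longleftrightarrow> integrable \<nu> (\<lambda>x. h x * F x)" "(\<integral>x. F x \<partial>\<mu>) = (\<integral>x. h x * F x \<partial>\<nu>)"
    if F: "F \<in> borel_measurable \<nu>" for F :: "'a \<Rightarrow> real"
    by (subst \<mu>h, subst integrable_real_density; use F h0 in simp) (subst \<mu>h, subst integral_real_density; use F h0 in simp)
  \<comment> \<open>The sum of \<open>\<nu>\<close> and \<open>\<mu>\<close> as one measure:
    closeness in its \<open>L^1\<close> space is closeness for both at once.\<close>
  define \<kappa> where "\<kappa> = density \<nu> (\<lambda>x. ennreal (1 + h x))"
  have int\<kappa>: "integrable \<kappa> F \<longleftrightarrow> integrable \<nu> (\<lambda>x. (1 + h x) * F x)" "(\<integral>x. F x \<partial>\<kappa>) = (\<integral>x. (1 + h x) * F x \<partial>\<nu>)"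
    if F: "F \<in> borel_measurable \<nu>" for F :: "'a \<Rightarrow> real"
    unfolding \<kappa>_def by (subst integrable_real_density; use F h0 in simp) (subst integral_real_density; use F h0 in simp)
  have sum\<kappa>: "integrable \<kappa> F" "(\<integral>x. F x \<partial>\<kappa>) = (\<integral>x. F x \<partial>\<nu>) + (\<integral>x. F x \<partial>\<mu>)"
    if "integrable \<nu> F" "integrable \<mu> F" for F :: "'a \<Rightarrow> real"
  proof -
    have F: "F \<in> borel_measurable \<nu>" using that(1) by simp
    have i: "integrable \<nu> (\<lambda>x. h x * F x)" using that(2) int\<mu>(1)[OF F] by simp
    have eq: "(\<lambda>x. (1 + h x) * F x) = (\<lambda>x. F x + h x * F x)" by (simp add: distrib_right)
    show "integrable \<kappa> F" using that(1) i unfolding int\<kappa>(1)[OF F] eq by simp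
    show "(\<integral>x. F x \<partial>\<kappa>) = (\<integral>x. F x \<partial>\<nu>) + (\<integral>x. F x \<partial>\<mu>)"
      using that(1) i unfolding int\<kappa>(2)[OF F] int\<mu>(2)[OF F] eq by simp
  qed
  have sets\<kappa>: "sets \<kappa> = sets \<nu>" by (simp add: \<kappa>_def)
  have bdd: "integrable \<nu> F" "integrable \<mu> F" "integrable \<kappa> F"
    if "F \<in> borel_measurable \<nu>" "\<And>x. \<bar>F x\<bar> \<le> B" for F :: "'a \<Rightarrow> real" and B
  proof -
    show 1: "integrable \<nu> F" by (rule N.integrable_const_bound[where B=B]) (use that in auto)
    show 2: "integrable \<mu> F" by (rule M.integrable_const_bound[where B=B]) (use that meas in auto)
    show "integrable \<kappa> F" by (rule sum\<kappa>(1)[OF 1 2])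
  qed
  have cper_meas: "\<phi> \<in> borel_measurable \<nu>" if "continuous_on UNIV \<phi>" for \<phi> :: "'a \<Rightarrow> real"
    by (intro torus_prob_measurable[OF \<nu>] borel_measurable_continuous_onI that)
  have cper: "integrable \<kappa> \<phi>" if "continuous_on UNIV \<phi>" for \<phi> :: "'a \<Rightarrow> real"
    by (intro sum\<kappa>(1) torus_integrable_continuous[OF \<nu>] torus_integrable_continuous[OF \<mu>] that)
  \<comment> \<open>Density of continuous periodic functions in \<open>L^1\<close>, by the induction
    over integrable functions; the base case is \<open>continuous_approx_indicator\<close>.\<close>
  have dense: "\<forall>\<epsilon>>0. \<exists>\<psi>. continuous_on UNIV \<psi> \<and> torus_periodic \<psi> \<and> (\<integral>x. \<bar>f x - \<psi> x\<bar> \<partial>\<kappa>) < \<epsilon>"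
    if "integrable \<kappa> f" for f :: "'a \<Rightarrow> real"
    using that
  proof (induction rule: integrable_induct)
    case (base A c)
    then have A: "A \<in> sets \<nu>" by (simp add: sets\<kappa>)
    show ?case
    proof (intro allI impI)
      fix \<epsilon> :: real assume "0 < \<epsilon>"
      define a where "a = \<bar>c\<bar> + 1"
      have a: "0 < a" "\<bar>c\<bar> < a" by (simp_all add: a_def add_nonneg_pos)
      define e where "e = \<epsilon> / (2 * a)"
      have e: "0 < e" using \<open>0 < \<epsilon>\<close> a by (simp add: e_def)
      obtain \<phi> where \<phi>: "continuous_on UNIV \<phi>" "torus_periodic \<phi>"
        "\<And>x. 0 \<le> \<phi> x \<and> \<phi> x \<le> 1"
        "(\<integral>x. \<bar>\<phi> x - indicator A x\<bar> \<partial>\<mu>) < e" "(\<integral>x. \<bar>\<phi> x - indicator A x\<bar> \<partial>\<nu>) < e"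
        by (rule continuous_approx_indicator[OF \<mu> \<nu> borel[OF A] e]) (rule that)
      have m: "(\<lambda>x. \<bar>\<phi> x - indicator A x\<bar>) \<in> borel_measurable \<nu>"
        using cper_meas[OF \<phi>(1)] A by measurable
      have b: "\<bar>\<bar>\<phi> x - indicator A x\<bar>\<bar> \<le> 1" for x using \<phi>(3)[of x] by (auto simp: indicator_def)
      have "(\<integral>x. \<bar>indicator A x *\<^sub>R c - c * \<phi> x\<bar> \<partial>\<kappa>) = (\<integral>x. \<bar>c\<bar> * \<bar>\<phi> x - indicator A x\<bar> \<partial>\<kappa>)"
        by (intro Bochner_Integration.integral_cong refl)
          (simp add: abs_mult[symmetric] abs_minus_commute right_diff_distrib mult.commute)
      also have "\<dots> = \<bar>c\<bar> * ((\<integral>x. \<bar>\<phi> x - indicator A x\<bar> \<partial>\<nu>) + (\<integral>x. \<bar>\<phi> x - indicator A x\<bar> \<partial>\<mu>))"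
        using sum\<kappa>(2)[OF bdd(1,2)[OF m b]] by simp
      also have "\<dots> \<le> \<bar>c\<bar> * (e + e)" using \<phi> by (intro mult_left_mono) auto
      also have "\<dots> < a * (e + e)" using e a by (intro mult_strict_right_mono) auto
      also have "\<dots> = \<epsilon>" using a by (simp add: e_def)
      finally have "(\<integral>x. \<bar>indicator A x *\<^sub>R c - c * \<phi> x\<bar> \<partial>\<kappa>) < \<epsilon>" .
      then show "\<exists>\<psi>. continuous_on UNIV \<psi> \<and> torus_periodic \<psi> \<and> (\<integral>x. \<bar>indicator A x *\<^sub>R c - \<psi> x\<bar> \<partial>\<kappa>) < \<epsilon>"
        using \<phi>(1,2) by (intro exI[of _ "\<lambda>x. c * \<phi> x"]) (auto simp: torus_periodic_def intro!: continuous_intros)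
    qed
  next
    case (add f g)
    show ?case
    proof (intro allI impI)
      fix \<epsilon> :: real assume "0 < \<epsilon>"
      then have e2: "0 < \<epsilon> / 2" by simp
      obtain \<phi> \<psi> where \<phi>: "continuous_on UNIV \<phi>" "torus_periodic \<phi>" "(\<integral>x. \<bar>f x - \<phi> x\<bar> \<partial>\<kappa>) < \<epsilon> / 2"
        and \<psi>: "continuous_on UNIV \<psi>" "torus_periodic \<psi>" "(\<integral>x. \<bar>g x - \<psi> x\<bar> \<partial>\<kappa>) < \<epsilon> / 2"
        using add(3)[rule_format, OF e2] add(4)[rule_format, OF e2] by blast
      note i = add(1,2) cper[OF \<phi>(1)] cper[OF \<psi>(1)]
      have "(\<integral>x. \<bar>f x + g x - (\<phi> x + \<psi> x)\<bar> \<partial>\<kappa>) \<le> (\<integral>x. \<bar>f x - \<phi> x\<bar> + \<bar>g x - \<psi> x\<bar> \<partial>\<kappa>)"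
        using i by (intro integral_mono) auto
      also have "\<dots> < \<epsilon>" using i \<phi>(3) \<psi>(3) by simp
      finally show "\<exists>\<psi>. continuous_on UNIV \<psi> \<and> torus_periodic \<psi> \<and> (\<integral>x. \<bar>f x + g x - \<psi> x\<bar> \<partial>\<kappa>) < \<epsilon>"
        using \<phi>(1,2) \<psi>(1,2) by (intro exI[of _ "\<lambda>x. \<phi> x + \<psi> x"]) (auto simp: torus_periodic_def intro!: continuous_intros)
    qed
  next
    case (lim f s)
    have "(\<lambda>i. \<integral>x. \<bar>f x - s i x\<bar> \<partial>\<kappa>) \<longlonglongrightarrow> (\<integral>x. 0 \<partial>\<kappa>)"
    proof (rule integral_dominated_convergence[where w="\<lambda>x. 3 * \<bar>f x\<bar>"])
      show "AE x in \<kappa>. (\<lambda>i. \<bar>f x - s i x\<bar>) \<longlonglongrightarrow> 0"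
      proof (rule AE_I2)
        fix x assume "x \<in> space \<kappa>"
        then have "(\<lambda>i. \<bar>f x - s i x\<bar>) \<longlonglongrightarrow> \<bar>f x - f x\<bar>" by (intro tendsto_intros lim)
        then show "(\<lambda>i. \<bar>f x - s i x\<bar>) \<longlonglongrightarrow> 0" by simp
      qed
      show "AE x in \<kappa>. norm \<bar>f x - s i x\<bar> \<le> 3 * \<bar>f x\<bar>" for i
      proof (rule AE_I2)
        fix x assume "x \<in> space \<kappa>"
        then have "norm (s i x) \<le> 2 * norm (f x)" by (rule lim)
        then have "\<bar>s i x\<bar> \<le> 2 * \<bar>f x\<bar>" by simp
        then show "norm \<bar>f x - s i x\<bar> \<le> 3 * \<bar>f x\<bar>" by simp
      qed
    qed (use lim.hyps in \<open>auto intro!: borel_measurable_integrable\<close>)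
    then have z: "(\<lambda>i. \<integral>x. \<bar>f x - s i x\<bar> \<partial>\<kappa>) \<longlonglongrightarrow> 0" by simp
    show ?case
    proof (intro allI impI)
      fix \<epsilon> :: real assume "0 < \<epsilon>"
      then have e2: "0 < \<epsilon> / 2" by simp
      obtain i where i: "(\<integral>x. \<bar>f x - s i x\<bar> \<partial>\<kappa>) < \<epsilon> / 2"
        using eventually_happens'[OF sequentially_bot order_tendstoD(2)[OF z e2]] by blast
      obtain \<phi> where \<phi>: "continuous_on UNIV \<phi>" "torus_periodic \<phi>" "(\<integral>x. \<bar>s i x - \<phi> x\<bar> \<partial>\<kappa>) < \<epsilon> / 2"
        using lim.IH[of i, rule_format, OF e2] by blast
      have ii: "integrable \<kappa> (s i)" "integrable \<kappa> f" "integrable \<kappa> \<phi>"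
        by (rule lim, rule lim, rule cper[OF \<phi>(1)])
      have "(\<integral>x. \<bar>f x - \<phi> x\<bar> \<partial>\<kappa>) \<le> (\<integral>x. \<bar>f x - s i x\<bar> + \<bar>s i x - \<phi> x\<bar> \<partial>\<kappa>)"
        using ii by (intro integral_mono) auto
      also have "\<dots> < \<epsilon>" using ii i \<phi>(3) by simp
      finally show "\<exists>\<psi>. continuous_on UNIV \<psi> \<and> torus_periodic \<psi> \<and> (\<integral>x. \<bar>f x - \<psi> x\<bar> \<partial>\<kappa>) < \<epsilon>"
        using \<phi>(1,2) by blast
    qed
  qed
  \<comment> \<open>Set to zero, rather than clamped, where \<open>h - 1\<close> is large: then
    \<open>\<phi>^2 = (h - 1) * \<phi>\<close> holds everywhere.\<close>
  define \<phi> where "\<phi> = (\<lambda>K::nat. \<lambda>x. if \<bar>h x - 1\<bar> \<le> real K then h x - 1 else 0)"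
  have \<phi>m: "\<phi> K \<in> borel_measurable \<nu>" for K unfolding \<phi>_def by measurable
  have \<phi>b: "\<bar>\<phi> K x\<bar> \<le> real K" for K x by (simp add: \<phi>_def)
  have sq: "(\<integral>x. (\<phi> K x)\<^sup>2 \<partial>\<nu>) \<le> r\<^sup>2" for K
  proof -
    define S where "S = (\<integral>x. (\<phi> K x)\<^sup>2 \<partial>\<nu>)"
    have S0: "0 \<le> S" unfolding S_def by simp
    have sqb: "\<bar>(\<phi> K x)\<^sup>2\<bar> \<le> (real K)\<^sup>2" for x using \<phi>b[of K x] by (simp add: abs_le_square_iff[symmetric])
    have sqm: "(\<lambda>x. (\<phi> K x)\<^sup>2) \<in> borel_measurable \<nu>" using \<phi>m by measurable
    have i\<phi>: "integrable \<nu> (\<phi> K)" "integrable \<mu> (\<phi> K)" "integrable \<kappa> (\<phi> K)"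
      using bdd[OF \<phi>m \<phi>b] by auto
    \<comment> \<open>The squared norm of the truncation is the quantity that the dual bound
      estimates, so \<open>S \<le> r * sqrt S\<close> once the dual bound is extended to
      \<open>\<phi> K\<close>.\<close>
    have "S = (\<integral>x. h x * \<phi> K x - \<phi> K x \<partial>\<nu>)"
      unfolding S_def by (intro Bochner_Integration.integral_cong refl) (simp add: \<phi>_def power2_eq_square algebra_simps)
    also have "\<dots> = (\<integral>x. \<phi> K x \<partial>\<mu>) - (\<integral>x. \<phi> K x \<partial>\<nu>)"
      using i\<phi> int\<mu>[OF \<phi>m[of K]] by simp
    finally have S_eq: "S = (\<integral>x. \<phi> K x \<partial>\<mu>) - (\<integral>x. \<phi> K x \<partial>\<nu>)" .
    have bound: "S \<le> (\<epsilon> + \<epsilon>) + r * sqrt (S + 2 * real K * \<epsilon>)" if e: "0 < \<epsilon>" for \<epsilon>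
    proof -
      obtain \<psi>0 where \<psi>0: "continuous_on UNIV \<psi>0" "torus_periodic \<psi>0" "(\<integral>x. \<bar>\<phi> K x - \<psi>0 x\<bar> \<partial>\<kappa>) < \<epsilon>"
        using dense[OF i\<phi>(3), rule_format, OF e] by blast
      \<comment> \<open>Clamping to the range of \<open>\<phi> K\<close> does not increase the
        distance to it, and the common bound \<open>K\<close> turns \<open>L^1\<close> closeness
        into closeness of the squared norms.\<close>
      define \<psi> where "\<psi> = (\<lambda>x. min (real K) (max (- real K) (\<psi>0 x)))"
      have \<psi>: "continuous_on UNIV \<psi>" "torus_periodic \<psi>"
        using \<psi>0 unfolding \<psi>_def by (auto simp: torus_periodic_def intro!: continuous_intros)
      have \<psi>b: "\<bar>\<psi> x\<bar> \<le> real K" for x by (auto simp: \<psi>_def)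
      have clamp: "\<bar>\<phi> K x - \<psi> x\<bar> \<le> \<bar>\<phi> K x - \<psi>0 x\<bar>" for x using \<phi>b[of K x] by (auto simp: \<psi>_def)
      have dm: "(\<lambda>x. \<bar>\<phi> K x - \<psi> x\<bar>) \<in> borel_measurable \<nu>" using \<phi>m cper_meas[OF \<psi>(1)] by measurable
      have db: "\<bar>\<bar>\<phi> K x - \<psi> x\<bar>\<bar> \<le> real K + real K" for x using \<phi>b[of K x] \<psi>b[of x] by linarith
      note di = bdd[OF dm db]
      have "(\<integral>x. \<bar>\<phi> K x - \<psi> x\<bar> \<partial>\<kappa>) \<le> (\<integral>x. \<bar>\<phi> K x - \<psi>0 x\<bar> \<partial>\<kappa>)"
        by (intro integral_mono di clamp integrable_abs Bochner_Integration.integrable_diff i\<phi> cper \<psi>0)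
      then have "(\<integral>x. \<bar>\<phi> K x - \<psi> x\<bar> \<partial>\<nu>) + (\<integral>x. \<bar>\<phi> K x - \<psi> x\<bar> \<partial>\<mu>) < \<epsilon>"
        using \<psi>0(3) sum\<kappa>(2)[OF di(1,2)] by simp
      moreover have "0 \<le> (\<integral>x. \<bar>\<phi> K x - \<psi> x\<bar> \<partial>\<nu>)" "0 \<le> (\<integral>x. \<bar>\<phi> K x - \<psi> x\<bar> \<partial>\<mu>)" by simp_all
      ultimately have d\<nu>: "(\<integral>x. \<bar>\<phi> K x - \<psi> x\<bar> \<partial>\<nu>) \<le> \<epsilon>" and d\<mu>: "(\<integral>x. \<bar>\<phi> K x - \<psi> x\<bar> \<partial>\<mu>) \<le> \<epsilon>" by linarith+
      have i\<psi>: "integrable \<nu> \<psi>" "integrable \<mu> \<psi>"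
        by (intro torus_integrable_continuous[OF \<nu>] torus_integrable_continuous[OF \<mu>] \<psi>)+
      have "\<bar>\<integral>x. \<phi> K x - \<psi> x \<partial>\<mu>\<bar> \<le> \<epsilon>" using integral_abs_bound[of \<mu> "\<lambda>x. \<phi> K x - \<psi> x"] d\<mu> by linarith
      moreover have "\<bar>\<integral>x. \<phi> K x - \<psi> x \<partial>\<nu>\<bar> \<le> \<epsilon>" using integral_abs_bound[of \<nu> "\<lambda>x. \<phi> K x - \<psi> x"] d\<nu> by linarith
      ultimately have "S \<le> ((\<integral>x. \<psi> x \<partial>\<mu>) - (\<integral>x. \<psi> x \<partial>\<nu>)) + (\<epsilon> + \<epsilon>)"
        unfolding S_eq using i\<phi> i\<psi> by (simp add: abs_le_iff)
      also have "(\<integral>x. \<psi> x \<partial>\<mu>) - (\<integral>x. \<psi> x \<partial>\<nu>) \<le> r * sqrt (\<integral>x. (\<psi> x)\<^sup>2 \<partial>\<nu>)" using dual[OF \<psi>] by linarith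
      also have "(\<integral>x. (\<psi> x)\<^sup>2 \<partial>\<nu>) \<le> S + 2 * real K * \<epsilon>"
      proof -
        have "(\<integral>x. (\<psi> x)\<^sup>2 \<partial>\<nu>) \<le> (\<integral>x. (\<phi> K x)\<^sup>2 + 2 * real K * \<bar>\<phi> K x - \<psi> x\<bar> \<partial>\<nu>)"
        proof (intro integral_mono Bochner_Integration.integrable_add integrable_mult_right di bdd(1)[OF sqm sqb])
          show "integrable \<nu> (\<lambda>x. (\<psi> x)\<^sup>2)" by (intro torus_integrable_continuous[OF \<nu>] continuous_intros \<psi>)
          fix x
          have "(\<psi> x)\<^sup>2 - (\<phi> K x)\<^sup>2 = (\<psi> x + \<phi> K x) * (\<psi> x - \<phi> K x)" by (simp add: power2_eq_square algebra_simps)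
          also have "\<dots> \<le> \<bar>\<psi> x + \<phi> K x\<bar> * \<bar>\<psi> x - \<phi> K x\<bar>" by (simp add: abs_mult[symmetric])
          also have "\<dots> \<le> (2 * real K) * \<bar>\<psi> x - \<phi> K x\<bar>"
            using \<phi>b[of K x] \<psi>b[of x] by (intro mult_right_mono) auto
          finally show "(\<psi> x)\<^sup>2 \<le> (\<phi> K x)\<^sup>2 + 2 * real K * \<bar>\<phi> K x - \<psi> x\<bar>" by (simp add: abs_minus_commute)
        qed
        also have "\<dots> = S + 2 * real K * (\<integral>x. \<bar>\<phi> K x - \<psi> x\<bar> \<partial>\<nu>)"
          using di bdd(1)[OF sqm sqb] by (simp add: S_def)
        also have "\<dots> \<le> S + 2 * real K * \<epsilon>" using d\<nu> by (intro add_left_mono mult_left_mono) auto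
        finally show ?thesis .
      qed
      finally show ?thesis using \<open>0 \<le> r\<close> by (simp add: mult_left_mono add.commute)
    qed
    have lim: "((\<lambda>\<epsilon>. (\<epsilon> + \<epsilon>) + r * sqrt (S + 2 * real K * \<epsilon>)) \<longlongrightarrow> (0 + 0) + r * sqrt (S + 2 * real K * 0)) (at_right 0)"
      by (intro tendsto_intros)
    have "S \<le> (0 + 0) + r * sqrt (S + 2 * real K * 0)"
    proof (rule tendsto_lowerbound[OF lim])
      show "eventually (\<lambda>\<epsilon>. S \<le> (\<epsilon> + \<epsilon>) + r * sqrt (S + 2 * real K * \<epsilon>)) (at_right 0)"
        by (rule eventually_at_rightI[of 0 1]) (simp_all only: bound greaterThanLessThan_iff zero_less_one)
    qed simp
    then have "sqrt S * sqrt S \<le> r * sqrt S" using S0 by simp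
    have "sqrt S \<le> r"
    proof (cases "S = 0")
      case False
      then have "0 < sqrt S" using S0 by simp
      with \<open>sqrt S * sqrt S \<le> r * sqrt S\<close> show ?thesis by (rule mult_right_le_imp_le)
    qed (use \<open>0 \<le> r\<close> in simp)
    then have "(sqrt S)\<^sup>2 \<le> r\<^sup>2" using S0 by (intro power_mono) auto
    then show ?thesis using S0 by (simp add: S_def)
  qed
  have "chi2 \<mu> \<nu> = (\<integral>\<^sup>+x. ennreal ((h x - 1)\<^sup>2) \<partial>\<nu>)" using ac by (simp add: chi2_def h_def)
  also have "\<dots> \<le> (\<integral>\<^sup>+x. liminf (\<lambda>K. ennreal ((\<phi> K x)\<^sup>2)) \<partial>\<nu>)"
  proof (rule nn_integral_mono)
    fix x
    obtain K0 :: nat where K0: "\<bar>h x - 1\<bar> \<le> real K0" using real_arch_simple by blast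
    have "ennreal ((h x - 1)\<^sup>2) \<le> ennreal ((\<phi> K x)\<^sup>2)" if "K0 \<le> K" for K
    proof -
      have "\<bar>h x - 1\<bar> \<le> real K" using K0 that by linarith
      then show ?thesis by (simp add: \<phi>_def)
    qed
    then show "ennreal ((h x - 1)\<^sup>2) \<le> liminf (\<lambda>K. ennreal ((\<phi> K x)\<^sup>2))"
      by (intro Liminf_bounded) (auto simp: eventually_sequentially)
  qed
  also have "\<dots> \<le> liminf (\<lambda>K. \<integral>\<^sup>+x. ennreal ((\<phi> K x)\<^sup>2) \<partial>\<nu>)"
    using \<phi>m by (intro nn_integral_liminf) measurable
  also have "\<dots> \<le> ennreal (r\<^sup>2)"
  proof -
    have "(\<integral>\<^sup>+x. ennreal ((\<phi> K x)\<^sup>2) \<partial>\<nu>) \<le> ennreal (r\<^sup>2)" for K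
    proof -
      have "integrable \<nu> (\<lambda>x. (\<phi> K x)\<^sup>2)"
        using \<phi>m \<phi>b[of K] by (intro N.integrable_const_bound[where B="(real K)\<^sup>2"]) (auto simp: abs_le_square_iff[symmetric])
      then have "(\<integral>\<^sup>+x. ennreal ((\<phi> K x)\<^sup>2) \<partial>\<nu>) = ennreal (\<integral>x. (\<phi> K x)\<^sup>2 \<partial>\<nu>)"
        by (intro nn_integral_eq_integral) auto
      then show ?thesis using sq by (simp add: ennreal_leI)
    qed
    then have "liminf (\<lambda>K. \<integral>\<^sup>+x. ennreal ((\<phi> K x)\<^sup>2) \<partial>\<nu>) \<le> limsup (\<lambda>K. ennreal (r\<^sup>2))"
      by (intro order_trans[OF Liminf_le_Limsup Limsup_mono]) auto
    then show ?thesis by (simp add: Limsup_const)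
  qed
  finally show ?thesis .
qed

section \<open>Effect of mollification on drifts and on the divergence\<close>

lemma mollify_oscillation:
  fixes D :: "'a::euclidean_space \<Rightarrow> 'c::euclidean_space" and \<rho> :: "'a \<Rightarrow> real"
  assumes \<mu>: "torus_prob_measure \<mu>" and \<rho>: "continuous_on UNIV \<rho>" "\<And>z. 0 \<le> \<rho> z"
    and D: "continuous_on UNIV D" "\<And>y. norm (D y) \<le> B"
    and near: "\<And>y. (\<And>b. b \<in> Basis \<Longrightarrow> (sin (pi * ((x - y) \<bullet> b)))\<^sup>2 < \<delta>) \<Longrightarrow> norm (D y - D x) \<le> \<eta>"
    and tail: "\<And>z b. b \<in> Basis \<Longrightarrow> \<delta> \<le> (sin (pi * (z \<bullet> b)))\<^sup>2 \<Longrightarrow> \<rho> z \<le> \<epsilon>"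
    and "0 \<le> \<eta>" "0 \<le> \<epsilon>"
  shows "norm ((\<integral>y. \<rho> (x - y) *\<^sub>R D y \<partial>\<mu>) - mollify \<rho> \<mu> x *\<^sub>R D x) \<le> \<eta> * mollify \<rho> \<mu> x + 2 * B * \<epsilon>"
proof -
  interpret prob_space \<mu> by (rule torus_prob_space[OF \<mu>])
  note cc = continuous_intros continuous_on_compose2[OF \<rho>(1)] D(1)
  note I = torus_integrable_continuous[OF \<mu>]
  have B: "0 \<le> B" using D(2)[of x] norm_ge_zero[of "D x"] by linarith
  have i1: "integrable \<mu> (\<lambda>y. \<rho> (x - y) *\<^sub>R D y)" and i2: "integrable \<mu> (\<lambda>y. \<rho> (x - y))"
    by (intro I cc; auto)+
  have "(\<integral>y. \<rho> (x - y) *\<^sub>R D y \<partial>\<mu>) - mollify \<rho> \<mu> x *\<^sub>R D x = (\<integral>y. \<rho> (x - y) *\<^sub>R D y - \<rho> (x - y) *\<^sub>R D x \<partial>\<mu>)"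
    using i1 i2 by (simp add: mollify_def)
  also have "norm \<dots> \<le> (\<integral>y. norm (\<rho> (x - y) *\<^sub>R D y - \<rho> (x - y) *\<^sub>R D x) \<partial>\<mu>)"
    by (rule integral_norm_bound)
  also have "\<dots> \<le> (\<integral>y. \<eta> * \<rho> (x - y) + 2 * B * \<epsilon> \<partial>\<mu>)"
  proof (intro integral_mono I cc)
    fix y
    have e: "norm (\<rho> (x - y) *\<^sub>R D y - \<rho> (x - y) *\<^sub>R D x) = \<rho> (x - y) * norm (D y - D x)"
      using \<rho>(2)[of "x - y"] by (simp add: scaleR_diff_right[symmetric])
    show "norm (\<rho> (x - y) *\<^sub>R D y - \<rho> (x - y) *\<^sub>R D x) \<le> \<eta> * \<rho> (x - y) + 2 * B * \<epsilon>"
    \<comment> \<open>In a far direction the kernel is at most \<open>\<epsilon>\<close> and the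
      oscillation of \<open>D\<close> at most \<open>2 * B\<close>; near \<open>x\<close> the
      oscillation is at most \<open>\<eta>\<close> and the kernel supplies its own mass.\<close>
    proof (cases "\<exists>b\<in>Basis. \<delta> \<le> (sin (pi * ((x - y) \<bullet> b)))\<^sup>2")
      case True
      then have r: "\<rho> (x - y) \<le> \<epsilon>" using tail by blast
      have "norm (D y - D x) \<le> norm (D y) + norm (D x)" by (rule norm_triangle_ineq4)
      also have "\<dots> \<le> 2 * B" using D(2)[of y] D(2)[of x] by simp
      finally have "\<rho> (x - y) * norm (D y - D x) \<le> \<epsilon> * (2 * B)"
        using r \<open>0 \<le> \<epsilon>\<close> by (intro mult_mono) auto
      moreover have "0 \<le> \<eta> * \<rho> (x - y)" using \<rho>(2)[of "x - y"] \<open>0 \<le> \<eta>\<close> by simp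
      ultimately show ?thesis unfolding e by (simp add: mult_ac)
    next
      case False
      then have "norm (D y - D x) \<le> \<eta>" by (intro near) force
      then have "\<rho> (x - y) * norm (D y - D x) \<le> \<rho> (x - y) * \<eta>" using \<rho>(2) by (intro mult_left_mono)
      moreover have "0 \<le> 2 * B * \<epsilon>" using B \<open>0 \<le> \<epsilon>\<close> by simp
      ultimately show ?thesis unfolding e by (simp add: mult_ac)
    qed
  qed auto
  also have "\<dots> = \<eta> * mollify \<rho> \<mu> x + 2 * B * \<epsilon>"
    using i2 by (simp add: mollify_def prob_space)
  finally show ?thesis .
qed

lemma mollify_lebesgue_even:
  fixes \<rho> :: "'a::euclidean_space \<Rightarrow> real"
  assumes "continuous_on UNIV \<rho>" "torus_periodic \<rho>" "\<And>z. \<rho> (- z) = \<rho> z"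
  shows "mollify \<rho> torus_lebesgue x = LI \<rho>"
proof -
  have "mollify \<rho> torus_lebesgue x = LI (\<lambda>y. \<rho> (y - x))"
    unfolding mollify_def using assms(3)[of "_ - x"] by simp
  then show ?thesis by (simp only: LI_translate_kernel[OF assms(1,2)])
qed

text \<open>Two replacements, each by \<open>mollify_oscillation\<close>: the drift is frozen at
  \<open>x\<close> under the kernel \<open>\<rho>\<close>, and the opponent is replaced by its
  mollification. The latter is done by moving \<open>\<sigma>\<close> onto \<open>kx\<close> in the
  second variable, for which \<open>\<sigma>\<close> has to be even.\<close>

lemma mollified_drift_close:
  fixes kx :: "'a::euclidean_space \<Rightarrow> 'b::euclidean_space \<Rightarrow> 'a" and \<rho> :: "'a \<Rightarrow> real" and \<sigma> :: "'b \<Rightarrow> real"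
  assumes \<mu>: "torus_prob_measure \<mu>" and \<kappa>: "torus_prob_measure \<kappa>"
    and kx: "continuous_on UNIV (\<lambda>(x, y). kx x y)" "\<And>x y. norm (kx x y) \<le> B"
    and nearx: "\<And>x x' y. (\<And>b. b \<in> Basis \<Longrightarrow> (sin (pi * ((x - x') \<bullet> b)))\<^sup>2 < \<delta>) \<Longrightarrow> norm (kx x' y - kx x y) \<le> \<eta>"
    and neary: "\<And>x y y'. (\<And>b. b \<in> Basis \<Longrightarrow> (sin (pi * ((y - y') \<bullet> b)))\<^sup>2 < \<delta>) \<Longrightarrow> norm (kx x y' - kx x y) \<le> \<eta>"
    and \<rho>: "continuous_on UNIV \<rho>" "\<And>z. 0 \<le> \<rho> z"
      "\<And>z b. b \<in> Basis \<Longrightarrow> \<delta> \<le> (sin (pi * (z \<bullet> b)))\<^sup>2 \<Longrightarrow> \<rho> z \<le> \<epsilon>"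
    and \<sigma>: "continuous_on UNIV \<sigma>" "torus_periodic \<sigma>" "\<And>z. 0 \<le> \<sigma> z" "LI \<sigma> = 1" "\<And>z. \<sigma> (- z) = \<sigma> z"
      "\<And>z b. b \<in> Basis \<Longrightarrow> \<delta> \<le> (sin (pi * (z \<bullet> b)))\<^sup>2 \<Longrightarrow> \<sigma> z \<le> \<epsilon>"
    and "0 \<le> \<eta>" "0 \<le> \<epsilon>"
  shows "norm ((\<integral>y. \<rho> (x - y) *\<^sub>R (\<integral>z. kx y z \<partial>\<kappa>) \<partial>\<mu>)
      - mollify \<rho> \<mu> x *\<^sub>R (\<integral>y. mollify \<sigma> \<kappa> y *\<^sub>R kx x y \<partial>torus_lebesgue))
    \<le> (2 * (\<eta> + 2 * B * \<epsilon>)) * (1 + mollify \<rho> \<mu> x)"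
proof -
  interpret K: prob_space \<kappa> by (rule torus_prob_space[OF \<kappa>])
  note L = torus_prob_measure_lebesgue
  define D where "D = (\<lambda>x. \<integral>z. kx x z \<partial>\<kappa>)"
  define Dq where "Dq = (\<integral>y. mollify \<sigma> \<kappa> y *\<^sub>R kx x y \<partial>torus_lebesgue)"
  have B: "0 \<le> B" using kx(2)[of x undefined] norm_ge_zero[of "kx x undefined"] by linarith
  have Dc: "continuous_on UNIV D" unfolding D_def by (rule continuous_torus_integral[OF \<kappa> kx(1)])
  have kc: "continuous_on UNIV (kx y)" for y by (rule continuous_on_slices[OF kx(1)])
  have p0: "0 \<le> mollify \<rho> \<mu> x" by (rule mollify_nonneg[OF \<rho>(2)])
  have 1: "norm ((\<integral>y. \<rho> (x - y) *\<^sub>R D y \<partial>\<mu>) - mollify \<rho> \<mu> x *\<^sub>R D x) \<le> \<eta> * mollify \<rho> \<mu> x + 2 * B * \<epsilon>"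
  proof (rule mollify_oscillation[OF \<mu> \<rho>(1,2) Dc _ _ \<rho>(3) \<open>0 \<le> \<eta>\<close> \<open>0 \<le> \<epsilon>\<close>])
    show "norm (D y) \<le> B" for y unfolding D_def by (rule torus_integral_norm_bound[OF \<kappa> kx(2) B])
    fix y assume n: "\<And>b. b \<in> Basis \<Longrightarrow> (sin (pi * ((x - y) \<bullet> b)))\<^sup>2 < \<delta>"
    have "D y - D x = (\<integral>z. kx y z - kx x z \<partial>\<kappa>)"
      unfolding D_def by (intro Bochner_Integration.integral_diff[symmetric] torus_integrable_continuous[OF \<kappa>] kc)
    also have "norm \<dots> \<le> \<eta>"
      by (intro torus_integral_norm_bound[OF \<kappa>] nearx n \<open>0 \<le> \<eta>\<close>)
    finally show "norm (D y - D x) \<le> \<eta>" .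
  qed
  have "Dq = (\<integral>y. (\<integral>z. \<sigma> (y - z) *\<^sub>R kx x y \<partial>\<kappa>) \<partial>torus_lebesgue)"
    unfolding Dq_def
  proof (intro Bochner_Integration.integral_cong refl)
    fix y
    have "integrable \<kappa> (\<lambda>z. \<sigma> (y - z))"
      by (intro torus_integrable_continuous[OF \<kappa>] continuous_on_compose2[OF \<sigma>(1)] continuous_intros) auto
    then show "mollify \<sigma> \<kappa> y *\<^sub>R kx x y = (\<integral>z. \<sigma> (y - z) *\<^sub>R kx x y \<partial>\<kappa>)" by (simp add: mollify_def)
  qed
  also have "\<dots> = (\<integral>z. (\<integral>y. \<sigma> (y - z) *\<^sub>R kx x y \<partial>torus_lebesgue) \<partial>\<kappa>)"
    by (rule torus_Fubini[OF \<kappa> L])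
      (auto simp: case_prod_beta intro!: continuous_intros continuous_on_compose2[OF \<sigma>(1)] continuous_on_compose2[OF kc])
  also have "\<dots> - D x = (\<integral>z. (\<integral>y. \<sigma> (y - z) *\<^sub>R kx x y \<partial>torus_lebesgue) - kx x z \<partial>\<kappa>)"
  proof -
    have "continuous_on UNIV (\<lambda>z. \<integral>y. \<sigma> (y - z) *\<^sub>R kx x y \<partial>torus_lebesgue)"
      by (rule continuous_torus_integral[OF L])
        (auto simp: case_prod_beta intro!: continuous_intros continuous_on_compose2[OF \<sigma>(1)] continuous_on_compose2[OF kc])
    then show ?thesis unfolding D_def
      by (intro Bochner_Integration.integral_diff[symmetric] torus_integrable_continuous[OF \<kappa>] kc)
  qed
  also have "norm \<dots> \<le> \<eta> + 2 * B * \<epsilon>"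
  proof (rule torus_integral_norm_bound[OF \<kappa>])
    fix z :: 'b
    have one: "mollify \<sigma> torus_lebesgue z = 1" using mollify_lebesgue_even[OF \<sigma>(1,2,5)] \<sigma>(4) by simp
    have "norm ((\<integral>y. \<sigma> (z - y) *\<^sub>R kx x y \<partial>torus_lebesgue) - mollify \<sigma> torus_lebesgue z *\<^sub>R kx x z)
        \<le> \<eta> * mollify \<sigma> torus_lebesgue z + 2 * B * \<epsilon>"
      by (rule mollify_oscillation[OF L \<sigma>(1,3) kc kx(2) neary \<sigma>(6) \<open>0 \<le> \<eta>\<close> \<open>0 \<le> \<epsilon>\<close>])
    moreover have "\<sigma> (z - y) = \<sigma> (y - z)" for y using \<sigma>(5)[of "y - z"] by simp
    ultimately show "norm ((\<integral>y. \<sigma> (y - z) *\<^sub>R kx x y \<partial>torus_lebesgue) - kx x z) \<le> \<eta> + 2 * B * \<epsilon>"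
      unfolding one by simp
  qed (use \<open>0 \<le> \<eta>\<close> \<open>0 \<le> \<epsilon>\<close> B in simp)
  finally have 2: "norm (Dq - D x) \<le> \<eta> + 2 * B * \<epsilon>" .
  have "(\<integral>y. \<rho> (x - y) *\<^sub>R D y \<partial>\<mu>) - mollify \<rho> \<mu> x *\<^sub>R Dq
      = ((\<integral>y. \<rho> (x - y) *\<^sub>R D y \<partial>\<mu>) - mollify \<rho> \<mu> x *\<^sub>R D x) - mollify \<rho> \<mu> x *\<^sub>R (Dq - D x)"
    by (simp add: scaleR_diff_right)
  also have "norm \<dots> \<le> (\<eta> * mollify \<rho> \<mu> x + 2 * B * \<epsilon>) + mollify \<rho> \<mu> x * (\<eta> + 2 * B * \<epsilon>)"
    using p0 by (intro order_trans[OF norm_triangle_ineq4] add_mono 1) (simp add: mult_left_mono 2)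
  also have "\<dots> \<le> (2 * (\<eta> + 2 * B * \<epsilon>)) * (1 + mollify \<rho> \<mu> x)"
  proof -
    have "0 \<le> 2 * B * \<epsilon>" "0 \<le> 2 * B * \<epsilon> * mollify \<rho> \<mu> x" using B \<open>0 \<le> \<epsilon>\<close> p0 by simp_all
    then show ?thesis using \<open>0 \<le> \<eta>\<close> by (simp add: algebra_simps)
  qed
  finally show ?thesis unfolding D_def Dq_def .
qed

lemma weighted_square_expand:
  assumes n: "prob_density n" and p: "continuous_on UNIV p" "LI p = 1"
  shows "LI (\<lambda>x. (p x * inverse (n x) - 1)\<^sup>2 * n x) = LI (\<lambda>x. (p x)\<^sup>2 * inverse (n x)) - 1"
proof -
  have nz: "n x \<noteq> 0" for x using prob_densityD(2)[OF n, of x] by simp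
  have ic: "continuous_on UNIV (\<lambda>x. inverse (n x))" by (intro continuous_intros prob_densityD(1)[OF n]) (use nz in auto)
  note cc = continuous_intros ic p(1) prob_densityD(1)[OF n]
  have "LI (\<lambda>x. (p x * inverse (n x) - 1)\<^sup>2 * n x) = LI (\<lambda>x. (p x)\<^sup>2 * inverse (n x) - (2 * p x - n x))"
    using nz by (intro Bochner_Integration.integral_cong refl) (simp add: power2_eq_square field_simps)
  also have "\<dots> = LI (\<lambda>x. (p x)\<^sup>2 * inverse (n x)) - LI (\<lambda>x. 2 * p x - n x)"
    by (intro Bochner_Integration.integral_diff torus_lebesgue_integrable cc) (use nz in auto)
  also have "LI (\<lambda>x. 2 * p x - n x) = LI (\<lambda>x. 2 * p x) - LI n"
    by (intro Bochner_Integration.integral_diff torus_lebesgue_integrable cc)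
  finally show ?thesis by (simp add: p(2) prob_densityD(4)[OF n])
qed

text \<open>Cauchy-Schwarz against the kernel moves the square inside the convolution.\<close>

lemma chi2_mollify_le:
  fixes \<mu> :: "'a::euclidean_space measure"
  assumes n: "prob_density n" and \<nu>: "\<nu> = density torus_lebesgue (\<lambda>x. ennreal (n x))" and \<mu>: "torus_prob_measure \<mu>"
    and fin: "chi2 \<mu> \<nu> \<noteq> \<infinity>"
    and \<rho>: "continuous_on UNIV \<rho>" "torus_periodic \<rho>" "\<And>z. 0 \<le> \<rho> z" "LI \<rho> = 1"
    and close: "\<And>x. mollify \<rho> \<nu> x \<le> (1 + \<eta>) * n x" and "0 \<le> \<eta>"
  shows "LI (\<lambda>x. (mollify \<rho> \<mu> x * inverse (n x) - 1)\<^sup>2 * n x) \<le> (1 + \<eta>) * (1 + enn2real (chi2 \<mu> \<nu>)) - 1"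
proof -
  note L = torus_prob_measure_lebesgue
  have \<nu>p: "torus_prob_measure \<nu>" unfolding \<nu> by (rule torus_density_prob[OF n])
  interpret M: prob_space \<mu> by (rule torus_prob_space[OF \<mu>])
  interpret N: prob_space \<nu> by (rule torus_prob_space[OF \<nu>p])
  have sets_eq: "sets \<mu> = sets \<nu>" by (simp add: torus_prob_sets[OF \<mu>] torus_prob_sets[OF \<nu>p])
  have ac: "absolutely_continuous \<nu> \<mu>" using fin by (auto simp: chi2_def split: if_splits)
  define h where "h = (\<lambda>x. enn2real (RN_deriv \<nu> \<mu> x))"
  define \<xi> where "\<xi> = enn2real (chi2 \<mu> \<nu>)"
  have h0: "0 \<le> h x" for x by (simp add: h_def)
  have hm[measurable]: "h \<in> borel_measurable \<nu>" unfolding h_def by measurable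
  have "AE x in \<nu>. RN_deriv \<nu> \<mu> x \<noteq> \<infinity>"
    by (rule N.RN_deriv_finite[OF M.sigma_finite_measure_axioms ac sets_eq])
  then have "AE x in \<nu>. RN_deriv \<nu> \<mu> x = ennreal (h x)"
    by eventually_elim (simp add: h_def less_top)
  then have \<mu>h: "\<mu> = density \<nu> (\<lambda>x. ennreal (h x))"
    using N.density_RN_deriv[OF ac sets_eq] density_cong[of "RN_deriv \<nu> \<mu>" \<nu> "\<lambda>x. ennreal (h x)"] by simp
  have chi: "chi2 \<mu> \<nu> = (\<integral>\<^sup>+x. ennreal ((h x - 1)\<^sup>2) \<partial>\<nu>)" using ac by (simp add: chi2_def h_def)
  then have sq1: "integrable \<nu> (\<lambda>x. (h x - 1)\<^sup>2)"
    using fin by (intro integrableI_nonneg) (auto simp: less_top)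
  have chi': "(\<integral>x. (h x - 1)\<^sup>2 \<partial>\<nu>) = \<xi>"
    unfolding \<xi>_def chi by (rule integral_eq_nn_integral) auto
  have "integrable (density \<nu> (\<lambda>x. ennreal (h x))) (\<lambda>x. 1 :: real)"
    "(\<integral>x. (1::real) \<partial>density \<nu> (\<lambda>x. ennreal (h x))) = 1"
    unfolding \<mu>h[symmetric] by (simp_all add: M.prob_space)
  note one = this
  have hi: "integrable \<nu> h"
    using one(1) integrable_real_density[of h \<nu> "\<lambda>x. 1", OF hm _ borel_measurable_const] h0 by simp
  have "(\<integral>x. h x \<partial>\<nu>) = (\<integral>x. h x * 1 \<partial>\<nu>)" by (simp only: mult_1_right)
  also have "\<dots> = (\<integral>x. 1 \<partial>density \<nu> (\<lambda>x. ennreal (h x)))"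
    by (rule integral_real_density[symmetric, OF hm _ borel_measurable_const]) (simp add: h0)
  finally have hi1: "(\<integral>x. h x \<partial>\<nu>) = 1" unfolding one(2) .
  have heq: "(h x)\<^sup>2 = (h x - 1)\<^sup>2 + (2 * h x - 1)" for x by (simp add: power2_eq_square algebra_simps)
  have h2: "integrable \<nu> (\<lambda>x. (h x)\<^sup>2)" unfolding heq using sq1 hi by simp
  have h2i: "(\<integral>x. (h x)\<^sup>2 \<partial>\<nu>) = 1 + \<xi>" unfolding heq using sq1 hi hi1 chi' by (simp add: N.prob_space)
  have \<xi>0: "0 \<le> \<xi>" by (simp add: \<xi>_def)
  define H where "H = 1 + \<xi>"
  have H: "0 < H" using \<xi>0 by (simp add: H_def)
  \<comment> \<open>The measure with density \<open>h^2\<close> is normalized by its mass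
    \<open>H = 1 + \<xi>\<close>, so that the facts on mollified probability measures apply and the
    integral of \<open>p2\<close> is 1.\<close>
  define \<mu>2 where "\<mu>2 = density \<nu> (\<lambda>x. ennreal ((h x)\<^sup>2 / H))"
  have \<mu>2: "torus_prob_measure \<mu>2"
  proof -
    have "(\<integral>\<^sup>+x. ennreal ((h x)\<^sup>2 / H) \<partial>\<nu>) = ennreal (\<integral>x. (h x)\<^sup>2 / H \<partial>\<nu>)"
      using h2 H by (intro nn_integral_eq_integral) auto
    also have "\<dots> = 1" using h2i H by (simp add: H_def)
    finally have "emeasure \<mu>2 (space \<mu>2) = 1"
      unfolding \<mu>2_def by (simp add: emeasure_density cong: nn_integral_cong_simp)
    then have "prob_space \<mu>2" by (rule prob_spaceI)
    then show ?thesis by (simp add: torus_prob_measure_def \<mu>2_def torus_prob_sets[OF \<nu>p])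
  qed
  define p where "p = mollify \<rho> \<mu>"
  define p2 where "p2 = mollify \<rho> \<mu>2"
  have pc: "continuous_on UNIV p" "continuous_on UNIV p2"
    unfolding p_def p2_def by (intro continuous_mollify \<mu> \<mu>2 \<rho>(1))+
  have \<rho>m: "(\<lambda>y. \<rho> (x - y)) \<in> borel_measurable \<nu>" and \<rho>i: "integrable \<nu> (\<lambda>y. \<rho> (x - y))" for x
  proof -
    have c: "continuous_on UNIV (\<lambda>y. \<rho> (x - y))" by (intro continuous_on_compose2[OF \<rho>(1)] continuous_intros) auto
    show "(\<lambda>y. \<rho> (x - y)) \<in> borel_measurable \<nu>"
      by (intro torus_prob_measurable[OF \<nu>p] borel_measurable_continuous_onI c)
    show "integrable \<nu> (\<lambda>y. \<rho> (x - y))" by (rule torus_integrable_continuous[OF \<nu>p c])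
  qed
  have CS: "(p x)\<^sup>2 \<le> (H * p2 x) * mollify \<rho> \<nu> x" for x
  proof -
    have px: "p x = (\<integral>y. h y * \<rho> (x - y) \<partial>\<nu>)" and hi': "integrable \<nu> (\<lambda>y. h y * \<rho> (x - y))"
    proof -
      have "integrable \<mu> (\<lambda>y. \<rho> (x - y))"
        by (intro torus_integrable_continuous[OF \<mu>] continuous_on_compose2[OF \<rho>(1)] continuous_intros) auto
      then show "integrable \<nu> (\<lambda>y. h y * \<rho> (x - y))" using \<rho>m h0 by (simp add: \<mu>h integrable_real_density)
      show "p x = (\<integral>y. h y * \<rho> (x - y) \<partial>\<nu>)"
        unfolding p_def mollify_def using \<rho>m h0 by (subst \<mu>h) (simp add: integral_real_density)
    qed
    have p2x: "H * p2 x = (\<integral>y. (h y)\<^sup>2 * \<rho> (x - y) \<partial>\<nu>)" and hi2: "integrable \<nu> (\<lambda>y. (h y)\<^sup>2 * \<rho> (x - y))"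
    proof -
      have "integrable \<mu>2 (\<lambda>y. \<rho> (x - y))"
        by (intro torus_integrable_continuous[OF \<mu>2] continuous_on_compose2[OF \<rho>(1)] continuous_intros) auto
      then have "integrable \<nu> (\<lambda>y. (h y)\<^sup>2 / H * \<rho> (x - y))"
        using \<rho>m H unfolding \<mu>2_def by (subst (asm) integrable_real_density) auto
      then have "integrable \<nu> (\<lambda>y. H * ((h y)\<^sup>2 / H * \<rho> (x - y)))" by (rule integrable_mult_right)
      then show "integrable \<nu> (\<lambda>y. (h y)\<^sup>2 * \<rho> (x - y))" using H by simp
      have "p2 x = (\<integral>y. (h y)\<^sup>2 / H * \<rho> (x - y) \<partial>\<nu>)"
        unfolding p2_def mollify_def \<mu>2_def using \<rho>m H by (subst integral_real_density) auto
      then have "H * p2 x = (\<integral>y. H * ((h y)\<^sup>2 / H * \<rho> (x - y)) \<partial>\<nu>)" by simp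
      then show "H * p2 x = (\<integral>y. (h y)\<^sup>2 * \<rho> (x - y) \<partial>\<nu>)" using H by simp
    qed
    have e: "(h y * sqrt (\<rho> (x - y)))\<^sup>2 = (h y)\<^sup>2 * \<rho> (x - y)" "(sqrt (\<rho> (x - y)))\<^sup>2 = \<rho> (x - y)"
      "(h y * sqrt (\<rho> (x - y))) * sqrt (\<rho> (x - y)) = h y * \<rho> (x - y)" for y
      using \<rho>(3)[of "x - y"] by (simp_all add: power_mult_distrib mult.assoc)
    have "\<bar>\<integral>y. (h y * sqrt (\<rho> (x - y))) * sqrt (\<rho> (x - y)) \<partial>\<nu>\<bar>
      \<le> sqrt (\<integral>y. (h y * sqrt (\<rho> (x - y)))\<^sup>2 \<partial>\<nu>) * sqrt (\<integral>y. (sqrt (\<rho> (x - y)))\<^sup>2 \<partial>\<nu>)"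
      by (rule integral_Cauchy_Schwarz) (simp_all only: e hi' hi2 \<rho>i)
    then have "\<bar>p x\<bar> \<le> sqrt (H * p2 x) * sqrt (mollify \<rho> \<nu> x)"
      unfolding e px p2x mollify_def .
    then have "\<bar>p x\<bar>\<^sup>2 \<le> (sqrt (H * p2 x) * sqrt (mollify \<rho> \<nu> x))\<^sup>2" by (intro power_mono) auto
    moreover have "0 \<le> H * p2 x" using H \<rho>(3) by (simp add: p2_def mollify_nonneg)
    moreover have "0 \<le> mollify \<rho> \<nu> x" by (rule mollify_nonneg[OF \<rho>(3)])
    ultimately show ?thesis by (simp add: power_mult_distrib)
  qed
  have nz: "n x \<noteq> 0" for x using prob_densityD(2)[OF n, of x] by simp
  have ic: "continuous_on UNIV (\<lambda>x. inverse (n x))" by (intro continuous_intros prob_densityD(1)[OF n]) (use nz in auto)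
  have "LI (\<lambda>x. (p x)\<^sup>2 * inverse (n x)) \<le> LI (\<lambda>x. (H * (1 + \<eta>)) * p2 x)"
  proof (intro integral_mono torus_lebesgue_integrable)
    fix x
    have np: "0 < n x" by (rule prob_densityD(2)[OF n])
    have H2: "0 \<le> H * p2 x" using H \<rho>(3) by (simp add: p2_def mollify_nonneg)
    have "(p x)\<^sup>2 \<le> (H * p2 x) * ((1 + \<eta>) * n x)"
      using CS[of x] mult_left_mono[OF close H2, of x] by linarith
    then have "(p x)\<^sup>2 * inverse (n x) \<le> (H * p2 x) * ((1 + \<eta>) * n x) * inverse (n x)"
      using np by (intro mult_right_mono) auto
    also have "(H * p2 x) * ((1 + \<eta>) * n x) * inverse (n x) = (H * (1 + \<eta>)) * p2 x" using np by simp
    finally show "(p x)\<^sup>2 * inverse (n x) \<le> (H * (1 + \<eta>)) * p2 x" .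
  qed (intro continuous_intros pc ic)+
  also have "\<dots> = H * (1 + \<eta>)"
    using LI_mollify[OF \<mu>2 \<rho>(1,2)] \<rho>(4) by (simp add: p2_def)
  finally have "LI (\<lambda>x. (p x)\<^sup>2 * inverse (n x)) \<le> H * (1 + \<eta>)" .
  moreover have "LI p = 1" unfolding p_def using LI_mollify[OF \<mu> \<rho>(1,2)] \<rho>(4) by simp
  ultimately show ?thesis
    using weighted_square_expand[OF n pc(1)] unfolding p_def[symmetric] \<xi>_def[symmetric] H_def
    by (simp add: mult.commute)
qed

text \<open>For each mollified density, weighted Cauchy-Schwarz bounds its difference from
  \<open>\<nu>\<close> on a test function by the root of its divergence. Both sides converge for a
  fixed \<open>\<phi>\<close>, and the limit is the dual bound of
  \<open>chi2_le_of_dual_bound\<close>.\<close>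

lemma chi2_lower_semicontinuous:
  fixes \<mu> :: "'a::euclidean_space measure" and \<rho> :: "nat \<Rightarrow> 'a \<Rightarrow> real"
  assumes n: "prob_density n" and \<nu>: "\<nu> = density torus_lebesgue (\<lambda>x. ennreal (n x))" and \<mu>: "torus_prob_measure \<mu>"
    and \<rho>: "\<And>j. continuous_on UNIV (\<rho> j)" "\<And>j. torus_periodic (\<rho> j)" "\<And>j. LI (\<rho> j) = 1"
    and approx: "\<And>\<phi> e. continuous_on UNIV \<phi> \<Longrightarrow> torus_periodic \<phi> \<Longrightarrow> 0 < e \<Longrightarrow>
      eventually (\<lambda>j. \<forall>y. \<bar>LI (\<lambda>x. \<phi> x * \<rho> j (x - y)) - \<phi> y\<bar> \<le> e) sequentially"
    and lim: "(\<lambda>j. LI (\<lambda>x. (mollify (\<rho> j) \<mu> x * inverse (n x) - 1)\<^sup>2 * n x)) \<longlonglongrightarrow> a"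
  shows "chi2 \<mu> \<nu> \<le> ennreal a"
proof -
  note L = torus_prob_measure_lebesgue
  interpret M: prob_space \<mu> by (rule torus_prob_space[OF \<mu>])
  have \<nu>p: "torus_prob_measure \<nu>" unfolding \<nu> by (rule torus_density_prob[OF n])
  have n0: "0 \<le> n x" and nz: "n x \<noteq> 0" for x using prob_densityD(2)[OF n, of x] by simp_all
  note nc = prob_densityD(1)[OF n]
  have ic: "continuous_on UNIV (\<lambda>x. inverse (n x))" by (intro continuous_intros nc) (use nz in auto)
  define X where "X = (\<lambda>j. LI (\<lambda>x. (mollify (\<rho> j) \<mu> x * inverse (n x) - 1)\<^sup>2 * n x))"
  have limX: "X \<longlonglongrightarrow> a" using lim by (simp add: X_def)
  have "0 \<le> X j" for j unfolding X_def using n0 by simp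
  then have a0: "0 \<le> a" using limX by (intro LIMSEQ_le_const) auto
  have "chi2 \<mu> \<nu> \<le> ennreal ((sqrt a)\<^sup>2)"
  proof (rule chi2_le_of_dual_bound[OF \<mu> \<nu>p])
    show "0 \<le> sqrt a" using a0 by simp
    fix \<phi> :: "'a \<Rightarrow> real" assume \<phi>: "continuous_on UNIV \<phi>" "torus_periodic \<phi>"
    have int\<nu>: "(\<integral>x. F x \<partial>\<nu>) = LI (\<lambda>x. F x * n x)" if "continuous_on UNIV F" for F :: "'a \<Rightarrow> real"
      unfolding \<nu> by (rule torus_density_integral[OF n that])
    define S where "S = sqrt (LI (\<lambda>x. (\<phi> x)\<^sup>2 * n x))"
    define A where "A = (\<lambda>j. LI (\<lambda>x. \<phi> x * mollify (\<rho> j) \<mu> x))"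
    have limA: "A \<longlonglongrightarrow> (\<integral>x. \<phi> x \<partial>\<mu>)"
    proof (rule LIMSEQ_I)
      fix e :: real assume "0 < e"
      then have e2: "0 < e / 2" by simp
      have "eventually (\<lambda>j. norm (A j - (\<integral>x. \<phi> x \<partial>\<mu>)) < e) sequentially"
        using approx[OF \<phi> e2]
      proof eventually_elim
        case (elim j)
        have c: "continuous_on UNIV (\<lambda>y. LI (\<lambda>x. \<phi> x * \<rho> j (x - y)))"
          by (rule continuous_torus_integral[OF L])
            (auto simp: case_prod_beta intro!: continuous_intros continuous_on_compose2[OF \<rho>(1)] continuous_on_compose2[OF \<phi>(1)])
        have "A j - (\<integral>x. \<phi> x \<partial>\<mu>) = (\<integral>y. LI (\<lambda>x. \<phi> x * \<rho> j (x - y)) - \<phi> y \<partial>\<mu>)"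
          unfolding A_def LI_mollify_mult[OF \<mu> \<rho>(1) \<phi>(1)]
          by (intro Bochner_Integration.integral_diff[symmetric] torus_integrable_continuous[OF \<mu>] c \<phi>(1))
        also have "norm \<dots> \<le> e / 2"
          using elim e2 by (intro torus_integral_norm_bound[OF \<mu>]) auto
        finally show ?case using \<open>0 < e\<close> by linarith
      qed
      then show "\<exists>no. \<forall>j\<ge>no. norm (A j - (\<integral>x. \<phi> x \<partial>\<mu>)) < e" by (simp add: eventually_sequentially)
    qed
    have bound: "\<bar>A j - (\<integral>x. \<phi> x \<partial>\<nu>)\<bar> \<le> S * sqrt (X j)" for j
    proof -
      define f where "f = (\<lambda>x. mollify (\<rho> j) \<mu> x * inverse (n x) - 1)"
      have mc: "continuous_on UNIV (mollify (\<rho> j) \<mu>)" by (rule continuous_mollify[OF \<mu> \<rho>(1)])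
      have fc: "continuous_on UNIV f" unfolding f_def by (intro continuous_intros mc ic)
      have "A j - (\<integral>x. \<phi> x \<partial>\<nu>) = LI (\<lambda>x. \<phi> x * mollify (\<rho> j) \<mu> x - \<phi> x * n x)"
        unfolding A_def int\<nu>[OF \<phi>(1)]
        by (intro Bochner_Integration.integral_diff[symmetric] torus_lebesgue_integrable continuous_intros \<phi>(1) mc nc)
      also have "\<dots> = LI (\<lambda>x. \<phi> x * f x * n x)"
        using nz by (intro Bochner_Integration.integral_cong refl) (simp add: f_def field_simps)
      finally show ?thesis
        using weighted_Cauchy_Schwarz[OF \<phi>(1) fc nc n0] unfolding S_def X_def f_def by simp
    qed
    have "\<bar>(\<integral>x. \<phi> x \<partial>\<mu>) - (\<integral>x. \<phi> x \<partial>\<nu>)\<bar> \<le> S * sqrt a"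
      by (rule LIMSEQ_le[OF tendsto_rabs[OF tendsto_diff[OF limA tendsto_const]]
            tendsto_mult[OF tendsto_const tendsto_real_sqrt[OF limX]]]) (use bound in blast)
    moreover have "(\<integral>x. (\<phi> x)\<^sup>2 \<partial>\<nu>) = LI (\<lambda>x. (\<phi> x)\<^sup>2 * n x)" by (intro int\<nu> continuous_intros \<phi>(1))
    ultimately show "\<bar>(\<integral>x. \<phi> x \<partial>\<mu>) - (\<integral>x. \<phi> x \<partial>\<nu>)\<bar> \<le> sqrt a * sqrt (\<integral>x. (\<phi> x)\<^sup>2 \<partial>\<nu>)"
      by (simp add: S_def mult.commute)
  qed
  then show ?thesis using a0 by simp
qed

section \<open>Removing the mollification\<close>

lemma torus_periodic_slices:
  fixes F :: "'a::euclidean_space \<times> 'b::euclidean_space \<Rightarrow> 'c"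
  assumes "torus_periodic F"
  shows "torus_periodic (\<lambda>x. F (x, y))" "torus_periodic (\<lambda>y. F (x, y))"
proof -
  have "F (x + b, y) = F (x, y)" if "b \<in> Basis" for b x
    using torus_periodicD[OF assms, of "(b, 0)" "(x, y)"] that by (simp add: Basis_prod_def)
  then show "torus_periodic (\<lambda>x. F (x, y))" by (simp add: torus_periodic_def)
  have "F (x, y + b) = F (x, y)" if "b \<in> Basis" for b y
    using torus_periodicD[OF assms, of "(0, b)" "(x, y)"] that by (simp add: Basis_prod_def)
  then show "torus_periodic (\<lambda>y. F (x, y))" by (simp add: torus_periodic_def)
qed

lemma C1_slices:
  fixes k :: "'a::euclidean_space \<times> 'b::euclidean_space \<Rightarrow> real"
  assumes "C1 k K"
  shows "C1 (\<lambda>x. k (x, y)) (\<lambda>x. fst (K (x, y)))" "C1 (\<lambda>y. k (x, y)) (\<lambda>y. snd (K (x, y)))"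
proof -
  note d = C1_has_derivative[OF assms] and c = continuous_on_compose2[OF C1_grad_continuous[OF assms]]
  show "C1 (\<lambda>x. k (x, y)) (\<lambda>x. fst (K (x, y)))"
    unfolding C1_def
  proof (intro conjI allI)
    show "continuous_on UNIV (\<lambda>x. fst (K (x, y)))" by (intro continuous_intros c) auto
    fix x :: 'a
    have "((\<lambda>x. (x, y)) has_derivative (\<lambda>h. (h, 0))) (at x)" by (auto intro!: derivative_eq_intros)
    then have "((\<lambda>x. k (x, y)) has_derivative (\<lambda>h. K (x, y) \<bullet> (h, 0))) (at x)"
      by (rule has_derivative_compose[OF _ d])
    then show "((\<lambda>x. k (x, y)) has_derivative (\<lambda>h. fst (K (x, y)) \<bullet> h)) (at x)"
      by (simp add: inner_prod_def)
  qed
  show "C1 (\<lambda>y. k (x, y)) (\<lambda>y. snd (K (x, y)))"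
    unfolding C1_def
  proof (intro conjI allI)
    show "continuous_on UNIV (\<lambda>y. snd (K (x, y)))" by (intro continuous_intros c) auto
    fix y :: 'b
    have "((\<lambda>y. (x, y)) has_derivative (\<lambda>h. (0, h))) (at y)" by (auto intro!: derivative_eq_intros)
    then have "((\<lambda>y. k (x, y)) has_derivative (\<lambda>h. K (x, y) \<bullet> (0, h))) (at y)"
      by (rule has_derivative_compose[OF _ d])
    then show "((\<lambda>y. k (x, y)) has_derivative (\<lambda>h. snd (K (x, y)) \<bullet> h)) (at y)"
      by (simp add: inner_prod_def)
  qed
qed

lemma C_k_2_imp_C1:
  assumes "C_k 2 k"
  shows "C1 k (gradient k)" and "b \<in> Basis \<Longrightarrow> C1 (pderivative b k) (gradient (pderivative b k))"
proof -
  have k: "k differentiable_on UNIV" and p: "\<And>b. b \<in> Basis \<Longrightarrow> C_k 1 (pderivative b k)"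
    using assms by (simp_all add: numeral_2_eq_2)
  show p1: "b \<in> Basis \<Longrightarrow> C1 (pderivative b k) (gradient (pderivative b k))" for b
    by (rule C_k_imp_C1[OF p])
  have "C_k 1 k" using k p1[THEN C1_continuous] by simp
  then show "C1 k (gradient k)" by (rule C_k_imp_C1)
qed

text \<open>Only the derivatives \<open>\<nabla>\<^sub>x\<partial>\<^sub>y\<close> in this order enter, so Schwarz' theorem is not needed.\<close>

lemma mixed_second_difference_bound:
  fixes k :: "'a::euclidean_space \<times> 'b::euclidean_space \<Rightarrow> real"
  assumes k: "C_k 2 k" "torus_periodic k"
  shows "0 \<le> M11 k"
    and "\<bar>k (x', y') - k (x, y') - k (x', y) + k (x, y)\<bar> \<le> M11 k * norm (x' - x) * norm (y' - y)"
proof -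
  define K where "K = gradient k"
  note K = C_k_2_imp_C1(1)[OF k(1), folded K_def]
  have Kp: "torus_periodic K" by (rule C1_periodic_grad[OF K k(2)])
  define w where "w = (\<lambda>c. pderivative (0, c) k)"
  have w: "C1 (w c) (gradient (w c))" if "c \<in> Basis" for c
    unfolding w_def by (rule C_k_2_imp_C1(2)[OF k(1)]) (use that in \<open>simp add: Basis_prod_def\<close>)
  have wK: "w c z = snd (K z) \<bullet> c" for c z
    unfolding w_def using pderivative_eq[OF C1_has_derivative[OF K]] by (simp add: inner_prod_def)
  have wp: "torus_periodic (w c)" for c using Kp unfolding wK[abs_def] by (simp add: torus_periodic_def)
  have mh: "mixed_hessian k z v = (\<Sum>c\<in>Basis. (v \<bullet> c) *\<^sub>R fst (gradient (w c) z))" for z v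
  proof -
    have "mixed_hessian k z v = (\<Sum>b\<in>Basis. \<Sum>c\<in>Basis. (v \<bullet> c) *\<^sub>R ((fst (gradient (w c) z) \<bullet> b) *\<^sub>R b))"
      unfolding mixed_hessian_def w_def[symmetric]
    proof (intro sum.cong refl)
      fix b :: 'a and c :: 'b assume "c \<in> Basis"
      then have "pderivative (b, 0) (w c) z = fst (gradient (w c) z) \<bullet> b"
        using pderivative_eq[OF C1_has_derivative[OF w]] by (simp add: inner_prod_def)
      then show "(pderivative (b, 0) (pderivative (0, c) k) z * (v \<bullet> c)) *\<^sub>R b
          = (v \<bullet> c) *\<^sub>R ((fst (gradient (w c) z) \<bullet> b) *\<^sub>R b)"
        by (simp add: w_def mult.commute)
    qed
    also have "\<dots> = (\<Sum>c\<in>Basis. \<Sum>b\<in>Basis. (v \<bullet> c) *\<^sub>R ((fst (gradient (w c) z) \<bullet> b) *\<^sub>R b))"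
      by (rule sum.swap)
    also have "\<dots> = (\<Sum>c\<in>Basis. (v \<bullet> c) *\<^sub>R fst (gradient (w c) z))"
      by (simp add: scaleR_sum_right[symmetric] euclidean_representation del: scaleR_scaleR)
    finally show ?thesis .
  qed
  have lin: "bounded_linear (mixed_hessian k z)" for z
    unfolding linear_conv_bounded_linear[symmetric] mh
    by (intro linearI) (simp_all add: inner_add_left scaleR_add_left sum.distrib scaleR_sum_right)
  have "\<exists>B. \<forall>z. norm (gradient (w c) z) \<le> B" if "c \<in> Basis" for c
    using torus_periodic_bounded[OF C1_grad_continuous[OF w[OF that]] C1_periodic_grad[OF w[OF that] wp]] by metis
  then obtain B where B: "\<And>c z. c \<in> Basis \<Longrightarrow> norm (gradient (w c) z) \<le> B c" by metis
  have "onorm (mixed_hessian k z) \<le> (\<Sum>c\<in>Basis. B c)" for z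
  proof (rule onorm_le)
    fix v :: 'b
    have "norm (mixed_hessian k z v) \<le> (\<Sum>c\<in>Basis. norm ((v \<bullet> c) *\<^sub>R fst (gradient (w c) z)))"
      unfolding mh by (rule norm_sum)
    also have "\<dots> \<le> (\<Sum>c\<in>Basis. B c * norm v)"
    proof (intro sum_mono)
      fix c :: 'b assume c: "c \<in> Basis"
      have "norm (fst (gradient (w c) z)) \<le> B c" using norm_fst_le[of "fst (gradient (w c) z)" "snd (gradient (w c) z)"] B[OF c, of z] by simp
      then show "norm ((v \<bullet> c) *\<^sub>R fst (gradient (w c) z)) \<le> B c * norm v"
        using mult_mono[OF _ Basis_le_norm[OF c, of v], of "norm (fst (gradient (w c) z))" "B c"]
          order_trans[OF norm_ge_zero \<open>norm (fst (gradient (w c) z)) \<le> B c\<close>] by (simp add: mult.commute)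
    qed
    finally show "norm (mixed_hessian k z v) \<le> (\<Sum>c\<in>Basis. B c) * norm v" by (simp add: sum_distrib_right)
  qed
  \<comment> \<open>The supremum in \<open>M11\<close> is over reals and bounds its members only
    once the family is known to be bounded; periodicity and continuity provide that.\<close>
  then have "bdd_above (range (\<lambda>z. onorm (mixed_hessian k z)))" by (auto simp: bdd_above_def)
  then have M: "onorm (mixed_hessian k z) \<le> M11 k" for z unfolding M11_def by (rule cSUP_upper2) auto
  show M0: "0 \<le> M11 k" using onorm_pos_le[OF lin, of undefined] M[of undefined] by linarith
  have step: "\<bar>snd (K (x', y)) \<bullet> v - snd (K (x, y)) \<bullet> v\<bar> \<le> (M11 k * norm v) * norm (x' - x)" for y v
  proof (rule C1_difference_bound)
    have "C1 (\<lambda>x. \<Sum>c\<in>Basis. (v \<bullet> c) * w c (x, y)) (\<lambda>x. \<Sum>c\<in>Basis. (v \<bullet> c) *\<^sub>R fst (gradient (w c) (x, y)))"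
      by (intro C1_sum C1_cmult C1_slices w)
    moreover have "snd (K z) \<bullet> v = (\<Sum>c\<in>Basis. (v \<bullet> c) * w c z)" for z
      by (subst euclidean_inner) (simp add: wK mult.commute)
    ultimately show "C1 (\<lambda>x. snd (K (x, y)) \<bullet> v) (\<lambda>x. mixed_hessian k (x, y) v)" by (simp add: mh)
    show "norm (mixed_hessian k (x, y) v) \<le> M11 k * norm v" for x
      using onorm[OF lin, of "(x, y)" v] mult_right_mono[OF M[of "(x, y)"], of "norm v"] by simp
  qed
  \<comment> \<open>The direction is taken to be the difference of the two gradients itself, which
    turns the directional bound \<open>step\<close> into one for the norm.\<close>
  have bound: "norm (snd (K (x', y)) - snd (K (x, y))) \<le> M11 k * norm (x' - x)" for y
  proof -
    define u where "u = snd (K (x', y)) - snd (K (x, y))"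
    have "norm u * norm u \<le> (M11 k * norm (x' - x)) * norm u"
      using step[of y u] by (simp add: u_def inner_diff_left[symmetric] dot_square_norm power2_eq_square mult_ac)
    then have "norm u \<le> M11 k * norm (x' - x)"
      using M0 by (cases "norm u = 0") (auto simp: mult_le_cancel_right)
    then show ?thesis by (simp add: u_def)
  qed
  have "\<bar>(k (x', y') - k (x, y')) - (k (x', y) - k (x, y))\<bar> \<le> (M11 k * norm (x' - x)) * norm (y' - y)"
    by (rule C1_difference_bound[OF C1_diff[OF C1_slices(2)[OF K] C1_slices(2)[OF K]] bound])
  then show "\<bar>k (x', y') - k (x, y') - k (x', y) + k (x, y)\<bar> \<le> M11 k * norm (x' - x) * norm (y' - y)"
    by (simp add: algebra_simps)
qed

text \<open>Passing to a smaller constant lets both players share \<open>c\<close>, the minimum of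
  their two constants.\<close>

lemma weighted_poincare_of_poincare:
  assumes n: "prob_density n" and \<nu>: "\<nu> = density torus_lebesgue (\<lambda>x. ennreal (n x))"
    and P: "poincare_inequality \<nu> c'" and c: "0 < c" "c \<le> c'"
  shows "weighted_poincare n c"
  unfolding weighted_poincare_def
proof (intro conjI allI impI c(1))
  fix f f' assume "C1 f f' \<and> torus_periodic f \<and> LI (\<lambda>x. f x * n x) = 0"
  then have f: "C1 f f'" "torus_periodic f" "LI (\<lambda>x. f x * n x) = 0" by auto
  note fc = C1_continuous[OF f(1)] and gc = C1_grad_continuous[OF f(1)]
  note int = torus_density_integral[OF n, folded \<nu>]
  have c': "0 < c'" using c by simp
  have "(\<integral>x. f x \<partial>\<nu>) = 0" using f(3) by (simp add: int fc)
  then have "(\<integral>x. \<bar>f x\<bar>\<^sup>2 \<partial>\<nu>) \<le> inverse c' * (\<integral>x. (norm (f' x))\<^sup>2 \<partial>\<nu>)"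
    using P f(2) C1_imp_C_k[OF f(1)] unfolding poincare_inequality_def C1_gradient[OF f(1), symmetric] by blast
  moreover have "(\<integral>x. \<bar>f x\<bar>\<^sup>2 \<partial>\<nu>) = LI (\<lambda>x. (f x)\<^sup>2 * n x)" "(\<integral>x. (norm (f' x))\<^sup>2 \<partial>\<nu>) = LI (\<lambda>x. (norm (f' x))\<^sup>2 * n x)"
    unfolding power2_abs by (intro int continuous_intros fc gc)+
  ultimately have "c' * LI (\<lambda>x. (f x)\<^sup>2 * n x) \<le> LI (\<lambda>x. (norm (f' x))\<^sup>2 * n x)"
    using c' by (simp add: field_simps)
  moreover have "0 \<le> LI (\<lambda>x. (f x)\<^sup>2 * n x)" using prob_densityD(3)[OF n] by simp
  ultimately show "c * LI (\<lambda>x. (f x)\<^sup>2 * n x) \<le> LI (\<lambda>x. (norm (f' x))\<^sup>2 * n x)"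
    using mult_right_mono[OF c(2)] by fastforce
qed

text \<open>Against a fixed opponent the equilibrium condition is the minimization of a free energy
  with potential \<open>V\<close>, so the Gibbs form applies; its logarithmic derivative gives the
  relation that \<open>torus_side\<close> asks for.\<close>

lemma gibbs_equilibrium_side:
  fixes k :: "'a::euclidean_space \<Rightarrow> 'b::euclidean_space \<Rightarrow> real"
  assumes "0 < \<tau>" and k: "continuous_on UNIV (\<lambda>(x, y). k x y)" "\<And>y. torus_periodic (\<lambda>x. k x y)"
    and kx: "continuous_on UNIV (\<lambda>(x, y). kx x y)" "\<And>y. C1 (\<lambda>x. k x y) (\<lambda>x. kx x y)"
    and \<nu>: "torus_prob_measure \<nu>" "finite_entropy \<nu>" and \<kappa>: "torus_prob_measure \<kappa>"
    and min: "\<And>\<mu>. torus_prob_measure \<mu> \<Longrightarrow> finite_entropy \<mu> \<Longrightarrow>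
      (\<integral>x. (\<integral>y. k x y \<partial>\<kappa>) \<partial>\<nu>) + \<tau> * boltzmann_entropy \<nu> \<le> (\<integral>x. (\<integral>y. k x y \<partial>\<kappa>) \<partial>\<mu>) + \<tau> * boltzmann_entropy \<mu>"
  obtains n n' where "prob_density n" "\<nu> = density torus_lebesgue (\<lambda>x. ennreal (n x))" "C1 n n'"
    "\<And>x. n' x = - (n x / \<tau>) *\<^sub>R (\<integral>y. kx x y \<partial>\<kappa>)"
proof -
  define V where "V = (\<lambda>x. \<integral>y. k x y \<partial>\<kappa>)"
  define G where "G = (\<lambda>x. \<integral>y. kx x y \<partial>\<kappa>)"
  define Z where "Z = LI (\<lambda>x. exp (- V x / \<tau>))"
  have V: "C1 V G" unfolding V_def G_def by (rule C1_torus_integral[OF \<kappa> k(1) kx(1)]) (rule kx(2))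
  have Vp: "torus_periodic V"
    unfolding V_def torus_periodic_def using torus_periodicD[OF k(2)] by (auto intro!: Bochner_Integration.integral_cong)
  define n where "n = (\<lambda>x. exp (- V x / \<tau>) / Z)"
  have g: "prob_density n" "\<nu> = density torus_lebesgue (\<lambda>x. ennreal (n x))"
    unfolding n_def Z_def
    by (rule gibbs_minimizer[OF \<open>0 < \<tau>\<close> C1_continuous[OF V] Vp \<nu>]; use min in \<open>simp add: V_def\<close>)+
  have "C1 (\<lambda>x. inverse Z * exp ((- 1 / \<tau>) * V x)) (\<lambda>x. inverse Z *\<^sub>R exp ((- 1 / \<tau>) * V x) *\<^sub>R (- 1 / \<tau>) *\<^sub>R G x)"
    by (intro C1_cmult C1_exp V)
  then have "C1 n (\<lambda>x. - (n x / \<tau>) *\<^sub>R G x)"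
    by (simp add: n_def divide_inverse mult_ac)
  then show ?thesis by (rule that[OF g]) (simp add: G_def)
qed

lemma density_integral_scaleR:
  fixes f :: "'b::euclidean_space \<Rightarrow> 'a::euclidean_space"
  assumes "prob_density m" "continuous_on UNIV f"
  shows "(\<integral>y. f y \<partial>density torus_lebesgue (\<lambda>y. ennreal (m y))) = (\<integral>y. m y *\<^sub>R f y \<partial>torus_lebesgue)"
  using assms prob_densityD(1,3)[OF assms(1)]
  by (intro integral_density) (auto intro!: torus_prob_measurable[OF torus_prob_measure_lebesgue] borel_measurable_continuous_onI)

section \<open>Choice of the kernels and passage to the limit\<close>

lemma mollifier_approx_identity:
  fixes \<rho> :: "nat \<Rightarrow> 'a::euclidean_space \<Rightarrow> real" and \<phi> :: "'a \<Rightarrow> real"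
  assumes \<rho>: "\<And>j. trig_poly (\<rho> j)" "\<And>j z. 0 \<le> \<rho> j z" "\<And>j. LI (\<rho> j) = 1" "\<And>j z. \<rho> j (- z) = \<rho> j z"
    and tail: "\<And>j z b. b \<in> Basis \<Longrightarrow> inverse (real (Suc j)) \<le> (sin (pi * (z \<bullet> b)))\<^sup>2 \<Longrightarrow> \<rho> j z \<le> inverse (real (Suc j))"
    and \<phi>: "continuous_on UNIV \<phi>" "torus_periodic \<phi>" and e: "0 < e"
  shows "eventually (\<lambda>j. \<forall>y. \<bar>LI (\<lambda>x. \<phi> x * \<rho> j (x - y)) - \<phi> y\<bar> \<le> e) sequentially"
proof -
  obtain B where B: "0 < B" "\<And>x. norm (\<phi> x) \<le> B" using torus_periodic_bounded[OF \<phi>] by blast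
  have "0 < e / 2" using e by simp
  then obtain \<delta> where \<delta>: "0 < \<delta>"
    "\<And>x y. \<forall>b\<in>Basis. (sin (pi * ((x - y) \<bullet> b)))\<^sup>2 < \<delta> \<Longrightarrow> dist (\<phi> x) (\<phi> y) < e / 2"
    by (rule torus_periodic_uniformly_continuous[OF \<phi>]) (rule that)
  have "eventually (\<lambda>j. inverse (real (Suc j)) < min \<delta> (e / (4 * B))) sequentially"
    using LIMSEQ_inverse_real_of_nat \<delta>(1) e B(1) by (intro order_tendstoD(2)) auto
  then show ?thesis
  proof eventually_elim
    case (elim j)
    define r where "r = inverse (real (Suc j))"
    have r: "0 \<le> r" "r \<le> \<delta>" "r \<le> e / (4 * B)" using elim by (simp_all add: r_def)
    show ?case
    proof
      fix y :: 'a
      have one: "mollify (\<rho> j) torus_lebesgue y = 1"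
        using mollify_lebesgue_even[OF trig_poly_continuous[OF \<rho>(1)] trig_poly_periodic[OF \<rho>(1)] \<rho>(4)] \<rho>(3) by simp
      have "norm ((\<integral>x. \<rho> j (y - x) *\<^sub>R \<phi> x \<partial>torus_lebesgue) - mollify (\<rho> j) torus_lebesgue y *\<^sub>R \<phi> y)
        \<le> e / 2 * mollify (\<rho> j) torus_lebesgue y + 2 * B * r"
      proof (rule mollify_oscillation[OF torus_prob_measure_lebesgue trig_poly_continuous[OF \<rho>(1)] \<rho>(2) \<phi>(1) B(2)])
        show "norm (\<phi> x - \<phi> y) \<le> e / 2" if "\<And>b. b \<in> Basis \<Longrightarrow> (sin (pi * ((y - x) \<bullet> b)))\<^sup>2 < \<delta>" for x
          using \<delta>(2)[of y x] that by (simp add: dist_norm abs_minus_commute less_imp_le)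
        show "\<rho> j z \<le> r" if "b \<in> Basis" "\<delta> \<le> (sin (pi * (z \<bullet> b)))\<^sup>2" for z b
          unfolding r_def using r(2) that by (intro tail[of b]) (auto simp: r_def)
      qed (use r e in auto)
      moreover have "2 * B * r \<le> e / 2" using r(3) B(1) by (simp add: field_simps)
      moreover have "(\<integral>x. \<rho> j (y - x) *\<^sub>R \<phi> x \<partial>torus_lebesgue) = LI (\<lambda>x. \<phi> x * \<rho> j (x - y))"
        using \<rho>(4)[of j "_ - y"] by (intro Bochner_Integration.integral_cong refl) (simp add: mult.commute)
      ultimately show "\<bar>LI (\<lambda>x. \<phi> x * \<rho> j (x - y)) - \<phi> y\<bar> \<le> e" unfolding one by simp
    qed
  qed
qed

lemma prob_density_lower_bound:
  assumes "prob_density n"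
  obtains a where "0 < a" "\<And>x. a \<le> n x"
proof -
  have pos: "0 < n x" for x by (rule prob_densityD(2)[OF assms])
  have "continuous_on UNIV (\<lambda>x. inverse (n x))"
    by (intro continuous_intros prob_densityD(1)[OF assms]) (use pos in \<open>auto simp: less_imp_neq[THEN not_sym]\<close>)
  moreover have "torus_periodic (\<lambda>x. inverse (n x))"
    using prob_densityD(5)[OF assms] by (simp add: torus_periodic_def)
  ultimately obtain B where B: "0 < B" "\<And>x. norm (inverse (n x)) \<le> B" by (metis torus_periodic_bounded)
  have "inverse B \<le> n x" for x
    using B(2)[of x] pos[of x] B(1) by (simp add: inverse_le_imp_le)
  then show ?thesis using B(1) by (intro that[of "inverse B"]) auto
qed

text \<open>A displacement in one factor has vanishing sine terms in the other, so the modulus of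
  continuity on the product serves both variables.\<close>

lemma torus_modulus_common:
  fixes kx :: "'a::euclidean_space \<Rightarrow> 'b::euclidean_space \<Rightarrow> 'c::euclidean_space"
  assumes kx: "continuous_on UNIV (\<lambda>(x, y). kx x y)" "torus_periodic (\<lambda>(x, y). kx x y)" and "0 < \<eta>"
  obtains \<delta> where "0 < \<delta>"
    "\<And>x x' y. \<forall>b\<in>Basis. (sin (pi * ((x - x') \<bullet> b)))\<^sup>2 < \<delta> \<Longrightarrow> norm (kx x' y - kx x y) \<le> \<eta>"
    "\<And>x y y'. \<forall>b\<in>Basis. (sin (pi * ((y - y') \<bullet> b)))\<^sup>2 < \<delta> \<Longrightarrow> norm (kx x y' - kx x y) \<le> \<eta>"
proof -
  obtain \<delta> where \<delta>: "0 < \<delta>"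
    "\<And>z w. \<forall>b\<in>Basis. (sin (pi * ((z - w) \<bullet> b)))\<^sup>2 < \<delta> \<Longrightarrow>
      dist (case z of (x, y) \<Rightarrow> kx x y) (case w of (x, y) \<Rightarrow> kx x y) < \<eta>"
    by (rule torus_periodic_uniformly_continuous[OF kx \<open>0 < \<eta>\<close>]) (rule that)
  show ?thesis
  proof (rule that[OF \<delta>(1)])
    fix x x' :: 'a and y :: 'b assume "\<forall>b\<in>Basis. (sin (pi * ((x - x') \<bullet> b)))\<^sup>2 < \<delta>"
    then show "norm (kx x' y - kx x y) \<le> \<eta>"
      using \<delta>(1) \<delta>(2)[of "(x, y)" "(x', y)"] by (fastforce simp: Basis_prod_def dist_norm norm_minus_commute)
  next
    fix x :: 'a and y y' :: 'b assume "\<forall>b\<in>Basis. (sin (pi * ((y - y') \<bullet> b)))\<^sup>2 < \<delta>"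
    then show "norm (kx x y' - kx x y) \<le> \<eta>"
      using \<delta>(1) \<delta>(2)[of "(x, y)" "(x, y')"] by (fastforce simp: Basis_prod_def dist_norm norm_minus_commute)
  qed
qed

text \<open>One pair of kernels has to meet the requirements of both players, because each kernel
  acts as \<open>\<rho>\<close> for one and as \<open>\<sigma>\<close> for the other. The pointwise
  majorants for the mollified equilibrium are needed for the initial divergence, evenness and tails
  for the limit.\<close>

lemma mollified_sides_exist:
  fixes k :: "'a::euclidean_space \<Rightarrow> 'b::euclidean_space \<Rightarrow> real"
  assumes A: "torus_side \<tau> c M k kx ky n n' m \<mu> \<kappa>"
    and B: "torus_side \<tau> c M (\<lambda>y x. - k x y) (\<lambda>y x. - ky x y) (\<lambda>y x. - kx x y) m m' n \<kappa> \<mu>"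
    and per: "torus_periodic (\<lambda>(x, y). kx x y)" "torus_periodic (\<lambda>(y, x). - ky x y)"
    and \<eta>: "0 < \<eta>"
  obtains \<rho> \<rho>' \<sigma> \<sigma>' where
    "mollified_side \<tau> c M k kx ky n n' m \<mu> \<kappa> \<rho> \<rho>' \<sigma> \<eta>"
    "mollified_side \<tau> c M (\<lambda>y x. - k x y) (\<lambda>y x. - ky x y) (\<lambda>y x. - kx x y) m m' n \<kappa> \<mu> \<sigma> \<sigma>' \<rho> \<eta>"
    "\<And>x. mollify \<rho> (density torus_lebesgue (\<lambda>x. ennreal (n x))) x \<le> (1 + \<eta>) * n x"
    "\<And>y. mollify \<sigma> (density torus_lebesgue (\<lambda>y. ennreal (m y))) y \<le> (1 + \<eta>) * m y"
    "\<And>z. \<rho> (- z) = \<rho> z" "\<And>z. \<sigma> (- z) = \<sigma> z"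
    "\<And>z b. b \<in> Basis \<Longrightarrow> \<eta> \<le> (sin (pi * (z \<bullet> b)))\<^sup>2 \<Longrightarrow> \<rho> z \<le> \<eta>"
    "\<And>z b. b \<in> Basis \<Longrightarrow> \<eta> \<le> (sin (pi * (z \<bullet> b)))\<^sup>2 \<Longrightarrow> \<sigma> z \<le> \<eta>"
proof -
  interpret A: torus_side \<tau> c M k kx ky n n' m \<mu> \<kappa> by (rule A)
  interpret B: torus_side \<tau> c M "\<lambda>y x. - k x y" "\<lambda>y x. - ky x y" "\<lambda>y x. - kx x y" m m' n \<kappa> \<mu> by (rule B)
  note L = torus_prob_measure_lebesgue
  note n = A.n_dens and m = A.m_dens
  obtain an am where a: "0 < an" "\<And>x. an \<le> n x" "0 < am" "\<And>y. am \<le> m y"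
    using prob_density_lower_bound[OF n] prob_density_lower_bound[OF m] by metis
  obtain B1 B2 B3 B4 where
    "0 < B1" "\<And>z. norm (case z of (x, y) \<Rightarrow> kx x y) \<le> B1" "0 < B2" "\<And>z. norm (case z of (y, x) \<Rightarrow> - ky x y) \<le> B2"
    "0 < B3" "\<And>x. norm (n x) \<le> B3" "0 < B4" "\<And>y. norm (m y) \<le> B4"
    using torus_periodic_bounded[OF A.kx_cont per(1)] torus_periodic_bounded[OF B.kx_cont per(2)]
      torus_periodic_bounded[OF prob_densityD(1,5)[OF n]] torus_periodic_bounded[OF prob_densityD(1,5)[OF m]] by metis
  note Bs = this
  define b where "b = B1 + B2 + B3 + B4"
  have b: "0 < b" "norm (kx x y) \<le> b" "norm (- ky x y) \<le> b" "norm (n x) \<le> b" "norm (m y) \<le> b" for x y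
    using Bs(1,3,5,7) Bs(2)[of "(x, y)"] Bs(4)[of "(y, x)"] Bs(6)[of x] Bs(8)[of y] unfolding b_def by auto
  \<comment> \<open>The additive error in mollifying \<open>n\<close> or \<open>m\<close> becomes
    relative through their positive lower bounds \<open>an\<close> and \<open>am\<close>.\<close>
  define h where "h = min \<eta> (\<eta> * min an am)"
  have h: "0 < h" "h \<le> \<eta>" "h \<le> \<eta> * an" "h \<le> \<eta> * am"
    using a(1,3) \<eta> by (auto simp: h_def min_def mult_left_mono)
  have h8: "0 < h / 8" using h by simp
  \<comment> \<open>Chosen so that the far contribution \<open>2 * b * e\<close> is at most
    \<open>h / 8\<close>, the same as the near one.\<close>
  define e where "e = min \<eta> (h / (16 * b))"
  have e: "0 < e" "e \<le> \<eta>" using \<eta> h b(1) by (auto simp: e_def)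
  have "e \<le> h / (16 * b)" by (simp add: e_def)
  then have eb: "2 * b * e \<le> h / 8" using b(1) by (simp add: field_simps)
  obtain d1 where d1: "0 < d1"
    "\<And>x x' y. \<forall>b\<in>Basis. (sin (pi * ((x - x') \<bullet> b)))\<^sup>2 < d1 \<Longrightarrow> norm (kx x' y - kx x y) \<le> h / 8"
    "\<And>x y y'. \<forall>b\<in>Basis. (sin (pi * ((y - y') \<bullet> b)))\<^sup>2 < d1 \<Longrightarrow> norm (kx x y' - kx x y) \<le> h / 8"
    by (rule torus_modulus_common[OF A.kx_cont per(1) h8]) (rule that)
  obtain d2 where d2: "0 < d2"
    "\<And>x x' y. \<forall>b\<in>Basis. (sin (pi * ((x - x') \<bullet> b)))\<^sup>2 < d2 \<Longrightarrow> norm (- ky y x' - - ky y x) \<le> h / 8"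
    "\<And>x y y'. \<forall>b\<in>Basis. (sin (pi * ((y - y') \<bullet> b)))\<^sup>2 < d2 \<Longrightarrow> norm (- ky y' x - - ky y x) \<le> h / 8"
    by (rule torus_modulus_common[OF B.kx_cont per(2) h8]) (rule that)
  obtain d3 where d3: "0 < d3"
    "\<And>x y. \<forall>b\<in>Basis. (sin (pi * ((x - y) \<bullet> b)))\<^sup>2 < d3 \<Longrightarrow> dist (n x) (n y) < h / 8"
    by (rule torus_periodic_uniformly_continuous[OF prob_densityD(1,5)[OF n] h8]) (rule that)
  obtain d4 where d4: "0 < d4"
    "\<And>x y. \<forall>b\<in>Basis. (sin (pi * ((x - y) \<bullet> b)))\<^sup>2 < d4 \<Longrightarrow> dist (m x) (m y) < h / 8"
    by (rule torus_periodic_uniformly_continuous[OF prob_densityD(1,5)[OF m] h8]) (rule that)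
  define d where "d = min \<eta> (min (min d1 d2) (min d3 d4))"
  have d: "0 < d" "d \<le> \<eta>" "d \<le> d1" "d \<le> d2" "d \<le> d3" "d \<le> d4"
    using \<eta> d1(1) d2(1) d3(1) d4(1) by (auto simp: d_def)
  obtain \<rho> :: "'a \<Rightarrow> real" where \<rho>: "trig_poly \<rho>" "\<And>z. 0 \<le> \<rho> z" "LI \<rho> = 1"
    "\<And>z b. b \<in> Basis \<Longrightarrow> d \<le> (sin (pi * (z \<bullet> b)))\<^sup>2 \<Longrightarrow> \<rho> z \<le> e" "\<And>z. \<rho> (- z) = \<rho> z"
    by (rule trig_mollifier_exists[OF d(1) e(1)]) (rule that)
  obtain \<sigma> :: "'b \<Rightarrow> real" where \<sigma>: "trig_poly \<sigma>" "\<And>z. 0 \<le> \<sigma> z" "LI \<sigma> = 1"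
    "\<And>z b. b \<in> Basis \<Longrightarrow> d \<le> (sin (pi * (z \<bullet> b)))\<^sup>2 \<Longrightarrow> \<sigma> z \<le> e" "\<And>z. \<sigma> (- z) = \<sigma> z"
    by (rule trig_mollifier_exists[OF d(1) e(1)]) (rule that)
  note \<rho>c = trig_poly_continuous[OF \<rho>(1)] and \<rho>p = trig_poly_periodic[OF \<rho>(1)]
  note \<sigma>c = trig_poly_continuous[OF \<sigma>(1)] and \<sigma>p = trig_poly_periodic[OF \<sigma>(1)]
  obtain \<rho>' where \<rho>': "C1 \<rho> \<rho>'" using trig_poly_gradient[OF \<rho>(1)] by blast
  obtain \<sigma>' where \<sigma>': "C1 \<sigma> \<sigma>'" using trig_poly_gradient[OF \<sigma>(1)] by blast
  \<comment> \<open>The drift error totals at most \<open>2 * (h / 8 + h / 8) = h / 2\<close>,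
    within \<open>\<eta>\<close>.\<close>
  have lift: "2 * (h / 8 + 2 * b * e) * (1 + u) \<le> \<eta> * (1 + u)" if "0 \<le> u" for u
    using eb h that by (intro mult_right_mono) auto
  have n1: "norm (kx x' y - kx x y) \<le> h / 8"
    if "\<And>b. b \<in> Basis \<Longrightarrow> (sin (pi * ((x - x') \<bullet> b)))\<^sup>2 < d" for x x' y
    by (rule d1(2)) (intro ballI order_less_le_trans[OF that d(3)])
  have n2: "norm (kx x y' - kx x y) \<le> h / 8"
    if "\<And>b. b \<in> Basis \<Longrightarrow> (sin (pi * ((y - y') \<bullet> b)))\<^sup>2 < d" for x y y'
    by (rule d1(3)) (intro ballI order_less_le_trans[OF that d(3)])
  have n3: "norm (- ky y x' - - ky y x) \<le> h / 8"
    if "\<And>b. b \<in> Basis \<Longrightarrow> (sin (pi * ((x - x') \<bullet> b)))\<^sup>2 < d" for x x' y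
    by (rule d2(2)) (intro ballI order_less_le_trans[OF that d(4)])
  have n4: "norm (- ky y' x - - ky y x) \<le> h / 8"
    if "\<And>b. b \<in> Basis \<Longrightarrow> (sin (pi * ((y - y') \<bullet> b)))\<^sup>2 < d" for x y y'
    by (rule d2(3)) (intro ballI order_less_le_trans[OF that d(4)])
  have n5: "norm (n y - n x) \<le> h / 8" if "\<And>b. b \<in> Basis \<Longrightarrow> (sin (pi * ((x - y) \<bullet> b)))\<^sup>2 < d" for x y
  proof -
    have "dist (n x) (n y) < h / 8" by (rule d3(2)) (intro ballI order_less_le_trans[OF that d(5)])
    then show ?thesis by (simp add: dist_norm abs_minus_commute less_imp_le)
  qed
  have n6: "norm (m y - m x) \<le> h / 8" if "\<And>b. b \<in> Basis \<Longrightarrow> (sin (pi * ((x - y) \<bullet> b)))\<^sup>2 < d" for x y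
  proof -
    have "dist (m x) (m y) < h / 8" by (rule d4(2)) (intro ballI order_less_le_trans[OF that d(6)])
    then show ?thesis by (simp add: dist_norm abs_minus_commute less_imp_le)
  qed
  show ?thesis
  proof (rule that)
    show "mollified_side \<tau> c M k kx ky n n' m \<mu> \<kappa> \<rho> \<rho>' \<sigma> \<eta>"
    proof (intro mollified_side.intro A mollified_side_axioms.intro \<rho>(1-3) \<sigma>(1-3) \<rho>')
      show "0 \<le> \<eta>" using \<eta> by simp
      fix s :: real and x assume s: "0 \<le> s"
      have "norm ((\<integral>y. \<rho> (x - y) *\<^sub>R (\<integral>z. kx y z \<partial>\<kappa> s) \<partial>\<mu> s)
          - mollify \<rho> (\<mu> s) x *\<^sub>R (\<integral>y. mollify \<sigma> (\<kappa> s) y *\<^sub>R kx x y \<partial>torus_lebesgue))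
        \<le> 2 * (h / 8 + 2 * b * e) * (1 + mollify \<rho> (\<mu> s) x)"
        by (rule mollified_drift_close[where \<delta> = d, OF A.mu[OF s] A.kappa[OF s] A.kx_cont b(2) n1 n2 \<rho>c \<rho>(2,4) \<sigma>c \<sigma>p \<sigma>(2,3,5,4)])
          (use h8 e(1) in auto)
      also have "\<dots> \<le> \<eta> * (1 + mollify \<rho> (\<mu> s) x)" by (intro lift mollify_nonneg \<rho>(2))
      finally show "norm ((\<integral>y. \<rho> (x - y) *\<^sub>R A.D s y \<partial>\<mu> s)
          - mollify \<rho> (\<mu> s) x *\<^sub>R (\<integral>y. mollify \<sigma> (\<kappa> s) y *\<^sub>R kx x y \<partial>torus_lebesgue))
        \<le> \<eta> * (1 + mollify \<rho> (\<mu> s) x)" by (simp add: A.D_def)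
    qed
    show "mollified_side \<tau> c M (\<lambda>y x. - k x y) (\<lambda>y x. - ky x y) (\<lambda>y x. - kx x y) m m' n \<kappa> \<mu> \<sigma> \<sigma>' \<rho> \<eta>"
    proof (intro mollified_side.intro B mollified_side_axioms.intro \<rho>(1-3) \<sigma>(1-3) \<sigma>')
      show "0 \<le> \<eta>" using \<eta> by simp
      fix s :: real and x assume s: "0 \<le> s"
      have "norm ((\<integral>y. \<sigma> (x - y) *\<^sub>R (\<integral>z. - ky z y \<partial>\<mu> s) \<partial>\<kappa> s)
          - mollify \<sigma> (\<kappa> s) x *\<^sub>R (\<integral>y. mollify \<rho> (\<mu> s) y *\<^sub>R - ky y x \<partial>torus_lebesgue))
        \<le> 2 * (h / 8 + 2 * b * e) * (1 + mollify \<sigma> (\<kappa> s) x)"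
        by (rule mollified_drift_close[where \<delta> = d and kx = "\<lambda>y x. - ky x y", OF B.mu[OF s] B.kappa[OF s] B.kx_cont b(3) n3 n4 \<sigma>c \<sigma>(2,4) \<rho>c \<rho>p \<rho>(2,3,5,4)])
          (use h8 e(1) in auto)
      also have "\<dots> \<le> \<eta> * (1 + mollify \<sigma> (\<kappa> s) x)" by (intro lift mollify_nonneg \<sigma>(2))
      finally show "norm ((\<integral>y. \<sigma> (x - y) *\<^sub>R B.D s y \<partial>\<kappa> s)
          - mollify \<sigma> (\<kappa> s) x *\<^sub>R (\<integral>y. mollify \<rho> (\<mu> s) y *\<^sub>R - ky y x \<partial>torus_lebesgue))
        \<le> \<eta> * (1 + mollify \<sigma> (\<kappa> s) x)" by (simp only: B.D_def)
    qed
    show "mollify \<rho> (density torus_lebesgue (\<lambda>x. ennreal (n x))) x \<le> (1 + \<eta>) * n x" for x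
    proof -
      have one: "mollify \<rho> torus_lebesgue x = 1" using mollify_lebesgue_even[OF \<rho>c \<rho>p \<rho>(5)] \<rho>(3) by simp
      have "norm ((\<integral>y. \<rho> (x - y) *\<^sub>R n y \<partial>torus_lebesgue) - mollify \<rho> torus_lebesgue x *\<^sub>R n x)
        \<le> h / 8 * mollify \<rho> torus_lebesgue x + 2 * b * e"
        by (rule mollify_oscillation[where \<delta> = d, OF L \<rho>c \<rho>(2) prob_densityD(1)[OF n] b(4) n5 \<rho>(4)])
          (use h8 e(1) in auto)
      moreover have "mollify \<rho> (density torus_lebesgue (\<lambda>x. ennreal (n x))) x = (\<integral>y. \<rho> (x - y) *\<^sub>R n y \<partial>torus_lebesgue)"
        unfolding mollify_def by (subst torus_density_integral[OF n]) (auto intro!: continuous_on_compose2[OF \<rho>c] continuous_intros)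
      moreover have "h \<le> \<eta> * n x" using h(3) a(2)[of x] \<eta> by (meson mult_left_mono less_imp_le order_trans)
      ultimately show ?thesis using eb h(1) unfolding one by (simp add: algebra_simps)
    qed
    show "mollify \<sigma> (density torus_lebesgue (\<lambda>x. ennreal (m x))) x \<le> (1 + \<eta>) * m x" for x
    proof -
      have one: "mollify \<sigma> torus_lebesgue x = 1" using mollify_lebesgue_even[OF \<sigma>c \<sigma>p \<sigma>(5)] \<sigma>(3) by simp
      have "norm ((\<integral>y. \<sigma> (x - y) *\<^sub>R m y \<partial>torus_lebesgue) - mollify \<sigma> torus_lebesgue x *\<^sub>R m x)
        \<le> h / 8 * mollify \<sigma> torus_lebesgue x + 2 * b * e"
        by (rule mollify_oscillation[where \<delta> = d, OF L \<sigma>c \<sigma>(2) prob_densityD(1)[OF m] b(5) n6 \<sigma>(4)])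
          (use h8 e(1) in auto)
      moreover have "mollify \<sigma> (density torus_lebesgue (\<lambda>x. ennreal (m x))) x = (\<integral>y. \<sigma> (x - y) *\<^sub>R m y \<partial>torus_lebesgue)"
        unfolding mollify_def by (subst torus_density_integral[OF m]) (auto intro!: continuous_on_compose2[OF \<sigma>c] continuous_intros)
      moreover have "h \<le> \<eta> * m x" using h(4) a(4)[of x] \<eta> by (meson mult_left_mono less_imp_le order_trans)
      ultimately show ?thesis using eb h(1) unfolding one by (simp add: algebra_simps)
    qed
    show "\<rho> (- z) = \<rho> z" for z by (rule \<rho>(5))
    show "\<sigma> (- z) = \<sigma> z" for z by (rule \<sigma>(5))
    show "\<rho> z \<le> \<eta>" if "b \<in> Basis" "\<eta> \<le> (sin (pi * (z \<bullet> b)))\<^sup>2" for z b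
      by (rule order_trans[OF \<rho>(4)[OF that(1) order_trans[OF d(2) that(2)]] e(2)])
    show "\<sigma> z \<le> \<eta>" if "b \<in> Basis" "\<eta> \<le> (sin (pi * (z \<bullet> b)))\<^sup>2" for z b
      by (rule order_trans[OF \<sigma>(4)[OF that(1) order_trans[OF d(2) that(2)]] e(2)])
  qed
qed

text \<open>Kernels with parameter \<open>\<eta> j\<close> tending to zero are inserted into
  \<open>mollified_decay\<close>. The level \<open>L\<close> is the same for all of them, so the
  sources \<open>\<beta> j\<close> tend to zero, and the right-hand sides converge to the claimed
  bound.\<close>

lemma chi2_decay:
  fixes k :: "'a::euclidean_space \<Rightarrow> 'b::euclidean_space \<Rightarrow> real"
  assumes A: "torus_side \<tau> c M k kx ky n n' m \<mu> \<kappa>"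
    and B: "torus_side \<tau> c M (\<lambda>y x. - k x y) (\<lambda>y x. - ky x y) (\<lambda>y x. - kx x y) m m' n \<kappa> \<mu>"
    and per: "torus_periodic (\<lambda>(x, y). kx x y)" "torus_periodic (\<lambda>(y, x). - ky x y)"
    and \<nu>x: "\<nu>x = density torus_lebesgue (\<lambda>x. ennreal (n x))" and \<nu>y: "\<nu>y = density torus_lebesgue (\<lambda>y. ennreal (m y))"
    and \<epsilon>: "0 < \<epsilon>" "\<epsilon> < 1" and q: "q = M / (\<tau> * c * \<epsilon>)"
    and fin: "chi2 (\<mu> 0) \<nu>x \<noteq> \<infinity>" "chi2 (\<kappa> 0) \<nu>y \<noteq> \<infinity>"
    and \<xi>: "\<xi> = enn2real (chi2 (\<mu> 0) \<nu>x) + enn2real (chi2 (\<kappa> 0) \<nu>y)" and small: "q\<^sup>2 * \<xi> \<le> 1 / 4"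
    and t: "0 \<le> t"
  shows "chi2 (\<mu> t) \<nu>x + chi2 (\<kappa> t) \<nu>y \<le> ennreal ((1 + q\<^sup>2) * \<xi> * exp (- (2 * \<tau> * c * (1 - \<epsilon>)) * t))"
proof -
  interpret A: torus_side \<tau> c M k kx ky n n' m \<mu> \<kappa> by (rule A)
  interpret B: torus_side \<tau> c M "\<lambda>y x. - k x y" "\<lambda>y x. - ky x y" "\<lambda>y x. - kx x y" m m' n \<kappa> \<mu> by (rule B)
  have c: "0 < c" using A.n_poincare by (simp add: weighted_poincare_def)
  define l where "l = 2 * \<tau> * c * (1 - \<epsilon>)"
  have l: "0 < l" using A.tau c \<epsilon> by (simp add: l_def)
  have \<xi>0: "0 \<le> \<xi>" by (simp add: \<xi>)
  define \<eta> where "\<eta> = (\<lambda>j. inverse (real (Suc j)))"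
  have \<eta>0: "0 < \<eta> j" for j by (simp add: \<eta>_def)
  have \<eta>lim: "\<eta> \<longlonglongrightarrow> 0" unfolding \<eta>_def by (rule LIMSEQ_inverse_real_of_nat)
  define P where "P = (\<lambda>j \<rho> \<rho>' \<sigma> \<sigma>'.
    mollified_side \<tau> c M k kx ky n n' m \<mu> \<kappa> \<rho> \<rho>' \<sigma> (\<eta> j) \<and>
    mollified_side \<tau> c M (\<lambda>y x. - k x y) (\<lambda>y x. - ky x y) (\<lambda>y x. - kx x y) m m' n \<kappa> \<mu> \<sigma> \<sigma>' \<rho> (\<eta> j) \<and>
    (\<forall>x. mollify \<rho> \<nu>x x \<le> (1 + \<eta> j) * n x) \<and> (\<forall>y. mollify \<sigma> \<nu>y y \<le> (1 + \<eta> j) * m y) \<and>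
    (\<forall>z. \<rho> (- z) = \<rho> z) \<and> (\<forall>z. \<sigma> (- z) = \<sigma> z) \<and>
    (\<forall>z. \<forall>b\<in>Basis. \<eta> j \<le> (sin (pi * (z \<bullet> b)))\<^sup>2 \<longrightarrow> \<rho> z \<le> \<eta> j) \<and>
    (\<forall>z. \<forall>b\<in>Basis. \<eta> j \<le> (sin (pi * (z \<bullet> b)))\<^sup>2 \<longrightarrow> \<sigma> z \<le> \<eta> j))"
  have "\<exists>\<rho> \<rho>' \<sigma> \<sigma>'. P j \<rho> \<rho>' \<sigma> \<sigma>'" for j
    unfolding P_def \<nu>x \<nu>y
    by (rule mollified_sides_exist[OF A B per \<eta>0[of j]],
      intro exI, rule conjI, assumption, rule conjI, assumption, intro conjI allI ballI impI; blast)
  then obtain \<rho> \<rho>' \<sigma> \<sigma>' where all: "\<And>j. P j (\<rho> j) (\<rho>' j) (\<sigma> j) (\<sigma>' j)" by metis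
  have SA: "mollified_side \<tau> c M k kx ky n n' m \<mu> \<kappa> (\<rho> j) (\<rho>' j) (\<sigma> j) (\<eta> j)"
    and SB: "mollified_side \<tau> c M (\<lambda>y x. - k x y) (\<lambda>y x. - ky x y) (\<lambda>y x. - kx x y) m m' n \<kappa> \<mu> (\<sigma> j) (\<sigma>' j) (\<rho> j) (\<eta> j)"
    and majx: "\<And>x. mollify (\<rho> j) \<nu>x x \<le> (1 + \<eta> j) * n x" and majy: "\<And>y. mollify (\<sigma> j) \<nu>y y \<le> (1 + \<eta> j) * m y"
    and even: "\<And>z. \<rho> j (- z) = \<rho> j z" "\<And>z. \<sigma> j (- z) = \<sigma> j z"
    and tail: "\<And>z b. b \<in> Basis \<Longrightarrow> \<eta> j \<le> (sin (pi * (z \<bullet> b)))\<^sup>2 \<Longrightarrow> \<rho> j z \<le> \<eta> j"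
      "\<And>z b. b \<in> Basis \<Longrightarrow> \<eta> j \<le> (sin (pi * (z \<bullet> b)))\<^sup>2 \<Longrightarrow> \<sigma> j z \<le> \<eta> j" for j
    using all[of j] unfolding P_def by blast+
  note \<rho> = mollified_side.rho[OF SA] and \<sigma> = mollified_side.rho[OF SB]
  note \<rho>c = trig_poly_continuous[OF \<rho>(1)] and \<rho>p = trig_poly_periodic[OF \<rho>(1)]
  note \<sigma>c = trig_poly_continuous[OF \<sigma>(1)] and \<sigma>p = trig_poly_periodic[OF \<sigma>(1)]
  define XA where "XA = (\<lambda>j t. LI (\<lambda>x. (mollify (\<rho> j) (\<mu> t) x * inverse (n x) - 1)\<^sup>2 * n x))"
  define XB where "XB = (\<lambda>j t. LI (\<lambda>y. (mollify (\<sigma> j) (\<kappa> t) y * inverse (m y) - 1)\<^sup>2 * m y))"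
  have XA0: "0 \<le> XA j s" and XB0: "0 \<le> XB j s" for j s
    using prob_densityD(3)[OF A.n_dens] prob_densityD(3)[OF A.m_dens] by (simp_all add: XA_def XB_def)
  \<comment> \<open>The sum of the two bounds of \<open>chi2_mollify_le\<close>; the summand
    \<open>2 * \<eta> j\<close> comes from the two unit masses.\<close>
  define x0 where "x0 = (\<lambda>j. \<xi> + \<eta> j * (2 + \<xi>))"
  have X0: "XA j 0 + XB j 0 \<le> x0 j" for j
  proof -
    have "XA j 0 \<le> (1 + \<eta> j) * (1 + enn2real (chi2 (\<mu> 0) \<nu>x)) - 1"
      unfolding XA_def
      by (rule chi2_mollify_le[OF A.n_dens \<nu>x A.mu fin(1) \<rho>c \<rho>p \<rho>(2,3) majx]) (use \<eta>0[of j] in simp_all)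
    moreover have "XB j 0 \<le> (1 + \<eta> j) * (1 + enn2real (chi2 (\<kappa> 0) \<nu>y)) - 1"
      unfolding XB_def
      by (rule chi2_mollify_le[OF A.m_dens \<nu>y A.kappa fin(2) \<sigma>c \<sigma>p \<sigma>(2,3) majy]) (use \<eta>0[of j] in simp_all)
    ultimately show ?thesis by (simp add: x0_def \<xi> algebra_simps)
  qed
  define C where "C = max (sqrt (LI (\<lambda>x. (1 + inverse (n x))\<^sup>2 * n x))) (sqrt (LI (\<lambda>y. (1 + inverse (m y))\<^sup>2 * m y)))"
  \<comment> \<open>The slack between initial value and level: \<open>q^2 * s\<close> is at most
    1/40, so that 1/4 grows to 11/40, and the strict gap absorbs \<open>x0 j - \<xi>\<close> and
    \<open>\<beta> j / l\<close> for large \<open>j\<close>.\<close>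
  define s where "s = 1 / (40 * (1 + q\<^sup>2))"
  have Q: "0 < 1 + q\<^sup>2" using zero_le_power2[of q] by linarith
  have s: "0 < s" "q\<^sup>2 * s \<le> 1 / 40" using Q by (simp_all add: s_def field_simps)
  define L where "L = (1 + q\<^sup>2) * (\<xi> + s)"
  have "q\<^sup>2 * (\<xi> + s) \<le> 11 / 40" using small s(2) by (simp add: distrib_left)
  then have smallL: "q\<^sup>2 * L \<le> 11 / 40 * (1 + q\<^sup>2)"
    unfolding L_def using mult_left_mono[of "q\<^sup>2 * (\<xi> + s)" "11 / 40" "1 + q\<^sup>2"] Q by (simp add: mult_ac)
  define \<beta> where "\<beta> = (\<lambda>j. 10 * (1 + q\<^sup>2) * (\<eta> j * (C + sqrt L))\<^sup>2 / (\<epsilon> * \<tau>))"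
  have x0lim: "x0 \<longlonglongrightarrow> \<xi>"
    unfolding x0_def using tendsto_add[OF tendsto_const tendsto_mult_left_zero[OF \<eta>lim]] by fastforce
  have "\<beta> \<longlonglongrightarrow> 10 * (1 + q\<^sup>2) * (0 * (C + sqrt L))\<^sup>2 / (\<epsilon> * \<tau>)"
    unfolding \<beta>_def using \<epsilon> A.tau by (intro tendsto_intros \<eta>lim) auto
  then have \<beta>lim: "(\<lambda>j. \<beta> j / l) \<longlonglongrightarrow> 0"
    using tendsto_divide[OF _ tendsto_const, of \<beta> 0 sequentially l] l by simp
  define W where "W = (\<lambda>j. (1 + q\<^sup>2) * x0 j * exp (- l * t) + \<beta> j / l)"
  have "W \<longlonglongrightarrow> (1 + q\<^sup>2) * \<xi> * exp (- l * t) + 0"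
    unfolding W_def by (intro tendsto_intros x0lim \<beta>lim)
  then have Wlim: "W \<longlonglongrightarrow> (1 + q\<^sup>2) * \<xi> * exp (- l * t)" by simp
  have "(\<lambda>j. (1 + q\<^sup>2) * x0 j + \<beta> j / l) \<longlonglongrightarrow> (1 + q\<^sup>2) * \<xi> + 0"
    by (intro tendsto_intros x0lim \<beta>lim)
  moreover have "(1 + q\<^sup>2) * \<xi> + 0 < L" using Q s(1) by (simp add: L_def)
  ultimately have "eventually (\<lambda>j. (1 + q\<^sup>2) * x0 j + \<beta> j / l < L) sequentially" by (rule order_tendstoD(2))
  then obtain N where N: "\<And>j. N \<le> j \<Longrightarrow> (1 + q\<^sup>2) * x0 j + \<beta> j / l < L" by (auto simp: eventually_sequentially)
  have XW: "XA j t + XB j t \<le> W j" if "N \<le> j" for j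
    unfolding W_def
    by (rule mollified_decay[where X = "\<lambda>t. XA j t + XB j t" and C = C and \<beta> = "\<beta> j" and L = L,
          OF SA SB \<epsilon> q _ _ _ l_def _ X0 N[OF that] smallL t])
      (simp_all only: XA_def XB_def C_def \<beta>_def max.cobounded1 max.cobounded2)
  \<comment> \<open>Only the sum of the two mollified divergences is controlled by a convergent
    bound. A subsequence along which both converge allows semicontinuity to be applied to each
    player, with limits that still add up correctly.\<close>
  define Z where "Z = (\<lambda>i. (XA (i + N) t, XB (i + N) t))"
  have "bounded (range Z)"
  proof -
    obtain b where b: "\<And>j. \<bar>W j\<bar> \<le> b"
      using convergent_imp_Bseq[of W] Wlim unfolding Bseq_def convergent_def by auto
    have "norm (Z i) \<le> b" for i
    proof -
      have "norm (Z i) \<le> norm (XA (i + N) t) + norm (XB (i + N) t)" unfolding Z_def by (rule norm_Pair_le)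
      also have "\<dots> \<le> W (i + N)" using XA0[of "i + N" t] XB0[of "i + N" t] XW[of "i + N"] by simp
      also have "\<dots> \<le> b" using b[of "i + N"] by linarith
      finally show ?thesis .
    qed
    then show ?thesis by (auto simp: bounded_iff)
  qed
  then obtain a b r where r: "strict_mono r" "(Z \<circ> r) \<longlonglongrightarrow> (a, b)"
    using bounded_imp_convergent_subsequence by (metis surj_pair)
  define u where "u = (\<lambda>i. r i + N)"
  have u: "filterlim u sequentially sequentially"
    unfolding u_def by (rule filterlim_at_top_mono[OF filterlim_subseq[OF r(1)]]) simp
  have limA: "(\<lambda>i. XA (u i) t) \<longlonglongrightarrow> a" and limB: "(\<lambda>i. XB (u i) t) \<longlonglongrightarrow> b"
    using tendsto_fst[OF r(2)] tendsto_snd[OF r(2)] by (simp_all add: Z_def u_def o_def)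
  have a0: "0 \<le> a" and b0: "0 \<le> b"
    using LIMSEQ_le_const[OF limA] LIMSEQ_le_const[OF limB] XA0 XB0 by blast+
  have ab: "a + b \<le> (1 + q\<^sup>2) * \<xi> * exp (- l * t)"
    by (rule LIMSEQ_le[OF tendsto_add[OF limA limB] filterlim_compose[OF Wlim u]])
      (use XW in \<open>auto simp: u_def\<close>)
  have "chi2 (\<mu> t) \<nu>x \<le> ennreal a"
  proof (rule chi2_lower_semicontinuous[OF A.n_dens \<nu>x A.mu[OF t] \<rho>c \<rho>p \<rho>(3) _ limA[unfolded XA_def]])
    fix \<phi> :: "'a \<Rightarrow> real" and e :: real assume \<phi>: "continuous_on UNIV \<phi>" "torus_periodic \<phi>" and e: "0 < e"
    have "eventually (\<lambda>j. \<forall>y. \<bar>LI (\<lambda>x. \<phi> x * \<rho> j (x - y)) - \<phi> y\<bar> \<le> e) sequentially"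
      by (rule mollifier_approx_identity[OF \<rho> even(1) tail(1)[unfolded \<eta>_def] \<phi> e])
    then show "eventually (\<lambda>i. \<forall>y. \<bar>LI (\<lambda>x. \<phi> x * \<rho> (u i) (x - y)) - \<phi> y\<bar> \<le> e) sequentially"
      by (rule eventually_compose_filterlim[OF _ u])
  qed
  moreover have "chi2 (\<kappa> t) \<nu>y \<le> ennreal b"
  proof (rule chi2_lower_semicontinuous[OF A.m_dens \<nu>y A.kappa[OF t] \<sigma>c \<sigma>p \<sigma>(3) _ limB[unfolded XB_def]])
    fix \<phi> :: "'b \<Rightarrow> real" and e :: real assume \<phi>: "continuous_on UNIV \<phi>" "torus_periodic \<phi>" and e: "0 < e"
    have "eventually (\<lambda>j. \<forall>y. \<bar>LI (\<lambda>x. \<phi> x * \<sigma> j (x - y)) - \<phi> y\<bar> \<le> e) sequentially"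
      by (rule mollifier_approx_identity[OF \<sigma> even(2) tail(2)[unfolded \<eta>_def] \<phi> e])
    then show "eventually (\<lambda>i. \<forall>y. \<bar>LI (\<lambda>x. \<phi> x * \<sigma> (u i) (x - y)) - \<phi> y\<bar> \<le> e) sequentially"
      by (rule eventually_compose_filterlim[OF _ u])
  qed
  ultimately have "chi2 (\<mu> t) \<nu>x + chi2 (\<kappa> t) \<nu>y \<le> ennreal a + ennreal b" by (rule add_mono)
  also have "\<dots> = ennreal (a + b)" using a0 b0 by simp
  also have "\<dots> \<le> ennreal ((1 + q\<^sup>2) * \<xi> * exp (- l * t))" by (rule ennreal_leI[OF ab])
  finally show ?thesis by (simp add: l_def)
qed

lemma torus_periodic_prodI:
  fixes F :: "'a::euclidean_space \<times> 'b::euclidean_space \<Rightarrow> 'c"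
  assumes "\<And>y. torus_periodic (\<lambda>x. F (x, y))" "\<And>x. torus_periodic (\<lambda>y. F (x, y))"
  shows "torus_periodic F"
  unfolding torus_periodic_def
proof (intro allI ballI)
  fix z e :: "'a \<times> 'b" assume "e \<in> Basis"
  then consider b where "b \<in> Basis" "e = (b, 0)" | b where "b \<in> Basis" "e = (0, b)"
    by (auto simp: Basis_prod_def)
  then show "F (z + e) = F z"
  proof cases
    case 1
    then show ?thesis using torus_periodicD[OF assms(1), of b "fst z" "snd z"] by (cases z) simp
  next
    case 2
    then show ?thesis using torus_periodicD[OF assms(2), of b "fst z" "snd z"] by (cases z) simp
  qed
qed

text \<open>Translates the saddle point and the coupled flow into two instances of
  \<open>torus_side\<close>. A maximizer for \<open>k\<close> is a minimizer for \<open>- k\<close>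
  with transposed arguments, so the second instance repeats the first with the signs
  changed.\<close>

lemma equilibrium_torus_sides:
  fixes k :: "'a::euclidean_space \<times> 'b::euclidean_space \<Rightarrow> real"
  assumes \<tau>: "0 < \<tau>" and k: "C_k 2 k" "torus_periodic k" and eq: "equilibrium \<tau> k \<nu>x \<nu>y"
    and flow: "langevin_descent_ascent \<tau> k \<mu> \<kappa>"
    and PI: "poincare_inequality \<nu>x cx" "poincare_inequality \<nu>y cy" and c: "c = min cx cy"
  obtains kx ky n n' m m' where
    "torus_side \<tau> c (M11 k) (\<lambda>x y. k (x, y)) kx ky n n' m \<mu> \<kappa>"
    "torus_side \<tau> c (M11 k) (\<lambda>y x. - k (x, y)) (\<lambda>y x. - ky x y) (\<lambda>y x. - kx x y) m m' n \<kappa> \<mu>"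
    "torus_periodic (\<lambda>(x, y). kx x y)" "torus_periodic (\<lambda>(y, x). - ky x y)"
    "\<nu>x = density torus_lebesgue (\<lambda>x. ennreal (n x))" "\<nu>y = density torus_lebesgue (\<lambda>y. ennreal (m y))"
proof -
  define K where "K = gradient k"
  note K = C_k_2_imp_C1(1)[OF k(1), folded K_def]
  have Kp: "torus_periodic K" by (rule C1_periodic_grad[OF K k(2)])
  define kx where "kx = (\<lambda>x y. fst (K (x, y)))"
  define ky where "ky = (\<lambda>x y. snd (K (x, y)))"
  note kc = C1_continuous[OF K] and Kc = C1_grad_continuous[OF K]
  have k1: "continuous_on UNIV (\<lambda>(x, y). k (x, y))" using kc by simp
  have k2: "continuous_on UNIV (\<lambda>(y, x). - k (x, y))"
    by (auto simp: case_prod_beta intro!: continuous_intros continuous_on_compose2[OF kc])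
  have k1': "continuous_on UNIV (\<lambda>(x, y). kx x y)"
    by (auto simp: case_prod_beta kx_def intro!: continuous_intros Kc)
  have k2': "continuous_on UNIV (\<lambda>(y, x). - ky x y)"
    by (auto simp: case_prod_beta ky_def intro!: continuous_intros continuous_on_compose2[OF Kc])
  have Cx: "C1 (\<lambda>x. k (x, y)) (\<lambda>x. kx x y)" and Cy: "C1 (\<lambda>y. k (x, y)) (ky x)" for x y
    unfolding kx_def ky_def by (rule C1_slices[OF K])+
  note px = torus_periodic_slices(1)[OF k(2)] and py = torus_periodic_slices(2)[OF k(2)]
  have neg_per: "torus_periodic (\<lambda>x. - f x)" if "torus_periodic f" for f :: "'c::euclidean_space \<Rightarrow> real"
    using that by (simp add: torus_periodic_def)
  have per: "torus_periodic (\<lambda>(x, y). kx x y)" "torus_periodic (\<lambda>(y, x). - ky x y)"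
    using torus_periodic_slices[OF Kp]
    by (auto intro!: torus_periodic_prodI; simp add: kx_def ky_def torus_periodic_def)+
  have \<nu>x: "torus_prob_measure \<nu>x" "finite_entropy \<nu>x" and \<nu>y: "torus_prob_measure \<nu>y" "finite_entropy \<nu>y"
    and minx: "\<And>\<mu>. torus_prob_measure \<mu> \<Longrightarrow> finite_entropy \<mu> \<Longrightarrow> payoff \<tau> k \<nu>x \<nu>y \<le> payoff \<tau> k \<mu> \<nu>y"
    and maxy: "\<And>\<mu>. torus_prob_measure \<mu> \<Longrightarrow> finite_entropy \<mu> \<Longrightarrow> payoff \<tau> k \<nu>x \<mu> \<le> payoff \<tau> k \<nu>x \<nu>y"
    using eq unfolding equilibrium_def by blast+
  obtain n n' where n: "prob_density n" "\<nu>x = density torus_lebesgue (\<lambda>x. ennreal (n x))" "C1 n n'"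
    "\<And>x. n' x = - (n x / \<tau>) *\<^sub>R (\<integral>y. kx x y \<partial>\<nu>y)"
  proof (rule gibbs_equilibrium_side[OF \<tau> k1 px k1' Cx \<nu>x \<nu>y(1)])
    show "(\<integral>x. (\<integral>y. k (x, y) \<partial>\<nu>y) \<partial>\<nu>x) + \<tau> * boltzmann_entropy \<nu>x
        \<le> (\<integral>x. (\<integral>y. k (x, y) \<partial>\<nu>y) \<partial>\<mu>) + \<tau> * boltzmann_entropy \<mu>"
      if "torus_prob_measure \<mu>" "finite_entropy \<mu>" for \<mu>
      using minx[OF that] by (simp add: payoff_def)
  qed (rule that)
  \<comment> \<open>Fubini exchanges the order of integration in the payoff, so that the inner
    integral is the potential acting on the maximizing player.\<close>
  obtain m m' where m: "prob_density m" "\<nu>y = density torus_lebesgue (\<lambda>y. ennreal (m y))" "C1 m m'"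
    "\<And>y. m' y = - (m y / \<tau>) *\<^sub>R (\<integral>x. - ky x y \<partial>\<nu>x)"
  proof (rule gibbs_equilibrium_side[OF \<tau> k2 neg_per[OF py] k2' C1_minus[OF Cy] \<nu>y \<nu>x(1)])
    show "(\<integral>y. (\<integral>x. - k (x, y) \<partial>\<nu>x) \<partial>\<nu>y) + \<tau> * boltzmann_entropy \<nu>y
        \<le> (\<integral>y. (\<integral>x. - k (x, y) \<partial>\<nu>x) \<partial>\<mu>) + \<tau> * boltzmann_entropy \<mu>"
      if "torus_prob_measure \<mu>" "finite_entropy \<mu>" for \<mu>
      using maxy[OF that] torus_Fubini[OF that(1) \<nu>x(1) k1] torus_Fubini[OF \<nu>y(1) \<nu>x(1) k1] by (simp add: payoff_def)
  qed (rule that)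
  have c0: "0 < c" using PI by (simp add: c poincare_inequality_def)
  have Pn: "weighted_poincare n c" by (rule weighted_poincare_of_poincare[OF n(1,2) PI(1) c0]) (simp add: c)
  have Pm: "weighted_poincare m c" by (rule weighted_poincare_of_poincare[OF m(1,2) PI(2) c0]) (simp add: c)
  have \<mu>: "torus_prob_measure (\<mu> s)" and \<kappa>: "torus_prob_measure (\<kappa> s)" if "0 \<le> s" for s
    using flow that unfolding langevin_descent_ascent_def by blast+
  have Gx: "gradient (\<lambda>x. \<integral>y. k (x, y) \<partial>\<kappa> s) = (\<lambda>x. \<integral>y. kx x y \<partial>\<kappa> s)" if "0 \<le> s" for s
    by (rule C1_gradient[OF C1_torus_integral[OF \<kappa>[OF that] k1 k1' Cx]])
  have Gy: "gradient (\<lambda>y. \<integral>x. k (x, y) \<partial>\<mu> s) = (\<lambda>y. - (\<integral>x. - ky x y \<partial>\<mu> s))" if "0 \<le> s" for s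
    using C1_gradient[OF C1_minus[OF C1_torus_integral[OF \<mu>[OF that] k2 k2' C1_minus[OF Cy]]]] by simp
  show ?thesis
  proof (rule that[OF _ _ per n(2) m(2)])
    show "torus_side \<tau> c (M11 k) (\<lambda>x y. k (x, y)) kx ky n n' m \<mu> \<kappa>"
    proof (rule torus_side.intro[OF \<tau> _ k1 k1' Cx Cy px py _ n(1) m(1) n(3) _ Pn Pm])
      show "0 \<le> M11 k" by (rule mixed_second_difference_bound(1)[OF k])
      show "\<bar>k (x', y') - k (x, y') - k (x', y) + k (x, y)\<bar> \<le> M11 k * norm (x' - x) * norm (y' - y)" for x x' y y'
        by (rule mixed_second_difference_bound(2)[OF k])
      show "n' x = - (n x / \<tau>) *\<^sub>R (\<integral>y. m y *\<^sub>R kx x y \<partial>torus_lebesgue)" for x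
        unfolding n(4) m(2) density_integral_scaleR[OF m(1) continuous_on_slices(1)[OF k1']] ..
      fix t :: real assume t: "0 \<le> t"
      show "torus_prob_measure (\<mu> t)" "torus_prob_measure (\<kappa> t)" by (fact \<mu>[OF t] \<kappa>[OF t])+
      fix \<phi> :: "'a \<Rightarrow> real" assume \<phi>: "trig_poly \<phi>"
      have "((\<lambda>s. - (\<integral>x. gradient \<phi> x \<bullet> gradient (\<lambda>x. \<integral>y. k (x, y) \<partial>\<kappa> s) x \<partial>\<mu> s) + \<tau> * (\<integral>x. laplacian \<phi> x \<partial>\<mu> s))
          has_integral ((\<integral>x. \<phi> x \<partial>\<mu> t) - (\<integral>x. \<phi> x \<partial>\<mu> 0))) {0..t}"
        using flow t trig_poly_C_infinity[OF \<phi>] trig_poly_periodic[OF \<phi>] unfolding langevin_descent_ascent_def by blast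
      then show "((\<lambda>s. - (\<integral>x. gradient \<phi> x \<bullet> (\<integral>y. kx x y \<partial>\<kappa> s) \<partial>\<mu> s) + \<tau> * (\<integral>x. laplacian \<phi> x \<partial>\<mu> s))
          has_integral ((\<integral>x. \<phi> x \<partial>\<mu> t) - (\<integral>x. \<phi> x \<partial>\<mu> 0))) {0..t}"
        by (rule has_integral_eq[rotated]) (simp add: Gx)
    qed
    show "torus_side \<tau> c (M11 k) (\<lambda>y x. - k (x, y)) (\<lambda>y x. - ky x y) (\<lambda>y x. - kx x y) m m' n \<kappa> \<mu>"
    proof (rule torus_side.intro[OF \<tau> _ k2 k2' C1_minus[OF Cy] C1_minus[OF Cx] neg_per[OF py] neg_per[OF px] _ m(1) n(1) m(3) _ Pm Pn])
      show "0 \<le> M11 k" by (rule mixed_second_difference_bound(1)[OF k])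
      show "\<bar>- k (y', x') - - k (y', x) - - k (y, x') + - k (y, x)\<bar> \<le> M11 k * norm (x' - x) * norm (y' - y)" for x x' y y'
        using mixed_second_difference_bound(2)[OF k, of y' x' y x] by (simp add: mult_ac)
      show "m' x = - (m x / \<tau>) *\<^sub>R (\<integral>y. n y *\<^sub>R - ky y x \<partial>torus_lebesgue)" for x
        unfolding m(4) n(2) density_integral_scaleR[OF n(1) continuous_on_slices(1)[OF k2']] ..
      fix t :: real assume t: "0 \<le> t"
      show "torus_prob_measure (\<kappa> t)" "torus_prob_measure (\<mu> t)" by (fact \<mu>[OF t] \<kappa>[OF t])+
      fix \<phi> :: "'b \<Rightarrow> real" assume \<phi>: "trig_poly \<phi>"
      have "((\<lambda>s. (\<integral>y. gradient \<phi> y \<bullet> gradient (\<lambda>y. \<integral>x. k (x, y) \<partial>\<mu> s) y \<partial>\<kappa> s) + \<tau> * (\<integral>y. laplacian \<phi> y \<partial>\<kappa> s))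
          has_integral ((\<integral>y. \<phi> y \<partial>\<kappa> t) - (\<integral>y. \<phi> y \<partial>\<kappa> 0))) {0..t}"
        using flow t trig_poly_C_infinity[OF \<phi>] trig_poly_periodic[OF \<phi>] unfolding langevin_descent_ascent_def by blast
      then show "((\<lambda>s. - (\<integral>y. gradient \<phi> y \<bullet> (\<integral>x. - ky x y \<partial>\<mu> s) \<partial>\<kappa> s) + \<tau> * (\<integral>y. laplacian \<phi> y \<partial>\<kappa> s))
          has_integral ((\<integral>y. \<phi> y \<partial>\<kappa> t) - (\<integral>y. \<phi> y \<partial>\<kappa> 0))) {0..t}"
        by (rule has_integral_eq[rotated]) (simp add: Gy)
    qed
  qed
qed

theorem theorem4p1:
  fixes k :: "(real ^ 'dx) \<times> (real ^ 'dy) \<Rightarrow> real"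
    and \<mu>x :: "real \<Rightarrow> (real ^ 'dx) measure" and \<mu>y :: "real \<Rightarrow> (real ^ 'dy) measure"
    and \<nu>x :: "(real ^ 'dx) measure" and \<nu>y :: "(real ^ 'dy) measure"
    and \<tau> cx cy c M \<epsilon> :: real
  assumes "0 < \<tau>"
    and "C_k 2 k" and "torus_periodic k" and "M = M11 k"
    and "equilibrium \<tau> k \<nu>x \<nu>y"
    and "langevin_descent_ascent \<tau> k \<mu>x \<mu>y"
    and "poincare_inequality \<nu>x cx" and "poincare_inequality \<nu>y cy" and "c = min cx cy"
    and "0 < \<epsilon>" and "\<epsilon> < 1"
    and "chi2 (\<mu>x 0) \<nu>x + chi2 (\<mu>y 0) \<nu>y
           \<le> (if M = 0 then \<infinity> else ennreal (\<tau>\<^sup>2 * c\<^sup>2 * \<epsilon>\<^sup>2 / (4 * M\<^sup>2)))"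
  shows "\<forall>t\<ge>0. chi2 (\<mu>x t) \<nu>x + chi2 (\<mu>y t) \<nu>y
           \<le> ennreal ((1 + M\<^sup>2 / (\<tau>\<^sup>2 * c\<^sup>2 * \<epsilon>\<^sup>2)) * exp (- 2 * \<tau> * c * (1 - \<epsilon>) * t))
              * (chi2 (\<mu>x 0) \<nu>x + chi2 (\<mu>y 0) \<nu>y)"
proof (intro allI impI)
  fix t :: real assume t: "0 \<le> t"
  define q where "q = M / (\<tau> * c * \<epsilon>)"
  have q2: "q\<^sup>2 = M\<^sup>2 / (\<tau>\<^sup>2 * c\<^sup>2 * \<epsilon>\<^sup>2)" by (simp add: q_def power_divide power_mult_distrib)
  have c: "0 < c" using assms(7-9) by (simp add: poincare_inequality_def)
  define F where "F = (1 + q\<^sup>2) * exp (- (2 * \<tau> * c * (1 - \<epsilon>)) * t)"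
  have F: "0 < F" using zero_le_power2[of q] by (simp add: F_def add_pos_nonneg)
  define a b where "a = chi2 (\<mu>x 0) \<nu>x" and "b = chi2 (\<mu>y 0) \<nu>y"
  have "chi2 (\<mu>x t) \<nu>x + chi2 (\<mu>y t) \<nu>y \<le> ennreal F * (a + b)"
  \<comment> \<open>An infinite initial divergence passes the smallness condition only for
    \<open>M = 0\<close>; as \<open>F\<close> is positive, the right-hand side is then infinite as
    well.\<close>
  proof (cases "a = \<infinity> \<or> b = \<infinity>")
    case True
    then have "ennreal F * (a + b) = \<infinity>" using F by (auto simp: ennreal_mult_eq_top_iff)
    then show ?thesis by simp
  next
    case False
    then have fin: "a \<noteq> \<infinity>" "b \<noteq> \<infinity>" by auto
    define \<xi> where "\<xi> = enn2real a + enn2real b"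
    have ab: "a + b = ennreal \<xi>" using fin by (simp add: \<xi>_def less_top)
    \<comment> \<open>The smallness threshold expressed in \<open>q\<close>; for
      \<open>M = 0\<close> also \<open>q = 0\<close>, which agrees with reading the threshold as
      infinite.\<close>
    have small: "q\<^sup>2 * \<xi> \<le> 1 / 4"
    proof (cases "M = 0")
      case False
      then have "ennreal \<xi> \<le> ennreal (\<tau>\<^sup>2 * c\<^sup>2 * \<epsilon>\<^sup>2 / (4 * M\<^sup>2))" using assms(12) ab by (simp add: a_def b_def)
      then have "\<xi> \<le> \<tau>\<^sup>2 * c\<^sup>2 * \<epsilon>\<^sup>2 / (4 * M\<^sup>2)" by (subst (asm) ennreal_le_iff) auto
      then show ?thesis using False \<open>0 < \<tau>\<close> \<open>0 < \<epsilon>\<close> c by (simp add: q2 field_simps)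
    qed (simp add: q_def)
    obtain kx ky n n' m m' where side:
      "torus_side \<tau> c M (\<lambda>x y. k (x, y)) kx ky n n' m \<mu>x \<mu>y"
      "torus_side \<tau> c M (\<lambda>y x. - k (x, y)) (\<lambda>y x. - ky x y) (\<lambda>y x. - kx x y) m m' n \<mu>y \<mu>x"
      "torus_periodic (\<lambda>(x, y). kx x y)" "torus_periodic (\<lambda>(y, x). - ky x y)"
      "\<nu>x = density torus_lebesgue (\<lambda>x. ennreal (n x))" "\<nu>y = density torus_lebesgue (\<lambda>y. ennreal (m y))"
      by (rule equilibrium_torus_sides[OF assms(1,2,3,5-9), folded assms(4)]) (rule that)
    have "chi2 (\<mu>x t) \<nu>x + chi2 (\<mu>y t) \<nu>y \<le> ennreal ((1 + q\<^sup>2) * \<xi> * exp (- (2 * \<tau> * c * (1 - \<epsilon>)) * t))"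
      using fin small by (intro chi2_decay[OF side assms(10,11) q_def _ _ _ _ t]) (simp_all add: a_def b_def \<xi>_def)
    also have "\<dots> = ennreal F * (a + b)"
      using F ennreal_mult''[of F \<xi>] unfolding ab by (simp add: F_def mult_ac \<xi>_def)
    finally show ?thesis .
  qed
  then show "chi2 (\<mu>x t) \<nu>x + chi2 (\<mu>y t) \<nu>y
      \<le> ennreal ((1 + M\<^sup>2 / (\<tau>\<^sup>2 * c\<^sup>2 * \<epsilon>\<^sup>2)) * exp (- 2 * \<tau> * c * (1 - \<epsilon>) * t)) * (chi2 (\<mu>x 0) \<nu>x + chi2 (\<mu>y 0) \<nu>y)"
    by (simp add: F_def q2 a_def b_def)
qed


end
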